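(* Let $\nu>0$, $\kappa>0$, $\alpha>0$, $L>0$, $N\in\mathbb{N}$, let $\Omega=\mathbb{T}^2$ be the two-dimensional torus of side $L$, let $f\in L^2(\Omega)$ be a time-independent scalar function with zero mean, and let $\mathcal{H}=H_0\times H^0$. Let $\tilde\varrho>0$ be a fixed radius that is absorbing for the untruncated deconvolution system in the sense given in the context, and let $\chi_{\tilde\varrho}$ be the associated cut-off. Consider, for $\mathbf{V}=(\mathbf{v},\vartheta)$ with values in $\mathcal{H}$, the truncated system $$\partial_t \mathbf{v}-\nu\Delta\mathbf{v}+\chi_{\tilde\varrho}\big(\|D_N^{1/2}\mathbf{V}\|\big)\,P_\sigma\big[\nabla\cdot(D_N\overline{\mathbf{v}}\otimes D_N\overline{\mathbf{v}})-\vartheta\,\mathbf{e}_2\big]=0,$$ $$\partial_t \vartheta-\kappa\Delta\vartheta+\chi_{\tilde\varrho}\big(\|D_N^{1/2}\mathbf{V}\|\big)\,\big[\nabla\cdot(D_N\overline{\vartheta}\,D_N\overline{\mathbf{v}})-f\big]=0,$$ with initial data $(\mathbf{v},\vartheta)|_{t=0}=(\mathbf{u}_0,\theta_0)\in\mathcal{H}$, and let $S(t)$, $t\ge 0$, be its solution semigroup on $\mathcal{H}$. Then this system admits a finite-dimensional inertial manifold $\mathcal{M}\subseteq\mathcal{H}$ (in the sense of the definition in the context). In particular, for every $(\mathbf{u}_0,\theta_0)\in\mathcal{H}$ the solution $S(t)(\mathbf{u}_0,\theta_0)$ approaches the invariant Lipschitz manifold $\mathcal{M}$ exponentially fast in 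time.
   Context: Function spaces. $\mathbb{T}^2=\mathbb{R}^2/(L\mathbb{Z})^2$; all functions are $L$-periodic with zero mean over $\mathbb{T}^2$, and are expanded in Fourier series $v=\sum_{k}\widehat v_k e^{ik\cdot x}$ over $k\in \frac{2\pi}{L}\mathbb{Z}^2\setminus\{0\}$. $H^0$ is the space of real scalar zero-mean functions in $L^2(\mathbb{T}^2)$; $H_0$ is the space of real vector fields $\mathbf{v}\in L^2(\mathbb{T}^2)^2$ with zero mean and $\nabla\cdot\mathbf{v}=0$ (weakly). $\|\cdot\|$ denotes the $L^2(\mathbb{T}^2)$ norm for scalar, vector and product-space elements, so $\|(\mathbf{v},\vartheta)\|^2=\|\mathbf{v}\|^2+\|\vartheta\|^2$. $P_\sigma$ is the Helmholtz-Leray orthogonal projection from zero-mean $L^2$ vector fields onto $H_0$. $\mathbf{e}_2=(0,1)^T$, and $\mathbf{a}\otimes\mathbf{b}$ is the usual tensor product. Filter and deconvolution. $A=I-\alpha^2\Delta$, and $\overline{u}=A^{-1}u$ (componentwise), i.e. $\widehat{\overline{u}}_k=(1+\alpha^2|k|^2)^{-1}\widehat u_k$. The deconvolution operator of order $N$ is $D_N=\sum_{n=0}^N (I-A^{-1})^n$, i.e. the Fourier multiplier with symbol $\widehat D_N(k)=\sum_{n=0}^N\big(\frac{\alpha^2|k|^2}{1+\alpha^2|k|^2}\big)^n$; $D_N^{1/2}$ is the multiplier with symbol $\widehat D_N(k)^{1/2}$. These operators act componentwise on $\mathbf{V}=(\mathbf{v},\vartheta)$. Cut-off. $\chi:[0,\infty)\to[0,1]$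 is a fixed smooth function with $\chi(r)=1$ for $0\le r\le 1$, $\chi(r)=0$ for $r\ge 2$, and $|\chi'(r)|\le 2$ for $r\geq 0$; for $\tilde\varrho>0$, $\chi_{\tilde\varrho}(r)=\chi(r/\tilde\varrho)$. Radius. The untruncated deconvolution system is $$\partial_t\mathbf{v}-\nu\Delta\mathbf{v}+\nabla\cdot(D_N\overline{\mathbf{v}}\otimes D_N\overline{\mathbf{v}})+\nabla\pi=\vartheta\,\mathbf{e}_2,\quad \partial_t\vartheta-\kappa\Delta\vartheta+\nabla\cdot(D_N\overline{\vartheta}\,D_N\overline{\mathbf{v}})=f,\quad \nabla\cdot\mathbf{v}=0,$$ with initial data in $\mathcal{H}$. The radius $\tilde\varrho>0$ is fixed such that every solution $\mathbf{V}=(\mathbf{v},\vartheta)$ of this system satisfies $\|D_N^{1/2}\mathbf{V}(t)\|\le\tilde\varrho$ for all sufficiently large $t$. Inertial manifold. A subset $\mathcal{M}\subseteq\mathcal{H}$ is an inertial manifold for the truncated system with solution operator $S(t)$ if: (i) $\mathcal{M}$ is a finite-dimensional Lipschitz manifold; (ii) $\mathcal{M}$ is invariant, i.e. $S(t)\mathcal{M}\subset\mathcal{M}$ for all $t\ge 0$; (iii) $\mathcal{M}$ attracts all solutions exponentially, i.e. $\mathrm{dist}_{\mathcal{H}}(S(t)(\mathbf{v}_0,\vartheta_0),\mathcal{M})\to 0$ as $t\to\infty$ for every $(\mathbf{v}_0,\vartheta_0)\in\mathcal{H}$, with exponential rate of decay, uniformly for $(\mathbf{v}_0,\vartheta_0)$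 in bounded subsets of $\mathcal{H}$. *)

theory Defs
  imports "HOL-Analysis.Analysis"
begin

section \<open>Periodic functions\<close>

text \<open>
  The torus of side \<open>L\<close> is represented by \<open>L\<close>-periodic functions on the plane, integrated over a
  period cell. Elements of \<open>L\<^sup>2\<close> are Borel representatives: two of them denote the same element
  when their \<open>L\<^sup>2\<close> distance is \<open>0\<close>. Every notion below depends on representatives only through
  integrals, hence only up to equality almost everywhere.
\<close>

type_synonym scalar_field = "real^2 \<Rightarrow> real"
type_synonym vector_field = "real^2 \<Rightarrow> real^2"
type_synonym state = "vector_field \<times> scalar_field"

definition cell :: "real \<Rightarrow> (real^2) set" where
  "cell L = cbox 0 (vec L)"

definition periodic :: "real \<Rightarrow> (real^2 \<Rightarrow> 'b) \<Rightarrow> bool" where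
  "periodic L u \<longleftrightarrow> (\<forall>x i. u (x + axis i L) = u x)"

definition L2_per :: "real \<Rightarrow> (real^2 \<Rightarrow> 'b::euclidean_space) set" where
  "L2_per L = {u. u \<in> borel_measurable borel \<and> periodic L u \<and>
                  set_integrable lborel (cell L) (\<lambda>x. (norm (u x))\<^sup>2)}"

definition L2_zero :: "real \<Rightarrow> (real^2 \<Rightarrow> 'b::euclidean_space) set" where
  "L2_zero L = {u \<in> L2_per L. (LINT x:cell L|lborel. u x) = 0}"

definition ip :: "real \<Rightarrow> (real^2 \<Rightarrow> 'b::euclidean_space) \<Rightarrow> (real^2 \<Rightarrow> 'b) \<Rightarrow> real" where
  "ip L u w = (LINT x:cell L|lborel. u x \<bullet> w x)"

definition L2_norm :: "real \<Rightarrow> (real^2 \<Rightarrow> 'b::euclidean_space) \<Rightarrow> real" where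
  "L2_norm L u = sqrt (LINT x:cell L|lborel. (norm (u x))\<^sup>2)"

section \<open>Test functions and weak derivatives\<close>

definition pd :: "2 \<Rightarrow> scalar_field \<Rightarrow> scalar_field" where
  "pd i \<phi> = (\<lambda>x. frechet_derivative \<phi> (at x) (axis i 1))"

definition laplacian :: "scalar_field \<Rightarrow> scalar_field" where
  "laplacian \<phi> = (\<lambda>x. \<Sum>i\<in>UNIV. pd i (pd i \<phi>) x)"

text \<open>\<open>C\<^sup>\<infinity>\<close>: all iterated partial derivatives are differentiable (hence continuous).\<close>

definition test_fun :: "real \<Rightarrow> scalar_field set" where
  "test_fun L = {\<phi>. periodic L \<phi> \<and> (\<forall>is x. foldr pd is \<phi> differentiable (at x))}"

definition has_weak_pd :: "real \<Rightarrow> 2 \<Rightarrow> scalar_field \<Rightarrow> scalar_field \<Rightarrow> bool" where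
  "has_weak_pd L i u w \<longleftrightarrow> w \<in> L2_per L \<and> (\<forall>\<phi>\<in>test_fun L. ip L w \<phi> = - ip L u (pd i \<phi>))"

text \<open>
  The weak derivative is determined up to equality almost everywhere. It is applied below only to
  functions that have one in \<open>L\<^sup>2\<close>: pressures in \<open>H\<^sup>1\<close>, and products of functions of the form
  \<open>D\<^sub>N (A\<^sup>-\<^sup>1 u)\<close> with \<open>u \<in> L\<^sup>2\<close>, which lie in \<open>H\<^sup>2\<close>, an algebra in dimension two.
\<close>

definition weak_pd :: "real \<Rightarrow> 2 \<Rightarrow> scalar_field \<Rightarrow> scalar_field" where
  "weak_pd L i u = (SOME w. has_weak_pd L i u w)"

definition H1_per :: "real \<Rightarrow> scalar_field set" where
  "H1_per L = {u \<in> L2_per L. \<forall>i. \<exists>w. has_weak_pd L i u w}"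

definition weak_div :: "real \<Rightarrow> vector_field \<Rightarrow> scalar_field" where
  "weak_div L G = (\<lambda>x. \<Sum>i\<in>UNIV. weak_pd L i (\<lambda>y. G y $ i) x)"

definition tensor :: "real^2 \<Rightarrow> real^2 \<Rightarrow> real^2^2" where
  "tensor a b = (\<chi> i j. a $ i * b $ j)"

definition weak_div_tensor :: "real \<Rightarrow> (real^2 \<Rightarrow> real^2^2) \<Rightarrow> vector_field" where
  "weak_div_tensor L G = (\<lambda>x. \<chi> j. \<Sum>i\<in>UNIV. weak_pd L i (\<lambda>y. G y $ i $ j) x)"

section \<open>Phase space and Helmholtz-Leray projection\<close>

definition H_div :: "real \<Rightarrow> vector_field set" where
  "H_div L = {v \<in> L2_zero L. \<forall>\<phi>\<in>test_fun L. ip L v (\<lambda>x. \<chi> i. pd i \<phi> x) = 0}"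

definition phase_space :: "real \<Rightarrow> state set" where
  "phase_space L = H_div L \<times> L2_zero L"

definition state_norm :: "real \<Rightarrow> state \<Rightarrow> real" where
  "state_norm L V = sqrt ((L2_norm L (fst V))\<^sup>2 + (L2_norm L (snd V))\<^sup>2)"

definition state_dist :: "real \<Rightarrow> state \<Rightarrow> state \<Rightarrow> real" where
  "state_dist L V W = state_norm L (\<lambda>x. fst V x - fst W x, \<lambda>x. snd V x - snd W x)"

definition leray :: "real \<Rightarrow> vector_field \<Rightarrow> vector_field" where
  "leray L q = (SOME u. u \<in> H_div L \<and> (\<forall>w\<in>H_div L. ip L (\<lambda>x. q x - u x) w = 0))"

section \<open>Fourier multipliers, filter and deconvolution\<close>

definition wave :: "real \<Rightarrow> int^2 \<Rightarrow> real^2" where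
  "wave L k = (\<chi> i. 2 * pi / L * of_int (k $ i))"

definition fourier_coeff :: "real \<Rightarrow> scalar_field \<Rightarrow> int^2 \<Rightarrow> complex" where
  "fourier_coeff L u k =
     (LINT x:cell L|lborel. complex_of_real (u x) * cis (- (wave L k \<bullet> x))) / complex_of_real (L\<^sup>2)"

text \<open>
  The multiplier with symbol \<open>m\<close>, a function of the wave vector; it exists and is unique up to
  equality almost everywhere for bounded even \<open>m\<close> on zero-mean \<open>L\<^sup>2\<close> functions.
\<close>

definition multiplier :: "real \<Rightarrow> (real^2 \<Rightarrow> real) \<Rightarrow> scalar_field \<Rightarrow> scalar_field" where
  "multiplier L m u = (SOME w. w \<in> L2_zero L \<and>
     (\<forall>k. fourier_coeff L w k = complex_of_real (m (wave L k)) * fourier_coeff L u k))"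

definition vmultiplier :: "real \<Rightarrow> (real^2 \<Rightarrow> real) \<Rightarrow> vector_field \<Rightarrow> vector_field" where
  "vmultiplier L m v = (\<lambda>x. \<chi> i. multiplier L m (\<lambda>y. v y $ i) x)"

definition filter_symbol :: "real \<Rightarrow> real^2 \<Rightarrow> real" where
  "filter_symbol \<alpha> k = 1 / (1 + \<alpha>\<^sup>2 * (norm k)\<^sup>2)"

definition deconv_symbol :: "real \<Rightarrow> nat \<Rightarrow> real^2 \<Rightarrow> real" where
  "deconv_symbol \<alpha> N k = (\<Sum>n\<le>N. (\<alpha>\<^sup>2 * (norm k)\<^sup>2 / (1 + \<alpha>\<^sup>2 * (norm k)\<^sup>2)) ^ n)"

definition DN_bar :: "real \<Rightarrow> real \<Rightarrow> nat \<Rightarrow> scalar_field \<Rightarrow> scalar_field" where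
  "DN_bar L \<alpha> N u = multiplier L (deconv_symbol \<alpha> N) (multiplier L (filter_symbol \<alpha>) u)"

definition DN_vbar :: "real \<Rightarrow> real \<Rightarrow> nat \<Rightarrow> vector_field \<Rightarrow> vector_field" where
  "DN_vbar L \<alpha> N v = vmultiplier L (deconv_symbol \<alpha> N) (vmultiplier L (filter_symbol \<alpha>) v)"

definition DN_half :: "real \<Rightarrow> real \<Rightarrow> nat \<Rightarrow> state \<Rightarrow> state" where
  "DN_half L \<alpha> N V = (vmultiplier L (\<lambda>k. sqrt (deconv_symbol \<alpha> N k)) (fst V),
                      multiplier L (\<lambda>k. sqrt (deconv_symbol \<alpha> N k)) (snd V))"

definition momentum_flux_div :: "real \<Rightarrow> real \<Rightarrow> nat \<Rightarrow> vector_field \<Rightarrow> vector_field" where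
  "momentum_flux_div L \<alpha> N v =
     weak_div_tensor L (\<lambda>x. tensor (DN_vbar L \<alpha> N v x) (DN_vbar L \<alpha> N v x))"

definition heat_flux_div :: "real \<Rightarrow> real \<Rightarrow> nat \<Rightarrow> vector_field \<Rightarrow> scalar_field \<Rightarrow> scalar_field" where
  "heat_flux_div L \<alpha> N v \<theta> =
     weak_div L (\<lambda>x. DN_bar L \<alpha> N \<theta> x *\<^sub>R DN_vbar L \<alpha> N v x)"

section \<open>Cut-off\<close>

text \<open>
  Only the values on \<open>[0,\<infinity>)\<close> matter. Since \<open>chi = 1\<close> on \<open>[0,1]\<close>, smoothness on \<open>[0,\<infinity>)\<close> and the
  bound on the derivative at \<open>0\<close> reduce to the corresponding conditions at \<open>r > 0\<close>.
\<close>

definition cutoff :: "(real \<Rightarrow> real) \<Rightarrow> bool" where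
  "cutoff chi \<longleftrightarrow>
     (\<forall>r\<ge>0. 0 \<le> chi r \<and> chi r \<le> 1) \<and>
     (\<forall>r. 0 \<le> r \<and> r \<le> 1 \<longrightarrow> chi r = 1) \<and>
     (\<forall>r\<ge>2. chi r = 0) \<and>
     (\<forall>n. \<forall>r>0. (deriv ^^ n) chi differentiable (at r)) \<and>
     (\<forall>r>0. \<bar>deriv chi r\<bar> \<le> 2)"

definition cut :: "real \<Rightarrow> real \<Rightarrow> nat \<Rightarrow> (real \<Rightarrow> real) \<Rightarrow> real \<Rightarrow> state \<Rightarrow> real" where
  "cut L \<alpha> N chi \<rho> V = chi (state_norm L (DN_half L \<alpha> N V) / \<rho>)"

section \<open>Weak solutions\<close>

text \<open>
  \<open>\<partial>\<^sub>t u - \<mu> \<Delta> u = g\<close> in the sense of distributions in space, integrated in time from the initial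
  value \<open>u 0\<close>.
\<close>

definition weak_heat ::
  "real \<Rightarrow> real \<Rightarrow> (real \<Rightarrow> scalar_field) \<Rightarrow> (real \<Rightarrow> scalar_field) \<Rightarrow> bool" where
  "weak_heat L \<mu> u g \<longleftrightarrow> (\<forall>\<phi>\<in>test_fun L. \<forall>t\<ge>0.
     ((\<lambda>s. \<mu> * ip L (u s) (laplacian \<phi>) + ip L (g s) \<phi>) has_integral
        (ip L (u t) \<phi> - ip L (u 0) \<phi>)) {0..t})"

definition continuous_curve :: "real \<Rightarrow> (real \<Rightarrow> state) \<Rightarrow> bool" where
  "continuous_curve L V \<longleftrightarrow> (\<forall>t\<ge>0. V t \<in> phase_space L) \<and>
     (\<forall>t\<ge>0. ((\<lambda>s. state_dist L (V s) (V t)) \<longlongrightarrow> 0) (at t within {0..}))"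

definition untruncated_solution ::
  "real \<Rightarrow> real \<Rightarrow> real \<Rightarrow> real \<Rightarrow> nat \<Rightarrow> scalar_field \<Rightarrow> (real \<Rightarrow> state) \<Rightarrow> bool" where
  "untruncated_solution \<nu> \<kappa> L \<alpha> N f V \<longleftrightarrow>
     continuous_curve L V \<and>
     (\<exists>\<pi> :: real \<Rightarrow> scalar_field. (\<forall>t\<ge>0. \<pi> t \<in> H1_per L) \<and>
        (\<forall>j. weak_heat L \<nu> (\<lambda>t x. fst (V t) x $ j)
               (\<lambda>t x. - momentum_flux_div L \<alpha> N (fst (V t)) x $ j
                      - weak_pd L j (\<pi> t) x
                      + (snd (V t) x *\<^sub>R axis 2 1) $ j))) \<and>
     weak_heat L \<kappa> (\<lambda>t. snd (V t))
       (\<lambda>t x. - heat_flux_div L \<alpha> N (fst (V t)) (snd (V t)) x + f x)"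

definition absorbing_radius ::
  "real \<Rightarrow> real \<Rightarrow> real \<Rightarrow> real \<Rightarrow> nat \<Rightarrow> scalar_field \<Rightarrow> real \<Rightarrow> bool" where
  "absorbing_radius \<nu> \<kappa> L \<alpha> N f \<rho> \<longleftrightarrow>
     (\<forall>V. untruncated_solution \<nu> \<kappa> L \<alpha> N f V \<longrightarrow>
        (\<exists>T\<ge>0. \<forall>t\<ge>T. state_norm L (DN_half L \<alpha> N (V t)) \<le> \<rho>))"

definition truncated_solution ::
  "real \<Rightarrow> real \<Rightarrow> real \<Rightarrow> real \<Rightarrow> nat \<Rightarrow> scalar_field \<Rightarrow> (real \<Rightarrow> real) \<Rightarrow> real
     \<Rightarrow> (real \<Rightarrow> state) \<Rightarrow> bool" where
  "truncated_solution \<nu> \<kappa> L \<alpha> N f chi \<rho> V \<longleftrightarrow>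
     continuous_curve L V \<and>
     (\<forall>j. weak_heat L \<nu> (\<lambda>t x. fst (V t) x $ j)
            (\<lambda>t x. - (cut L \<alpha> N chi \<rho> (V t) *
               leray L (\<lambda>y. momentum_flux_div L \<alpha> N (fst (V t)) y - snd (V t) y *\<^sub>R axis 2 1) x $ j))) \<and>
     weak_heat L \<kappa> (\<lambda>t. snd (V t))
       (\<lambda>t x. - (cut L \<alpha> N chi \<rho> (V t) *
               (heat_flux_div L \<alpha> N (fst (V t)) (snd (V t)) x - f x)))"

definition solution_semigroup ::
  "real \<Rightarrow> real \<Rightarrow> real \<Rightarrow> real \<Rightarrow> nat \<Rightarrow> scalar_field \<Rightarrow> (real \<Rightarrow> real) \<Rightarrow> real
     \<Rightarrow> (real \<Rightarrow> state \<Rightarrow> state) \<Rightarrow> bool" where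
  "solution_semigroup \<nu> \<kappa> L \<alpha> N f chi \<rho> S \<longleftrightarrow>
     (\<forall>V0\<in>phase_space L. truncated_solution \<nu> \<kappa> L \<alpha> N f chi \<rho> (\<lambda>t. S t V0) \<and>
                         state_dist L (S 0 V0) V0 = 0)"

section \<open>Inertial manifolds\<close>

text \<open>A set of representatives that is a union of classes of almost-everywhere equal states.\<close>

definition subset_of_phase_space :: "real \<Rightarrow> state set \<Rightarrow> bool" where
  "subset_of_phase_space L M \<longleftrightarrow> M \<subseteq> phase_space L \<and>
     (\<forall>V\<in>M. \<forall>W\<in>phase_space L. state_dist L V W = 0 \<longrightarrow> W \<in> M)"

text \<open>
  Every point has a relatively open neighbourhood that is bi-Lipschitz homeomorphic to an open
  subset of \<open>\<real>\<^sup>n\<close>. The space \<open>Euclidean_space n\<close> consists of the real sequences that vanish from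
  index \<open>n\<close> on.
\<close>

definition lipschitz_manifold :: "real \<Rightarrow> nat \<Rightarrow> state set \<Rightarrow> bool" where
  "lipschitz_manifold L n M \<longleftrightarrow> subset_of_phase_space L M \<and>
     (\<forall>V\<in>M. \<exists>r>0. \<exists>\<psi> :: state \<Rightarrow> nat \<Rightarrow> real. \<exists>c>0. \<exists>C.
        openin (Euclidean_space n) (\<psi> ` {W \<in> M. state_dist L V W < r}) \<and>
        (\<forall>W\<in>{W \<in> M. state_dist L V W < r}. \<forall>W'\<in>{W \<in> M. state_dist L V W < r}.
           c * state_dist L W W' \<le> L2_set (\<lambda>i. \<psi> W i - \<psi> W' i) {..<n} \<and>
           L2_set (\<lambda>i. \<psi> W i - \<psi> W' i) {..<n} \<le> C * state_dist L W W'))"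

definition dist_to_set :: "real \<Rightarrow> state \<Rightarrow> state set \<Rightarrow> real" where
  "dist_to_set L V M = (INF W\<in>M. state_dist L V W)"

text \<open>Nonemptiness is demanded because the real infimum over the empty set is meaningless.\<close>

definition inertial_manifold :: "real \<Rightarrow> (real \<Rightarrow> state \<Rightarrow> state) \<Rightarrow> state set \<Rightarrow> bool" where
  "inertial_manifold L S M \<longleftrightarrow>
     M \<noteq> {} \<and>
     (\<exists>n. lipschitz_manifold L n M) \<and>
     (\<forall>t\<ge>0. S t ` M \<subseteq> M) \<and>
     (\<exists>\<omega>>0. \<forall>B. B \<subseteq> phase_space L \<and> (\<exists>R. \<forall>V\<in>B. state_norm L V \<le> R) \<longrightarrow>
        (\<exists>C. \<forall>V0\<in>B. \<forall>t\<ge>0. dist_to_set L (S t V0) M \<le> C * exp (- \<omega> * t)))"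

end

theory Submission
  imports Defs "HOL-Number_Theory.Number_Theory"
begin

text \<open>
  In the real Fourier coordinates given by the Hartley basis, the truncated system is an ordinary
  differential equation on a product of two \<open>\<ell>\<^sup>2\<close> spaces, with the diagonal linear part of entries
  \<open>\<nu> \<bar>k\<bar>\<^sup>2\<close> and \<open>\<kappa> \<bar>k\<bar>\<^sup>2\<close>. Since \<open>D\<^sub>N A\<inverse>\<close> gains two derivatives and the cut-off vanishes on large
  states, the nonlinearity is bounded and globally Lipschitz on the phase space itself. Hence the
  spectral gap condition only asks for a large gap common to the two sets of rates. It exists
  because \<open>(L / 2\<pi>)\<^sup>2 \<bar>k\<bar>\<^sup>2\<close> is a sum of two squares: the Chinese remainder theorem with primes congruent
  to \<open>3\<close> modulo \<open>4\<close> yields arbitrarily long intervals free of such sums, and these can be placed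
  simultaneously in both spectra, using Kronecker's approximation theorem if \<open>\<nu> / \<kappa>\<close> is irrational.
  With such a gap, the trajectories whose fast part stays bounded backwards in time are found by a
  Lyapunov-Perron fixed point, and their values form the graph of a Lipschitz map over the slow part.
  A solution is attracted because its distance at time \<open>t\<close> to the point of the graph with the same
  slow part is controlled by the fast parts at time \<open>0\<close>, with an exponentially decaying factor.
\<close>

section \<open>Gaps between sums of two squares\<close>

text \<open>The obstacle is that velocity and temperature diffuse at different speeds: the linear
  part has two spectra, and the cut between slow and fast modes must fall into a gap of both at
  once. The width needed is four times the Lipschitz constant: with an exponential weight halfway
  between the edges of the gap, each of the two Duhamel integrals (slow and fast modes) has as its
  constant the Lipschitz constant divided by half the gap, and their sum must stay below
  \<open>1\<close>. The nonlinearity is globally Lipschitz for two reasons. The symbol of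
  \<open>D_N\<close> is at least \<open>1\<close>, so the cut-off removes all states of norm beyond
  \<open>2 * \<rho>\<close>. And two gained derivatives in dimension two put the smoothed fields
  both into the bounded functions and into \<open>H^1\<close>, which controls the divergence of a
  product in \<open>L^2\<close>. A divergence-free planar field has only one scalar coefficient per
  mode, along the direction orthogonal to the wave vector, so velocity and temperature use the same
  sequence space. The invariant set consists of end points of backward trajectories, and its
  invariance follows by appending a given solution to such a trajectory.\<close>

definition sum2sq :: "int \<Rightarrow> bool" where
  "sum2sq n \<longleftrightarrow> (\<exists>a b. n = a\<^sup>2 + b\<^sup>2)"

text \<open>Otherwise \<open>p\<close> divides neither number, and raising
  \<open>a^2 = - b^2\<close> modulo \<open>p\<close> to the power \<open>(p - 1) / 2\<close>, which
  is odd, turns Fermat's little theorem into \<open>1 = - 1\<close> modulo \<open>p\<close>.\<close>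

lemma prime_3_mod_4_dvd_sum_squares:
  fixes p :: nat and a b :: int
  assumes p: "prime p" "p mod 4 = 3" and dvd: "int p dvd a\<^sup>2 + b\<^sup>2"
  shows "int p dvd a"
proof (rule ccontr)
  assume na: "\<not> int p dvd a"
  have nb: "\<not> int p dvd b"
  proof
    assume "int p dvd b"
    then have "int p dvd a\<^sup>2"
      using dvd by (metis dvd_add_left_iff dvd_mult power2_eq_square)
    then show False
      using na p(1) prime_dvd_power_int by (metis prime_int_nat_transfer prime_nat_int_transfer)
  qed
  define m where "m = (p - 1) div 2"
  have m: "p - 1 = 2 * m" "odd m"
    using p(2) unfolding m_def by presburger+
  have fermat: "[c ^ (p - 1) = 1] (mod int p)" if "\<not> int p dvd c" for c :: int
  proof -
    have "\<not> p dvd nat \<bar>c\<bar>"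
      using that by (simp add: int_dvd_int_iff nat_abs_dvd_iff flip: dvd_nat_abs_iff)
    then have "[nat \<bar>c\<bar> ^ (p - 1) = 1] (mod p)"
      using fermat_theorem p(1) by blast
    then have "[int (nat \<bar>c\<bar> ^ (p - 1)) = int 1] (mod int p)"
      by (simp only: cong_int_iff)
    moreover have "int (nat \<bar>c\<bar> ^ (p - 1)) = c ^ (p - 1)"
      using m by (simp add: power_mult)
    ultimately show ?thesis by simp
  qed
  have "[a\<^sup>2 = - b\<^sup>2] (mod int p)"
    using dvd by (simp add: cong_iff_dvd_diff)
  then have "[(a\<^sup>2) ^ m = (- b\<^sup>2) ^ m] (mod int p)"
    by (rule cong_pow)
  then have "[a ^ (p - 1) = - (b ^ (p - 1))] (mod int p)"
    using m by (simp add: power_mult)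
  moreover have "[- (b ^ (p - 1)) = - 1] (mod int p)"
    using fermat[OF nb] by (simp add: cong_minus_minus_iff)
  ultimately have "[1 = - 1] (mod int p)"
    using fermat[OF na] by (meson cong_sym cong_trans)
  then have "int p dvd 2"
    by (simp add: cong_iff_dvd_diff)
  then have "p \<le> 2"
    by (metis int_dvd_int_iff of_nat_numeral dvd_imp_le zero_less_numeral)
  with p(2) show False by (simp add: le_Suc_eq numeral_2_eq_2)
qed

text \<open>Such an \<open>n\<close> is divisible by \<open>p\<close> exactly once, whereas a sum of
  two squares divisible by \<open>p\<close> has both terms, hence itself, divisible by
  \<open>p^2\<close>.\<close>

lemma not_sum2sq_if_cong:
  fixes p :: nat and n :: int
  assumes p: "prime p" "p mod 4 = 3" and n: "[n = int p] (mod (int p)\<^sup>2)"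
  shows "\<not> sum2sq n"
proof
  assume "sum2sq n"
  then obtain a b where ab: "n = a\<^sup>2 + b\<^sup>2" by (auto simp: sum2sq_def)
  from n obtain c where "n - int p = (int p)\<^sup>2 * c"
    unfolding cong_iff_dvd_diff by (elim dvdE)
  then have c: "n = int p + (int p)\<^sup>2 * c" by simp
  then have "int p dvd n" by (simp add: power2_eq_square)
  then have "int p dvd a\<^sup>2 + b\<^sup>2" "int p dvd b\<^sup>2 + a\<^sup>2"
    unfolding ab by (simp_all only: add.commute)
  then have "int p dvd a" "int p dvd b"
    by (blast intro: prime_3_mod_4_dvd_sum_squares[OF p])+
  then have "(int p)\<^sup>2 dvd n"
    using ab by (simp add: dvd_power_same)
  then have "(int p)\<^sup>2 dvd int p"
    unfolding c by (simp add: dvd_add_left_iff)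
  then have "int p * int p dvd int p * 1"
    by (simp add: power2_eq_square)
  moreover have "int p \<noteq> 0" using p(1) by auto
  ultimately have "int p dvd 1" using dvd_mult_cancel_left by blast
  with p(1) show False by (simp add: prime_nat_iff)
qed

text \<open>Odd primes are \<open>1\<close> or \<open>3\<close> modulo \<open>4\<close>, and
  dividing by a prime of the first kind leaves the residue \<open>3\<close> unchanged, so the
  descent must meet a prime of the second kind.\<close>

lemma ex_prime_factor_3_mod_4:
  fixes n :: nat
  assumes "n mod 4 = 3"
  shows "\<exists>p. prime p \<and> p dvd n \<and> p mod 4 = 3"
  using assms
proof (induction n rule: less_induct)
  case (less n)
  then have "n \<noteq> 1" by auto
  then obtain p where p: "prime p" "p dvd n" using prime_factor_nat by blast
  show ?case
  proof (cases "p mod 4 = 3")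
    case False
    from p obtain c where c: "n = p * c" by auto
    have "odd n" using less.prems by presburger
    then have "odd p" using c by auto
    then have p1: "p mod 4 = 1" using False by presburger
    have "n mod 4 = (p mod 4) * (c mod 4) mod 4" using c by (simp add: mod_mult_eq)
    then have c3: "c mod 4 = 3" using p1 less.prems by simp
    have "c < n" using c c3 prime_gt_1_nat[OF p(1)] by (cases "c = 0") auto
    then show ?thesis using less.IH[OF _ c3] c by auto
  qed (use p in auto)
qed

text \<open>Euclid's argument applied to \<open>4 * fact m - 1\<close>, which is \<open>3\<close>
  modulo \<open>4\<close> and coprime to all numbers up to \<open>m\<close>.\<close>

lemma infinite_primes_3_mod_4: "infinite {p::nat. prime p \<and> p mod 4 = 3}"
  unfolding infinite_nat_iff_unbounded
proof
  fix m :: nat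
  have "4 * fact m \<ge> (4::nat)" using fact_ge_1[of m, where ?'a = nat] by linarith
  have "(4 * k - 1) mod 4 = 3" if "k > 0" for k :: nat
  proof -
    have "4 * k - 1 = 3 + 4 * (k - 1)" using that by simp
    then show ?thesis by (simp only: mod_mult_self2) simp
  qed
  then have "(4 * fact m - 1 :: nat) mod 4 = 3" by (metis fact_gt_zero)
  then obtain p :: nat where p: "prime p" "p dvd 4 * fact m - 1" "p mod 4 = 3"
    using ex_prime_factor_3_mod_4 by blast
  have "m < p"
  proof (rule ccontr)
    assume "\<not> m < p"
    then have "p dvd fact m" using prime_ge_1_nat[OF p(1)] by (intro dvd_fact) auto
    then have "p dvd 4 * fact m" by simp
    then have "p dvd 4 * fact m - (4 * fact m - 1)" using p(2) dvd_diff_nat by blast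
    then have "p dvd 1" using \<open>4 * fact m \<ge> (4::nat)\<close> by simp
    with p(1) show False by (simp add: prime_nat_iff)
  qed
  then show "\<exists>n>m. n \<in> {p. prime p \<and> p mod 4 = 3}" using p by auto
qed

text \<open>Each linear form \<open>q i * z + j i\<close> gets its own prime and is made congruent
  to that prime modulo its square; the Chinese remainder theorem solves these conditions together.
  The slopes \<open>q i\<close> allow progressions of different speeds, as they occur for a rational
  ratio of the diffusivities.\<close>

lemma ex_residue_class_avoiding_sum2sq:
  fixes q j :: "nat \<Rightarrow> nat" and n :: nat
  assumes q: "\<And>i. i < n \<Longrightarrow> q i > 0"
  shows "\<exists>A z0. A > 0 \<and> (\<forall>z. [z = int z0] (mod int A) \<longrightarrow> (\<forall>i<n. \<not> sum2sq (int (q i) * z + int (j i))))"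
proof -
  \<comment> \<open>Primes above all slopes \<open>q i\<close>, so that every slope is invertible
    modulo the square of its prime.\<close>
  define P0 where "P0 = {p. prime p \<and> p mod 4 = 3} - {..Max (insert 0 (q ` {..<n}))}"
  have inf: "infinite P0"
    unfolding P0_def using infinite_primes_3_mod_4 by (simp add: Diff_infinite_finite)
  define P where "P = enumerate P0"
  have P: "P i \<in> P0" for i unfolding P_def using enumerate_in_set[OF inf] .
  have inj: "P i \<noteq> P k" if "i \<noteq> k" for i k
    using that unfolding P_def by (metis enumerate_mono inf nat_neq_iff)
  have prm: "prime (P i)" "P i mod 4 = 3" for i using P[of i] by (auto simp: P0_def)
  have big: "q i < P i" if "i < n" for i
  proof -
    have "q i \<le> Max (insert 0 (q ` {..<n}))" using that by (intro Max_ge) auto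
    also have "\<dots> < P i" using P[of i] unfolding P0_def by (simp only: Diff_iff atMost_iff not_le)
    finally show ?thesis .
  qed
  have "\<exists>u. i < n \<longrightarrow> [q i * u + j i = P i] (mod (P i)\<^sup>2)" for i
  proof (cases "i < n")
    case True
    have "coprime (q i) (P i)"
      using prm(1)[of i] big[OF True] q[OF True]
      by (metis coprime_commute nat_dvd_not_less prime_imp_coprime_nat)
    then have "coprime (int (q i)) ((int (P i))\<^sup>2)" by simp
    then obtain v where v: "[int (q i) * v = 1] (mod (int (P i))\<^sup>2)"
      using cong_solve_coprime_int by blast
    define w where "w = v * (int (P i) - int (j i)) mod (int (P i))\<^sup>2"
    have "[w = v * (int (P i) - int (j i))] (mod (int (P i))\<^sup>2)"
      by (simp add: w_def)
    then have "[int (q i) * w = int (q i) * (v * (int (P i) - int (j i)))] (mod (int (P i))\<^sup>2)"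
      by (rule cong_scalar_left)
    also have "int (q i) * (v * (int (P i) - int (j i))) = (int (q i) * v) * (int (P i) - int (j i))"
      by simp
    also have "[\<dots> = 1 * (int (P i) - int (j i))] (mod (int (P i))\<^sup>2)"
      using v by (rule cong_scalar_right)
    finally have "[int (q i) * w + int (j i) = 1 * (int (P i) - int (j i)) + int (j i)] (mod (int (P i))\<^sup>2)"
      by (rule cong_add_rcancel[THEN iffD2])
    moreover have "w \<ge> 0" using prm(1)[of i] by (auto simp: w_def prime_gt_0_nat)
    ultimately have "[int (q i * nat w + j i) = int (P i)] (mod int ((P i)\<^sup>2))" by simp
    then show ?thesis by (metis cong_int_iff)
  qed auto
  then obtain u where u: "\<And>i. i < n \<Longrightarrow> [q i * u i + j i = P i] (mod (P i)\<^sup>2)" by metis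
  have "\<exists>x. \<forall>i\<in>{..<n}. [x = u i] (mod (P i)\<^sup>2)"
    by (rule chinese_remainder_nat) (use inj prm in \<open>auto intro!: primes_coprime\<close>)
  then obtain z0 where z0: "\<And>i. i < n \<Longrightarrow> [z0 = u i] (mod (P i)\<^sup>2)" by auto
  define A where "A = (\<Prod>i<n. (P i)\<^sup>2)"
  have "A > 0" unfolding A_def using prm by (auto intro!: prod_pos simp: prime_gt_0_nat)
  moreover have "\<not> sum2sq (int (q i) * z + int (j i))" if z: "[z = int z0] (mod int A)" and i: "i < n" for z i
  proof (rule not_sum2sq_if_cong[OF prm(1)[of i] prm(2)[of i]])
    have "(P i)\<^sup>2 dvd A" unfolding A_def using i by (intro dvd_prodI) auto
    then have "(int (P i))\<^sup>2 dvd int A" by (metis int_dvd_int_iff of_nat_power)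
    then have "[z = int z0] (mod (int (P i))\<^sup>2)" using z cong_dvd_modulus by blast
    moreover have "[int z0 = int (u i)] (mod (int (P i))\<^sup>2)"
      using z0[OF i] by (metis cong_int_iff of_nat_power)
    ultimately have "[z = int (u i)] (mod (int (P i))\<^sup>2)" by (rule cong_trans)
    then have "[int (q i) * z + int (j i) = int (q i) * int (u i) + int (j i)] (mod (int (P i))\<^sup>2)"
      by (intro cong_add cong_mult cong_refl)
    also have "int (q i) * int (u i) + int (j i) = int (q i * u i + j i)" by simp
    also have "[\<dots> = int (P i)] (mod (int (P i))\<^sup>2)"
      using u[OF i] by (metis cong_int_iff of_nat_power)
    finally show "[int (q i) * z + int (j i) = int (P i)] (mod (int (P i))\<^sup>2)" .
  qed
  ultimately show ?thesis by blast
qed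

text \<open>For \<open>r = p / q\<close> take \<open>y = q * z\<close>: both \<open>y\<close> and
  \<open>r * y\<close> are then integers, linear in \<open>z\<close>, and \<open>2 * g\<close> forms
  have to be avoided. For irrational \<open>r\<close> it is enough to bring both floors into one
  good residue class modulo \<open>A\<close>; the class of \<open>y = n0 + A * s\<close> is
  automatic, and \<open>s\<close> is left to steer \<open>r * y\<close>.\<close>

lemma ex_floor_gaps:
  fixes r :: real and g :: nat
  assumes r: "r > 0"
  shows "\<exists>y>0. \<forall>j<g. \<not> sum2sq (\<lfloor>y\<rfloor> + int j) \<and> \<not> sum2sq (\<lfloor>r * y\<rfloor> + int j)"
proof (cases "r \<in> \<rat>")
  case True
  then obtain p q :: nat where pq: "q \<noteq> 0" "r = real p / real q"
    using r by (metis Rats_abs_nat_div_natE abs_of_pos)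
  then have p: "p > 0" using r by (cases p) auto
  define Q where "Q i = (if i < g then q else p)" for i
  define J where "J i = (if i < g then i else i - g)" for i
  have Qpos: "Q i > 0" for i using pq p by (simp add: Q_def)
  obtain A z0 where A: "A > 0" and *:
    "\<And>z i. [z = int z0] (mod int A) \<Longrightarrow> i < 2 * g \<Longrightarrow> \<not> sum2sq (int (Q i) * z + int (J i))"
    using ex_residue_class_avoiding_sum2sq[of "2 * g" Q J, OF Qpos] by blast
  define z where "z = z0 + A"
  have z: "[int z = int z0] (mod int A)" by (simp add: z_def cong_def)
  have "r * real (q * z) = real (p * z)" using pq by simp
  then have fl: "\<lfloor>r * real (q * z)\<rfloor> = int p * int z" "\<lfloor>real (q * z)\<rfloor> = int q * int z"
    by (metis floor_of_nat of_nat_mult)+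
  have "\<not> sum2sq (int q * int z + int j) \<and> \<not> sum2sq (int p * int z + int j)" if "j < g" for j
    using *[OF z, of j] *[OF z, of "j + g"] that by (auto simp: Q_def J_def)
  moreover have "real (q * z) > 0" using pq A by (simp add: z_def)
  ultimately show ?thesis using fl by metis
next
  case False
  obtain A n0 where A: "A > 0" and *:
    "\<And>z i. [z = int n0] (mod int A) \<Longrightarrow> i < g \<Longrightarrow> \<not> sum2sq (z + int i)"
    using ex_residue_class_avoiding_sum2sq[of g "\<lambda>_. 1" "\<lambda>i. i"] by auto
  \<comment> \<open>The aim is \<open>r * (n0 + A * s)\<close> close to \<open>n0 + 1/2\<close>
    modulo \<open>A\<close>; solved for \<open>s * r\<close> this prescribes the fractional part
    \<open>\<tau>\<close>. An error below \<open>1 / (2 * A)\<close> becomes one below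
    \<open>1/2\<close> after multiplication by \<open>A\<close>, so aiming at a half-integer keeps
    the floor exact.\<close>
  define \<tau> where "\<tau> = frac ((real n0 + 1/2 - real n0 * r) / real A)"
  have irr: "r \<notin> \<rat>" by fact
  have t: "0 \<le> \<tau>" "\<tau> \<le> 1" by (auto simp: \<tau>_def intro: less_imp_le frac_lt_1)
  obtain s where s: "s > 0" "\<bar>frac (real s * r) - \<tau>\<bar> < 1 / (2 * real A)"
    using Kronecker_approx_1_explicit[OF irr t, of "1 / (2 * real A)"] A by auto
  define M where "M = \<lfloor>real s * r\<rfloor> - \<lfloor>(real n0 + 1/2 - real n0 * r) / real A\<rfloor>"
  have eq: "real s * r = (real n0 + 1/2 - real n0 * r) / real A + real_of_int M + (frac (real s * r) - \<tau>)"
    by (simp add: M_def \<tau>_def frac_def)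
  define y where "y = real (n0 + A * s)"
  have "real A * (real s * r) = real n0 + 1/2 - real n0 * r + real A * real_of_int M + real A * (frac (real s * r) - \<tau>)"
    using arg_cong[OF eq, of "\<lambda>x. real A * x"] A by (simp add: distrib_left)
  then have ry: "r * y = real_of_int (int n0 + int A * M) + (1/2 + real A * (frac (real s * r) - \<tau>))"
    unfolding y_def by (simp add: algebra_simps)
  have "\<bar>real A * (frac (real s * r) - \<tau>)\<bar> < 1/2"
    using mult_strict_left_mono[OF s(2), of "real A"] A by (simp add: abs_mult)
  then have f1: "\<lfloor>r * y\<rfloor> = int n0 + int A * M"
    unfolding ry by (intro floor_unique) (auto simp: abs_less_iff)
  have f2: "\<lfloor>y\<rfloor> = int n0 + int A * int s" unfolding y_def by (metis floor_of_nat of_nat_add of_nat_mult)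
  have "y > 0" using A s(1) unfolding y_def of_nat_0_less_iff by simp
  moreover have "\<not> sum2sq (\<lfloor>y\<rfloor> + int j) \<and> \<not> sum2sq (\<lfloor>r * y\<rfloor> + int j)" if "j < g" for j
    unfolding f1 f2 using * that by (auto simp: cong_def)
  ultimately show ?thesis by blast
qed

text \<open>Division by \<open>c1\<close> and by \<open>c2\<close> turns the common real gap into
  two runs of integers without sums of two squares, starting at \<open>y\<close> and at
  \<open>(c1 / c2) * y\<close>. In \<open>g\<close> the summand \<open>2\<close> leaves room for
  passing from a real number to its floor.\<close>

theorem ex_common_gap_sum2sq:
  fixes c1 c2 G :: real
  assumes c: "c1 > 0" "c2 > 0"
  shows "\<exists>x>0. \<forall>m. sum2sq m \<longrightarrow> (c1 * of_int m \<le> x \<or> x + G \<le> c1 * of_int m) \<and>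
                                   (c2 * of_int m \<le> x \<or> x + G \<le> c2 * of_int m)"
proof -
  define g where "g = nat (max \<lceil>G / c1\<rceil> \<lceil>G / c2\<rceil>) + 2"
  have g: "G / c1 + 2 \<le> real g" "G / c2 + 2 \<le> real g"
    unfolding g_def by linarith+
  obtain y where y: "y > 0" "\<And>j. j < g \<Longrightarrow> \<not> sum2sq (\<lfloor>y\<rfloor> + int j)"
      "\<And>j. j < g \<Longrightarrow> \<not> sum2sq (\<lfloor>c1 / c2 * y\<rfloor> + int j)"
    using ex_floor_gaps[of "c1 / c2" g] c by auto
  have key: "of_int m \<le> w \<or> w + D \<le> of_int m"
    if "\<And>j. j < g \<Longrightarrow> \<not> sum2sq (\<lfloor>w\<rfloor> + int j)" "D + 2 \<le> real g" "sum2sq m" for w D :: real and m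
  proof (rule ccontr)
    assume "\<not> ?thesis"
    then have lt: "w < of_int m" "of_int m < w + D" by auto
    define j where "j = nat (m - \<lfloor>w\<rfloor>)"
    have "\<lfloor>w\<rfloor> \<le> m" using lt by linarith
    then have "m = \<lfloor>w\<rfloor> + int j" by (simp add: j_def)
    moreover have "j < g"
    proof -
      have "real_of_int (m - \<lfloor>w\<rfloor>) < real g" using lt that(2) by linarith
      then show ?thesis unfolding j_def using \<open>\<lfloor>w\<rfloor> \<le> m\<close> by linarith
    qed
    ultimately show False using that(1,3) by metis
  qed
  define x where "x = c1 * y"
  have "x > 0" using c y by (simp add: x_def)
  moreover have "(c1 * of_int m \<le> x \<or> x + G \<le> c1 * of_int m) \<and>
                 (c2 * of_int m \<le> x \<or> x + G \<le> c2 * of_int m)" if "sum2sq m" for m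
  proof
    have "of_int m \<le> y \<or> y + G / c1 \<le> of_int m" using key[OF y(2) g(1) that] by simp
    then show "c1 * of_int m \<le> x \<or> x + G \<le> c1 * of_int m"
      using c unfolding x_def by (auto simp: field_simps)
    have "of_int m \<le> c1 / c2 * y \<or> c1 / c2 * y + G / c2 \<le> of_int m" using key[OF y(3) g(2) that] by simp
    then show "c2 * of_int m \<le> x \<or> x + G \<le> c2 * of_int m"
      using c unfolding x_def by (auto simp: field_simps)
  qed
  ultimately show ?thesis by blast
qed

section \<open>Square summable families\<close>

definition square_summable :: "('i \<Rightarrow> real) \<Rightarrow> bool" where
  "square_summable a \<longleftrightarrow> (\<lambda>i. (a i)\<^sup>2) summable_on UNIV"

lemma square_summableI:
  assumes "\<And>K. finite K \<Longrightarrow> (\<Sum>i\<in>K. (a i)\<^sup>2) \<le> B"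
  shows "square_summable a"
  unfolding square_summable_def
  by (rule nonneg_bdd_above_summable_on) (use assms in \<open>auto intro!: bdd_aboveI2\<close>)

lemma sum_le_infsum_squares:
  assumes "square_summable a" "finite K"
  shows "(\<Sum>i\<in>K. (a i)\<^sup>2) \<le> (\<Sum>\<^sub>\<infinity>i. (a i)\<^sup>2)"
  using assms unfolding square_summable_def by (intro finite_sum_le_infsum) auto

lemma square_summable_add:
  assumes "square_summable a" "square_summable b"
  shows "square_summable (\<lambda>i. a i + b i)"
proof (rule square_summableI)
  fix K :: "'a set" assume K: "finite K"
  have "(\<Sum>i\<in>K. (a i + b i)\<^sup>2) \<le> (\<Sum>i\<in>K. 2 * (a i)\<^sup>2 + 2 * (b i)\<^sup>2)"
    by (intro sum_mono) (smt (verit) sum_squares_bound power2_sum)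
  also have "\<dots> = 2 * (\<Sum>i\<in>K. (a i)\<^sup>2) + 2 * (\<Sum>i\<in>K. (b i)\<^sup>2)"
    by (simp add: sum.distrib sum_distrib_left)
  also have "\<dots> \<le> 2 * (\<Sum>\<^sub>\<infinity>i. (a i)\<^sup>2) + 2 * (\<Sum>\<^sub>\<infinity>i. (b i)\<^sup>2)"
    using sum_le_infsum_squares[OF assms(1) K] sum_le_infsum_squares[OF assms(2) K] by simp
  finally show "(\<Sum>i\<in>K. (a i + b i)\<^sup>2) \<le> 2 * (\<Sum>\<^sub>\<infinity>i. (a i)\<^sup>2) + 2 * (\<Sum>\<^sub>\<infinity>i. (b i)\<^sup>2)" .
qed

lemma square_summable_scale: "square_summable a \<Longrightarrow> square_summable (\<lambda>i. c * a i)"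
  unfolding square_summable_def by (simp add: power_mult_distrib summable_on_cmult_right)

lemma summable_on_mult_square_summable:
  assumes "square_summable a" "square_summable b"
  shows "(\<lambda>i. a i * b i) summable_on UNIV"
proof -
  have "(\<lambda>i. (1/2) * ((a i)\<^sup>2 + (b i)\<^sup>2)) summable_on UNIV"
    using assms unfolding square_summable_def by (intro summable_on_cmult_right summable_on_add)
  then have "(\<lambda>i. norm (a i * b i)) summable_on UNIV"
  proof (rule summable_on_comparison_test)
    fix i
    have "0 \<le> (\<bar>a i\<bar> - \<bar>b i\<bar>)\<^sup>2" by simp
    then show "norm (a i * b i) \<le> (1/2) * ((a i)\<^sup>2 + (b i)\<^sup>2)"
      by (simp add: power2_diff abs_mult)
  qed auto
  then show ?thesis by (rule abs_summable_summable)
qed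

text \<open>A type of its own makes completeness and the inner product class instances, so that
  integrals of vector-valued curves and the Banach fixed point theorem apply to coefficient
  families.\<close>

typedef 'i ell2 = "{a :: 'i \<Rightarrow> real. square_summable a}"
  morphisms coord Abs_ell2
  by (rule exI[of _ "\<lambda>_. 0"]) (simp add: square_summable_def)

setup_lifting type_definition_ell2

lemma square_summable_coord [simp]: "square_summable (coord x)"
  using coord by auto

lemma ell2_eqI: "(\<And>i. coord x i = coord y i) \<Longrightarrow> x = y"
  by (metis coord_inject ext)

instantiation ell2 :: (type) real_vector
begin
lift_definition zero_ell2 :: "'a ell2" is "\<lambda>_. 0" by (simp add: square_summable_def)
lift_definition plus_ell2 :: "'a ell2 \<Rightarrow> 'a ell2 \<Rightarrow> 'a ell2" is "\<lambda>a b i. a i + b i"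
  by (rule square_summable_add)
lift_definition uminus_ell2 :: "'a ell2 \<Rightarrow> 'a ell2" is "\<lambda>a i. - a i"
  by (simp add: square_summable_def)
lift_definition minus_ell2 :: "'a ell2 \<Rightarrow> 'a ell2 \<Rightarrow> 'a ell2" is "\<lambda>a b i. a i - b i"
proof -
  fix a b :: "'a \<Rightarrow> real"
  assume "square_summable a" "square_summable b"
  then have "square_summable (\<lambda>i. a i + (-1) * b i)"
    by (intro square_summable_add square_summable_scale)
  then show "square_summable (\<lambda>i. a i - b i)" by simp
qed
lift_definition scaleR_ell2 :: "real \<Rightarrow> 'a ell2 \<Rightarrow> 'a ell2" is "\<lambda>c a i. c * a i"
  by (rule square_summable_scale)
instance
  by standard (transfer; simp add: fun_eq_iff algebra_simps)+
end

lemma coord_zero [simp]: "coord 0 i = 0" by transfer simp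
lemma coord_add [simp]: "coord (x + y) i = coord x i + coord y i" by transfer simp
lemma coord_diff [simp]: "coord (x - y) i = coord x i - coord y i" by transfer simp
lemma coord_minus [simp]: "coord (- x) i = - coord x i" by transfer simp
lemma coord_scaleR [simp]: "coord (c *\<^sub>R x) i = c * coord x i" by transfer simp
lemma coord_sum: "coord (sum f K) i = (\<Sum>k\<in>K. coord (f k) i)"
  by (induction K rule: infinite_finite_induct) auto

instantiation ell2 :: (type) real_inner
begin
definition inner_ell2 :: "'a ell2 \<Rightarrow> 'a ell2 \<Rightarrow> real" where
  "inner_ell2 x y = (\<Sum>\<^sub>\<infinity>i. coord x i * coord y i)"
definition norm_ell2 :: "'a ell2 \<Rightarrow> real" where "norm_ell2 x = sqrt (x \<bullet> x)"
definition dist_ell2 :: "'a ell2 \<Rightarrow> 'a ell2 \<Rightarrow> real" where "dist_ell2 x y = norm (x - y)"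
definition sgn_ell2 :: "'a ell2 \<Rightarrow> 'a ell2" where "sgn_ell2 x = inverse (norm x) *\<^sub>R x"
definition uniformity_ell2 :: "('a ell2 \<times> 'a ell2) filter" where
  "uniformity_ell2 = (INF e\<in>{0 <..}. principal {(x, y). dist x y < e})"
definition open_ell2 :: "'a ell2 set \<Rightarrow> bool" where
  "open_ell2 U = (\<forall>x\<in>U. eventually (\<lambda>(x', y). x' = x \<longrightarrow> y \<in> U) uniformity)"
instance
proof
  fix x y z :: "'a ell2" and r :: real
  show "x \<bullet> y = y \<bullet> x" by (simp add: inner_ell2_def mult.commute)
  show "(x + y) \<bullet> z = x \<bullet> z + y \<bullet> z"
    unfolding inner_ell2_def coord_add distrib_right
    by (intro infsum_add summable_on_mult_square_summable) auto
  show "r *\<^sub>R x \<bullet> y = r * (x \<bullet> y)"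
    by (simp add: inner_ell2_def mult.assoc infsum_cmult_right')
  show "0 \<le> x \<bullet> x" unfolding inner_ell2_def by (intro infsum_nonneg) auto
  show "x \<bullet> x = 0 \<longleftrightarrow> x = 0"
  proof
    assume "x \<bullet> x = 0"
    then have "(\<Sum>\<^sub>\<infinity>i. (coord x i)\<^sup>2) = 0" by (simp add: inner_ell2_def power2_eq_square)
    then have "coord x i = 0" for i
      using sum_le_infsum_squares[of "coord x" "{i}"] by simp
    then show "x = 0" by (intro ell2_eqI) simp
  qed (simp add: inner_ell2_def)
qed (simp_all add: norm_ell2_def dist_ell2_def sgn_ell2_def uniformity_ell2_def open_ell2_def)
end

lemma norm_ell2_square: "(norm x)\<^sup>2 = (\<Sum>\<^sub>\<infinity>i. (coord x i)\<^sup>2)"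
  by (simp only: power2_norm_eq_inner inner_ell2_def) (simp add: power2_eq_square)

lemma has_sum_norm_ell2: "((\<lambda>i. (coord x i)\<^sup>2) has_sum (norm x)\<^sup>2) UNIV"
  unfolding norm_ell2_square using square_summable_coord[of x]
  unfolding square_summable_def by (rule has_sum_infsum)

lemma sum_squares_le_norm: "finite K \<Longrightarrow> (\<Sum>i\<in>K. (coord x i)\<^sup>2) \<le> (norm x)\<^sup>2"
  unfolding norm_ell2_square by (intro sum_le_infsum_squares) auto

lemma norm_ell2_leI:
  assumes "\<And>K. finite K \<Longrightarrow> (\<Sum>i\<in>K. (coord x i)\<^sup>2) \<le> B\<^sup>2" "B \<ge> 0"
  shows "norm x \<le> B"
proof (rule power2_le_imp_le)
  show "(norm x)\<^sup>2 \<le> B\<^sup>2" unfolding norm_ell2_square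
    using square_summable_coord[of x] unfolding square_summable_def
    by (rule infsum_le_finite_sums) (use assms in auto)
qed (use assms in auto)

text \<open>The way to produce elements from estimates: a bound on all finite partial sums of
  squares suffices. The gradient of a product is obtained in this manner.\<close>

lemma ell2_boundedE:
  assumes "\<And>K. finite K \<Longrightarrow> (\<Sum>i\<in>K. (a i)\<^sup>2) \<le> B\<^sup>2" "B \<ge> 0"
  obtains x where "coord x = a" "norm x \<le> B"
proof -
  have "square_summable a" using assms(1) by (rule square_summableI)
  then have "coord (Abs_ell2 a) = a" by (simp add: Abs_ell2_inverse)
  moreover have "norm (Abs_ell2 a) \<le> B"
    by (rule norm_ell2_leI) (use assms calculation in auto)
  ultimately show ?thesis by (rule that)
qed

lemma abs_coord_le_norm: "\<bar>coord x i\<bar> \<le> norm x"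
  using sum_squares_le_norm[of "{i}" x] by (simp add: abs_le_square_iff[symmetric])

lemma norm_ell2_mono:
  assumes "\<And>i. \<bar>coord x i\<bar> \<le> c * \<bar>coord y i\<bar>" "c \<ge> 0"
  shows "norm x \<le> c * norm y"
proof (rule norm_ell2_leI)
  fix K :: "'a set" assume K: "finite K"
  have "(\<Sum>i\<in>K. (coord x i)\<^sup>2) \<le> (\<Sum>i\<in>K. c\<^sup>2 * (coord y i)\<^sup>2)"
    using assms by (intro sum_mono) (metis abs_le_square_iff abs_mult abs_of_nonneg power_mult_distrib)
  also have "\<dots> \<le> c\<^sup>2 * (norm y)\<^sup>2"
    using sum_squares_le_norm[OF K, of y] by (simp add: sum_distrib_left[symmetric] mult_left_mono)
  finally show "(\<Sum>i\<in>K. (coord x i)\<^sup>2) \<le> (c * norm y)\<^sup>2" by (simp add: power_mult_distrib)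
qed (use assms in auto)

lemma bounded_linear_coord: "bounded_linear (\<lambda>x. coord x i)"
  by (rule bounded_linear_intro[of _ 1]) (use abs_coord_le_norm in auto)

text \<open>Coordinates converge separately; the Cauchy bound is passed to the limit on each finite
  index set, and since it does not depend on that set it holds in norm.\<close>

instance ell2 :: (type) banach
proof
  fix X :: "nat \<Rightarrow> 'a ell2"
  assume X: "Cauchy X"
  have "Cauchy (\<lambda>n. coord (X n) i)" for i
    using bounded_linear.Cauchy[OF bounded_linear_coord X] .
  then have "\<exists>l. (\<lambda>n. coord (X n) i) \<longlonglongrightarrow> l" for i
    by (simp add: real_Cauchy_convergent convergent_def[symmetric])
  then obtain l where l: "\<And>i. (\<lambda>n. coord (X n) i) \<longlonglongrightarrow> l i" by metis
  have tail: "(\<Sum>i\<in>K. (coord (X m) i - l i)\<^sup>2) \<le> e\<^sup>2"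
    if "finite K" and M: "\<And>m n. m \<ge> M \<Longrightarrow> n \<ge> M \<Longrightarrow> norm (X m - X n) \<le> e" and "m \<ge> M" for K m M e
  proof (rule LIMSEQ_le_const2)
    show "(\<lambda>n. \<Sum>i\<in>K. (coord (X m) i - coord (X n) i)\<^sup>2) \<longlonglongrightarrow> (\<Sum>i\<in>K. (coord (X m) i - l i)\<^sup>2)"
      by (intro tendsto_intros l)
    have "(\<Sum>i\<in>K. (coord (X m) i - coord (X n) i)\<^sup>2) \<le> e\<^sup>2" if "n \<ge> M" for n
    proof -
      have "(\<Sum>i\<in>K. (coord (X m) i - coord (X n) i)\<^sup>2) \<le> (norm (X m - X n))\<^sup>2"
        using sum_squares_le_norm[OF \<open>finite K\<close>, of "X m - X n"] by simp
      also have "\<dots> \<le> e\<^sup>2" using M[OF \<open>m \<ge> M\<close> that] by (intro power_mono) auto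
      finally show ?thesis .
    qed
    then show "\<exists>N. \<forall>n\<ge>N. (\<Sum>i\<in>K. (coord (X m) i - coord (X n) i)\<^sup>2) \<le> e\<^sup>2" by blast
  qed
  have cau: "\<exists>M. \<forall>m\<ge>M. \<forall>n\<ge>M. norm (X m - X n) \<le> e" if "e > 0" for e
    using CauchyD[OF X that] by (meson less_imp_le)
  obtain M1 where M1: "\<And>m n. m \<ge> M1 \<Longrightarrow> n \<ge> M1 \<Longrightarrow> norm (X m - X n) \<le> 1"
    using cau[of 1] by auto
  have "square_summable (\<lambda>i. coord (X M1) i - l i)"
    using tail[OF _ M1 order_refl] by (intro square_summableI[where B = "1\<^sup>2"]) auto
  from square_summable_add[OF square_summable_coord[of "X M1"] square_summable_scale[OF this, of "-1"]]
  have "square_summable l" by simp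
  then have L: "coord (Abs_ell2 l) = l" by (simp add: Abs_ell2_inverse)
  have "X \<longlonglongrightarrow> Abs_ell2 l"
  proof (rule LIMSEQ_I)
    fix r :: real assume r: "r > 0"
    obtain M where M: "\<And>m n. m \<ge> M \<Longrightarrow> n \<ge> M \<Longrightarrow> norm (X m - X n) \<le> r/2"
      using cau[of "r/2"] r by auto
    have "norm (X m - Abs_ell2 l) \<le> r/2" if "m \<ge> M" for m
      by (rule norm_ell2_leI) (use tail[OF _ M that] r L in auto)
    then show "\<exists>no. \<forall>n\<ge>no. norm (X n - Abs_ell2 l) < r"
      using r by (intro exI[of _ M]) (smt (verit) field_sum_of_halves)
  qed
  then show "convergent X" by (auto simp: convergent_def)
qed

text \<open>For an unbounded family \<open>d\<close> the operator \<open>diag d\<close> is \<open>0\<close>.\<close>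

lift_definition diag :: "('i \<Rightarrow> real) \<Rightarrow> 'i ell2 \<Rightarrow> 'i ell2" is
  "\<lambda>d a i. if bounded (range d) then d i * a i else 0"
proof -
  fix d a :: "'i \<Rightarrow> real"
  assume a: "square_summable a"
  show "square_summable (\<lambda>i. if bounded (range d) then d i * a i else 0)"
  proof (cases "bounded (range d)")
    case True
    then obtain B where B: "\<And>i. \<bar>d i\<bar> \<le> B" by (auto simp: bounded_iff)
    have "(\<Sum>i\<in>K. (d i * a i)\<^sup>2) \<le> B\<^sup>2 * (\<Sum>\<^sub>\<infinity>i. (a i)\<^sup>2)" if "finite K" for K
    proof -
      have "(\<Sum>i\<in>K. (d i * a i)\<^sup>2) \<le> (\<Sum>i\<in>K. B\<^sup>2 * (a i)\<^sup>2)"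
        unfolding power_mult_distrib using B
        by (intro sum_mono mult_right_mono) (auto simp: abs_le_square_iff[symmetric] intro: order.trans[OF B abs_ge_self])
      also have "\<dots> \<le> B\<^sup>2 * (\<Sum>\<^sub>\<infinity>i. (a i)\<^sup>2)"
        unfolding sum_distrib_left[symmetric] using sum_le_infsum_squares[OF a that] by (intro mult_left_mono) auto
      finally show ?thesis .
    qed
    then show ?thesis using True by (auto intro: square_summableI)
  qed (simp add: square_summable_def)
qed

lemma coord_diag: "(\<And>i. \<bar>d i\<bar> \<le> B) \<Longrightarrow> coord (diag d x) i = d i * coord x i"
  by transfer (auto simp: bounded_iff)

section \<open>Inertial manifolds for exponential dichotomies with a spectral gap\<close>

locale growth_semigroup =
  fixes U :: "real \<Rightarrow> 'h::banach \<Rightarrow> 'h" and \<omega> :: real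
  assumes linear: "t \<ge> 0 \<Longrightarrow> bounded_linear (U t)"
    and semigroup: "s \<ge> 0 \<Longrightarrow> t \<ge> 0 \<Longrightarrow> U (s + t) x = U s (U t x)"
    and growth: "t \<ge> 0 \<Longrightarrow> norm (U t x) \<le> exp (\<omega> * t) * norm x"
    and strongly_continuous: "continuous_on {0..} (\<lambda>t. U t x)"
begin

lemma diff: "t \<ge> 0 \<Longrightarrow> U t (x - y) = U t x - U t y"
  using linear by (simp add: linear_diff bounded_linear.linear)

lemma add: "t \<ge> 0 \<Longrightarrow> U t (x + y) = U t x + U t y"
  using linear by (simp add: linear_add bounded_linear.linear)

text \<open>Joint continuity from strong continuity: the change of the vector is damped by the
  locally bounded factor \<open>exp (\<omega> * r s)\<close>, and the change of the time acts on a
  fixed vector.\<close>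

lemma continuous_on_compose:
  fixes r :: "'a::topological_space \<Rightarrow> real"
  assumes r: "continuous_on S r" "\<And>s. s \<in> S \<Longrightarrow> r s \<ge> 0" and g: "continuous_on S g"
  shows "continuous_on S (\<lambda>s. U (r s) (g s))"
  unfolding continuous_on_def
proof
  fix s0 assume s0: "s0 \<in> S"
  have rl: "(r \<longlongrightarrow> r s0) (at s0 within S)" and gl: "(g \<longlongrightarrow> g s0) (at s0 within S)"
    using r(1) g s0 by (auto simp: continuous_on_def)
  have 1: "((\<lambda>s. U (r s) (g s0)) \<longlongrightarrow> U (r s0) (g s0)) (at s0 within S)"
    using continuous_on_compose2[OF strongly_continuous[of "g s0"] r(1)] r(2) s0
    by (auto simp: continuous_on_def)
  have "((\<lambda>s. exp (\<omega> * r s) * norm (g s - g s0)) \<longlongrightarrow> exp (\<omega> * r s0) * norm (g s0 - g s0)) (at s0 within S)"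
    by (intro tendsto_intros rl gl)
  then have z: "((\<lambda>s. exp (\<omega> * r s) * norm (g s - g s0)) \<longlongrightarrow> 0) (at s0 within S)" by simp
  have 2: "((\<lambda>s. U (r s) (g s) - U (r s) (g s0)) \<longlongrightarrow> 0) (at s0 within S)"
  proof (rule tendsto_0_le[OF z, of _ 1])
    show "\<forall>\<^sub>F s in at s0 within S. norm (U (r s) (g s) - U (r s) (g s0)) \<le> norm (exp (\<omega> * r s) * norm (g s - g s0)) * 1"
      unfolding eventually_at_filter
      by (rule always_eventually) (auto simp: diff[symmetric] r(2) growth)
  qed
  from tendsto_add[OF 2 1] show "((\<lambda>s. U (r s) (g s)) \<longlongrightarrow> U (r s0) (g s0)) (at s0 within S)" by simp
qed

lemma integrable_convolution:
  "continuous_on {0..x} g \<Longrightarrow> (\<lambda>r. U r (g r)) integrable_on {0..x}"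
  by (intro integrable_continuous_interval continuous_on_compose continuous_intros) auto

text \<open>Cut the integral at \<open>x\<close> and shift the second piece; the semigroup law
  factors out \<open>U x\<close>, which leaves the integral by bounded linearity. All gluing of
  trajectories and all restart formulas rest on this identity.\<close>

lemma convolution_split:
  assumes xy: "x \<ge> 0" "y \<ge> 0" and g: "continuous_on {0..x + y} g"
  shows "integral {0..x + y} (\<lambda>r. U r (g r)) =
         integral {0..x} (\<lambda>r. U r (g r)) + U x (integral {0..y} (\<lambda>r. U r (g (x + r))))"
proof -
  have int: "(\<lambda>r. U r (g r)) integrable_on {0..x + y}" by (rule integrable_convolution[OF g])
  have "integral {0..x + y} (\<lambda>r. U r (g r)) =
      integral {0..x} (\<lambda>r. U r (g r)) + integral {x..x + y} (\<lambda>r. U r (g r))"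
    using xy int by (intro Henstock_Kurzweil_Integration.integral_combine[symmetric]) auto
  also have "integral {x..x + y} (\<lambda>r. U r (g r)) = integral {0..y} (\<lambda>r. U (r + x) (g (r + x)))"
  proof -
    have "(\<lambda>r. U r (g r)) integrable_on {x..x + y}"
      by (rule integrable_subinterval_real[OF int]) (use xy in auto)
    then have "((\<lambda>r. U r (g r)) has_integral integral {x..x + y} (\<lambda>r. U r (g r))) (cbox x (x + y))"
      by (simp add: has_integral_integral)
    from has_integral_affinity[OF this, of 1 x]
    show ?thesis by (auto intro!: integral_unique[symmetric] simp: image_add_atLeastAtMost' add.commute)
  qed
  also have "\<dots> = integral {0..y} (\<lambda>r. U x (U r (g (x + r))))"
    by (intro integral_cong) (use xy in \<open>auto simp: semigroup[symmetric] add.commute\<close>)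
  also have "\<dots> = U x (integral {0..y} (\<lambda>r. U r (g (x + r))))"
  proof -
    have "continuous_on {0..y} (\<lambda>r. g (x + r))"
      by (rule continuous_on_compose2[OF g]) (use xy in \<open>auto intro!: continuous_intros\<close>)
    then show ?thesis
      using integral_linear[OF integrable_convolution linear[OF xy(1)]] by (simp add: o_def)
  qed
  finally show ?thesis .
qed

text \<open>The integrand decays at rate \<open>- (\<omega> + \<beta>)\<close>, which integrates to
  the reciprocal of that rate. It is used with \<open>\<beta>\<close> equal to \<open>0\<close> for
  bounded forcing and to \<open>\<gamma>\<close> or \<open>- \<gamma>\<close> in the weighted
  norm.\<close>

lemma norm_convolution_le:
  assumes g: "continuous_on {0..x} g" and bd: "\<And>r. 0 \<le> r \<Longrightarrow> r \<le> x \<Longrightarrow> norm (g r) \<le> C * exp (\<beta> * r)"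
    and C: "C \<ge> 0" and neg: "\<omega> + \<beta> < 0" and x: "x \<ge> 0"
  shows "norm (integral {0..x} (\<lambda>r. U r (g r))) \<le> C / - (\<omega> + \<beta>)"
proof -
  define \<eta> where "\<eta> = - (\<omega> + \<beta>)"
  have \<eta>: "\<eta> > 0" using neg by (simp add: \<eta>_def)
  have "((\<lambda>r. C * exp (- \<eta> * r)) has_integral (- C / \<eta> * exp (- \<eta> * x) - (- C / \<eta> * exp (- \<eta> * 0)))) {0..x}"
    by (rule fundamental_theorem_of_calculus[OF x])
       (use \<eta> in \<open>auto intro!: derivative_eq_intros simp: has_real_derivative_iff_has_vector_derivative[symmetric]\<close>)
  then have hi: "((\<lambda>r. C * exp (- \<eta> * r)) has_integral (C / \<eta> - C / \<eta> * exp (- \<eta> * x))) {0..x}" by simp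
  have "norm (integral {0..x} (\<lambda>r. U r (g r))) \<le> integral {0..x} (\<lambda>r. C * exp (- \<eta> * r))"
  proof (rule integral_norm_bound_integral[OF integrable_convolution[OF g] has_integral_integrable[OF hi]])
    fix r assume r: "r \<in> {0..x}"
    have "norm (U r (g r)) \<le> exp (\<omega> * r) * norm (g r)" using r by (intro growth) auto
    also have "\<dots> \<le> exp (\<omega> * r) * (C * exp (\<beta> * r))" using r by (intro mult_left_mono bd) auto
    also have "\<dots> = C * exp (- \<eta> * r)" by (simp add: \<eta>_def algebra_simps exp_add[symmetric])
    finally show "norm (U r (g r)) \<le> C * exp (- \<eta> * r)" .
  qed
  also have "\<dots> = C / \<eta> - C / \<eta> * exp (- \<eta> * x)" by (rule integral_unique[OF hi])
  also have "\<dots> \<le> C / \<eta>" using C \<eta> by simp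
  finally show ?thesis by (simp add: \<eta>_def)
qed

text \<open>The Duhamel integral over an unbounded past. As a limit of proper integrals it only
  involves continuous integrands on compact intervals.\<close>

definition improper_convolution :: "(real \<Rightarrow> 'h) \<Rightarrow> 'h" where
  "improper_convolution g = Lim at_top (\<lambda>x. integral {0..x} (\<lambda>r. U r (g r)))"

context
  fixes g :: "real \<Rightarrow> 'h" and C \<beta> :: real
  assumes g: "continuous_on {0..} g" and bd: "\<And>r. 0 \<le> r \<Longrightarrow> norm (g r) \<le> C * exp (\<beta> * r)"
    and neg: "\<omega> + \<beta> < 0"
begin

lemma C_nonneg: "C \<ge> 0"
  using bd[of 0] order_trans[OF norm_ge_zero, of "g 0" C] by simp

lemma shifted_bound: "x \<ge> 0 \<Longrightarrow> 0 \<le> r \<Longrightarrow> norm (g (x + r)) \<le> (C * exp (\<beta> * x)) * exp (\<beta> * r)"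
  using bd[of "x + r"] by (simp add: algebra_simps exp_add)

lemma continuous_on_shifted: "x \<ge> 0 \<Longrightarrow> continuous_on {0..} (\<lambda>r. g (x + r))"
  by (rule continuous_on_compose2[OF g]) (auto intro!: continuous_intros)

lemma convolution_tail:
  assumes "0 \<le> x" "x \<le> y"
  shows "norm (integral {0..y} (\<lambda>r. U r (g r)) - integral {0..x} (\<lambda>r. U r (g r))) \<le>
         C / - (\<omega> + \<beta>) * exp ((\<omega> + \<beta>) * x)"
proof -
  have "integral {0..y} (\<lambda>r. U r (g r)) - integral {0..x} (\<lambda>r. U r (g r)) =
      U x (integral {0..y - x} (\<lambda>r. U r (g (x + r))))"
    using convolution_split[of x "y - x" g] assms continuous_on_subset[OF g] by auto
  also have "norm \<dots> \<le> exp (\<omega> * x) * norm (integral {0..y - x} (\<lambda>r. U r (g (x + r))))"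
    using assms by (intro growth)
  also have "\<dots> \<le> exp (\<omega> * x) * ((C * exp (\<beta> * x)) / - (\<omega> + \<beta>))"
    using assms C_nonneg neg
    by (intro mult_left_mono norm_convolution_le shifted_bound continuous_on_subset[OF continuous_on_shifted]) auto
  also have "\<dots> = C / - (\<omega> + \<beta>) * exp ((\<omega> + \<beta>) * x)"
    by (simp add: distrib_right exp_add)
  finally show ?thesis .
qed

text \<open>The exponential tail bound makes the integrals Cauchy along the integers; the same
  bound, passed to the limit, then gives convergence along the reals together with its rate.\<close>

lemma improper_convolution:
  shows "((\<lambda>x. integral {0..x} (\<lambda>r. U r (g r))) \<longlongrightarrow> improper_convolution g) at_top" (is ?lim)
    and "x \<ge> 0 \<Longrightarrow> norm (improper_convolution g - integral {0..x} (\<lambda>r. U r (g r))) \<le>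
         C / - (\<omega> + \<beta>) * exp ((\<omega> + \<beta>) * x)" (is "_ \<Longrightarrow> ?tail x")
proof -
  let ?I = "\<lambda>x. integral {0..x} (\<lambda>r. U r (g r))"
  define E where "E x = C / - (\<omega> + \<beta>) * exp ((\<omega> + \<beta>) * x)" for x
  have "filterlim (\<lambda>x. (\<omega> + \<beta>) * x) at_bot at_top"
    using neg by (intro filterlim_tendsto_neg_mult_at_bot[OF tendsto_const] filterlim_ident)
  then have "((\<lambda>x. C / - (\<omega> + \<beta>) * exp ((\<omega> + \<beta>) * x)) \<longlongrightarrow> C / - (\<omega> + \<beta>) * 0) at_top"
    by (intro tendsto_intros filterlim_compose[OF exp_at_bot])
  then have E0: "(E \<longlongrightarrow> 0) at_top" by (simp add: E_def[abs_def])
  have E: "norm (?I y - ?I x) \<le> E x" if "0 \<le> x" "x \<le> y" for x y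
    using convolution_tail[OF that] by (simp add: E_def)
  have E_anti: "E y \<le> E x" if "x \<le> y" for x y
    unfolding E_def using C_nonneg neg that
    by (intro mult_left_mono divide_nonneg_pos) (auto intro: mult_left_mono_neg)
  have "Cauchy (\<lambda>n::nat. ?I (real n))"
  proof (rule CauchyI)
    fix e :: real assume e: "e > 0"
    then have "\<forall>\<^sub>F x in at_top. E x < e" using order_tendstoD(2)[OF E0] by blast
    then obtain X where X: "\<And>x. x \<ge> X \<Longrightarrow> E x < e" by (auto simp: eventually_at_top_linorder)
    have "norm (?I (real m) - ?I (real n)) < e" if mn: "m \<ge> nat \<lceil>X\<rceil>" "n \<ge> nat \<lceil>X\<rceil>" for m n
    proof (cases "n \<le> m")
      case True
      then show ?thesis using E[of "real n" "real m"] X[of "real n"] mn by (simp add: nat_le_iff ceiling_le_iff)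
    next
      case False
      then show ?thesis using E[of "real m" "real n"] X[of "real m"] mn
        by (simp add: nat_le_iff ceiling_le_iff norm_minus_commute)
    qed
    then show "\<exists>M. \<forall>m\<ge>M. \<forall>n\<ge>M. norm (?I (real m) - ?I (real n)) < e" by blast
  qed
  then obtain l where l: "(\<lambda>n::nat. ?I (real n)) \<longlonglongrightarrow> l" using Cauchy_convergent convergent_def by blast
  have tail: "norm (l - ?I x) \<le> E x" if "x \<ge> 0" for x
  proof (rule LIMSEQ_le_const2)
    show "(\<lambda>n. norm (?I (real n) - ?I x)) \<longlonglongrightarrow> norm (l - ?I x)" by (intro tendsto_intros l)
    have "norm (?I (real n) - ?I x) \<le> E x" if "n \<ge> nat \<lceil>x\<rceil>" for n
      using that \<open>x \<ge> 0\<close> by (intro E) (auto simp: nat_le_iff ceiling_le_iff)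
    then show "\<exists>N. \<forall>n\<ge>N. norm (?I (real n) - ?I x) \<le> E x" by blast
  qed
  have "((\<lambda>x. ?I x - l) \<longlongrightarrow> 0) at_top"
  proof (rule Lim_null_comparison[OF _ E0])
    show "\<forall>\<^sub>F x in at_top. norm (?I x - l) \<le> E x"
      using eventually_ge_at_top[of 0] by eventually_elim (use tail in \<open>auto simp: norm_minus_commute\<close>)
  qed
  then have "(?I \<longlongrightarrow> l) at_top" by (simp add: LIM_zero_iff)
  then have eq: "improper_convolution g = l" and lim: ?lim
    unfolding improper_convolution_def by (simp_all add: tendsto_Lim)
  show ?lim by (rule lim)
  show "?tail x" if "x \<ge> 0" using tail[OF that] by (simp add: eq E_def)
qed

lemma norm_improper_convolution_le: "norm (improper_convolution g) \<le> C / - (\<omega> + \<beta>)"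
  using improper_convolution(2)[of 0] by simp

end

text \<open>Limit of \<open>convolution_split\<close> as the upper end tends to infinity. It shows
  later that the integral over the whole past solves the Duhamel formula from any earlier
  time.\<close>

lemma improper_convolution_shift:
  assumes g: "continuous_on {0..} g" and bd: "\<And>r. 0 \<le> r \<Longrightarrow> norm (g r) \<le> C * exp (\<beta> * r)"
    and neg: "\<omega> + \<beta> < 0" and x: "x \<ge> 0"
  shows "improper_convolution g =
         integral {0..x} (\<lambda>r. U r (g r)) + U x (improper_convolution (\<lambda>r. g (x + r)))"
proof (rule tendsto_unique[OF _ improper_convolution(1)[OF g bd neg]])
  have 1: "((\<lambda>y. integral {0..y} (\<lambda>r. U r (g (x + r)))) \<longlongrightarrow> improper_convolution (\<lambda>r. g (x + r))) at_top"
    using improper_convolution(1)[OF continuous_on_shifted[OF g bd neg x] shifted_bound[OF g bd neg x] neg] .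
  have "filterlim (\<lambda>y::real. y - x) at_top at_top"
    using filterlim_tendsto_add_at_top[OF tendsto_const[of "- x"] filterlim_ident] by simp
  from filterlim_compose[OF 1 this]
  have "((\<lambda>y. integral {0..x} (\<lambda>r. U r (g r)) + U x (integral {0..y - x} (\<lambda>r. U r (g (x + r))))) \<longlongrightarrow>
     integral {0..x} (\<lambda>r. U r (g r)) + U x (improper_convolution (\<lambda>r. g (x + r)))) at_top"
    by (intro tendsto_add tendsto_const bounded_linear.tendsto[OF linear[OF x]])
  then show "((\<lambda>y. integral {0..y} (\<lambda>r. U r (g r))) \<longlongrightarrow>
     integral {0..x} (\<lambda>r. U r (g r)) + U x (improper_convolution (\<lambda>r. g (x + r)))) at_top"
  proof (rule Lim_transform_eventually)
    show "\<forall>\<^sub>F y in at_top. integral {0..x} (\<lambda>r. U r (g r)) + U x (integral {0..y - x} (\<lambda>r. U r (g (x + r)))) =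
        integral {0..y} (\<lambda>r. U r (g r))"
      using eventually_ge_at_top[of x]
    proof eventually_elim
      case (elim y)
      then show ?case using convolution_split[of x "y - x" g] x continuous_on_subset[OF g] by auto
    qed
  qed
qed simp

lemma improper_convolution_diff:
  assumes g: "continuous_on {0..} g" "\<And>r. 0 \<le> r \<Longrightarrow> norm (g r) \<le> C * exp (\<beta> * r)"
    and h: "continuous_on {0..} h" "\<And>r. 0 \<le> r \<Longrightarrow> norm (h r) \<le> C' * exp (\<beta> * r)"
    and neg: "\<omega> + \<beta> < 0"
  shows "improper_convolution g - improper_convolution h = improper_convolution (\<lambda>r. g r - h r)"
proof (rule tendsto_unique[symmetric])
  show "((\<lambda>x. integral {0..x} (\<lambda>r. U r (g r)) - integral {0..x} (\<lambda>r. U r (h r))) \<longlongrightarrow>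
      improper_convolution g - improper_convolution h) at_top"
    using improper_convolution(1)[OF g neg] improper_convolution(1)[OF h neg] by (rule tendsto_diff)
  have bd: "norm (g r - h r) \<le> (C + C') * exp (\<beta> * r)" if "0 \<le> r" for r
    using g(2)[OF that] h(2)[OF that] norm_triangle_ineq4[of "g r" "h r"] by (simp add: algebra_simps)
  have "((\<lambda>x. integral {0..x} (\<lambda>r. U r (g r - h r))) \<longlongrightarrow> improper_convolution (\<lambda>r. g r - h r)) at_top"
    by (rule improper_convolution(1)[OF continuous_on_diff[OF g(1) h(1)] bd neg])
  then show "((\<lambda>x. integral {0..x} (\<lambda>r. U r (g r)) - integral {0..x} (\<lambda>r. U r (h r))) \<longlongrightarrow>
      improper_convolution (\<lambda>r. g r - h r)) at_top"
  proof (rule Lim_transform_eventually)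
    show "\<forall>\<^sub>F x in at_top. integral {0..x} (\<lambda>r. U r (g r - h r)) =
        integral {0..x} (\<lambda>r. U r (g r)) - integral {0..x} (\<lambda>r. U r (h r))"
    proof (rule always_eventually, rule allI)
      fix x
      have "integral {0..x} (\<lambda>r. U r (g r - h r)) = integral {0..x} (\<lambda>r. U r (g r) - U r (h r))"
        by (intro integral_cong) (auto simp: diff)
      also have "\<dots> = integral {0..x} (\<lambda>r. U r (g r)) - integral {0..x} (\<lambda>r. U r (h r))"
        by (intro Henstock_Kurzweil_Integration.integral_diff integrable_convolution
            continuous_on_subset[OF g(1)] continuous_on_subset[OF h(1)]) auto
      finally show "integral {0..x} (\<lambda>r. U r (g r - h r)) =
        integral {0..x} (\<lambda>r. U r (g r)) - integral {0..x} (\<lambda>r. U r (h r))" .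
    qed
  qed
qed simp

end

text \<open>
  \<open>Ub\<close> is the flow on the finite-dimensional (slow) part run backwards in time, \<open>Uf\<close> the forward
  flow on the complementary fast part; \<open>Ub 0\<close> and \<open>Uf 0\<close> are the two projections.
\<close>

locale dichotomy =
  b: growth_semigroup Ub a + f: growth_semigroup Uf "- b"
  for Ub Uf :: "real \<Rightarrow> 'h::banach \<Rightarrow> 'h" and a b :: real +
  fixes F :: "'h \<Rightarrow> 'h" and K \<Lambda> :: real
  assumes proj_add: "Ub 0 x + Uf 0 x = x"
    and Ub_Uf: "s \<ge> 0 \<Longrightarrow> t \<ge> 0 \<Longrightarrow> Ub s (Uf t x) = 0"
    and Uf_Ub: "s \<ge> 0 \<Longrightarrow> t \<ge> 0 \<Longrightarrow> Uf s (Ub t x) = 0"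
    and F_bound: "norm (F x) \<le> K"
    and F_lipschitz: "norm (F x - F y) \<le> \<Lambda> * norm (x - y)"
    and a_nonneg: "a \<ge> 0" and \<Lambda>_pos: "\<Lambda> > 0" and gap: "a + 4 * \<Lambda> < b"
begin

lemma K_nonneg: "K \<ge> 0"
  using F_bound[of 0] order_trans[OF norm_ge_zero] by blast

lemma continuous_on_F: "continuous_on S F"
proof -
  have "\<Lambda>-lipschitz_on S F" using F_lipschitz \<Lambda>_pos by (auto simp: lipschitz_on_def dist_norm)
  then show ?thesis by (rule lipschitz_on_continuous_on)
qed

lemma continuous_on_F_comp: "continuous_on S y \<Longrightarrow> continuous_on S (\<lambda>t. F (y t))"
  by (rule continuous_on_compose2[OF continuous_on_F]) auto

lemma fast_invariant: "t \<ge> 0 \<Longrightarrow> Uf t (Uf 0 x) = Uf t x" "t \<ge> 0 \<Longrightarrow> Uf 0 (Uf t x) = Uf t x"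
  using f.semigroup[of t 0 x] f.semigroup[of 0 t x] by auto

lemma slow_invariant: "t \<ge> 0 \<Longrightarrow> Ub t (Ub 0 x) = Ub t x" "t \<ge> 0 \<Longrightarrow> Ub 0 (Ub t x) = Ub t x"
  using b.semigroup[of t 0 x] b.semigroup[of 0 t x] by auto

text \<open>\<open>\<gamma>\<close> is the middle of the gap and \<open>D\<close> its distance to
  both edges. In the norm weighted by \<open>exp (\<gamma> * t)\<close> each of the two Duhamel
  integrals has Lipschitz constant \<open>\<Lambda> / D\<close>; \<open>\<delta>\<close> is their
  sum, and \<open>a + 4 * \<Lambda> < b\<close> says exactly that it is below
  \<open>1\<close>.\<close>

definition \<gamma> :: real where "\<gamma> = (a + b) / 2"
definition D :: real where "D = (b - a) / 2"
definition \<delta> :: real where "\<delta> = 2 * \<Lambda> / D"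

lemma D_pos: "D > 0" and \<gamma>_pos: "\<gamma> > 0" and b_pos: "b > 0"
  using gap a_nonneg \<Lambda>_pos by (auto simp: D_def \<gamma>_def)

lemma rates: "- b + \<gamma> = - D" "a + - \<gamma> = - D"
  by (auto simp: D_def \<gamma>_def field_simps)

lemma rate_order: "a \<le> \<gamma>" "\<gamma> \<le> b"
  using D_pos by (auto simp: D_def \<gamma>_def field_simps)

lemma \<delta>_bounds: "0 \<le> \<delta>" "\<delta> < 1"
  using gap \<Lambda>_pos D_pos by (auto simp: \<delta>_def D_def field_simps)

section \<open>Mild trajectories and their comparison\<close>

text \<open>Variation of constants on an arbitrary, possibly unbounded interval. The fast equation
  is solved for the later time and the slow one for the earlier time, so that each semigroup is
  applied only for nonnegative durations.\<close>

definition mild :: "(real \<Rightarrow> 'h) \<Rightarrow> real set \<Rightarrow> bool" where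
  "mild y I \<longleftrightarrow> is_interval I \<and> continuous_on I y \<and> (\<forall>s\<in>I. \<forall>t\<in>I. s \<le> t \<longrightarrow>
     Uf 0 (y t) = Uf (t - s) (y s) + integral {0..t - s} (\<lambda>r. Uf r (F (y (t - r)))) \<and>
     Ub 0 (y s) = Ub (t - s) (y t) - integral {0..t - s} (\<lambda>r. Ub r (F (y (s + r)))))"

lemma mild_subset: "mild y I \<Longrightarrow> J \<subseteq> I \<Longrightarrow> is_interval J \<Longrightarrow> mild y J"
  unfolding mild_def by (blast intro: continuous_on_subset)

lemma mild_continuous_on: "mild y I \<Longrightarrow> continuous_on I y"
  unfolding mild_def by (elim conjE)

lemma mild_is_interval: "mild y I \<Longrightarrow> is_interval I"
  unfolding mild_def by (elim conjE)

lemma mild_interval: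
  assumes "mild y I" "s \<in> I" "t \<in> I"
  shows "{s..t} \<subseteq> I"
proof
  fix x assume "x \<in> {s..t}"
  then have "s \<le> x \<and> x \<le> t" by simp
  then show "x \<in> I" using mild_is_interval[OF assms(1)] assms(2,3) unfolding is_interval_1 by blast
qed

lemma mild_fast:
  assumes "mild y I" "s \<in> I" "t \<in> I" "s \<le> t"
  shows "Uf 0 (y t) = Uf (t - s) (y s) + integral {0..t - s} (\<lambda>r. Uf r (F (y (t - r))))"
  using assms unfolding mild_def by blast

lemma mild_slow:
  assumes "mild y I" "s \<in> I" "t \<in> I" "s \<le> t"
  shows "Ub 0 (y s) = Ub (t - s) (y t) - integral {0..t - s} (\<lambda>r. Ub r (F (y (s + r))))"
  using assms unfolding mild_def by blast

lemma mild_continuous: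
  assumes "mild y I" "s \<in> I" "t \<in> I"
  shows "continuous_on {0..t - s} (\<lambda>r. F (y (t - r)))" "continuous_on {0..t - s} (\<lambda>r. F (y (s + r)))"
proof -
  have y: "continuous_on {s..t} y"
    by (rule continuous_on_subset[OF mild_continuous_on[OF assms(1)] mild_interval[OF assms]])
  show "continuous_on {0..t - s} (\<lambda>r. F (y (t - r)))"
    by (intro continuous_on_F_comp continuous_on_compose2[OF y]) (auto intro!: continuous_intros)
  show "continuous_on {0..t - s} (\<lambda>r. F (y (s + r)))"
    by (intro continuous_on_F_comp continuous_on_compose2[OF y]) (auto intro!: continuous_intros)
qed

lemma mild_cong:
  assumes y: "mild y I" and eq: "\<And>t. t \<in> I \<Longrightarrow> z t = y t"
  shows "mild z I"
  unfolding mild_def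
proof (intro conjI ballI impI)
  show "is_interval I" by (rule mild_is_interval[OF y])
  show "continuous_on I z"
    using mild_continuous_on[OF y] eq by (simp cong: continuous_on_cong)
  fix s t assume st: "s \<in> I" "t \<in> I" "s \<le> t"
  have mem: "t - r \<in> I" "s + r \<in> I" if "r \<in> {0..t - s}" for r
    by (rule subsetD[OF mild_interval[OF y st(1,2)]]; use that in auto)+
  have "integral {0..t - s} (\<lambda>r. Uf r (F (z (t - r)))) = integral {0..t - s} (\<lambda>r. Uf r (F (y (t - r))))"
    by (rule integral_cong) (simp only: eq[OF mem(1)])
  then show "Uf 0 (z t) = Uf (t - s) (z s) + integral {0..t - s} (\<lambda>r. Uf r (F (z (t - r))))"
    unfolding eq[OF st(1)] eq[OF st(2)] using mild_fast[OF y st] by (simp only:)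
  have "integral {0..t - s} (\<lambda>r. Ub r (F (z (s + r)))) = integral {0..t - s} (\<lambda>r. Ub r (F (y (s + r))))"
    by (rule integral_cong) (simp only: eq[OF mem(2)])
  then show "Ub 0 (z s) = Ub (t - s) (z t) - integral {0..t - s} (\<lambda>r. Ub r (F (z (s + r))))"
    unfolding eq[OF st(1)] eq[OF st(2)] using mild_slow[OF y st] by (simp only:)
qed

lemma mild_shift:
  assumes y: "mild y I" and J: "\<And>t. t \<in> J \<longleftrightarrow> t + h \<in> I"
  shows "mild (\<lambda>t. y (t + h)) J"
  unfolding mild_def
proof (intro conjI ballI impI)
  show "is_interval J"
    unfolding is_interval_1
  proof (intro ballI allI impI)
    fix p q x assume "p \<in> J" "q \<in> J" "p \<le> x \<and> x \<le> q"
    then have "x + h \<in> I" using mild_interval[OF y, of "p + h" "q + h"] by (auto simp: J)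
    then show "x \<in> J" by (simp add: J)
  qed
  show "continuous_on J (\<lambda>t. y (t + h))"
    by (rule continuous_on_compose2[OF mild_continuous_on[OF y]]) (auto intro!: continuous_intros simp: J)
  fix s t assume st: "s \<in> J" "t \<in> J" "s \<le> t"
  have e: "t + h - (s + h) = t - s" "t + h - r = t - r + h" "s + h + r = s + r + h" for r by auto
  have "Uf 0 (y (t + h)) = Uf (t + h - (s + h)) (y (s + h)) + integral {0..t + h - (s + h)} (\<lambda>r. Uf r (F (y (t + h - r)))) \<and>
     Ub 0 (y (s + h)) = Ub (t + h - (s + h)) (y (t + h)) - integral {0..t + h - (s + h)} (\<lambda>r. Ub r (F (y (s + h + r))))"
  proof -
    have "s + h \<in> I" "t + h \<in> I" "s + h \<le> t + h" using st J by auto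
    then show ?thesis using mild_fast[OF y] mild_slow[OF y] by blast
  qed
  then show "Uf 0 (y (t + h)) = Uf (t - s) (y (s + h)) + integral {0..t - s} (\<lambda>r. Uf r (F (y (t - r + h))))"
    "Ub 0 (y (s + h)) = Ub (t - s) (y (t + h)) - integral {0..t - s} (\<lambda>r. Ub r (F (y (s + r + h))))"
    unfolding e by auto
qed

text \<open>Only times on both sides of \<open>0\<close> need an argument: there both formulas are
  composed at \<open>0\<close>, and \<open>convolution_split\<close> joins the two
  integrals.\<close>

lemma mild_concat:
  assumes y: "mild y {..0}" and c: "mild c {0..}" and eq: "y 0 = c 0"
  shows "mild (\<lambda>t. if t \<le> 0 then y t else c t) UNIV" (is "mild ?z UNIV")
proof -
  have "continuous_on ({..0} \<union> {0..}) ?z"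
    using mild_continuous_on[OF y] mild_continuous_on[OF c] eq by (intro continuous_on_If) auto
  moreover have "{..0} \<union> {0..} = (UNIV :: real set)" by auto
  ultimately have cont: "continuous_on UNIV ?z" by metis
  have yz: "mild ?z {..0}" by (rule mild_cong[OF y]) auto
  have cz: "mild ?z {0..}" by (rule mild_cong[OF c]) (use eq in auto)
  show ?thesis unfolding mild_def
  proof (intro conjI ballI impI)
    fix s t :: real assume st: "s \<le> t"
    consider "t \<le> 0" | "0 \<le> s" | "s < 0" "0 < t" by linarith
    then have "Uf 0 (?z t) = Uf (t - s) (?z s) + integral {0..t - s} (\<lambda>r. Uf r (F (?z (t - r)))) \<and>
      Ub 0 (?z s) = Ub (t - s) (?z t) - integral {0..t - s} (\<lambda>r. Ub r (F (?z (s + r))))"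
    proof cases
      case 1
      then show ?thesis using mild_fast[OF yz, of s t] mild_slow[OF yz, of s t] st by simp
    next
      case 2
      then show ?thesis using mild_fast[OF cz, of s t] mild_slow[OF cz, of s t] st by simp
    next
      case 3
      define z where "z = ?z"
      note yz = yz[folded z_def] and cz = cz[folded z_def] and cont = cont[folded z_def]
      have cg: "continuous_on S (\<lambda>r. F (z (t - r)))" "continuous_on S (\<lambda>r. F (z (s + r)))" for S
        by (intro continuous_on_F_comp continuous_on_compose2[OF cont]; auto intro!: continuous_intros)+
      have s0: "Uf 0 (z 0) = Uf (0 - s) (z s) + integral {0..0 - s} (\<lambda>r. Uf r (F (z (0 - r))))"
          "Ub 0 (z s) = Ub (0 - s) (z 0) - integral {0..0 - s} (\<lambda>r. Ub r (F (z (s + r))))"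
        by (rule mild_fast[OF yz] mild_slow[OF yz]; use 3 in simp)+
      have t0: "Uf 0 (z t) = Uf (t - 0) (z 0) + integral {0..t - 0} (\<lambda>r. Uf r (F (z (t - r))))"
          "Ub 0 (z 0) = Ub (t - 0) (z t) - integral {0..t - 0} (\<lambda>r. Ub r (F (z (0 + r))))"
        by (rule mild_fast[OF cz] mild_slow[OF cz]; use 3 in simp)+
      have "Uf t (z 0) = Uf t (Uf 0 (z 0))" using 3 by (simp add: fast_invariant)
      also have "\<dots> = Uf (t - s) (z s) + Uf t (integral {0..- s} (\<lambda>r. Uf r (F (z (t - (t + r))))))"
        unfolding s0 using 3 f.semigroup[of t "- s" "z s"] by (simp add: f.add)
      finally have 1: "Uf 0 (z t) = Uf (t - s) (z s) + integral {0..t - s} (\<lambda>r. Uf r (F (z (t - r))))"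
        using t0(1) f.convolution_split[of t "- s" "\<lambda>r. F (z (t - r))"] 3 cg by simp
      have "Ub (- s) (z 0) = Ub (- s) (Ub 0 (z 0))" using 3 by (simp add: slow_invariant)
      also have "\<dots> = Ub (t - s) (z t) - Ub (- s) (integral {0..t} (\<lambda>r. Ub r (F (z (s + (- s + r))))))"
        unfolding t0 using 3 b.semigroup[of "- s" t "z t"] by (simp add: b.diff)
      finally have 2: "Ub 0 (z s) = Ub (t - s) (z t) - integral {0..t - s} (\<lambda>r. Ub r (F (z (s + r))))"
        using s0(2) b.convolution_split[of "- s" t "\<lambda>r. F (z (s + r))"] 3 cg by simp
      show ?thesis using 1 2 unfolding z_def by blast
    qed
    then show "Uf 0 (?z t) = Uf (t - s) (?z s) + integral {0..t - s} (\<lambda>r. Uf r (F (?z (t - r))))"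
      "Ub 0 (?z s) = Ub (t - s) (?z t) - integral {0..t - s} (\<lambda>r. Ub r (F (?z (s + r))))" by blast+
  qed (use cont in auto)
qed

text \<open>
  The weight \<open>exp (\<gamma> t)\<close> balances the two exponential rates: in the weighted supremum norm both
  Duhamel integrals are bounded by \<open>\<delta> / 2\<close>, so the difference of two solutions is controlled by the
  fast part of its initial value and the slow part of its final value.
\<close>

lemma mild_difference:
  assumes u: "mild u {s0..t0}" and v: "mild v {s0..t0}" and t: "s0 \<le> t" "t \<le> t0"
  shows "exp (\<gamma> * t) * norm (u t - v t) * (1 - \<delta>) \<le>
    exp (\<gamma> * s0) * norm (Uf 0 (u s0 - v s0)) + exp (\<gamma> * t0) * norm (Ub 0 (u t0 - v t0))"
proof -
  define w where "w t = u t - v t" for t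
  have "continuous_on {s0..t0} (\<lambda>t. exp (\<gamma> * t) * norm (w t))"
    unfolding w_def by (intro continuous_intros mild_continuous_on[OF u] mild_continuous_on[OF v])
  \<comment> \<open>The weighted distance attains its maximum on the compact interval. The estimate
    is made at this point only; there the nonlinear terms return as \<open>\<delta> * m\<close>,
    which is absorbed into the left side because \<open>\<delta> < 1\<close>.\<close>
  then obtain x where x: "s0 \<le> x" "x \<le> t0"
      and sup: "\<And>r. s0 \<le> r \<Longrightarrow> r \<le> t0 \<Longrightarrow> exp (\<gamma> * r) * norm (w r) \<le> exp (\<gamma> * x) * norm (w x)"
    using continuous_attains_sup[of "{s0..t0}" "\<lambda>t. exp (\<gamma> * t) * norm (w t)"] t by auto
  define m where "m = exp (\<gamma> * x) * norm (w x)"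
  have m: "m \<ge> 0" by (simp add: m_def)
  have wr: "norm (w r) \<le> m * exp (- \<gamma> * r)" if "s0 \<le> r" "r \<le> t0" for r
    using sup[OF that] by (simp add: m_def exp_minus field_simps)
  have Fw: "norm (F (u r) - F (v r)) \<le> \<Lambda> * m * exp (- \<gamma> * r)" if "s0 \<le> r" "r \<le> t0" for r
  proof -
    have "norm (F (u r) - F (v r)) \<le> \<Lambda> * norm (w r)" using F_lipschitz by (simp add: w_def)
    also have "\<dots> \<le> \<Lambda> * (m * exp (- \<gamma> * r))" using wr[OF that] \<Lambda>_pos by (intro mult_left_mono) auto
    finally show ?thesis by simp
  qed
  have in': "s0 \<in> {s0..t0}" "x \<in> {s0..t0}" "t0 \<in> {s0..t0}" using x by auto
  note cu = mild_continuous[OF u] and cv = mild_continuous[OF v]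
  define I where "I = integral {0..x - s0} (\<lambda>r. Uf r (F (u (x - r)) - F (v (x - r))))"
  define J where "J = integral {0..t0 - x} (\<lambda>r. Ub r (F (u (x + r)) - F (v (x + r))))"
  have "I = integral {0..x - s0} (\<lambda>r. Uf r (F (u (x - r))) - Uf r (F (v (x - r))))"
    unfolding I_def by (intro integral_cong) (auto simp: f.diff)
  also have "\<dots> = integral {0..x - s0} (\<lambda>r. Uf r (F (u (x - r)))) - integral {0..x - s0} (\<lambda>r. Uf r (F (v (x - r))))"
    by (intro Henstock_Kurzweil_Integration.integral_diff f.integrable_convolution cu cv in')
  finally have I': "I = \<dots>" .
  have "J = integral {0..t0 - x} (\<lambda>r. Ub r (F (u (x + r))) - Ub r (F (v (x + r))))"
    unfolding J_def by (intro integral_cong) (auto simp: b.diff)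
  also have "\<dots> = integral {0..t0 - x} (\<lambda>r. Ub r (F (u (x + r)))) - integral {0..t0 - x} (\<lambda>r. Ub r (F (v (x + r))))"
    by (intro Henstock_Kurzweil_Integration.integral_diff b.integrable_convolution cu cv in')
  finally have J': "J = \<dots>" .
  have "Uf 0 (w x) = Uf 0 (u x) - Uf 0 (v x)" by (simp add: w_def f.diff)
  also have "\<dots> = Uf (x - s0) (w s0) + I"
    unfolding mild_fast[OF u in'(1,2) x(1)] mild_fast[OF v in'(1,2) x(1)] I' w_def
    using x by (simp add: f.diff)
  also have "Uf (x - s0) (w s0) = Uf (x - s0) (Uf 0 (w s0))" using x by (simp add: fast_invariant)
  finally have fast: "Uf 0 (w x) = Uf (x - s0) (Uf 0 (w s0)) + I" .
  have "Ub 0 (w x) = Ub 0 (u x) - Ub 0 (v x)" by (simp add: w_def b.diff)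
  also have "\<dots> = Ub (t0 - x) (w t0) - J"
    unfolding mild_slow[OF u in'(2,3) x(2)] mild_slow[OF v in'(2,3) x(2)] J' w_def
    using x by (simp add: b.diff)
  also have "Ub (t0 - x) (w t0) = Ub (t0 - x) (Ub 0 (w t0))" using x by (simp add: slow_invariant)
  finally have slow: "Ub 0 (w x) = Ub (t0 - x) (Ub 0 (w t0)) - J" .
  have "norm I \<le> (\<Lambda> * m * exp (- \<gamma> * x)) / - (- b + \<gamma>)"
    unfolding I_def
  proof (rule f.norm_convolution_le)
    show "norm (F (u (x - r)) - F (v (x - r))) \<le> \<Lambda> * m * exp (- \<gamma> * x) * exp (\<gamma> * r)" if "0 \<le> r" "r \<le> x - s0" for r
    proof -
      have "- \<gamma> * (x - r) = - \<gamma> * x + \<gamma> * r" by (simp add: algebra_simps)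
      then have "exp (- \<gamma> * (x - r)) = exp (- \<gamma> * x) * exp (\<gamma> * r)" by (simp only: exp_add)
      then show ?thesis using Fw[of "x - r"] that x by (simp add: mult.assoc)
    qed
  qed (use rates D_pos m \<Lambda>_pos x in \<open>auto intro!: continuous_on_diff cu cv\<close>)
  then have nI: "norm I \<le> \<Lambda> * m * exp (- \<gamma> * x) / D" unfolding rates by simp
  have "norm J \<le> (\<Lambda> * m * exp (- \<gamma> * x)) / - (a + - \<gamma>)"
    unfolding J_def
  proof (rule b.norm_convolution_le)
    show "norm (F (u (x + r)) - F (v (x + r))) \<le> \<Lambda> * m * exp (- \<gamma> * x) * exp (- \<gamma> * r)" if "0 \<le> r" "r \<le> t0 - x" for r
    proof -
      have "- \<gamma> * (x + r) = - \<gamma> * x + - \<gamma> * r" by (simp add: algebra_simps)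
      then have "exp (- \<gamma> * (x + r)) = exp (- \<gamma> * x) * exp (- \<gamma> * r)" by (simp only: exp_add)
      then show ?thesis using Fw[of "x + r"] that x by (simp add: mult.assoc)
    qed
  qed (use rates D_pos m \<Lambda>_pos x in \<open>auto intro!: continuous_on_diff cu cv\<close>)
  then have nJ: "norm J \<le> \<Lambda> * m * exp (- \<gamma> * x) / D" unfolding rates by simp
  have "norm (Uf (x - s0) (Uf 0 (w s0))) \<le> exp (- b * (x - s0)) * norm (Uf 0 (w s0))"
    using x by (intro f.growth) auto
  also have "\<dots> \<le> exp (- \<gamma> * (x - s0)) * norm (Uf 0 (w s0))"
    using x mult_right_mono[OF rate_order(2), of "x - s0"] by (intro mult_right_mono) auto
  finally have nf: "norm (Uf (x - s0) (Uf 0 (w s0))) \<le> exp (- \<gamma> * (x - s0)) * norm (Uf 0 (w s0))" .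
  have "norm (Ub (t0 - x) (Ub 0 (w t0))) \<le> exp (a * (t0 - x)) * norm (Ub 0 (w t0))"
    using x by (intro b.growth) auto
  also have "\<dots> \<le> exp (\<gamma> * (t0 - x)) * norm (Ub 0 (w t0))"
    using x mult_right_mono[OF rate_order(1), of "t0 - x"] by (intro mult_right_mono) auto
  finally have nb: "norm (Ub (t0 - x) (Ub 0 (w t0))) \<le> exp (\<gamma> * (t0 - x)) * norm (Ub 0 (w t0))" .
  have "norm (w x) = norm (Ub 0 (w x) + Uf 0 (w x))" by (simp add: proj_add)
  also have "\<dots> \<le> (norm (Ub (t0 - x) (Ub 0 (w t0))) + norm J) + (norm (Uf (x - s0) (Uf 0 (w s0))) + norm I)"
    unfolding fast slow by (intro order_trans[OF norm_triangle_ineq] add_mono norm_triangle_ineq norm_triangle_ineq4)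
  also have "\<dots> \<le> (exp (\<gamma> * (t0 - x)) * norm (Ub 0 (w t0)) + \<Lambda> * m * exp (- \<gamma> * x) / D) +
      (exp (- \<gamma> * (x - s0)) * norm (Uf 0 (w s0)) + \<Lambda> * m * exp (- \<gamma> * x) / D)"
    by (intro add_mono nf nb nI nJ)
  finally have "m \<le> exp (\<gamma> * x) * \<dots>" unfolding m_def by (intro mult_left_mono) auto
  also have "\<dots> = exp (\<gamma> * s0) * norm (Uf 0 (w s0)) + exp (\<gamma> * t0) * norm (Ub 0 (w t0)) + \<delta> * m"
  proof -
    have "exp (\<gamma> * x) * exp (\<gamma> * (t0 - x)) = exp (\<gamma> * t0)" "exp (\<gamma> * x) * exp (- \<gamma> * (x - s0)) = exp (\<gamma> * s0)"
      "exp (\<gamma> * x) * exp (- \<gamma> * x) = 1"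
      by (simp_all add: exp_add[symmetric] right_diff_distrib)
    note exps = this
    have "e * ((e1 * A + \<Lambda> * m * e3 / D) + (e2 * B + \<Lambda> * m * e3 / D)) =
        (e * e2) * B + (e * e1) * A + \<delta> * m * (e * e3)" for e e1 e2 e3 A B
      by (simp add: \<delta>_def field_simps)
    then show ?thesis by (simp only: exps mult_1_right)
  qed
  finally have "m * (1 - \<delta>) \<le> exp (\<gamma> * s0) * norm (Uf 0 (w s0)) + exp (\<gamma> * t0) * norm (Ub 0 (w t0))"
    by (simp add: algebra_simps)
  moreover have "exp (\<gamma> * t) * norm (w t) * (1 - \<delta>) \<le> m * (1 - \<delta>)"
    using sup[OF t] \<delta>_bounds unfolding m_def by (intro mult_right_mono) auto
  ultimately show ?thesis by (simp add: w_def)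
qed

text \<open>Only the fast part has to stay bounded in the past; the slow part may grow backwards in
  time. This selects one value of the fast part for every slow part.\<close>

definition manifold :: "'h set" where
  "manifold = {y 0 | y. mild y {..0} \<and> (\<exists>B. \<forall>t\<le>0. norm (Uf 0 (y t)) \<le> B)}"

lemma manifoldE:
  assumes "x \<in> manifold"
  obtains y B where "mild y {..0}" "\<And>t. t \<le> 0 \<Longrightarrow> norm (Uf 0 (y t)) \<le> B" "y 0 = x"
proof -
  from assms have "\<exists>y. x = y 0 \<and> mild y {..0} \<and> (\<exists>B. \<forall>t\<le>0. norm (Uf 0 (y t)) \<le> B)"
    unfolding manifold_def by (rule CollectD)
  then obtain y B where y: "x = y 0" "mild y {..0}" "\<forall>t\<le>0. norm (Uf 0 (y t)) \<le> B"
    by (elim exE conjE)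
  show ?thesis by (rule that[OF y(2) y(3)[rule_format] y(1)[symmetric]])
qed

lemma manifoldI: "mild y {..0} \<Longrightarrow> (\<And>t. t \<le> 0 \<Longrightarrow> norm (Uf 0 (y t)) \<le> B) \<Longrightarrow> y 0 \<in> manifold"
  unfolding manifold_def by (intro CollectI exI[of _ y] conjI refl exI[of _ B] allI impI)

text \<open>Starting ever earlier removes the contribution \<open>exp (- b * x) * B\<close> of the
  initial value and leaves the Duhamel bound \<open>K / b\<close>. A bound that depends on the
  trajectory thus improves to a universal one.\<close>

lemma fast_part_bound:
  assumes y: "mild y {..0}" and B: "\<And>t. t \<le> 0 \<Longrightarrow> norm (Uf 0 (y t)) \<le> B" and t: "t \<le> 0"
  shows "norm (Uf 0 (y t)) \<le> K / b"
proof (rule tendsto_lowerbound)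
  have "filterlim (\<lambda>x. (- b) * x) at_bot at_top"
    using b_pos by (intro filterlim_tendsto_neg_mult_at_bot[OF tendsto_const] filterlim_ident) auto
  then have "((\<lambda>x. exp ((- b) * x) * B + K / b) \<longlongrightarrow> 0 * B + K / b) at_top"
    by (intro tendsto_intros filterlim_compose[OF exp_at_bot])
  then show "((\<lambda>x. exp (- b * x) * B + K / b) \<longlongrightarrow> K / b) at_top" by simp
  show "\<forall>\<^sub>F x in at_top. norm (Uf 0 (y t)) \<le> exp (- b * x) * B + K / b"
    using eventually_ge_at_top[of 0]
  proof eventually_elim
    case (elim x)
    have "Uf 0 (y t) = Uf (t - (t - x)) (y (t - x)) + integral {0..t - (t - x)} (\<lambda>r. Uf r (F (y (t - r))))"
      by (rule mild_fast[OF y]) (use t elim in auto)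
    then have e: "Uf 0 (y t) = Uf x (Uf 0 (y (t - x))) + integral {0..x} (\<lambda>r. Uf r (F (y (t - r))))"
      using elim by (simp add: fast_invariant)
    have cont: "continuous_on {0..x} (\<lambda>r. F (y (t - r)))"
      using mild_continuous(1)[OF y, of "t - x" t] t elim by simp
    have "norm (integral {0..x} (\<lambda>r. Uf r (F (y (t - r))))) \<le> K / - (- b + 0)"
      by (rule f.norm_convolution_le[OF cont]) (use F_bound K_nonneg b_pos elim in simp_all)
    moreover have "norm (Uf x (Uf 0 (y (t - x)))) \<le> exp (- b * x) * B"
      using f.growth[OF elim, of "Uf 0 (y (t - x))"] B[of "t - x"] t elim
      by (elim order_trans, intro mult_left_mono) auto
    ultimately have "norm (Uf 0 (y t)) \<le> exp (- b * x) * B + K / - (- b + 0)"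
      unfolding e by (intro norm_triangle_mono)
    then show ?case by simp
  qed
qed simp

text \<open>Compare two backward trajectories on \<open>[- x, 0]\<close>: the fast difference at the
  left end is at most \<open>2 * K / b\<close> and carries the weight
  \<open>exp (- \<gamma> * x)\<close>, so it disappears as \<open>x\<close> grows and only the slow
  difference at \<open>0\<close> remains.\<close>

theorem manifold_lipschitz:
  assumes "x \<in> manifold" "x' \<in> manifold"
  shows "norm (x - x') \<le> 1 / (1 - \<delta>) * norm (Ub 0 x - Ub 0 x')"
proof -
  obtain u B where u: "mild u {..0}" "\<And>t. t \<le> 0 \<Longrightarrow> norm (Uf 0 (u t)) \<le> B" "u 0 = x"
    using assms(1) by (rule manifoldE) (rule that)
  obtain v B' where v: "mild v {..0}" "\<And>t. t \<le> 0 \<Longrightarrow> norm (Uf 0 (v t)) \<le> B'" "v 0 = x'"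
    using assms(2) by (rule manifoldE) (rule that)
  have "norm (u 0 - v 0) * (1 - \<delta>) \<le> norm (Ub 0 (u 0 - v 0))"
  proof (rule tendsto_lowerbound)
    have "filterlim (\<lambda>x. (- \<gamma>) * x) at_bot at_top"
      using \<gamma>_pos by (intro filterlim_tendsto_neg_mult_at_bot[OF tendsto_const] filterlim_ident) auto
    then have "((\<lambda>x. exp ((- \<gamma>) * x) * (2 * (K / b)) + norm (Ub 0 (u 0 - v 0))) \<longlongrightarrow>
        0 * (2 * (K / b)) + norm (Ub 0 (u 0 - v 0))) at_top"
      by (intro tendsto_intros filterlim_compose[OF exp_at_bot])
    then show "((\<lambda>x. exp ((- \<gamma>) * x) * (2 * (K / b)) + norm (Ub 0 (u 0 - v 0))) \<longlongrightarrow>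
        norm (Ub 0 (u 0 - v 0))) at_top" by simp
    show "\<forall>\<^sub>F x in at_top. norm (u 0 - v 0) * (1 - \<delta>) \<le> exp ((- \<gamma>) * x) * (2 * (K / b)) + norm (Ub 0 (u 0 - v 0))"
      using eventually_ge_at_top[of 0]
    proof eventually_elim
      case (elim x)
      have "mild u {- x..0}" "mild v {- x..0}" using u v by (auto intro: mild_subset)
      from mild_difference[OF this, of 0] elim
      have "norm (u 0 - v 0) * (1 - \<delta>) \<le> exp ((- \<gamma>) * x) * norm (Uf 0 (u (- x) - v (- x))) + norm (Ub 0 (u 0 - v 0))"
        by simp
      also have "norm (Uf 0 (u (- x) - v (- x))) \<le> K / b + K / b"
        unfolding f.diff[OF order_refl]
        by (intro order_trans[OF norm_triangle_ineq4] add_mono fast_part_bound[OF u(1,2)] fast_part_bound[OF v(1,2)])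
           (use elim in auto)
      finally show ?case by simp
    qed
  qed simp
  then show ?thesis using u(3) v(3) \<delta>_bounds by (simp add: b.diff field_simps)
qed

text \<open>The curve is appended to the backward trajectory of its initial point, and the result is
  shifted by \<open>t\<close>. On the added compact piece the fast part is bounded by
  continuity.\<close>

theorem manifold_invariant:
  assumes c: "mild c {0..}" and c0: "c 0 \<in> manifold" and t: "t \<ge> 0"
  shows "c t \<in> manifold"
proof -
  from c0 obtain y B where y: "mild y {..0}" "\<And>t. t \<le> 0 \<Longrightarrow> norm (Uf 0 (y t)) \<le> B" "y 0 = c 0"
    by (rule manifoldE) (rule that)
  define z where "z r = (if r \<le> 0 then y r else c r)" for r
  have z: "mild z UNIV" unfolding z_def[abs_def] using mild_concat[OF y(1) c y(3)] .
  have zt: "mild (\<lambda>r. z (r + t)) {..0}"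
    by (rule mild_subset[OF mild_shift[OF z, of UNIV]]) auto
  have "continuous_on {0..t} z" by (rule continuous_on_subset[OF mild_continuous_on[OF z]]) auto
  then have "continuous_on {0..t} (\<lambda>r. norm (Uf 0 (z r)))"
    by (intro continuous_on_norm f.continuous_on_compose continuous_intros) auto
  then have "bounded ((\<lambda>r. norm (Uf 0 (z r))) ` {0..t})"
    by (intro compact_imp_bounded compact_continuous_image) auto
  then obtain B' where "\<forall>r\<in>{0..t}. norm (Uf 0 (z r)) \<le> B'"
    unfolding bounded_iff by auto
  then have B': "norm (Uf 0 (z r)) \<le> B'" if "0 \<le> r" "r \<le> t" for r
    using that by simp
  have "norm (Uf 0 (z (r + t))) \<le> max B B'" if "r \<le> 0" for r
  proof (cases "r + t \<le> 0")
    case True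
    then show ?thesis using y(2)[of "r + t"] by (simp add: z_def)
  next
    case False
    then show ?thesis using B'[of "r + t"] that by simp
  qed
  then have "z (0 + t) \<in> manifold" by (rule manifoldI[OF zt])
  moreover have "z t = c t" using t y(3) by (auto simp: z_def)
  ultimately show ?thesis by simp
qed

section \<open>The Lyapunov-Perron operator\<close>

definition unweight :: "(real \<Rightarrow>\<^sub>C 'h) \<Rightarrow> real \<Rightarrow> 'h" where
  "unweight z t = exp (- \<gamma> * t) *\<^sub>R apply_bcontfun z t"

definition slow_integral :: "(real \<Rightarrow> 'h) \<Rightarrow> real \<Rightarrow> 'h" where
  "slow_integral y t = integral {0..- t} (\<lambda>r. Ub r (F (y (t + r))))"

definition fast_integral :: "(real \<Rightarrow> 'h) \<Rightarrow> real \<Rightarrow> 'h" where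
  "fast_integral y t = f.improper_convolution (\<lambda>r. F (y (t - r)))"

text \<open>A fixed point, after the weight is removed, is a backward trajectory with slow part
  \<open>Ub 0 p\<close> at time \<open>0\<close> and with the fast part generated entirely by its
  past. The space of bounded continuous functions lives on the whole line, so \<open>min t 0\<close>
  extends everything constantly beyond \<open>0\<close>.\<close>

definition perron :: "'h \<Rightarrow> (real \<Rightarrow> 'h) \<Rightarrow> real \<Rightarrow> 'h" where
  "perron p y t = exp (\<gamma> * min t 0) *\<^sub>R
     (Ub (- min t 0) p - slow_integral y (min t 0) + fast_integral y (min t 0))"

lemma continuous_unweight: "continuous_on S (unweight z)"
  unfolding unweight_def[abs_def] by (intro continuous_intros continuous_on_apply_bcontfun)

lemma continuous_F_shift:
  fixes y :: "real \<Rightarrow> 'h"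
  assumes "continuous_on UNIV y"
  shows "continuous_on S (\<lambda>r. F (y (t + r)))" "continuous_on S (\<lambda>r. F (y (t - r)))"
proof -
  show "continuous_on S (\<lambda>r. F (y (t + r)))"
    by (intro continuous_on_F_comp
        continuous_on_compose2[OF assms continuous_on_add[OF continuous_on_const continuous_on_id]]) simp
  show "continuous_on S (\<lambda>r. F (y (t - r)))"
    by (intro continuous_on_F_comp
        continuous_on_compose2[OF assms continuous_on_diff[OF continuous_on_const continuous_on_id]]) simp
qed

text \<open>Both the integrand and the interval depend on \<open>t\<close>. Rescaling by
  \<open>r = - t * \<theta>\<close> fixes the interval to \<open>[0, 1]\<close>, where continuity
  under the integral sign is available.\<close>

lemma continuous_slow_integral:
  assumes y: "continuous_on UNIV y"
  shows "continuous_on {..0} (slow_integral y)"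
proof -
  have "slow_integral y t = (- t) *\<^sub>R integral (cbox 0 1) (\<lambda>\<theta>. Ub (- t * \<theta>) (F (y (t + - t * \<theta>))))" if t: "t \<le> 0" for t
  proof (cases "t = 0")
    case False
    define s where "s = - t"
    have s: "s > 0" "t = - s" using t False by (auto simp: s_def)
    have "((\<lambda>r. Ub r (F (y (t + r)))) has_integral slow_integral y t) (cbox 0 s)"
      unfolding slow_integral_def cbox_interval s_def
      by (intro integrable_integral b.integrable_convolution continuous_F_shift y)
    from has_integral_affinity[OF this, of s 0] s(1)
    have "((\<lambda>\<theta>. Ub (s * \<theta>) (F (y (t + s * \<theta>)))) has_integral (1 / s) *\<^sub>R slow_integral y t)
        ((\<lambda>x. x / s) ` {0..s})"
      by simp
    also have "(\<lambda>x. x / s) ` {0..s} = cbox 0 1"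
      using s(1) by (simp add: image_divide_atLeastAtMost)
    finally show ?thesis using s(1) unfolding s_def by (simp add: integral_unique)
  qed (simp add: slow_integral_def)
  moreover have "continuous_on {..0} (\<lambda>t. (- t) *\<^sub>R integral (cbox 0 1) (\<lambda>\<theta>. Ub (- t * \<theta>) (F (y (t + - t * \<theta>)))))"
  proof (intro continuous_intros integral_continuous_on_param)
    show "continuous_on ({..0} \<times> cbox 0 1) (\<lambda>(t, \<theta>). Ub (- t * \<theta>) (F (y (t + - t * \<theta>))))"
      unfolding case_prod_beta
      by (intro b.continuous_on_compose continuous_on_F_comp continuous_on_compose2[OF y])
         (auto intro!: continuous_intros simp: mult_nonpos_nonneg)
  qed
  ultimately show ?thesis by (subst continuous_on_cong[OF refl]) auto
qed

lemma F_shift_bound: "norm (F (y (t - r))) \<le> K * exp (0 * r)"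
  using F_bound by simp

lemma b_neg: "- b + 0 < 0" using b_pos by simp

text \<open>Truncations at \<open>n\<close> depend continuously on \<open>t\<close>, and since
  \<open>F\<close> is bounded by \<open>K\<close> their tails are small uniformly in
  \<open>t\<close>.\<close>

lemma continuous_fast_integral:
  assumes y: "continuous_on UNIV y"
  shows "continuous_on UNIV (fast_integral y)"
proof (rule uniform_limit_theorem[where F = sequentially])
  define I where "I n t = integral (cbox 0 (real n)) (\<lambda>r. Uf r (F (y (t - r))))" for n t
  have "continuous_on UNIV (I n)" for n
    unfolding I_def[abs_def]
  proof (rule integral_continuous_on_param)
    show "continuous_on (UNIV \<times> cbox 0 (real n)) (\<lambda>(t, r). Uf r (F (y (t - r))))"
      unfolding case_prod_beta
      by (intro f.continuous_on_compose continuous_on_F_comp continuous_on_compose2[OF y])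
         (auto intro!: continuous_intros)
  qed
  then show "\<forall>\<^sub>F n in sequentially. continuous_on UNIV (I n)" by simp
  show "uniform_limit UNIV I (fast_integral y) sequentially"
  proof (rule uniform_limitI)
    fix e :: real assume e: "e > 0"
    have "filterlim (\<lambda>n::nat. (- b + 0) * real n) at_bot sequentially"
      using b_neg by (intro filterlim_tendsto_neg_mult_at_bot[OF tendsto_const] filterlim_real_sequentially) auto
    then have "(\<lambda>n. K / - (- b + 0) * exp ((- b + 0) * real n)) \<longlonglongrightarrow> K / - (- b + 0) * 0"
      by (intro tendsto_intros filterlim_compose[OF exp_at_bot])
    then have "\<forall>\<^sub>F n in sequentially. K / - (- b + 0) * exp ((- b + 0) * real n) < e"
      using order_tendstoD(2)[of _ "K / - (- b + 0) * 0" sequentially e] e by simp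
    then show "\<forall>\<^sub>F n in sequentially. \<forall>t\<in>UNIV. dist (I n t) (fast_integral y t) < e"
    proof eventually_elim
      case (elim n)
      have "dist (I n t) (fast_integral y t) \<le> K / - (- b + 0) * exp ((- b + 0) * real n)" for t
        unfolding dist_norm I_def cbox_interval fast_integral_def
        by (subst norm_minus_commute, rule f.improper_convolution(2)[OF continuous_F_shift(2)[OF y, of "{0..}" t] F_shift_bound[of y t] b_neg]) auto
      then show ?case using elim by (meson le_less_trans)
    qed
  qed
qed simp

lemma weighted_slow_integral_le:
  assumes y: "continuous_on {0..- t} g" and t: "t \<le> 0"
    and bd: "\<And>r. 0 \<le> r \<Longrightarrow> r \<le> - t \<Longrightarrow> norm (g r) \<le> C * exp (- \<gamma> * (t + r))" and C: "C \<ge> 0"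
  shows "exp (\<gamma> * t) * norm (integral {0..- t} (\<lambda>r. Ub r (g r))) \<le> C / D"
proof -
  have "norm (integral {0..- t} (\<lambda>r. Ub r (g r))) \<le> C * exp (- \<gamma> * t) / - (a + - \<gamma>)"
  proof (rule b.norm_convolution_le[OF y])
    fix r assume r: "0 \<le> r" "r \<le> - t"
    have "- \<gamma> * (t + r) = - \<gamma> * t + - \<gamma> * r" by (simp add: algebra_simps)
    then have "exp (- \<gamma> * (t + r)) = exp (- \<gamma> * t) * exp (- \<gamma> * r)" by (simp only: exp_add)
    then show "norm (g r) \<le> C * exp (- \<gamma> * t) * exp (- \<gamma> * r)" using bd[OF r] by (simp only: mult.assoc)
  qed (use C t rates D_pos in auto)
  then have "exp (\<gamma> * t) * norm (integral {0..- t} (\<lambda>r. Ub r (g r))) \<le> exp (\<gamma> * t) * (C * exp (- \<gamma> * t) / D)"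
    unfolding rates by (intro mult_left_mono) auto
  also have "\<dots> = C / D" by (simp add: exp_minus)
  finally show ?thesis .
qed

text \<open>For \<open>t \<le> 0\<close> the weight beats the backward growth
  \<open>exp (- a * t)\<close> of the slow flow because \<open>a \<le> \<gamma>\<close>. The two
  integrals contribute at most \<open>K / D\<close> and \<open>K / b\<close>.\<close>

lemma perron_bcontfun:
  assumes y: "continuous_on UNIV y"
  shows "perron p y \<in> bcontfun"
proof (rule bcontfun_normI)
  have c1: "continuous_on UNIV (\<lambda>t. slow_integral y (min t 0))"
    by (rule continuous_on_compose2[OF continuous_slow_integral[OF y]]) (auto intro!: continuous_intros)
  have c2: "continuous_on UNIV (\<lambda>t. fast_integral y (min t 0))"
    by (rule continuous_on_compose2[OF continuous_fast_integral[OF y]]) (auto intro!: continuous_intros)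
  have c3: "continuous_on UNIV (\<lambda>t. Ub (- min t 0) p)"
    by (rule continuous_on_compose2[OF b.strongly_continuous]) (auto intro!: continuous_intros simp: min_le_iff_disj)
  show "continuous_on UNIV (perron p y)"
    unfolding perron_def[abs_def] by (intro continuous_intros c1 c2 c3)
  fix x :: real
  define t where "t = min x 0"
  have t: "t \<le> 0" by (simp add: t_def min_def)
  have "exp (\<gamma> * t) * norm (Ub (- t) p) \<le> exp (\<gamma> * t) * (exp (a * - t) * norm p)"
    using t by (intro mult_left_mono b.growth) auto
  also have "\<dots> = exp ((\<gamma> - a) * t) * norm p"
    by (simp add: exp_add[symmetric] algebra_simps)
  also have "\<dots> \<le> 1 * norm p"
    using t rate_order by (intro mult_right_mono) (auto simp: mult_nonneg_nonpos)
  finally have 1: "exp (\<gamma> * t) * norm (Ub (- t) p) \<le> norm p" by simp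
  have 2: "exp (\<gamma> * t) * norm (slow_integral y t) \<le> K / D"
    unfolding slow_integral_def
  proof (rule weighted_slow_integral_le[OF continuous_F_shift(1)[OF y] t _ K_nonneg])
    fix r assume "0 \<le> r" "r \<le> - t"
    then have "exp (- \<gamma> * (t + r)) \<ge> 1" using \<gamma>_pos by (simp add: mult_nonneg_nonpos)
    then show "norm (F (y (t + r))) \<le> K * exp (- \<gamma> * (t + r))"
      using F_bound[of "y (t + r)"] K_nonneg mult_left_mono[of 1 "exp (- \<gamma> * (t + r))" K] by simp
  qed
  have "norm (fast_integral y t) \<le> K / - (- b + 0)"
    unfolding fast_integral_def
    by (rule f.norm_improper_convolution_le[OF continuous_F_shift(2)[OF y, of "{0..}" t] F_shift_bound[of y t] b_neg])
  moreover have "exp (\<gamma> * t) * norm (fast_integral y t) \<le> 1 * norm (fast_integral y t)"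
    using t \<gamma>_pos by (intro mult_right_mono) (auto simp: mult_nonneg_nonpos)
  ultimately have 3: "exp (\<gamma> * t) * norm (fast_integral y t) \<le> K / b" by simp
  have "norm (perron p y x) = exp (\<gamma> * t) * norm (Ub (- t) p - slow_integral y t + fast_integral y t)"
    by (simp add: perron_def t_def)
  also have "\<dots> \<le> exp (\<gamma> * t) * (norm (Ub (- t) p) + norm (slow_integral y t) + norm (fast_integral y t))"
    by (intro mult_left_mono norm_triangle_mono norm_triangle_ineq4) auto
  also have "\<dots> \<le> norm p + K / D + K / b" using 1 2 3 by (simp add: distrib_left)
  finally show "norm (perron p y x) \<le> norm p + K / D + K / b" .
qed

lemma norm_F_unweight_diff:
  "norm (F (unweight z s) - F (unweight z' s)) \<le> \<Lambda> * dist z z' * exp (- \<gamma> * s)"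
proof -
  have "norm (F (unweight z s) - F (unweight z' s)) \<le> \<Lambda> * norm (unweight z s - unweight z' s)"
    by (rule F_lipschitz)
  also have "norm (unweight z s - unweight z' s) = exp (- \<gamma> * s) * dist (apply_bcontfun z s) (apply_bcontfun z' s)"
    by (simp add: unweight_def dist_norm flip: scaleR_diff_right)
  also have "\<dots> \<le> exp (- \<gamma> * s) * dist z z'" by (intro mult_left_mono dist_bounded) auto
  finally show ?thesis using \<Lambda>_pos by (simp add: mult_ac)
qed

text \<open>The term with \<open>p\<close> cancels, and the differences of the slow and of the fast
  integral contribute \<open>\<Lambda> / D\<close> each.\<close>

lemma perron_contraction:
  "norm (perron p (unweight z) x - perron p (unweight z') x) \<le> \<delta> * dist z z'"
proof -
  define t where "t = min x 0"
  define y where "y = unweight z"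
  define y' where "y' = unweight z'"
  define C where "C = \<Lambda> * dist z z'"
  have C: "C \<ge> 0" using \<Lambda>_pos by (simp add: C_def)
  have t: "t \<le> 0" by (simp add: t_def min_def)
  have cy: "continuous_on UNIV y" "continuous_on UNIV y'" by (auto simp: y_def y'_def continuous_unweight)
  have Fd: "norm (F (y s) - F (y' s)) \<le> C * exp (- \<gamma> * s)" for s
    unfolding y_def y'_def C_def by (rule norm_F_unweight_diff)
  have "slow_integral y t - slow_integral y' t = integral {0..- t} (\<lambda>r. Ub r (F (y (t + r))) - Ub r (F (y' (t + r))))"
    unfolding slow_integral_def
    by (intro Henstock_Kurzweil_Integration.integral_diff[symmetric] b.integrable_convolution continuous_F_shift cy)
  also have "\<dots> = integral {0..- t} (\<lambda>r. Ub r (F (y (t + r)) - F (y' (t + r))))"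
    by (intro integral_cong) (auto simp: b.diff)
  finally have s: "slow_integral y t - slow_integral y' t = \<dots>" .
  have 1: "exp (\<gamma> * t) * norm (slow_integral y t - slow_integral y' t) \<le> C / D"
    unfolding s
    by (rule weighted_slow_integral_le[OF continuous_on_diff[OF continuous_F_shift(1)[OF cy(1)] continuous_F_shift(1)[OF cy(2)]] t Fd C])
  have f: "fast_integral y t - fast_integral y' t = f.improper_convolution (\<lambda>r. F (y (t - r)) - F (y' (t - r)))"
    unfolding fast_integral_def
    by (rule f.improper_convolution_diff[OF continuous_F_shift(2)[OF cy(1), of "{0..}" t] F_shift_bound[of y t]
          continuous_F_shift(2)[OF cy(2), of "{0..}" t] F_shift_bound[of y' t] b_neg])
  have "norm (fast_integral y t - fast_integral y' t) \<le> (C * exp (- \<gamma> * t)) / - (- b + \<gamma>)"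
    unfolding f
  proof (rule f.norm_improper_convolution_le[OF continuous_on_diff[OF continuous_F_shift(2)[OF cy(1)] continuous_F_shift(2)[OF cy(2)]]])
    fix r :: real assume "0 \<le> r"
    have "- \<gamma> * (t - r) = - \<gamma> * t + \<gamma> * r" by (simp add: algebra_simps)
    then have "exp (- \<gamma> * (t - r)) = exp (- \<gamma> * t) * exp (\<gamma> * r)" by (simp only: exp_add)
    then show "norm (F (y (t - r)) - F (y' (t - r))) \<le> C * exp (- \<gamma> * t) * exp (\<gamma> * r)"
      using Fd[of "t - r"] by (simp only: mult.assoc)
  qed (use rates D_pos in auto)
  then have "exp (\<gamma> * t) * norm (fast_integral y t - fast_integral y' t) \<le> exp (\<gamma> * t) * (C * exp (- \<gamma> * t) / D)"
    unfolding rates by (intro mult_left_mono) auto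
  also have "\<dots> = C / D" by (simp add: exp_minus)
  finally have 2: "exp (\<gamma> * t) * norm (fast_integral y t - fast_integral y' t) \<le> C / D" .
  have "perron p y x - perron p y' x = exp (\<gamma> * t) *\<^sub>R
      ((fast_integral y t - fast_integral y' t) - (slow_integral y t - slow_integral y' t))"
    by (simp add: perron_def t_def[symmetric] algebra_simps)
  then have "norm (perron p y x - perron p y' x) = exp (\<gamma> * t) *
      norm ((fast_integral y t - fast_integral y' t) - (slow_integral y t - slow_integral y' t))"
    by simp
  also have "\<dots> \<le> exp (\<gamma> * t) * (norm (fast_integral y t - fast_integral y' t) + norm (slow_integral y t - slow_integral y' t))"
    by (intro mult_left_mono norm_triangle_ineq4) auto
  also have "\<dots> \<le> C / D + C / D" using 1 2 by (simp add: distrib_left)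
  also have "\<dots> = \<delta> * dist z z'" by (simp add: \<delta>_def C_def field_simps)
  finally show ?thesis by (simp add: y_def y'_def)
qed

text \<open>Every slow part is attained, so the manifold is a graph over the full slow subspace.
  Banach's theorem supplies the trajectory; at time \<open>0\<close> the slow integral is over a
  degenerate interval, which leaves exactly \<open>Ub 0 p\<close>.\<close>

theorem manifold_exists: "\<exists>x\<in>manifold. Ub 0 x = Ub 0 p"
proof -
  define T where "T z = Bcontfun (perron p (unweight z))" for z
  have T: "apply_bcontfun (T z) = perron p (unweight z)" for z
    unfolding T_def by (rule Bcontfun_inverse[OF perron_bcontfun[OF continuous_unweight]])
  have "\<exists>!z. T z = z"
  proof (rule banach_fix_type[OF \<delta>_bounds], intro allI)
    show "dist (T z) (T z') \<le> \<delta> * dist z z'" for z z'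
      by (rule dist_bound) (auto simp: T dist_norm[of "perron p _ _"] perron_contraction)
  qed
  then obtain z where z: "T z = z" by blast
  define y where "y = unweight z"
  have cy: "continuous_on S y" for S by (simp add: y_def continuous_unweight)
  note cF = continuous_F_shift[OF cy]
  have y: "y t = Ub (- t) p - slow_integral y t + fast_integral y t" if "t \<le> 0" for t
  proof -
    have "y t = exp (- \<gamma> * t) *\<^sub>R perron p y t"
      using T[of z] unfolding z y_def by (simp add: unweight_def)
    then show ?thesis using that by (simp add: perron_def exp_minus)
  qed
  \<comment> \<open>These two restart identities are the Duhamel formulas in disguise: after
    projection, \<open>y\<close> is \<open>Ub (- t) p - slow_integral y t\<close> on the slow part
    and \<open>fast_integral y t\<close> on the fast part.\<close>
  have slow: "slow_integral y s = integral {0..t - s} (\<lambda>r. Ub r (F (y (s + r)))) + Ub (t - s) (slow_integral y t)"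
    if "s \<le> t" "t \<le> 0" for s t
    using b.convolution_split[of "t - s" "- t" "\<lambda>r. F (y (s + r))"] that cF
    by (simp add: slow_integral_def)
  have fast: "fast_integral y t = integral {0..t - s} (\<lambda>r. Uf r (F (y (t - r)))) + Uf (t - s) (fast_integral y s)"
    if "s \<le> t" for s t
    using f.improper_convolution_shift[OF cF(2)[of "{0..}" t] F_shift_bound[of y t] b_neg, of "t - s"] that
    by (simp add: fast_integral_def)
  have fast0: "Uf 0 (fast_integral y t) = fast_integral y t" for t
    using fast[of t t] by simp
  have slow0: "Ub 0 (slow_integral y t) = slow_integral y t" if "t \<le> 0" for t
    using slow[of t t] that by simp
  have Uf_y: "Uf 0 (y t) = fast_integral y t" if t: "t \<le> 0" for t
  proof -
    have "Uf 0 (slow_integral y t) = 0" using Uf_Ub[of 0 0 "slow_integral y t"] slow0[OF t] by simp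
    then show ?thesis using t by (simp add: y f.add f.diff Uf_Ub fast0)
  qed
  have Ub_y: "Ub 0 (y t) = Ub (- t) p - slow_integral y t" if t: "t \<le> 0" for t
  proof -
    have "Ub 0 (fast_integral y t) = 0" using Ub_Uf[of 0 0 "fast_integral y t"] fast0 by simp
    then show ?thesis using t by (simp add: y b.add b.diff slow0 slow_invariant)
  qed
  have "mild y {..0}"
    unfolding mild_def
  proof (intro conjI ballI impI)
    fix s t :: real assume st: "s \<in> {..0}" "t \<in> {..0}" "s \<le> t"
    then have s: "s \<le> 0" and t: "t \<le> 0" by auto
    have "Uf (t - s) (y s) = Uf (t - s) (Uf 0 (y s))" using st by (simp only: fast_invariant diff_ge_0_iff_ge)
    then show "Uf 0 (y t) = Uf (t - s) (y s) + integral {0..t - s} (\<lambda>r. Uf r (F (y (t - r))))"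
      unfolding Uf_y[OF s] Uf_y[OF t] using fast[OF st(3)] by simp
    have "Ub (t - s) (y t) = Ub (t - s) (Ub 0 (y t))" using st by (simp only: slow_invariant diff_ge_0_iff_ge)
    also have "\<dots> = Ub (t - s) (Ub (- t) p) - Ub (t - s) (slow_integral y t)"
      unfolding Ub_y[OF t] using st by (simp add: b.diff)
    also have "Ub (t - s) (Ub (- t) p) = Ub (- s) p"
      using b.semigroup[of "t - s" "- t" p] st by simp
    finally show "Ub 0 (y s) = Ub (t - s) (y t) - integral {0..t - s} (\<lambda>r. Ub r (F (y (s + r))))"
      unfolding Ub_y[OF s] using slow[OF st(3) t] by simp
  qed (auto simp: cy is_interval_1)
  moreover have "norm (Uf 0 (y t)) \<le> K / - (- b + 0)" if "t \<le> 0" for t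
    unfolding Uf_y[OF that] fast_integral_def
    by (rule f.norm_improper_convolution_le[OF cF(2)[of "{0..}" t] F_shift_bound[of y t] b_neg])
  ultimately have "y 0 \<in> manifold" by (rule manifoldI)
  moreover have "Ub 0 (y 0) = Ub 0 p" using Ub_y[of 0] by (simp add: slow_integral_def)
  ultimately show ?thesis by blast
qed

theorem manifold_attracts:
  assumes c: "mild c {0..}" and t: "t \<ge> 0"
  shows "\<exists>x\<in>manifold. norm (c t - x) \<le> (norm (Uf 0 (c 0)) + K / b) / (1 - \<delta>) * exp (- \<gamma> * t)"
proof -
  obtain x where x: "x \<in> manifold" "Ub 0 x = Ub 0 (c t)" using manifold_exists by blast
  obtain y B where y: "mild y {..0}" "\<And>t. t \<le> 0 \<Longrightarrow> norm (Uf 0 (y t)) \<le> B" "y 0 = x"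
    using x(1) by (rule manifoldE) (rule that)
  \<comment> \<open>The backward trajectory of \<open>x\<close> is moved so that it ends at time
    \<open>t\<close>. Its value at time \<open>0\<close> is \<open>y (- t)\<close>, whose fast part
    is at most \<open>K / b\<close> whatever \<open>t\<close> is; the slow parts agree at time
    \<open>t\<close>.\<close>
  have 1: "mild (\<lambda>r. y (r + - t)) {0..t}"
    by (rule mild_subset[OF mild_shift[OF y(1), of "{..t}"]]) auto
  have 2: "mild c {0..t}" by (rule mild_subset[OF c]) auto
  have "exp (\<gamma> * t) * norm (c t - x) * (1 - \<delta>) \<le> norm (Uf 0 (c 0 - y (- t)))"
    using mild_difference[OF 2 1 t order_refl] x(2) y(3) by (simp add: b.diff)
  also have "\<dots> \<le> norm (Uf 0 (c 0)) + K / b"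
    unfolding f.diff[OF order_refl]
    by (intro order_trans[OF norm_triangle_ineq4] add_mono order_refl fast_part_bound[OF y(1,2)]) (use t in auto)
  finally have "exp (\<gamma> * t) * norm (c t - x) * (1 - \<delta>) \<le> norm (Uf 0 (c 0)) + K / b" .
  then have "norm (c t - x) \<le> (norm (Uf 0 (c 0)) + K / b) / (1 - \<delta>) * exp (- \<gamma> * t)"
    using \<delta>_bounds by (simp add: exp_minus field_simps)
  with x(1) show ?thesis by blast
qed

end

section \<open>Square integrable functions on a finite measure space\<close>

definition square_integrable :: "'a measure \<Rightarrow> ('a \<Rightarrow> real) \<Rightarrow> bool" where
  "square_integrable M u \<longleftrightarrow> u \<in> borel_measurable M \<and> integrable M (\<lambda>x. (u x)\<^sup>2)"

lemma square_integrable_mult: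
  assumes "square_integrable M u" "square_integrable M v"
  shows "integrable M (\<lambda>x. u x * v x)"
proof (rule Bochner_Integration.integrable_bound)
  show "integrable M (\<lambda>x. (u x)\<^sup>2 + (v x)\<^sup>2)"
    using assms by (auto simp: square_integrable_def)
  show "(\<lambda>x. u x * v x) \<in> borel_measurable M"
    using assms by (auto simp: square_integrable_def)
  have "norm (a * b) \<le> norm (a\<^sup>2 + b\<^sup>2)" for a b :: real
  proof -
    have "norm (a * b) = \<bar>a\<bar> * \<bar>b\<bar>" "norm (a\<^sup>2 + b\<^sup>2) = \<bar>a\<bar>\<^sup>2 + \<bar>b\<bar>\<^sup>2" by (auto simp: abs_mult)
    moreover have "0 \<le> \<bar>a\<bar> * \<bar>b\<bar>" "2 * (\<bar>a\<bar> * \<bar>b\<bar>) \<le> \<bar>a\<bar>\<^sup>2 + \<bar>b\<bar>\<^sup>2"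
      using sum_squares_bound[of "\<bar>a\<bar>" "\<bar>b\<bar>"] by simp_all
    ultimately show ?thesis by linarith
  qed
  then show "AE x in M. norm (u x * v x) \<le> norm ((u x)\<^sup>2 + (v x)\<^sup>2)" by simp
qed

lemma square_integrable_add:
  assumes "square_integrable M u" "square_integrable M v"
  shows "square_integrable M (\<lambda>x. u x + v x)"
  using assms square_integrable_mult[OF assms] unfolding square_integrable_def power2_sum
  by (auto simp: mult.assoc)

lemma square_integrable_scale: "square_integrable M u \<Longrightarrow> square_integrable M (\<lambda>x. c * u x)"
  unfolding square_integrable_def power_mult_distrib by auto

lemma square_integrable_diff:
  assumes "square_integrable M u" "square_integrable M v"
  shows "square_integrable M (\<lambda>x. u x - v x)"
  using square_integrable_add[OF assms(1) square_integrable_scale[OF assms(2), of "-1"]] by simp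

lemma (in finite_measure) square_integrable_bounded:
  assumes u: "u \<in> borel_measurable M" and B: "AE x in M. \<bar>u x\<bar> \<le> B"
  shows "square_integrable M u"
  unfolding square_integrable_def
proof
  show "integrable M (\<lambda>x. (u x)\<^sup>2)"
  proof (rule integrable_const_bound)
    show "AE x in M. norm ((u x)\<^sup>2) \<le> B\<^sup>2"
      using B by eventually_elim (simp add: abs_le_square_iff[symmetric])
  qed (use u in auto)
qed (rule u)

lemma (in finite_measure) integrable_if_square_integrable:
  "square_integrable M u \<Longrightarrow> integrable M u"
  using square_integrable_mult[OF _ square_integrable_bounded[of "\<lambda>_. 1" 1], of u] by simp

lemma integral_square_diff_expand:
  assumes u: "square_integrable M u" and v: "square_integrable M v"
  shows "(\<integral>x. (u x - c * v x)\<^sup>2 \<partial>M) =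
    (\<integral>x. (u x)\<^sup>2 \<partial>M) - 2 * c * (\<integral>x. u x * v x \<partial>M) + c\<^sup>2 * (\<integral>x. (v x)\<^sup>2 \<partial>M)"
proof -
  have "(\<lambda>x. (u x - c * v x)\<^sup>2) = (\<lambda>x. (u x)\<^sup>2 - 2 * c * (u x * v x) + c\<^sup>2 * (v x)\<^sup>2)"
    by (simp add: power2_eq_square algebra_simps)
  then show ?thesis
    using u v square_integrable_mult[OF u v]
    by (simp add: square_integrable_def)
qed

text \<open>The quadratic polynomial in \<open>s\<close> given by the integral of
  \<open>(u - s * v)^2\<close> is nonnegative; evaluate it at its minimum
  \<open>b / c\<close>.\<close>

lemma integral_Cauchy_Schwarz:
  assumes u: "square_integrable M u" and v: "square_integrable M v"
  shows "(\<integral>x. u x * v x \<partial>M)\<^sup>2 \<le> (\<integral>x. (u x)\<^sup>2 \<partial>M) * (\<integral>x. (v x)\<^sup>2 \<partial>M)"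
proof -
  define a b c where "a = (\<integral>x. (u x)\<^sup>2 \<partial>M)" and "b = (\<integral>x. u x * v x \<partial>M)" and "c = (\<integral>x. (v x)\<^sup>2 \<partial>M)"
  have pos: "0 \<le> a - 2 * s * b + s\<^sup>2 * c" for s
    unfolding a_def b_def c_def integral_square_diff_expand[OF u v, symmetric] by simp
  have c: "c \<ge> 0" unfolding c_def by simp
  have "b\<^sup>2 \<le> a * c"
  proof (cases "c = 0")
    case True
    have "b = 0"
    proof (rule ccontr)
      assume "b \<noteq> 0"
      \<comment> \<open>For \<open>c = 0\<close> the polynomial is affine in \<open>s\<close>; this
        value of \<open>s\<close> is where it would equal \<open>- 1\<close>.\<close>
      have "0 \<le> a - 2 * ((a + 1) / (2 * b)) * b" using pos[of "(a + 1) / (2 * b)"] True by simp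
      also have "\<dots> = - 1" using \<open>b \<noteq> 0\<close> by (simp add: field_simps)
      finally show False by simp
    qed
    then show ?thesis using True by simp
  next
    case False
    have "0 \<le> a - 2 * (b / c) * b + (b / c)\<^sup>2 * c" by (rule pos)
    also have "\<dots> = a - b\<^sup>2 / c" using False by (simp add: power2_eq_square field_simps)
    finally show ?thesis using c False by (simp add: field_simps)
  qed
  then show ?thesis by (simp add: a_def b_def c_def)
qed

lemma abs_integral_mult_le:
  assumes u: "square_integrable M u" and v: "square_integrable M v"
  shows "\<bar>\<integral>x. u x * v x \<partial>M\<bar> \<le> sqrt (\<integral>x. (u x)\<^sup>2 \<partial>M) * sqrt (\<integral>x. (v x)\<^sup>2 \<partial>M)"
  using real_sqrt_le_mono[OF integral_Cauchy_Schwarz[OF u v]] by (simp add: real_sqrt_mult)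

text \<open>On a finite measure space \<open>L^2\<close>-Cauchy implies \<open>L^1\<close>-Cauchy,
  which gives an almost everywhere convergent subsequence; Fatou's lemma then yields
  \<open>L^2\<close> convergence. The limit is stated as a pointwise \<open>lim\<close>, so that it
  inherits periodicity and Borel measurability on the whole plane from the approximants.\<close>

lemma (in finite_measure) square_integrable_complete:
  fixes s :: "nat \<Rightarrow> 'a \<Rightarrow> real"
  assumes s: "\<And>n. square_integrable M (s n)"
    and cauchy: "\<And>e. e > 0 \<Longrightarrow> \<exists>N. \<forall>m\<ge>N. \<forall>n\<ge>N. (\<integral>x. (s m x - s n x)\<^sup>2 \<partial>M) < e"
  obtains r where "strict_mono r" "square_integrable M (\<lambda>x. lim (\<lambda>j. s (r j) x))"
    "(\<lambda>n. \<integral>x. (s n x - lim (\<lambda>j. s (r j) x))\<^sup>2 \<partial>M) \<longlonglongrightarrow> 0"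
proof -
  have one: "square_integrable M (\<lambda>_. 1)" by (rule square_integrable_bounded[of _ 1]) auto
  have sm[measurable]: "s n \<in> borel_measurable M" for n using s by (simp add: square_integrable_def)
  have L1: "\<exists>N. \<forall>i\<ge>N. \<forall>j\<ge>N. (\<integral>x. norm (s i x - s j x) \<partial>M) < e" if e: "e > 0" for e
  proof -
    define c where "c = measure M (space M) + 1"
    have c: "c > 0" by (simp add: c_def add_nonneg_pos)
    obtain N where N: "\<And>m n. m \<ge> N \<Longrightarrow> n \<ge> N \<Longrightarrow> (\<integral>x. (s m x - s n x)\<^sup>2 \<partial>M) < e\<^sup>2 / c"
      using cauchy[of "e\<^sup>2 / c"] e c by auto
    have "(\<integral>x. norm (s i x - s j x) \<partial>M) < e" if "i \<ge> N" "j \<ge> N" for i j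
    proof -
      have d: "square_integrable M (\<lambda>x. \<bar>s i x - s j x\<bar>)"
        using square_integrable_diff[OF s s, of i j] by (simp add: square_integrable_def)
      have "(\<integral>x. norm (s i x - s j x) \<partial>M)\<^sup>2 \<le> (\<integral>x. (s i x - s j x)\<^sup>2 \<partial>M) * measure M (space M)"
        using integral_Cauchy_Schwarz[OF d one] by simp
      also have "\<dots> \<le> (e\<^sup>2 / c) * measure M (space M)"
        using N[OF that] by (intro mult_right_mono) auto
      also have "\<dots> < e\<^sup>2" using e c by (simp add: c_def field_simps)
      finally show ?thesis using e by (simp add: power2_less_imp_less)
    qed
    then show ?thesis by blast
  qed
  obtain r where r: "strict_mono r" "AE x in M. Cauchy (\<lambda>i. s (r i) x)"
    using cauchy_L1_AE_cauchy_subseq[OF integrable_if_square_integrable[OF s] L1] by blast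
  define u where "u x = lim (\<lambda>j. s (r j) x)" for x
  have um[measurable]: "u \<in> borel_measurable M" unfolding u_def[abs_def] by measurable
  have lim: "AE x in M. (\<lambda>j. s (r j) x) \<longlonglongrightarrow> u x"
    using r(2) by eventually_elim (simp add: u_def Cauchy_convergent convergent_LIMSEQ_iff[symmetric])
  have fatou: "(\<integral>\<^sup>+x. ennreal ((s n x - u x)\<^sup>2) \<partial>M) \<le> ennreal e"
    if N: "\<And>m. m \<ge> N \<Longrightarrow> (\<integral>x. (s n x - s m x)\<^sup>2 \<partial>M) < e" for n N e
  proof -
    have "(\<integral>\<^sup>+x. ennreal ((s n x - u x)\<^sup>2) \<partial>M) = (\<integral>\<^sup>+x. liminf (\<lambda>j. ennreal ((s n x - s (r j) x)\<^sup>2)) \<partial>M)"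
    proof (rule nn_integral_cong_AE)
      show "AE x in M. ennreal ((s n x - u x)\<^sup>2) = liminf (\<lambda>j. ennreal ((s n x - s (r j) x)\<^sup>2))"
        using lim
      proof eventually_elim
        case (elim x)
        then have "(\<lambda>j. ennreal ((s n x - s (r j) x)\<^sup>2)) \<longlonglongrightarrow> ennreal ((s n x - u x)\<^sup>2)"
          by (intro tendsto_intros)
        then show ?case by (rule lim_imp_Liminf[OF trivial_limit_sequentially, symmetric])
      qed
    qed
    also have "\<dots> \<le> liminf (\<lambda>j. \<integral>\<^sup>+x. ennreal ((s n x - s (r j) x)\<^sup>2) \<partial>M)"
      by (rule nn_integral_liminf) measurable
    also have "\<dots> \<le> liminf (\<lambda>j. ennreal e)"
    proof (rule Liminf_mono)
      show "\<forall>\<^sub>F j in sequentially. (\<integral>\<^sup>+x. ennreal ((s n x - s (r j) x)\<^sup>2) \<partial>M) \<le> ennreal e"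
        using eventually_ge_at_top[of N]
      proof eventually_elim
        case (elim j)
        have "integrable M (\<lambda>x. (s n x - s (r j) x)\<^sup>2)"
          using square_integrable_diff[OF s s] by (simp add: square_integrable_def)
        moreover have "r j \<ge> N" using elim seq_suble[OF r(1), of j] by simp
        ultimately show ?case using N[of "r j"] by (simp add: nn_integral_eq_integral ennreal_leI)
      qed
    qed
    finally show ?thesis by (simp add: Liminf_const)
  qed
  have int: "integrable M (\<lambda>x. (s n x - u x)\<^sup>2)" "(\<integral>x. (s n x - u x)\<^sup>2 \<partial>M) \<le> e"
    if "\<And>m. m \<ge> N \<Longrightarrow> (\<integral>x. (s n x - s m x)\<^sup>2 \<partial>M) < e" "e > 0" for n N e
  proof -
    have fat: "(\<integral>\<^sup>+x. ennreal ((s n x - u x)\<^sup>2) \<partial>M) \<le> ennreal e" by (rule fatou[OF that(1)])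
    show i: "integrable M (\<lambda>x. (s n x - u x)\<^sup>2)"
      by (intro integrableI_bounded) (use le_less_trans[OF fat] in auto)
    show "(\<integral>x. (s n x - u x)\<^sup>2 \<partial>M) \<le> e"
      using fat nn_integral_eq_integral[OF i] that(2) by simp
  qed
  obtain N1 where N1: "\<And>m n. m \<ge> N1 \<Longrightarrow> n \<ge> N1 \<Longrightarrow> (\<integral>x. (s m x - s n x)\<^sup>2 \<partial>M) < 1"
    using cauchy[of 1] by auto
  have "square_integrable M (\<lambda>x. s N1 x - u x)"
    using int(1)[of N1 N1 1] N1 by (simp add: square_integrable_def)
  from square_integrable_diff[OF s[of N1] this] have su: "square_integrable M u" by simp
  have "(\<lambda>n. \<integral>x. (s n x - u x)\<^sup>2 \<partial>M) \<longlonglongrightarrow> 0"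
  proof (rule LIMSEQ_I)
    fix e :: real assume e: "e > 0"
    obtain N where N: "\<And>m n. m \<ge> N \<Longrightarrow> n \<ge> N \<Longrightarrow> (\<integral>x. (s m x - s n x)\<^sup>2 \<partial>M) < e / 2"
      using cauchy[of "e / 2"] e by auto
    have "norm ((\<integral>x. (s n x - u x)\<^sup>2 \<partial>M) - 0) < e" if "n \<ge> N" for n
      using int(2)[of N n "e / 2"] N[OF that] e by simp
    then show "\<exists>no. \<forall>n\<ge>no. norm ((\<integral>x. (s n x - u x)\<^sup>2 \<partial>M) - 0) < e" by blast
  qed
  then show ?thesis using that[OF r(1)] su by (simp add: u_def[abs_def])
qed

lemma integral_square_eq_0_iff:
  assumes "square_integrable M u"
  shows "(\<integral>x. (u x)\<^sup>2 \<partial>M) = 0 \<longleftrightarrow> (AE x in M. u x = 0)"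
  using assms integral_nonneg_eq_0_iff_AE[of M "\<lambda>x. (u x)\<^sup>2"] by (simp add: square_integrable_def)

lemma tendsto_integral_mult:
  assumes s: "\<And>n. square_integrable M (s n)" and u: "square_integrable M u" and v: "square_integrable M v"
    and lim: "(\<lambda>n. \<integral>x. (s n x - u x)\<^sup>2 \<partial>M) \<longlonglongrightarrow> 0"
  shows "(\<lambda>n. \<integral>x. s n x * v x \<partial>M) \<longlonglongrightarrow> (\<integral>x. u x * v x \<partial>M)"
proof -
  have "(\<lambda>n. (\<integral>x. s n x * v x \<partial>M) - (\<integral>x. u x * v x \<partial>M)) \<longlonglongrightarrow> 0"
  proof (rule Lim_null_comparison)
    show "\<forall>\<^sub>F n in sequentially. norm ((\<integral>x. s n x * v x \<partial>M) - (\<integral>x. u x * v x \<partial>M)) \<le>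
        sqrt (\<integral>x. (s n x - u x)\<^sup>2 \<partial>M) * sqrt (\<integral>x. (v x)\<^sup>2 \<partial>M)"
    proof (rule always_eventually, rule allI)
      fix n
      have "(\<integral>x. s n x * v x \<partial>M) - (\<integral>x. u x * v x \<partial>M) = (\<integral>x. (s n x - u x) * v x \<partial>M)"
        by (simp add: left_diff_distrib square_integrable_mult s u v)
      then show "norm ((\<integral>x. s n x * v x \<partial>M) - (\<integral>x. u x * v x \<partial>M)) \<le>
        sqrt (\<integral>x. (s n x - u x)\<^sup>2 \<partial>M) * sqrt (\<integral>x. (v x)\<^sup>2 \<partial>M)"
        using abs_integral_mult_le[OF square_integrable_diff[OF s u] v] by simp
    qed
    have "(\<lambda>n. sqrt (\<integral>x. (s n x - u x)\<^sup>2 \<partial>M) * sqrt (\<integral>x. (v x)\<^sup>2 \<partial>M)) \<longlonglongrightarrow>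
        sqrt 0 * sqrt (\<integral>x. (v x)\<^sup>2 \<partial>M)"
      by (intro tendsto_intros lim)
    then show "(\<lambda>n. sqrt (\<integral>x. (s n x - u x)\<^sup>2 \<partial>M) * sqrt (\<integral>x. (v x)\<^sup>2 \<partial>M)) \<longlonglongrightarrow> 0" by simp
  qed
  then show ?thesis by (simp add: LIM_zero_iff)
qed

section \<open>Integration over the period cell\<close>

definition cellm :: "real \<Rightarrow> (real^2) measure" where
  "cellm L = restrict_space lborel (cell L)"

lemma cell_borel [measurable]: "cell L \<in> sets borel"
  by (simp add: cell_def)

lemma sets_cellm: "sets (cellm L) = sets (restrict_space borel (cell L))"
  unfolding cellm_def by (rule sets_restrict_space_cong) simp

lemma space_cellm [simp]: "space (cellm L) = cell L"
  by (simp add: cellm_def space_restrict_space)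

lemma borel_measurable_cellm: "f \<in> borel_measurable borel \<Longrightarrow> f \<in> borel_measurable (cellm L)"
  unfolding cellm_def by (intro measurable_restrict_space1) simp

lemma finite_measure_cellm: "finite_measure (cellm L)"
proof (rule finite_measureI)
  have "emeasure lborel (cell L) < \<infinity>" unfolding cell_def by (rule emeasure_lborel_cbox_finite)
  then show "emeasure (cellm L) (space (cellm L)) \<noteq> \<infinity>"
    by (simp add: cellm_def emeasure_restrict_space)
qed

interpretation cellm: finite_measure "cellm L" for L by (rule finite_measure_cellm)

lemma integral_cellm: 
  fixes f :: "real^2 \<Rightarrow> 'b::{banach, second_countable_topology}"
  shows "integral\<^sup>L (cellm L) f = (LINT x:cell L|lborel. f x)"
  unfolding cellm_def set_lebesgue_integral_def by (rule integral_restrict_space) simp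

lemma integrable_cellm:
  fixes f :: "real^2 \<Rightarrow> 'b::{banach, second_countable_topology}"
  shows "integrable (cellm L) f \<longleftrightarrow> set_integrable lborel (cell L) f"
  unfolding cellm_def set_integrable_def by (rule integrable_restrict_space) simp

lemma mem_cell: "x \<in> cell L \<longleftrightarrow> (\<forall>j. 0 \<le> x $ j \<and> x $ j \<le> L)"
  by (simp add: cell_def mem_box_cart)

lemma axis_zero: "axis i (0 :: real) = (0 :: real^2)"
  by (simp add: axis_def vec_eq_iff)

lemma AE_component_neq: "AE x in lborel. (x :: real^2) $ j \<noteq> c"
  using AE_lborel_inner_neq[of "axis j 1 :: real^2" c] by (simp add: inner_axis axis_in_Basis_iff)

lemma measure_cell:
  assumes "L > 0"
  shows "measure (cellm L) (cell L) = L\<^sup>2"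
proof -
  have "(0 :: real^2) \<in> cbox 0 (vec L)" using assms by (simp add: mem_box_cart)
  then have "measure lborel (cbox (0 :: real^2) (vec L)) = (\<Prod>i\<in>(UNIV :: 2 set). L)"
    by (subst content_cbox_cart) auto
  then show ?thesis by (simp add: cellm_def measure_restrict_space cell_def)
qed

lemma integrable_lborel_indicator_bounded:
  fixes u :: "real^2 \<Rightarrow> real"
  assumes u: "continuous_on UNIV u" and A: "A \<in> sets borel" "bounded A"
  shows "integrable lborel (\<lambda>x. indicator A x * u x)"
proof -
  obtain a b where ab: "A \<subseteq> cbox a b" using A(2) bounded_subset_cbox_symmetric by metis
  have "set_integrable lborel (cbox a b) u"
    unfolding set_integrable_def
    by (rule borel_integrable_compact) (use u continuous_on_subset in auto)
  then have "set_integrable lborel A u" by (rule set_integrable_subset) (use A ab in auto)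
  then show ?thesis by (simp add: set_integrable_def)
qed

lemma continuous_integrable_cellm:
  fixes u :: "real^2 \<Rightarrow> real"
  shows "continuous_on UNIV u \<Longrightarrow> integrable (cellm L) u"
  unfolding integrable_cellm set_integrable_def
  using integrable_lborel_indicator_bounded[of u "cell L"] by (simp add: cell_def)

lemma lborel_integral_translate:
  fixes f :: "'a::euclidean_space \<Rightarrow> real"
  assumes "f \<in> borel_measurable borel"
  shows "(\<integral>x. f (c + x) \<partial>lborel) = (\<integral>x. f x \<partial>lborel)"
proof -
  have "(\<integral>x. f x \<partial>lborel) = (\<integral>x. f x \<partial>distr lborel borel ((+) c))" by (simp add: lborel_distr_plus)
  also have "\<dots> = (\<integral>x. f (c + x) \<partial>lborel)" by (rule integral_distr) (use assms in auto)
  finally show ?thesis by simp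
qed

text \<open>Up to a null set the cell may be taken half-open. Translation pushes a slab out at one
  side and opens an equal slab at the other; the two are one period apart and carry the same
  integral.\<close>

lemma integral_cellm_translate:
  fixes u :: "real^2 \<Rightarrow> real"
  assumes u: "continuous_on UNIV u" and per: "periodic L u" and s: "0 \<le> s" "s \<le> L"
  shows "(\<integral>x. u (x + axis i s) \<partial>cellm L) = (\<integral>x. u x \<partial>cellm L)"
proof -
  define H where "H = {x :: real^2. \<forall>j. 0 \<le> x $ j \<and> x $ j < L}"
  define C where "C = {x \<in> H. x $ i < s}"
  have Hm: "H \<in> sets borel" unfolding H_def by measurable
  have Cm: "C \<in> sets borel" unfolding C_def H_def by measurable
  have "H \<subseteq> cell L"
  proof
    fix x assume "x \<in> H"
    then show "x \<in> cell L" by (simp add: H_def mem_cell less_imp_le)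
  qed
  then have bH: "bounded H" by (rule bounded_subset[rotated]) (simp add: cell_def)
  have bC: "bounded C" by (rule bounded_subset[OF bH]) (auto simp: C_def)
  have um: "u \<in> borel_measurable borel" by (rule borel_measurable_continuous_onI[OF u])
  have AEH: "AE x in lborel. indicator (cell L) x = (indicator H x :: real)"
  proof -
    have "AE x in lborel. \<forall>j. (x :: real^2) $ j \<noteq> L"
      using AE_component_neq by (simp add: AE_all_countable)
    then show ?thesis
      by eventually_elim (auto simp: indicator_def H_def mem_cell less_le)
  qed
  have cellH: "(\<integral>x. v x \<partial>cellm L) = (\<integral>x. indicator H x * v x \<partial>lborel)"
    if "continuous_on UNIV v" for v :: "real^2 \<Rightarrow> real"
  proof -
    have [measurable]: "v \<in> borel_measurable borel" by (rule borel_measurable_continuous_onI[OF that])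
    have [measurable]: "H \<in> sets borel" by (rule Hm)
    show ?thesis unfolding integral_cellm set_lebesgue_integral_def
      by (rule integral_cong_AE) (use AEH in \<open>auto elim!: eventually_mono\<close>)
  qed
  have [measurable]: "H \<in> sets borel" "C \<in> sets borel" "u \<in> borel_measurable borel" by fact+
  have cs: "continuous_on UNIV (\<lambda>x. u (x + axis i s))"
    by (intro continuous_on_compose2[OF u]) (auto intro!: continuous_intros)
  \<comment> \<open>The translated half-open cell is the original one without its lower slab
    \<open>C\<close> and with the copy of \<open>C\<close> moved by a full period.\<close>
  have split: "indicator H (y - axis i s) = (indicator H y - indicator C y + indicator C (y - axis i L) :: real)" for y
  proof -
    have other: "(y - axis i c) $ j = y $ j" if "j \<noteq> i" for j and c :: real
      using that by (simp add: axis_def)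
    have self: "(y - axis i c) $ i = y $ i - c" for c :: real by (simp add: axis_def)
    define R where "R \<longleftrightarrow> (\<forall>j. j \<noteq> i \<longrightarrow> 0 \<le> y $ j \<and> y $ j < L)"
    have H: "y - axis i c \<in> H \<longleftrightarrow> R \<and> c \<le> y $ i \<and> y $ i < L + c" for c :: real
      unfolding H_def R_def mem_Collect_eq using other self[of c]
      by (metis (no_types, opaque_lifting) add.commute diff_ge_0_iff_ge diff_less_eq)
    from H[of 0] have H0: "y \<in> H \<longleftrightarrow> R \<and> 0 \<le> y $ i \<and> y $ i < L" by (simp add: axis_zero)
    show ?thesis unfolding indicator_def C_def using s
      by (auto simp: H H0 self)
  qed
  have "(\<integral>x. u (x + axis i s) \<partial>cellm L) = (\<integral>x. indicator H x * u (x + axis i s) \<partial>lborel)"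
    by (rule cellH[OF cs])
  also have "\<dots> = (\<integral>x. indicator H ((axis i s + x) - axis i s) * u (axis i s + x) \<partial>lborel)"
    by (simp add: add.commute)
  also have "\<dots> = (\<integral>y. indicator H (y - axis i s) * u y \<partial>lborel)"
    by (rule lborel_integral_translate) measurable
  also have "\<dots> = (\<integral>y. (indicator H y * u y - indicator C y * u y) + indicator C (y - axis i L) * u y \<partial>lborel)"
    unfolding split by (simp add: algebra_simps)
  also have "\<dots> = (\<integral>y. indicator H y * u y \<partial>lborel) - (\<integral>y. indicator C y * u y \<partial>lborel)
      + (\<integral>y. indicator C (y - axis i L) * u y \<partial>lborel)"
  proof -
    define C' where "C' = (\<lambda>x. axis i L + x) ` C"
    have "y \<in> C' \<longleftrightarrow> y - axis i L \<in> C" for y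
      unfolding C'_def by (metis (no_types, lifting) add.commute diff_add_cancel image_iff add_diff_cancel)
    then have C': "indicator C (y - axis i L) = (indicator C' y :: real)" for y
      by (simp add: indicator_def)
    have "C' = (\<lambda>y. y - axis i L) -` C" using \<open>\<And>y. y \<in> C' \<longleftrightarrow> y - axis i L \<in> C\<close> by auto
    moreover have "(\<lambda>y. y - axis i L) -` C \<inter> space borel \<in> sets borel"
      by (rule measurable_sets[of _ borel borel]) auto
    ultimately have "C' \<in> sets borel" by simp
    moreover have "bounded C'" unfolding C'_def by (rule bounded_translation[OF bC])
    ultimately have "integrable lborel (\<lambda>y. indicator C (y - axis i L) * u y)"
      unfolding C' by (rule integrable_lborel_indicator_bounded[OF u])
    then show ?thesis
      using integrable_lborel_indicator_bounded[OF u Hm bH] integrable_lborel_indicator_bounded[OF u Cm bC] by simp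
  qed
  also have "(\<integral>y. indicator C (y - axis i L) * u y \<partial>lborel) =
      (\<integral>x. indicator C ((axis i L + x) - axis i L) * u (axis i L + x) \<partial>lborel)"
    by (rule lborel_integral_translate[symmetric]) measurable
  also have "\<dots> = (\<integral>y. indicator C y * u y \<partial>lborel)"
    using per by (simp add: periodic_def add.commute)
  finally show ?thesis by (simp add: cellH[OF u])
qed

text \<open>Difference quotients have integral zero by translation invariance. By the mean value
  theorem they are bounded by the maximum of \<open>g\<close> on the doubled cell, so dominated
  convergence applies. Every integration by parts below is this lemma for a product.\<close>

lemma integral_directional_derivative:
  fixes \<phi> g :: "real^2 \<Rightarrow> real"
  assumes L: "L > 0" and \<phi>: "continuous_on UNIV \<phi>" "periodic L \<phi>" and g: "continuous_on UNIV g"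
    and deriv: "\<And>x. ((\<lambda>s. \<phi> (x + axis i s)) has_real_derivative g x) (at 0)"
  shows "(\<integral>x. g x \<partial>cellm L) = 0"
proof -
  have deriv': "((\<lambda>s. \<phi> (x + axis i s)) has_real_derivative g (x + axis i s)) (at s)" for x s
  proof -
    have "((\<lambda>r. \<phi> ((x + axis i s) + axis i (r - s))) has_real_derivative g (x + axis i s)) (at s)"
      using DERIV_shift[of "\<lambda>r. \<phi> ((x + axis i s) + axis i (r - s))" "g (x + axis i s)" 0 s]
        deriv[of "x + axis i s"] by simp
    moreover have "axis i s + axis i (r - s) = (axis i r :: real^2)" for r
      by (simp add: axis_def vec_eq_iff)
    ultimately show ?thesis by (simp add: add.assoc)
  qed
  define h where "h n = L * inverse (real (Suc n))" for n
  have h: "h n > 0" "h n \<le> L" for n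
    using L by (auto simp: h_def field_simps)
  have "h \<longlonglongrightarrow> 0"
    unfolding h_def[abs_def] by (rule tendsto_mult_right_zero[OF LIMSEQ_inverse_real_of_nat])
  define q where "q n x = (\<phi> (x + axis i (h n)) - \<phi> x) / h n" for n x
  have cs: "continuous_on UNIV (\<lambda>x. \<phi> (x + axis i (h n)))" for n
    by (intro continuous_on_compose2[OF \<phi>(1)]) (auto intro!: continuous_intros)
  have q0: "(\<integral>x. q n x \<partial>cellm L) = 0" for n
  proof -
    have "(\<integral>x. q n x \<partial>cellm L) = ((\<integral>x. \<phi> (x + axis i (h n)) \<partial>cellm L) - (\<integral>x. \<phi> x \<partial>cellm L)) / h n"
      unfolding q_def using continuous_integrable_cellm[OF cs] continuous_integrable_cellm[OF \<phi>(1)] by simp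
    then show ?thesis using integral_cellm_translate[OF \<phi>, of "h n" i] h[of n] by simp
  qed
  have "bounded (g ` cbox 0 (vec (2 * L)))"
    using g by (intro compact_imp_bounded compact_continuous_image) (auto intro: continuous_on_subset)
  then obtain B where "\<forall>y\<in>g ` cbox 0 (vec (2 * L)). norm y \<le> B"
    unfolding bounded_iff by blast
  then have B: "norm (g x) \<le> B" if "x \<in> cbox 0 (vec (2 * L))" for x
    using that by simp
  have qB: "norm (q n x) \<le> B" if x: "x \<in> cell L" for n x
  proof -
    obtain z where z: "0 < z" "z < h n" "\<phi> (x + axis i (h n)) - \<phi> (x + axis i 0) = (h n - 0) * g (x + axis i z)"
      using MVT2[OF h(1)[of n], of "\<lambda>s. \<phi> (x + axis i s)" "\<lambda>s. g (x + axis i s)"] deriv' by auto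
    have "q n x = g (x + axis i z)"
      using z(3) h(1)[of n] by (simp add: q_def axis_zero)
    moreover have "x + axis i z \<in> cbox 0 (vec (2 * L))"
    proof -
      have "0 \<le> (x + axis i z) $ j \<and> (x + axis i z) $ j \<le> 2 * L" for j
      proof -
        have "0 \<le> x $ j \<and> x $ j \<le> L" using x by (simp add: mem_cell)
        moreover have "0 \<le> axis i z $ j \<and> axis i z $ j \<le> L"
          using z(1,2) h(2)[of n] L by (simp add: axis_def)
        ultimately show ?thesis by simp
      qed
      then show ?thesis by (simp add: mem_box_cart)
    qed
    ultimately show ?thesis using B by simp
  qed
  have "(\<lambda>n. \<integral>x. q n x \<partial>cellm L) \<longlonglongrightarrow> (\<integral>x. g x \<partial>cellm L)"
  proof (rule integral_dominated_convergence[where w = "\<lambda>_. B"])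
    show "g \<in> borel_measurable (cellm L)"
      by (intro borel_measurable_cellm borel_measurable_continuous_onI g)
    show "q n \<in> borel_measurable (cellm L)" for n
      unfolding q_def[abs_def]
      by (intro borel_measurable_cellm borel_measurable_continuous_onI continuous_intros cs \<phi>) (use h(1)[of n] in auto)
    show "AE x in cellm L. (\<lambda>n. q n x) \<longlonglongrightarrow> g x"
    proof (rule AE_I2)
      fix x
      have "((\<lambda>r. (\<phi> (x + axis i r) - \<phi> x) / r) \<longlongrightarrow> g x) (at 0)"
        using deriv[of x] by (simp add: has_field_derivative_iff axis_zero)
      then show "(\<lambda>n. q n x) \<longlonglongrightarrow> g x"
        unfolding q_def
      proof (rule filterlim_compose)
        show "filterlim h (at 0) sequentially"
          unfolding filterlim_at using \<open>h \<longlonglongrightarrow> 0\<close> less_imp_neq[OF h(1)]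
          by (auto intro!: always_eventually)
      qed
    qed
    show "AE x in cellm L. norm (q n x) \<le> B" for n
      using qB by (intro AE_I2) auto
  qed auto
  then show ?thesis using q0 by (simp add: LIMSEQ_const_iff)
qed

section \<open>The Hartley basis\<close>

text \<open>
  The functions \<open>cos (k \<cdot> x) + sin (k \<cdot> x)\<close> form a real orthonormal basis indexed by the whole wave
  lattice, and differentiation maps the one with index \<open>k\<close> to a multiple of the one with index \<open>- k\<close>.
\<close>

definition hartley :: "real \<Rightarrow> int^2 \<Rightarrow> real^2 \<Rightarrow> real" where
  "hartley L k x = (cos (wave L k \<bullet> x) + sin (wave L k \<bullet> x)) / L"

lemma wave_add: "wave L (k + l) = wave L k + wave L l"
  by (simp add: wave_def vec_eq_iff distrib_left)
lemma wave_diff: "wave L (k - l) = wave L k - wave L l"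
  by (simp add: wave_def vec_eq_iff right_diff_distrib)
lemma wave_minus: "wave L (- k) = - wave L k"
  by (simp add: wave_def vec_eq_iff)
lemma wave_zero: "wave L 0 = 0"
  by (simp add: wave_def vec_eq_iff)

lemma wave_eq_0_iff: "L > 0 \<Longrightarrow> wave L k $ i = 0 \<longleftrightarrow> k $ i = 0"
  by (simp add: wave_def)

lemma wave_inner_axis: "L > 0 \<Longrightarrow> wave L k \<bullet> axis i L = 2 * pi * of_int (k $ i)"
  by (simp add: inner_axis wave_def)

lemma cos_wave_periodic: "L > 0 \<Longrightarrow> cos (wave L k \<bullet> (x + axis i L)) = cos (wave L k \<bullet> x)"
  and sin_wave_periodic: "L > 0 \<Longrightarrow> sin (wave L k \<bullet> (x + axis i L)) = sin (wave L k \<bullet> x)"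
  by (simp_all add: inner_add_right wave_inner_axis cos_add sin_add)

lemma periodic_hartley: "L > 0 \<Longrightarrow> periodic L (hartley L k)"
  by (simp add: periodic_def hartley_def cos_wave_periodic sin_wave_periodic)

lemma continuous_hartley: "continuous_on S (hartley L k)"
  unfolding hartley_def[abs_def] divide_inverse by (intro continuous_intros)

lemma abs_hartley_le: "L > 0 \<Longrightarrow> \<bar>hartley L k x\<bar> \<le> 2 / L"
  using abs_cos_le_one[of "wave L k \<bullet> x"] abs_sin_le_one[of "wave L k \<bullet> x"]
  by (simp add: hartley_def abs_divide divide_right_mono del: abs_cos_le_one abs_sin_le_one)

lemma hartley_0: "hartley L 0 x = 1 / L"
  by (simp add: hartley_def wave_zero)

lemma has_derivative_hartley:
  "(hartley L k has_derivative (\<lambda>h. (wave L k \<bullet> h) * hartley L (- k) x)) (at x)"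
proof -
  have "((\<lambda>x. cos (wave L k \<bullet> x) + sin (wave L k \<bullet> x)) has_derivative
      (\<lambda>h. (wave L k \<bullet> h) * (cos (wave L k \<bullet> x) - sin (wave L k \<bullet> x)))) (at x)"
    by (auto intro!: derivative_eq_intros simp: algebra_simps)
  from bounded_linear.has_derivative[OF bounded_linear_divide this]
  show ?thesis unfolding hartley_def[abs_def] wave_minus by simp
qed

lemma pd_scale_hartley: "pd i (\<lambda>x. c * hartley L k x) = (\<lambda>x. (c * wave L k $ i) * hartley L (- k) x)"
proof
  fix x
  have "((\<lambda>x. c * hartley L k x) has_derivative (\<lambda>h. c * ((wave L k \<bullet> h) * hartley L (- k) x))) (at x)"
    by (intro has_derivative_mult_right has_derivative_hartley)
  then show "pd i (\<lambda>x. c * hartley L k x) x = (c * wave L k $ i) * hartley L (- k) x"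
    unfolding pd_def by (simp add: frechet_derivative_at[symmetric] inner_axis)
qed

lemma pd_hartley: "pd i (hartley L k) = (\<lambda>x. wave L k $ i * hartley L (- k) x)"
  using pd_scale_hartley[of i 1 L k] by simp

lemma laplacian_hartley: "laplacian (hartley L k) = (\<lambda>x. - (norm (wave L k))\<^sup>2 * hartley L k x)"
  unfolding laplacian_def pd_hartley pd_scale_hartley wave_minus
  by (simp add: fun_eq_iff power2_norm_eq_inner inner_vec_def sum_negf flip: sum_distrib_right)

lemma test_fun_hartley: "L > 0 \<Longrightarrow> hartley L k \<in> test_fun L"
proof -
  assume L: "L > 0"
  have "\<exists>c k'. foldr pd is (hartley L k) = (\<lambda>x. c * hartley L k' x)" for "is"
  proof (induction "is")
    case Nil
    show ?case by (rule exI[of _ 1], rule exI[of _ k]) simp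
  next
    case (Cons i "is")
    then show ?case using pd_scale_hartley by (metis foldr_Cons o_apply)
  qed
  moreover have "(\<lambda>x. c * hartley L k' x) differentiable at x" for c k' x
    using has_derivative_mult_right[OF has_derivative_hartley] unfolding differentiable_def by blast
  ultimately have "foldr pd is (hartley L k) differentiable at x" for "is" x by metis
  then show ?thesis using periodic_hartley[OF L] by (simp add: test_fun_def)
qed

lemma DERIV_along_axis:
  fixes \<phi> :: "real^2 \<Rightarrow> real"
  assumes "(\<phi> has_derivative D) (at x)"
  shows "((\<lambda>s. \<phi> (x + axis i s)) has_real_derivative D (axis i 1)) (at (0 :: real))"
proof -
  define a :: "real^2" where "a = axis i 1"
  have axs: "axis i s = s *\<^sub>R a" for s by (simp add: a_def axis_def vec_eq_iff)
  have "((\<lambda>s::real. x + axis i s) has_derivative (\<lambda>s. axis i s)) (at 0)"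
    unfolding axs by (auto intro!: derivative_eq_intros)
  moreover have "(\<phi> has_derivative D) (at (x + axis i 0))" using assms by (simp add: axis_zero)
  ultimately have d: "((\<lambda>s. \<phi> (x + axis i s)) has_derivative (\<lambda>s. D (axis i s))) (at 0)"
    by (rule has_derivative_compose)
  have "(\<lambda>s. D (axis i s)) = (*) (D a)"
    unfolding axs using has_derivative_linear[OF assms] by (simp add: fun_eq_iff linear_cmul)
  with d show ?thesis unfolding has_field_derivative_def a_def by (simp only:)
qed

text \<open>In a direction in which \<open>k\<close> has a nonzero component, the cosine is a
  multiple of the derivative of the periodic sine.\<close>

lemma integral_cos_wave:
  assumes L: "L > 0" and k: "k \<noteq> 0"
  shows "(\<integral>x. cos (wave L k \<bullet> x) \<partial>cellm L) = 0"
proof -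
  obtain i where "k $ i \<noteq> 0" using k by (auto simp: vec_eq_iff)
  then have w: "wave L k $ i \<noteq> 0" using wave_eq_0_iff[OF L] by simp
  have "(\<integral>x. wave L k $ i * cos (wave L k \<bullet> x) \<partial>cellm L) = 0"
  proof (rule integral_directional_derivative[OF L])
    show "continuous_on UNIV (\<lambda>x. sin (wave L k \<bullet> x))" "continuous_on UNIV (\<lambda>x. wave L k $ i * cos (wave L k \<bullet> x))"
      by (intro continuous_intros)+
    show "periodic L (\<lambda>x. sin (wave L k \<bullet> x))" by (simp add: periodic_def sin_wave_periodic L)
    fix x
    have "((\<lambda>x. sin (wave L k \<bullet> x)) has_derivative (\<lambda>h. (wave L k \<bullet> h) * cos (wave L k \<bullet> x))) (at x)"
      by (auto intro!: derivative_eq_intros)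
    from DERIV_along_axis[OF this, of i]
    show "((\<lambda>s. sin (wave L k \<bullet> (x + axis i s))) has_real_derivative wave L k $ i * cos (wave L k \<bullet> x)) (at 0)"
      by (simp add: inner_axis)
  qed
  then show ?thesis using w by simp
qed

lemma integral_sin_wave:
  assumes L: "L > 0"
  shows "(\<integral>x. sin (wave L k \<bullet> x) \<partial>cellm L) = 0"
proof (cases "k = 0")
  case False
  then obtain i where "k $ i \<noteq> 0" by (auto simp: vec_eq_iff)
  then have w: "wave L k $ i \<noteq> 0" using wave_eq_0_iff[OF L] by simp
  have "(\<integral>x. - wave L k $ i * sin (wave L k \<bullet> x) \<partial>cellm L) = 0"
  proof (rule integral_directional_derivative[OF L])
    show "continuous_on UNIV (\<lambda>x. cos (wave L k \<bullet> x))" "continuous_on UNIV (\<lambda>x. - wave L k $ i * sin (wave L k \<bullet> x))"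
      by (intro continuous_intros)+
    show "periodic L (\<lambda>x. cos (wave L k \<bullet> x))" by (simp add: periodic_def cos_wave_periodic L)
    fix x
    have "((\<lambda>x. cos (wave L k \<bullet> x)) has_derivative (\<lambda>h. - (wave L k \<bullet> h) * sin (wave L k \<bullet> x))) (at x)"
      by (auto intro!: derivative_eq_intros)
    from DERIV_along_axis[OF this, of i]
    show "((\<lambda>s. cos (wave L k \<bullet> (x + axis i s))) has_real_derivative - wave L k $ i * sin (wave L k \<bullet> x)) (at 0)"
      by (simp add: inner_axis)
  qed
  then show ?thesis using w by simp
qed (simp add: wave_zero)

lemma hartley_mult:
  "hartley L k x * hartley L l x = (cos (wave L (k - l) \<bullet> x) + sin (wave L (k + l) \<bullet> x)) / L\<^sup>2"
  by (simp add: hartley_def wave_add wave_diff inner_add_left inner_diff_left cos_diff sin_add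
      power2_eq_square field_simps)

text \<open>A product of two basis functions is a cosine with frequency \<open>k - l\<close> plus a
  sine with frequency \<open>k + l\<close>; the only term with nonzero mean is the cosine of
  frequency zero.\<close>

lemma orthonormal_hartley:
  assumes L: "L > 0"
  shows "(\<integral>x. hartley L k x * hartley L l x \<partial>cellm L) = (if k = l then 1 else 0)"
proof -
  have i: "integrable (cellm L) (\<lambda>x. cos (wave L (k - l) \<bullet> x))" "integrable (cellm L) (\<lambda>x. sin (wave L (k + l) \<bullet> x))"
    by (intro continuous_integrable_cellm continuous_intros)+
  have "(\<integral>x. hartley L k x * hartley L l x \<partial>cellm L) =
      ((\<integral>x. cos (wave L (k - l) \<bullet> x) \<partial>cellm L) + (\<integral>x. sin (wave L (k + l) \<bullet> x) \<partial>cellm L)) / L\<^sup>2"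
    unfolding hartley_mult using i by simp
  also have "(\<integral>x. cos (wave L (k - l) \<bullet> x) \<partial>cellm L) = (if k = l then L\<^sup>2 else 0)"
    using integral_cos_wave[OF L, of "k - l"] by (auto simp: wave_zero measure_cell L)
  finally show ?thesis using L integral_sin_wave[OF L] by simp
qed

inductive trig_poly :: "real \<Rightarrow> (real^2 \<Rightarrow> real) \<Rightarrow> bool" for L where
  hartley: "trig_poly L (hartley L k)"
| scale: "trig_poly L u \<Longrightarrow> trig_poly L (\<lambda>x. c * u x)"
| add: "trig_poly L u \<Longrightarrow> trig_poly L v \<Longrightarrow> trig_poly L (\<lambda>x. u x + v x)"

lemma trig_poly_cos_sin:
  assumes L: "L > 0"
  shows "trig_poly L (\<lambda>x. cos (wave L k \<bullet> x))" "trig_poly L (\<lambda>x. sin (wave L k \<bullet> x))"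
proof -
  have c: "cos (wave L k \<bullet> x) = (L / 2) * hartley L k x + (L / 2) * hartley L (- k) x" for x
    using L by (simp add: hartley_def wave_minus field_simps)
  have s: "sin (wave L k \<bullet> x) = (L / 2) * hartley L k x + (- (L / 2)) * hartley L (- k) x" for x
    using L by (simp add: hartley_def wave_minus field_simps)
  show "trig_poly L (\<lambda>x. cos (wave L k \<bullet> x))" "trig_poly L (\<lambda>x. sin (wave L k \<bullet> x))"
    unfolding c s by (intro trig_poly.intros)+
qed

text \<open>Closure under products is what lets polynomials in the coordinates of
  \<open>torus_map\<close> pull back to trigonometric polynomials.\<close>

lemma trig_poly_mult:
  assumes L: "L > 0" and u: "trig_poly L u" and v: "trig_poly L v"
  shows "trig_poly L (\<lambda>x. u x * v x)"
  using u
proof induction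
  case (hartley k)
  show ?case using v
  proof induction
    case (hartley l)
    have eq: "hartley L k x * hartley L l x =
        (1 / L\<^sup>2) * (cos (wave L (k - l) \<bullet> x) + sin (wave L (k + l) \<bullet> x))" for x
      by (simp add: hartley_mult)
    show ?case unfolding eq by (intro trig_poly.scale trig_poly.add trig_poly_cos_sin[OF L])
  next
    case (scale v c)
    then have "trig_poly L (\<lambda>x. c * (hartley L k x * v x))" by (intro trig_poly.scale)
    then show ?case by (simp add: mult_ac)
  qed (auto simp: distrib_left intro: trig_poly.add)
next
  case (scale u c)
  then have "trig_poly L (\<lambda>x. c * (u x * v x))" by (intro trig_poly.scale)
  then show ?case by (simp add: mult_ac)
qed (auto simp: distrib_right intro: trig_poly.add)

lemma trig_poly_const: "L > 0 \<Longrightarrow> trig_poly L (\<lambda>_. c)"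
  using trig_poly.scale[OF trig_poly_cos_sin(1)[of L 0], of c] by (simp add: wave_zero)

lemma trig_poly_sum: "L > 0 \<Longrightarrow> (\<And>i. i \<in> I \<Longrightarrow> trig_poly L (u i)) \<Longrightarrow> trig_poly L (\<lambda>x. \<Sum>i\<in>I. u i x)"
  by (induction I rule: infinite_finite_induct) (auto intro: trig_poly.add trig_poly_const)

lemma square_integrable_continuous:
  fixes u :: "real^2 \<Rightarrow> real"
  assumes "continuous_on UNIV u"
  shows "square_integrable (cellm L) u"
  unfolding square_integrable_def
  by (intro conjI borel_measurable_cellm borel_measurable_continuous_onI continuous_integrable_cellm
      continuous_intros assms)

lemma continuous_trig_poly: "trig_poly L u \<Longrightarrow> continuous_on S u"
  by (induction rule: trig_poly.induct) (auto intro!: continuous_intros continuous_hartley)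

lemma integral_trig_poly_eq_0:
  assumes v: "square_integrable (cellm L) v" and orth: "\<And>k. (\<integral>x. v x * hartley L k x \<partial>cellm L) = 0"
    and u: "trig_poly L u"
  shows "(\<integral>x. v x * u x \<partial>cellm L) = 0"
  using u
proof induction
  case (scale u c)
  have "(\<integral>x. v x * (c * u x) \<partial>cellm L) = c * (\<integral>x. v x * u x \<partial>cellm L)"
    by (simp add: mult.left_commute)
  then show ?case using scale by simp
next
  case (add u w)
  have "integrable (cellm L) (\<lambda>x. v x * u x)" "integrable (cellm L) (\<lambda>x. v x * w x)"
    using add by (auto intro!: square_integrable_mult v square_integrable_continuous continuous_trig_poly)
  then show ?case using add by (simp add: distrib_left)
qed (use orth in simp)

section \<open>Completeness of the Hartley basis\<close>

text \<open>The embedding of the torus as a product of two circles in four-dimensional space. On its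
  compact image polynomials are uniformly dense by the Stone-Weierstrass theorem.\<close>

definition torus_map :: "real \<Rightarrow> real^2 \<Rightarrow> (real^2) \<times> (real^2)" where
  "torus_map L x = ((\<chi> i. cos (2 * pi / L * x $ i)), (\<chi> i. sin (2 * pi / L * x $ i)))"

lemma continuous_torus_map: "continuous_on S (torus_map L)"
  unfolding torus_map_def[abs_def] by (intro continuous_intros continuous_on_vec_lambda)

lemma wave_axis_inner: "wave L (axis i 1) \<bullet> x = 2 * pi / L * x $ i"
proof -
  have "wave L (axis i 1) = axis i (2 * pi / L)" by (simp add: wave_def axis_def vec_eq_iff)
  then show ?thesis by (subst inner_commute) (simp add: inner_axis)
qed

lemma trig_poly_real_polynomial:
  assumes L: "L > 0" and g: "real_polynomial_function g"
  shows "trig_poly L (\<lambda>x. g (torus_map L x))"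
  using g
proof induction
  case (linear f)
  have comp: "trig_poly L (\<lambda>x. torus_map L x \<bullet> b)" if b: "b \<in> Basis" for b
  proof -
    consider i where "b = (axis i 1, 0)" | i where "b = (0, axis i 1)"
      using b by (auto simp: Basis_prod_def Basis_vec_def)
    then show ?thesis
    proof cases
      case 1
      then show ?thesis using trig_poly_cos_sin(1)[OF L, of "axis i 1"]
        by (simp add: torus_map_def inner_axis wave_axis_inner)
    next
      case 2
      then show ?thesis using trig_poly_cos_sin(2)[OF L, of "axis i 1"]
        by (simp add: torus_map_def inner_axis wave_axis_inner)
    qed
  qed
  have "f (torus_map L x) = (\<Sum>b\<in>Basis. f b * (torus_map L x \<bullet> b))" for x
  proof -
    have "f (torus_map L x) = f (\<Sum>b\<in>Basis. (torus_map L x \<bullet> b) *\<^sub>R b)"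
      by (simp only: euclidean_representation)
    also have "\<dots> = (\<Sum>b\<in>Basis. f b * (torus_map L x \<bullet> b))"
      using bounded_linear.linear[OF linear] by (simp add: linear_sum linear_scale mult.commute)
    finally show ?thesis .
  qed
  then show ?case by (simp only:) (intro trig_poly_sum[OF L] trig_poly.scale comp)
next
  case (const c)
  show ?case by (rule trig_poly_const[OF L])
next
  case (add f g)
  then show ?case by (intro trig_poly.add)
next
  case (mult f g)
  then show ?case by (intro trig_poly_mult[OF L])
qed

lemma torus_map_inj_interior:
  assumes L: "L > 0" and x: "\<And>j. 0 < x $ j \<and> x $ j < L" and y: "y \<in> cell L"
    and eq: "torus_map L x = torus_map L y"
  shows "x = y"
proof -
  have "x $ j = y $ j" for j
  proof -
    have "cos (2 * pi / L * x $ j) = cos (2 * pi / L * y $ j)" "sin (2 * pi / L * x $ j) = sin (2 * pi / L * y $ j)"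
      using eq unfolding torus_map_def by (simp_all add: vec_eq_iff)
    then obtain n :: int where n: "2 * pi / L * x $ j = 2 * pi / L * y $ j + 2 * pi * n"
      using sin_cos_eq_iff by blast
    have "2 * pi / L * x $ j = 2 * pi / L * (y $ j + L * n)"
      using n L by (simp add: field_simps)
    then have xy: "x $ j = y $ j + L * n" using L by simp
    have "0 \<le> y $ j" "y $ j \<le> L" using y by (auto simp: mem_cell)
    then have "\<bar>L * n\<bar> < L * 1" using xy x[of j] by linarith
    then have "\<bar>real_of_int n\<bar> < 1" using L by (simp add: abs_mult)
    then have "n = 0" by linarith
    then show ?thesis using xy by simp
  qed
  then show ?thesis by (simp add: vec_eq_iff)
qed

lemma AE_cellm_interior: "AE x in cellm L. \<forall>j. 0 < x $ j \<and> x $ j < L"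
proof -
  have "AE x in lborel. \<forall>j. (x :: real^2) $ j \<noteq> 0 \<and> x $ j \<noteq> L"
    using AE_component_neq by (simp add: AE_all_countable AE_conj_iff)
  then have "AE x in lborel. x \<in> cell L \<longrightarrow> (\<forall>j. 0 < x $ j \<and> x $ j < L)"
    by eventually_elim (simp add: mem_cell less_le)
  then show ?thesis unfolding cellm_def by (simp add: AE_restrict_space_iff)
qed

text \<open>The indicator of \<open>B\<close> is a bounded pointwise limit, almost everywhere on the
  cell, of trigonometric polynomials, against all of which \<open>v\<close> integrates to
  zero.\<close>

lemma integral_closed_eq_0:
  assumes L: "L > 0" and v: "square_integrable (cellm L) v"
    and orth: "\<And>k. (\<integral>x. v x * hartley L k x \<partial>cellm L) = 0"
    and B: "closed B"
  shows "(\<integral>x. indicator B x * v x \<partial>cellm L) = 0"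
proof -
  define B' where "B' = B \<inter> cell L"
  define T where "T = torus_map L ` B'"
  have iv: "integrable (cellm L) v" by (rule cellm.integrable_if_square_integrable[OF v])
  show ?thesis
  proof (cases "B' = {}")
    case True
    have "(\<integral>x. indicator B x * v x \<partial>cellm L) = (\<integral>x. 0 \<partial>cellm L)"
      by (rule Bochner_Integration.integral_cong) (use True in \<open>auto simp: B'_def indicator_def\<close>)
    then show ?thesis by simp
  next
    case False
    have "compact B'" unfolding B'_def using B by (intro closed_Int_compact) (simp_all add: cell_def)
    then have T: "closed T" "T \<noteq> {}"
      unfolding T_def using False by (auto intro!: compact_imp_closed compact_continuous_image continuous_torus_map)
    \<comment> \<open>Continuous functions that decrease to the indicator of the closed set
      \<open>T\<close>; each one is replaced by a polynomial with error below
      \<open>1 / (m + 1)\<close>.\<close>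
    define F where "F m z = max 0 (1 - real m * infdist z T)" for m z
    have F01: "0 \<le> F m z \<and> F m z \<le> 1" for m z by (simp add: F_def infdist_nonneg)
    have "\<exists>g. real_polynomial_function g \<and> (\<forall>z\<in>torus_map L ` cell L. \<bar>F m z - g z\<bar> < inverse (real (Suc m)))" for m
    proof -
      have "continuous_on (torus_map L ` cell L) (F m)"
        unfolding F_def by (intro continuous_intros)
      moreover have "compact (torus_map L ` cell L)"
        by (intro compact_continuous_image continuous_torus_map) (simp add: cell_def)
      ultimately show ?thesis
        using Stone_Weierstrass_real_polynomial_function[of _ "F m" "inverse (real (Suc m))"]
        by (metis inverse_positive_iff_positive of_nat_0_less_iff zero_less_Suc)
    qed
    then obtain g where g: "\<And>m. real_polynomial_function (g m)"
      and Fg: "\<And>m z. z \<in> torus_map L ` cell L \<Longrightarrow> \<bar>F m z - g m z\<bar> < inverse (real (Suc m))"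
      by metis
    define G where "G m x = g m (torus_map L x)" for m x
    have tG: "trig_poly L (G m)" for m unfolding G_def[abs_def] by (rule trig_poly_real_polynomial[OF L g])
    have int0: "(\<integral>x. v x * G m x \<partial>cellm L) = 0" for m
      by (rule integral_trig_poly_eq_0[OF v orth tG])
    have vm: "v \<in> borel_measurable (cellm L)" using v by (simp add: square_integrable_def)
    have "(\<lambda>m. \<integral>x. v x * G m x \<partial>cellm L) \<longlonglongrightarrow> (\<integral>x. indicator B x * v x \<partial>cellm L)"
    proof (rule integral_dominated_convergence[where w = "\<lambda>x. 2 * \<bar>v x\<bar>"])
      have "(\<lambda>x. indicator B x :: real) \<in> borel_measurable (cellm L)"
        by (intro borel_measurable_cellm) (use B in auto)
      then show "(\<lambda>x. indicator B x * v x) \<in> borel_measurable (cellm L)"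
        using vm by (rule borel_measurable_times)
      show "(\<lambda>x. v x * G m x) \<in> borel_measurable (cellm L)" for m
        by (intro borel_measurable_times vm borel_measurable_cellm borel_measurable_continuous_onI continuous_trig_poly[OF tG])
      show "integrable (cellm L) (\<lambda>x. 2 * \<bar>v x\<bar>)" using iv by simp
      show "AE x in cellm L. norm (v x * G m x) \<le> 2 * \<bar>v x\<bar>" for m
      proof (rule AE_I2)
        fix x assume "x \<in> space (cellm L)"
        then have "\<bar>F m (torus_map L x) - G m x\<bar> < inverse (real (Suc m))" using Fg by (simp add: G_def)
        moreover have "inverse (real (Suc m)) \<le> 1" by (simp add: inverse_le_1_iff)
        ultimately have "\<bar>G m x\<bar> \<le> 2" using F01[of m "torus_map L x"] by linarith
        then have "\<bar>G m x\<bar> * \<bar>v x\<bar> \<le> 2 * \<bar>v x\<bar>" by (rule mult_right_mono) simp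
        then show "norm (v x * G m x) \<le> 2 * \<bar>v x\<bar>" by (simp add: abs_mult mult.commute)
      qed
      have "AE x in cellm L. x \<in> cell L" by (rule AE_I2) simp
      then show "AE x in cellm L. (\<lambda>m. v x * G m x) \<longlonglongrightarrow> indicator B x * v x"
        using AE_cellm_interior
      proof eventually_elim
        case (elim x)
        \<comment> \<open>Opposite edges of the closed cell have the same image, so membership can
          be pulled back only at interior points, which are almost all points.\<close>
        have xT: "torus_map L x \<in> T \<longleftrightarrow> x \<in> B"
          unfolding T_def B'_def using elim torus_map_inj_interior[OF L, of x] by blast
        have "(\<lambda>m. F m (torus_map L x)) \<longlonglongrightarrow> indicator B x"
        proof (cases "x \<in> B")
          case True
          then have "infdist (torus_map L x) T = 0" using xT by simp
          then show ?thesis using True by (simp add: F_def)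
        next
          case False
          define d where "d = infdist (torus_map L x) T"
          have d: "d > 0"
            using False xT T in_closed_iff_infdist_zero[of T] infdist_nonneg[of "torus_map L x" T] unfolding d_def
            by (metis less_eq_real_def)
          obtain N where N: "1 / d < real N" using reals_Archimedean2 by blast
          have "F m (torus_map L x) = 0" if "m \<ge> N" for m
          proof -
            have "1 / d < real m" using N that by linarith
            then have "1 < real m * d" using d by (simp add: field_simps)
            then show ?thesis by (simp add: F_def d_def)
          qed
          then have "\<forall>\<^sub>F m in sequentially. F m (torus_map L x) = 0"
            by (auto simp: eventually_sequentially)
          then show ?thesis using False by (simp add: tendsto_eventually)
        qed
        moreover have "(\<lambda>m. G m x - F m (torus_map L x)) \<longlonglongrightarrow> 0"
        proof (rule Lim_null_comparison[OF _ LIMSEQ_inverse_real_of_nat])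
          show "\<forall>\<^sub>F m in sequentially. norm (G m x - F m (torus_map L x)) \<le> inverse (real (Suc m))"
            using Fg[of "torus_map L x"] elim
            by (intro always_eventually) (auto simp: G_def abs_minus_commute intro: less_imp_le)
        qed
        ultimately have "(\<lambda>m. (G m x - F m (torus_map L x)) + F m (torus_map L x)) \<longlonglongrightarrow> 0 + indicator B x"
          by (intro tendsto_add)
        then have "(\<lambda>m. v x * G m x) \<longlonglongrightarrow> v x * indicator B x" by (intro tendsto_mult) auto
        then show ?case by (simp add: mult.commute)
      qed
    qed
    then show ?thesis using int0 by (simp add: LIMSEQ_const_iff)
  qed
qed

text \<open>Closed sets form a generator of the Borel sets that is stable under intersection.
  Complements and disjoint unions preserve a vanishing integral, so \<open>v\<close> has zero
  integral over every Borel set and hence vanishes almost everywhere.\<close>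

lemma hartley_complete:
  assumes L: "L > 0" and v: "square_integrable (cellm L) v"
    and orth: "\<And>k. (\<integral>x. v x * hartley L k x \<partial>cellm L) = 0"
  shows "AE x in cellm L. v x = 0"
proof -
  have iv: "integrable (cellm L) v" by (rule cellm.integrable_if_square_integrable[OF v])
  have Bint: "integrable (cellm L) (\<lambda>x. indicator A x * v x)" if "A \<in> sets borel" for A :: "(real^2) set"
  proof (rule Bochner_Integration.integrable_bound[OF iv])
    have "(\<lambda>x. indicator A x :: real) \<in> borel_measurable (cellm L)"
      by (intro borel_measurable_cellm) (use that in auto)
    moreover have "v \<in> borel_measurable (cellm L)" using v by (simp add: square_integrable_def)
    ultimately show "(\<lambda>x. indicator A x * v x) \<in> borel_measurable (cellm L)"
      by (rule borel_measurable_times)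
  qed (auto simp: indicator_def)
  have zero: "(\<integral>x. indicator A x * v x \<partial>cellm L) = 0" if "A \<in> sets borel" for A :: "(real^2) set"
  proof -
    have "Int_stable (Collect (closed :: (real^2) set \<Rightarrow> bool))" by (auto simp: Int_stable_def)
    moreover have "Collect (closed :: (real^2) set \<Rightarrow> bool) \<subseteq> Pow UNIV" by simp
    moreover have "A \<in> sigma_sets UNIV (Collect closed)" using that by (simp add: borel_eq_closed)
    ultimately show ?thesis
    proof (induction rule: sigma_sets_induct_disjoint)
      case (basic A)
      then show ?case using integral_closed_eq_0[OF L v orth] by simp
    next
      case (compl A)
      then have A: "A \<in> sets borel" by (simp add: borel_eq_closed)
      have "(\<integral>x. v x \<partial>cellm L) = (\<integral>x. indicator UNIV x * v x \<partial>cellm L)" by simp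
      also have "\<dots> = 0" by (rule integral_closed_eq_0[OF L v orth]) simp
      finally have "(\<integral>x. v x - indicator A x * v x \<partial>cellm L) = 0"
        using compl iv Bint[OF A] by simp
      moreover have "indicator (UNIV - A) x * v x = v x - indicator A x * v x" for x
        by (simp add: indicator_def)
      ultimately show ?case by simp
    next
      case (union A)
      then have A: "range A \<subseteq> sets borel" "\<And>i. A i \<in> sets borel" by (auto simp: borel_eq_closed)
      define A' where "A' i = cell L \<inter> A i" for i
      have A'm: "A' i \<in> sets (cellm L)" for i
        using A(2)[of i] by (auto simp: sets_cellm sets_restrict_space A'_def)
      have ind: "(LINT x:C|cellm L. v x) = (\<integral>x. indicator D x * v x \<partial>cellm L)" if "C = cell L \<inter> D" for C D
        unfolding set_lebesgue_integral_def
        by (rule Bochner_Integration.integral_cong) (auto simp: that indicator_def)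
      have "(LINT x:(\<Union>i. A' i)|cellm L. v x) = (\<Sum>i. (LINT x:A' i|cellm L. v x))"
      proof (rule lebesgue_integral_countable_add[OF A'm])
        show "A' i \<inter> A' j = {}" if "i \<noteq> j" for i j
          using union(1) that by (auto simp: A'_def disjoint_family_on_def)
        have "set_integrable (cellm L) (cell L) v"
          unfolding set_integrable_def
          by (rule Bochner_Integration.integrable_cong[THEN iffD2, OF refl _ iv]) (simp add: indicator_def)
        moreover have "(\<Union>i. A' i) \<in> sets (cellm L)" using A'm by blast
        moreover have "(\<Union>i. A' i) \<subseteq> cell L" by (auto simp: A'_def)
        ultimately show "set_integrable (cellm L) (\<Union>i. A' i) v"
          by (rule set_integrable_subset)
      qed
      also have "\<dots> = 0" using union(3) by (simp add: ind[OF A'_def])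
      finally have "(LINT x:(\<Union>i. A' i)|cellm L. v x) = 0" .
      moreover have "(\<Union>i. A' i) = cell L \<inter> (\<Union>i. A i)" by (auto simp: A'_def)
      ultimately show ?case by (simp only: ind)
    qed auto
  qed
  show ?thesis
  proof (rule density_unique_real)
    show "integrable (cellm L) v" by (rule iv)
    fix A assume "A \<in> sets (cellm L)"
    then obtain A' where A': "A' \<in> sets borel" "A = cell L \<inter> A'"
      unfolding sets_cellm sets_restrict_space by auto
    have "(LINT x:A|cellm L. v x) = (\<integral>x. indicator A' x * v x \<partial>cellm L)"
      unfolding set_lebesgue_integral_def
      by (rule Bochner_Integration.integral_cong) (auto simp: A' indicator_def)
    then show "(LINT x:A|cellm L. v x) = (LINT x:A|cellm L. 0)" using zero[OF A'(1)] by simp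
  qed simp
qed

section \<open>Fourier coefficients, Parseval and Riesz-Fischer\<close>

locale torus =
  fixes L :: real
  assumes L_pos: "L > 0"
begin

abbreviation e :: "int^2 \<Rightarrow> real^2 \<Rightarrow> real" where "e \<equiv> hartley L"
abbreviation \<mu> :: "(real^2) measure" where "\<mu> \<equiv> cellm L"

definition cf :: "(real^2 \<Rightarrow> real) \<Rightarrow> int^2 \<Rightarrow> real" where
  "cf u k = (\<integral>x. u x * e k x \<partial>\<mu>)"

lemma ip_scalar: "ip L u w = (\<integral>x. u x * w x \<partial>\<mu>)" for u w :: "real^2 \<Rightarrow> real"
  by (simp add: ip_def integral_cellm)

lemma cf_ip: "cf u k = ip L u (e k)"
  by (simp add: cf_def ip_scalar)

lemma L2_norm_square: "(L2_norm L u)\<^sup>2 = (\<integral>x. (u x)\<^sup>2 \<partial>\<mu>)" for u :: "real^2 \<Rightarrow> real"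
  unfolding L2_norm_def integral_cellm[symmetric] by simp

lemma L2_norm_nonneg: "L2_norm L u \<ge> 0"
  by (simp add: L2_norm_def set_lebesgue_integral_def)

lemma L2_per_iff:
  fixes u :: "real^2 \<Rightarrow> real"
  shows "u \<in> L2_per L \<longleftrightarrow> u \<in> borel_measurable borel \<and> periodic L u \<and> square_integrable \<mu> u"
  unfolding L2_per_def mem_Collect_eq square_integrable_def integrable_cellm[symmetric] real_norm_def power2_abs
  using borel_measurable_cellm[of u L] by (intro iffI conjI; elim conjE; assumption?) simp

lemma L2_si: "u \<in> L2_per L \<Longrightarrow> square_integrable \<mu> u" for u :: "real^2 \<Rightarrow> real"
  by (simp add: L2_per_iff)

lemma L2_continuous:
  fixes u :: "real^2 \<Rightarrow> real"
  shows "continuous_on UNIV u \<Longrightarrow> periodic L u \<Longrightarrow> u \<in> L2_per L"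
  unfolding L2_per_iff by (simp add: borel_measurable_continuous_onI square_integrable_continuous)

lemma L2_hartley [simp]: "e k \<in> L2_per L"
  by (intro L2_continuous continuous_hartley periodic_hartley L_pos)

lemma L2_add: "u \<in> L2_per L \<Longrightarrow> v \<in> L2_per L \<Longrightarrow> (\<lambda>x. u x + v x) \<in> L2_per L"
  and L2_diff: "u \<in> L2_per L \<Longrightarrow> v \<in> L2_per L \<Longrightarrow> (\<lambda>x. u x - v x) \<in> L2_per L"
  and L2_scale: "u \<in> L2_per L \<Longrightarrow> (\<lambda>x. c * u x) \<in> L2_per L"
  for u v :: "real^2 \<Rightarrow> real"
  unfolding L2_per_iff
  by (auto simp: periodic_def intro: square_integrable_add square_integrable_diff square_integrable_scale)

lemma L2_zero_fun [simp]: "(\<lambda>_. 0 :: real) \<in> L2_per L"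
  by (rule L2_continuous) (auto simp: periodic_def)

lemma L2_sum: "(\<And>i. i \<in> I \<Longrightarrow> u i \<in> L2_per L) \<Longrightarrow> (\<lambda>x. \<Sum>i\<in>I. u i x :: real) \<in> L2_per L"
  by (induction I rule: infinite_finite_induct) (auto intro: L2_add)

lemma integrable_mult: "u \<in> L2_per L \<Longrightarrow> v \<in> L2_per L \<Longrightarrow> integrable \<mu> (\<lambda>x. u x * v x)"
  for u v :: "real^2 \<Rightarrow> real"
  by (intro square_integrable_mult L2_si)

lemma cf_add: "u \<in> L2_per L \<Longrightarrow> v \<in> L2_per L \<Longrightarrow> cf (\<lambda>x. u x + v x) k = cf u k + cf v k"
  and cf_diff: "u \<in> L2_per L \<Longrightarrow> v \<in> L2_per L \<Longrightarrow> cf (\<lambda>x. u x - v x) k = cf u k - cf v k"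
  by (simp_all add: cf_def distrib_right left_diff_distrib integrable_mult)

lemma cf_scale: "cf (\<lambda>x. c * u x) k = c * cf u k"
  by (simp add: cf_def mult.assoc)

lemma cf_sum: "(\<And>i. i \<in> I \<Longrightarrow> u i \<in> L2_per L) \<Longrightarrow> cf (\<lambda>x. \<Sum>i\<in>I. u i x) k = (\<Sum>i\<in>I. cf (u i) k)"
  unfolding cf_def sum_distrib_right
  by (rule Bochner_Integration.integral_sum) (auto intro: integrable_mult)

definition trig_sum :: "(int^2) set \<Rightarrow> (int^2 \<Rightarrow> real) \<Rightarrow> real^2 \<Rightarrow> real" where
  "trig_sum K c x = (\<Sum>k\<in>K. c k * e k x)"

lemma L2_trig_sum [simp]: "trig_sum K c \<in> L2_per L"
  unfolding trig_sum_def[abs_def] by (intro L2_sum L2_scale L2_hartley)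

lemma cf_hartley: "cf (e k) l = (if k = l then 1 else 0)"
  by (simp add: cf_def orthonormal_hartley[OF L_pos])

lemma cf_trig_sum: "finite K \<Longrightarrow> cf (trig_sum K c) k = (if k \<in> K then c k else 0)"
  unfolding trig_sum_def[abs_def] by (subst cf_sum) (auto simp: L2_scale cf_scale cf_hartley if_distrib cong: if_cong)

lemma integral_mult_trig_sum:
  assumes "u \<in> L2_per L"
  shows "(\<integral>x. u x * trig_sum K c x \<partial>\<mu>) = (\<Sum>k\<in>K. c k * cf u k)"
proof -
  have "(\<integral>x. u x * trig_sum K c x \<partial>\<mu>) = (\<integral>x. (\<Sum>k\<in>K. c k * (u x * e k x)) \<partial>\<mu>)"
    by (simp add: trig_sum_def sum_distrib_left mult.left_commute)
  also have "\<dots> = (\<Sum>k\<in>K. c k * cf u k)"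
    unfolding cf_def by (subst Bochner_Integration.integral_sum) (auto intro: integrable_mult assms)
  finally show ?thesis .
qed

lemma integral_trig_sum_diff_square:
  assumes u: "u \<in> L2_per L" and K: "finite K"
  shows "(\<integral>x. (u x - trig_sum K (cf u) x)\<^sup>2 \<partial>\<mu>) = (\<integral>x. (u x)\<^sup>2 \<partial>\<mu>) - (\<Sum>k\<in>K. (cf u k)\<^sup>2)"
proof -
  have 1: "(\<integral>x. u x * trig_sum K (cf u) x \<partial>\<mu>) = (\<Sum>k\<in>K. (cf u k)\<^sup>2)"
    by (simp add: integral_mult_trig_sum[OF u] power2_eq_square)
  have 2: "(\<integral>x. (trig_sum K (cf u) x)\<^sup>2 \<partial>\<mu>) = (\<Sum>k\<in>K. (cf u k)\<^sup>2)"
    using integral_mult_trig_sum[OF L2_trig_sum, of K "cf u" K "cf u"] K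
    by (simp add: cf_trig_sum power2_eq_square)
  show ?thesis
    using integral_square_diff_expand[OF L2_si[OF u] L2_si[OF L2_trig_sum], of 1 K "cf u"] 1 2 by simp
qed

lemma bessel:
  assumes "u \<in> L2_per L" "finite K"
  shows "(\<Sum>k\<in>K. (cf u k)\<^sup>2) \<le> (L2_norm L u)\<^sup>2"
proof -
  have "0 \<le> (\<integral>x. (u x - trig_sum K (cf u) x)\<^sup>2 \<partial>\<mu>)" by simp
  then show ?thesis using integral_trig_sum_diff_square[OF assms] by (simp add: L2_norm_square)
qed

definition fourier :: "(real^2 \<Rightarrow> real) \<Rightarrow> (int^2) ell2" where
  "fourier u = Abs_ell2 (cf u)"

lemma coord_fourier [simp]: "u \<in> L2_per L \<Longrightarrow> coord (fourier u) = cf u"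
  unfolding fourier_def using square_summableI[OF bessel] by (simp add: Abs_ell2_inverse)

lemma fourier_add: "u \<in> L2_per L \<Longrightarrow> v \<in> L2_per L \<Longrightarrow> fourier (\<lambda>x. u x + v x) = fourier u + fourier v"
  and fourier_diff: "u \<in> L2_per L \<Longrightarrow> v \<in> L2_per L \<Longrightarrow> fourier (\<lambda>x. u x - v x) = fourier u - fourier v"
  by (auto intro!: ell2_eqI simp: L2_add L2_diff cf_add cf_diff)

definition freq_box :: "nat \<Rightarrow> (int^2) set" where
  "freq_box n = {k. \<forall>i. \<bar>k $ i\<bar> \<le> int n}"

lemma finite_freq_box [simp]: "finite (freq_box n)"
proof -
  have "freq_box n \<subseteq> (\<lambda>f. vec_lambda f) ` (PiE UNIV (\<lambda>_. {- int n..int n}))"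
  proof
    fix k assume "k \<in> freq_box n"
    then show "k \<in> (\<lambda>f. vec_lambda f) ` (PiE UNIV (\<lambda>_. {- int n..int n}))"
      by (intro image_eqI[of _ _ "vec_nth k"]) (auto simp: freq_box_def abs_le_iff minus_le_iff)
  qed
  then show ?thesis by (rule finite_subset) (intro finite_imageI finite_PiE; simp)
qed

lemma freq_box_mono: "m \<le> n \<Longrightarrow> freq_box m \<subseteq> freq_box n"
  by (auto simp: freq_box_def intro: order_trans[of _ "int m"])

lemma filterlim_freq_box: "filterlim freq_box (finite_subsets_at_top UNIV) sequentially"
  unfolding filterlim_finite_subsets_at_top
proof (intro allI impI)
  fix X :: "(int^2) set" assume X: "finite X \<and> X \<subseteq> UNIV"
  define n where "n = nat (Max (insert 0 ((\<lambda>k. \<Sum>i\<in>UNIV. \<bar>k $ i\<bar>) ` X)))"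
  have "X \<subseteq> freq_box n"
  proof
    fix k assume k: "k \<in> X"
    have "\<bar>k $ i\<bar> \<le> int n" for i
    proof -
      have "\<bar>k $ i\<bar> \<le> (\<Sum>i\<in>UNIV. \<bar>k $ i\<bar>)" by (rule member_le_sum) auto
      also have "\<dots> \<le> Max (insert 0 ((\<lambda>k. \<Sum>i\<in>UNIV. \<bar>k $ i\<bar>) ` X))"
        using X k by (intro Max_ge) auto
      finally show ?thesis unfolding n_def by linarith
    qed
    then show "k \<in> freq_box n" by (simp add: freq_box_def)
  qed
  then have "X \<subseteq> freq_box m" if "m \<ge> n" for m using freq_box_mono[OF that] by blast
  then show "\<forall>\<^sub>F m in sequentially. finite (freq_box m) \<and> X \<subseteq> freq_box m \<and> freq_box m \<subseteq> UNIV"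
    unfolding eventually_sequentially by (intro exI[of _ n]) simp
qed

lemma eventually_freq_box: "\<forall>\<^sub>F n in sequentially. k \<in> freq_box n"
  using filterlim_freq_box[unfolded filterlim_finite_subsets_at_top, rule_format, of "{k}"]
  by (auto elim: eventually_mono)

lemma sum_freq_box_tendsto:
  "(\<lambda>n. \<Sum>k\<in>freq_box n. (coord a k)\<^sup>2) \<longlonglongrightarrow> (norm a)\<^sup>2"
  using filterlim_compose[OF has_sum_norm_ell2[of a, unfolded has_sum_def] filterlim_freq_box] .

text \<open>The squared distance of two partial sums over frequency boxes is the difference of the
  corresponding sums of squares, so the partial sums are Cauchy. The limit has the prescribed
  coefficients, and here Parseval's identity is part of the construction.\<close>

lemma riesz_fischer_ex:
  fixes a :: "(int^2) ell2"
  shows "\<exists>u\<in>L2_per L. cf u = coord a \<and> (L2_norm L u)\<^sup>2 = (norm a)\<^sup>2"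
proof -
  define S where "S n = trig_sum (freq_box n) (coord a)" for n
  define T where "T n = (\<Sum>k\<in>freq_box n. (coord a k)\<^sup>2)" for n
  have SL2: "S n \<in> L2_per L" for n by (simp add: S_def)
  have diff: "(\<integral>x. (S m x - S n x)\<^sup>2 \<partial>\<mu>) = T m - T n" if "n \<le> m" for m n
  proof -
    have "trig_sum (freq_box n) (cf (S m)) = S n"
      unfolding S_def using freq_box_mono[OF that]
      by (auto simp: trig_sum_def cf_trig_sum fun_eq_iff intro!: sum.cong)
    then have "(\<integral>x. (S m x - S n x)\<^sup>2 \<partial>\<mu>) = (\<integral>x. (S m x)\<^sup>2 \<partial>\<mu>) - (\<Sum>k\<in>freq_box n. (cf (S m) k)\<^sup>2)"
      using integral_trig_sum_diff_square[OF SL2, of "freq_box n" m] by simp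
    also have "(\<Sum>k\<in>freq_box n. (cf (S m) k)\<^sup>2) = T n"
      unfolding S_def T_def using freq_box_mono[OF that]
      by (intro sum.cong) (auto simp: cf_trig_sum)
    also have "(\<integral>x. (S m x)\<^sup>2 \<partial>\<mu>) = T m"
      using integral_mult_trig_sum[OF SL2, of m "freq_box m" "coord a"]
      by (simp add: S_def T_def cf_trig_sum power2_eq_square)
    finally show ?thesis .
  qed
  have T: "T \<longlonglongrightarrow> (norm a)\<^sup>2" unfolding T_def by (rule sum_freq_box_tendsto)
  have diff': "(\<integral>x. (S m x - S n x)\<^sup>2 \<partial>\<mu>) = \<bar>T m - T n\<bar>" for m n
  proof (cases "n \<le> m")
    case True
    have "0 \<le> (\<integral>x. (S m x - S n x)\<^sup>2 \<partial>\<mu>)" by simp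
    then show ?thesis using diff[OF True] by simp
  next
    case False
    have "(\<integral>x. (S m x - S n x)\<^sup>2 \<partial>\<mu>) = (\<integral>x. (S n x - S m x)\<^sup>2 \<partial>\<mu>)" by (simp add: power2_commute)
    moreover have "0 \<le> (\<integral>x. (S n x - S m x)\<^sup>2 \<partial>\<mu>)" by simp
    ultimately show ?thesis using diff[of m n] False by simp
  qed
  have "Cauchy T" using T by (rule LIMSEQ_imp_Cauchy)
  then have cauchy: "\<exists>N. \<forall>m\<ge>N. \<forall>n\<ge>N. (\<integral>x. (S m x - S n x)\<^sup>2 \<partial>\<mu>) < \<epsilon>" if "\<epsilon> > 0" for \<epsilon>
    unfolding diff' using that by (simp add: Cauchy_def dist_real_def)
  obtain r where r: "strict_mono r" "square_integrable \<mu> (\<lambda>x. lim (\<lambda>j. S (r j) x))"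
    "(\<lambda>n. \<integral>x. (S n x - lim (\<lambda>j. S (r j) x))\<^sup>2 \<partial>\<mu>) \<longlonglongrightarrow> 0"
    using cellm.square_integrable_complete[where s = S, OF L2_si[OF SL2] cauchy] by blast
  define u where "u x = lim (\<lambda>j. S (r j) x)" for x
  have "u \<in> borel_measurable borel"
    unfolding u_def[abs_def] by (rule borel_measurable_lim_metric) (use SL2 in \<open>simp add: L2_per_iff\<close>)
  moreover have "periodic L u"
    using SL2 by (simp add: u_def periodic_def L2_per_iff)
  ultimately have u: "u \<in> L2_per L" using r(2) by (simp add: L2_per_iff u_def[abs_def])
  have lim: "(\<lambda>n. \<integral>x. (S n x - u x)\<^sup>2 \<partial>\<mu>) \<longlonglongrightarrow> 0" using r(3) by (simp add: u_def)
  have cfu: "cf u k = coord a k" for k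
  proof (rule LIMSEQ_unique)
    show "(\<lambda>n. \<integral>x. S n x * e k x \<partial>\<mu>) \<longlonglongrightarrow> cf u k"
      unfolding cf_def by (rule tendsto_integral_mult[OF L2_si[OF SL2] L2_si[OF u] L2_si[OF L2_hartley] lim])
    have "\<forall>\<^sub>F n in sequentially. (\<integral>x. S n x * e k x \<partial>\<mu>) = coord a k"
      using eventually_freq_box[of k]
      by eventually_elim (simp add: S_def cf_def[symmetric] cf_trig_sum)
    then show "(\<lambda>n. \<integral>x. S n x * e k x \<partial>\<mu>) \<longlonglongrightarrow> coord a k" by (rule tendsto_eventually)
  qed
  have "(\<lambda>n. \<integral>x. (S n x - u x)\<^sup>2 \<partial>\<mu>) = (\<lambda>n. (L2_norm L u)\<^sup>2 - T n)"
  proof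
    fix n
    have "(\<integral>x. (S n x - u x)\<^sup>2 \<partial>\<mu>) = (\<integral>x. (u x - trig_sum (freq_box n) (cf u) x)\<^sup>2 \<partial>\<mu>)"
      using cfu by (simp add: S_def power2_commute trig_sum_def)
    then show "(\<integral>x. (S n x - u x)\<^sup>2 \<partial>\<mu>) = (L2_norm L u)\<^sup>2 - T n"
      using integral_trig_sum_diff_square[OF u finite_freq_box] cfu by (simp add: T_def L2_norm_square)
  qed
  then have "(\<lambda>n. (L2_norm L u)\<^sup>2 - T n) \<longlonglongrightarrow> 0" using lim by simp
  moreover have "(\<lambda>n. (L2_norm L u)\<^sup>2 - T n) \<longlonglongrightarrow> (L2_norm L u)\<^sup>2 - (norm a)\<^sup>2"
    by (intro tendsto_intros T)
  ultimately have "(L2_norm L u)\<^sup>2 - (norm a)\<^sup>2 = 0" using LIMSEQ_unique by blast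
  then show ?thesis using u cfu by (auto simp: fun_eq_iff)
qed

definition series :: "(int^2) ell2 \<Rightarrow> real^2 \<Rightarrow> real" where
  "series a = (SOME u. u \<in> L2_per L \<and> cf u = coord a)"

lemma L2_series [simp]: "series a \<in> L2_per L" and cf_series [simp]: "cf (series a) = coord a"
proof -
  have "\<exists>u. u \<in> L2_per L \<and> cf u = coord a" using riesz_fischer_ex[of a] by blast
  from someI_ex[OF this] show "series a \<in> L2_per L" "cf (series a) = coord a"
    unfolding series_def by blast+
qed

lemma AE_eq_if_cf_eq:
  assumes u: "u \<in> L2_per L" and v: "v \<in> L2_per L" and eq: "\<And>k. cf u k = cf v k"
  shows "AE x in \<mu>. u x = v x"
proof -
  have "AE x in \<mu>. u x - v x = 0"
    by (rule hartley_complete[OF L_pos L2_si[OF L2_diff[OF u v]]]) (use cf_diff[OF u v] eq in \<open>simp add: cf_def\<close>)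
  then show ?thesis by eventually_elim simp
qed

text \<open>Bessel's inequality gives only one direction. Equality comes from comparing
  \<open>u\<close> with the function built from its coefficients, whose norm is known exactly; the
  two agree almost everywhere by completeness.\<close>

lemma parseval: "u \<in> L2_per L \<Longrightarrow> L2_norm L u = norm (fourier u)"
proof -
  assume u: "u \<in> L2_per L"
  obtain w where w: "w \<in> L2_per L" "cf w = cf u" "(L2_norm L w)\<^sup>2 = (norm (fourier u))\<^sup>2"
    using riesz_fischer_ex[of "fourier u"] u by auto
  have AE: "AE x in \<mu>. u x = w x" by (rule AE_eq_if_cf_eq[OF u w(1)]) (simp add: w(2))
  have "(\<integral>x. (u x)\<^sup>2 \<partial>\<mu>) = (\<integral>x. (w x)\<^sup>2 \<partial>\<mu>)"
    by (rule integral_cong_AE)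
       (use L2_si[OF u] L2_si[OF w(1)] AE in \<open>auto simp: square_integrable_def elim: eventually_mono\<close>)
  then have "(L2_norm L u)\<^sup>2 = (norm (fourier u))\<^sup>2" using w(3) by (simp add: L2_norm_square)
  then show ?thesis using L2_norm_nonneg[of u] by (simp add: power2_eq_iff_nonneg)
qed

lemma parseval_inner:
  assumes u: "u \<in> L2_per L" and v: "v \<in> L2_per L"
  shows "(\<integral>x. u x * v x \<partial>\<mu>) = fourier u \<bullet> fourier v"
proof -
  have sq: "(\<integral>x. (u x)\<^sup>2 \<partial>\<mu>) = (norm (fourier u))\<^sup>2" if "u \<in> L2_per L" for u
    using parseval[OF that] L2_norm_square[of u] by simp
  have "(\<integral>x. (u x - (- 1) * v x)\<^sup>2 \<partial>\<mu>) =
    (\<integral>x. (u x)\<^sup>2 \<partial>\<mu>) - 2 * (- 1) * (\<integral>x. u x * v x \<partial>\<mu>) + (- 1)\<^sup>2 * (\<integral>x. (v x)\<^sup>2 \<partial>\<mu>)"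
    by (rule integral_square_diff_expand[OF L2_si[OF u] L2_si[OF v]])
  then have "(norm (fourier u + fourier v))\<^sup>2 =
      (norm (fourier u))\<^sup>2 + 2 * (\<integral>x. u x * v x \<partial>\<mu>) + (norm (fourier v))\<^sup>2"
    using sq[OF L2_add[OF u v]] sq[OF u] sq[OF v] by (simp add: fourier_add[OF u v])
  then show ?thesis by (simp add: dot_norm)
qed

lemma trig_sum_tendsto:
  assumes u: "u \<in> L2_per L"
  shows "(\<lambda>n. \<integral>x. (trig_sum (freq_box n) (cf u) x - u x)\<^sup>2 \<partial>\<mu>) \<longlonglongrightarrow> 0"
proof -
  have "(\<integral>x. (trig_sum (freq_box n) (cf u) x - u x)\<^sup>2 \<partial>\<mu>) =
      (norm (fourier u))\<^sup>2 - (\<Sum>k\<in>freq_box n. (cf u k)\<^sup>2)" for n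
    using integral_trig_sum_diff_square[OF u finite_freq_box, of n] parseval[OF u] L2_norm_square[of u]
    by (simp add: power2_commute)
  moreover have "(\<lambda>n. (norm (fourier u))\<^sup>2 - (\<Sum>k\<in>freq_box n. (cf u k)\<^sup>2)) \<longlonglongrightarrow> (norm (fourier u))\<^sup>2 - (norm (fourier u))\<^sup>2"
    using sum_freq_box_tendsto[of "fourier u"] u by (intro tendsto_intros) simp
  ultimately show ?thesis by simp
qed

lemma integral_eq_cf_0: "(\<integral>x. u x \<partial>\<mu>) = L * cf u 0"
  using L_pos by (simp add: cf_def hartley_0)

lemma L2_zero_iff: "u \<in> L2_zero L \<longleftrightarrow> u \<in> L2_per L \<and> cf u 0 = 0" for u :: "real^2 \<Rightarrow> real"
  using L_pos integral_eq_cf_0[of u] by (auto simp: L2_zero_def integral_cellm)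

end

section \<open>Test functions, weak derivatives and multipliers in Fourier variables\<close>

context torus
begin

lemma integral_mult_scale: "(\<integral>x. u x * (c * v x) \<partial>\<mu>) = c * (\<integral>x. u x * v x \<partial>\<mu>)"
  for c :: real
proof -
  have "(\<lambda>x. u x * (c * v x)) = (\<lambda>x. c * (u x * v x))" by (simp add: fun_eq_iff)
  then show ?thesis by simp
qed

lemma test_fun_differentiable: "\<phi> \<in> test_fun L \<Longrightarrow> \<phi> differentiable (at x)"
  unfolding test_fun_def by (auto dest: spec[of _ "[]"])

lemma test_fun_periodic: "\<phi> \<in> test_fun L \<Longrightarrow> periodic L \<phi>"
  by (simp add: test_fun_def)

lemma test_fun_continuous: "\<phi> \<in> test_fun L \<Longrightarrow> continuous_on S \<phi>"
  by (intro continuous_at_imp_continuous_on ballI differentiable_imp_continuous_within test_fun_differentiable)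

lemma test_fun_L2: "\<phi> \<in> test_fun L \<Longrightarrow> \<phi> \<in> L2_per L"
  by (intro L2_continuous test_fun_continuous test_fun_periodic)

lemma test_fun_pd:
  assumes \<phi>: "\<phi> \<in> test_fun L"
  shows "pd i \<phi> \<in> test_fun L"
proof -
  have "frechet_derivative \<phi> (at (x + axis j L)) = frechet_derivative \<phi> (at x)" for x j
  proof -
    define a :: "real^2" where "a = axis j L"
    have "(\<phi> has_derivative frechet_derivative \<phi> (at (x + a))) (at (x + a))"
      using test_fun_differentiable[OF \<phi>] frechet_derivative_works by blast
    moreover have "((\<lambda>y. y + a) has_derivative (\<lambda>h. h)) (at x)"
      by (auto intro!: derivative_eq_intros)
    ultimately have "((\<lambda>y. \<phi> (y + a)) has_derivative (\<lambda>h. frechet_derivative \<phi> (at (x + a)) h)) (at x)"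
      by (rule has_derivative_compose[rotated])
    moreover have "(\<lambda>y. \<phi> (y + a)) = \<phi>"
      using test_fun_periodic[OF \<phi>] by (simp add: periodic_def a_def fun_eq_iff)
    ultimately have "(\<phi> has_derivative frechet_derivative \<phi> (at (x + a))) (at x)" by simp
    from frechet_derivative_at[OF this] show ?thesis by (simp add: a_def)
  qed
  then have "periodic L (pd i \<phi>)" by (simp add: periodic_def pd_def)
  moreover have "foldr pd is (pd i \<phi>) differentiable (at x)" for "is" x
    using \<phi> unfolding test_fun_def by (auto dest: spec[of _ "is @ [i]"])
  ultimately show ?thesis by (simp add: test_fun_def)
qed

text \<open>Integration by parts; the index \<open>- k\<close> appears because differentiation sends
  the basis function of index \<open>k\<close> to that of index \<open>- k\<close>.\<close>

lemma cf_pd_test_fun: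
  assumes \<phi>: "\<phi> \<in> test_fun L"
  shows "cf (pd i \<phi>) k = - wave L k $ i * cf \<phi> (- k)"
proof -
  have c\<phi>: "continuous_on UNIV \<phi>" and cp: "continuous_on UNIV (pd i \<phi>)"
    by (intro test_fun_continuous \<phi> test_fun_pd)+
  have "(\<integral>x. pd i \<phi> x * e k x + \<phi> x * (wave L k $ i * e (- k) x) \<partial>\<mu>) = 0"
  proof (rule integral_directional_derivative[OF L_pos])
    show "continuous_on UNIV (\<lambda>x. \<phi> x * e k x)"
      "continuous_on UNIV (\<lambda>x. pd i \<phi> x * e k x + \<phi> x * (wave L k $ i * e (- k) x))"
      by (intro continuous_intros continuous_hartley c\<phi> cp)+
    show "periodic L (\<lambda>x. \<phi> x * e k x)"
      using test_fun_periodic[OF \<phi>] periodic_hartley[OF L_pos, of k] by (simp add: periodic_def)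
    fix x
    have "(\<phi> has_derivative frechet_derivative \<phi> (at x)) (at x)"
      using test_fun_differentiable[OF \<phi>] frechet_derivative_works by blast
    from DERIV_along_axis[OF this, of i]
    have 1: "((\<lambda>s. \<phi> (x + axis i s)) has_real_derivative pd i \<phi> x) (at 0)" by (simp add: pd_def)
    have 2: "((\<lambda>s. e k (x + axis i s)) has_real_derivative wave L k $ i * e (- k) x) (at 0)"
      using DERIV_along_axis[OF has_derivative_hartley, of L k x i] by (simp add: inner_axis)
    show "((\<lambda>s. \<phi> (x + axis i s) * e k (x + axis i s)) has_real_derivative
        pd i \<phi> x * e k x + \<phi> x * (wave L k $ i * e (- k) x)) (at 0)"
      using DERIV_mult[OF 1 2] by (simp add: axis_zero algebra_simps)
  qed
  moreover have "(\<integral>x. pd i \<phi> x * e k x + \<phi> x * (wave L k $ i * e (- k) x) \<partial>\<mu>) =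
      cf (pd i \<phi>) k + wave L k $ i * cf \<phi> (- k)"
  proof -
    have "integrable \<mu> (\<lambda>x. \<phi> x * (wave L k $ i * e (- k) x))"
      by (intro integrable_mult test_fun_L2[OF \<phi>] L2_scale L2_hartley)
    moreover have "integrable \<mu> (\<lambda>x. pd i \<phi> x * e k x)"
      by (intro integrable_mult test_fun_L2 test_fun_pd \<phi> L2_hartley)
    ultimately show ?thesis by (simp add: cf_def integral_mult_scale)
  qed
  ultimately show ?thesis by simp
qed

lemma infsum_reflect: "(\<Sum>\<^sub>\<infinity>k. g (- k)) = (\<Sum>\<^sub>\<infinity>k. g (k :: int^2))"
  by (rule infsum_reindex_bij_betw) (rule bij_uminus)

lemma ip_fourier: "u \<in> L2_per L \<Longrightarrow> v \<in> L2_per L \<Longrightarrow> ip L u v = (\<Sum>\<^sub>\<infinity>k. cf u k * cf v k)"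
  for u v :: "real^2 \<Rightarrow> real"
  by (simp add: ip_scalar parseval_inner inner_ell2_def)

text \<open>Basis functions are test functions, which determines the coefficients. Conversely,
  Parseval's identity reduces an arbitrary test function to its coefficients, and reflecting the
  summation index undoes the swap of \<open>k\<close> and \<open>- k\<close>.\<close>

lemma has_weak_pd_iff:
  assumes u: "u \<in> L2_per L"
  shows "has_weak_pd L i u w \<longleftrightarrow> w \<in> L2_per L \<and> (\<forall>k. cf w k = - wave L k $ i * cf u (- k))"
proof
  assume w: "has_weak_pd L i u w"
  have "cf w k = - wave L k $ i * cf u (- k)" for k
  proof -
    have "ip L w (e k) = - ip L u (pd i (e k))"
      using w test_fun_hartley[OF L_pos] unfolding has_weak_pd_def by blast
    then show ?thesis unfolding pd_hartley by (simp add: cf_ip ip_scalar integral_mult_scale)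
  qed
  then show "w \<in> L2_per L \<and> (\<forall>k. cf w k = - wave L k $ i * cf u (- k))"
    using w by (simp add: has_weak_pd_def)
next
  assume w: "w \<in> L2_per L \<and> (\<forall>k. cf w k = - wave L k $ i * cf u (- k))"
  have "ip L w \<phi> = - ip L u (pd i \<phi>)" if \<phi>: "\<phi> \<in> test_fun L" for \<phi>
  proof -
    have "ip L w \<phi> = (\<Sum>\<^sub>\<infinity>k. - (cf u (- k) * (- wave L (- k) $ i * cf \<phi> (- (- k)))))"
      using w test_fun_L2[OF \<phi>] by (simp add: ip_fourier wave_minus mult_ac)
    also have "\<dots> = (\<Sum>\<^sub>\<infinity>k. - (cf u k * (- wave L k $ i * cf \<phi> (- k))))"
      by (rule infsum_reflect)
    also have "\<dots> = - ip L u (pd i \<phi>)"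
      using u test_fun_L2[OF test_fun_pd[OF \<phi>]] by (simp add: ip_fourier cf_pd_test_fun[OF \<phi>] Infinite_Sum.infsum_uminus)
    finally show ?thesis .
  qed
  then show "has_weak_pd L i u w" using w by (simp add: has_weak_pd_def)
qed

text \<open>The choice behind \<open>weak_pd\<close> is meaningful once the expected coefficients
  are square summable; the element \<open>b\<close> certifies this.\<close>

lemma weak_pd:
  assumes u: "u \<in> L2_per L" and b: "\<And>k. coord b k = - wave L k $ i * cf u (- k)"
  shows "weak_pd L i u \<in> L2_per L" "cf (weak_pd L i u) k = - wave L k $ i * cf u (- k)"
proof -
  have "has_weak_pd L i u (series b)" using b by (simp add: has_weak_pd_iff[OF u])
  then have "\<exists>w. has_weak_pd L i u w" by blast
  then have "has_weak_pd L i u (weak_pd L i u)" unfolding weak_pd_def by (rule someI_ex)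
  then show "weak_pd L i u \<in> L2_per L" "cf (weak_pd L i u) k = - wave L k $ i * cf u (- k)"
    by (simp_all add: has_weak_pd_iff[OF u])
qed

text \<open>The even part of the Hartley coefficients is the cosine transform and gives the real
  part; the odd part is the sine transform and gives the imaginary part.\<close>

lemma fourier_coeff_cf:
  assumes u: "u \<in> L2_per L"
  shows "fourier_coeff L u k = Complex ((cf u k + cf u (- k)) / (2 * L)) (- (cf u k - cf u (- k)) / (2 * L))"
proof -
  define C where "C = (\<integral>x. u x * cos (wave L k \<bullet> x) \<partial>\<mu>)"
  define S where "S = (\<integral>x. u x * sin (wave L k \<bullet> x) \<partial>\<mu>)"
  have "(\<lambda>x. cos (wave L k \<bullet> x)) \<in> L2_per L" "(\<lambda>x. sin (wave L k \<bullet> x)) \<in> L2_per L"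
    by (intro L2_continuous continuous_intros; simp add: periodic_def cos_wave_periodic sin_wave_periodic L_pos)+
  then have ic: "integrable \<mu> (\<lambda>x. u x * cos (wave L k \<bullet> x))" and int_s: "integrable \<mu> (\<lambda>x. u x * sin (wave L k \<bullet> x))"
    using u by (auto intro: integrable_mult)
  have cf1: "cf u k = (C + S) / L"
    using ic int_s by (simp add: cf_def hartley_def C_def S_def distrib_left)
  have cf2: "cf u (- k) = (C - S) / L"
    using ic int_s by (simp add: cf_def hartley_def C_def S_def wave_minus right_diff_distrib)
  have eq: "complex_of_real (u x) * cis (- (wave L k \<bullet> x)) =
      complex_of_real (u x * cos (wave L k \<bullet> x)) - \<i> * complex_of_real (u x * sin (wave L k \<bullet> x))" for x
    by (simp add: complex_eq_iff)
  have split: "(\<integral>x. complex_of_real (f x) - \<i> * complex_of_real (g x) \<partial>\<mu>) =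
      complex_of_real (\<integral>x. f x \<partial>\<mu>) - \<i> * complex_of_real (\<integral>x. g x \<partial>\<mu>)"
    if "integrable \<mu> f" "integrable \<mu> g" for f g
    using that by simp
  have "(LINT x:cell L|lborel. complex_of_real (u x) * cis (- (wave L k \<bullet> x))) =
      complex_of_real C - \<i> * complex_of_real S"
    unfolding integral_cellm[symmetric] eq C_def S_def by (rule split[OF ic int_s])
  then have "fourier_coeff L u k = (complex_of_real C - \<i> * complex_of_real S) / complex_of_real (L\<^sup>2)"
    by (simp add: fourier_coeff_def)
  also have "\<dots> = Complex (C / L\<^sup>2) (- S / L\<^sup>2)"
    by (simp only: complex_eq_iff Re_divide_of_real Im_divide_of_real) simp
  also have "C / L\<^sup>2 = (cf u k + cf u (- k)) / (2 * L)"
    unfolding cf1 cf2 using L_pos by (simp add: field_simps power2_eq_square)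
  also have "- S / L\<^sup>2 = - (cf u k - cf u (- k)) / (2 * L)"
    unfolding cf1 cf2 using L_pos by (simp add: field_simps power2_eq_square)
  finally show ?thesis .
qed

text \<open>An even real symbol treats \<open>k\<close> and \<open>- k\<close> alike, so it commutes
  with the passage from complex to Hartley coefficients and is diagonal there too. Boundedness lets
  Riesz-Fischer provide the function.\<close>

lemma multiplier:
  assumes u: "u \<in> L2_zero L" and B: "\<And>w. \<bar>m w\<bar> \<le> B" and even: "\<And>w. m (- w) = m w"
  shows "multiplier L m u \<in> L2_zero L" "cf (multiplier L m u) k = m (wave L k) * cf u k"
proof -
  have u2: "u \<in> L2_per L" "cf u 0 = 0" using u by (auto simp: L2_zero_iff)
  define P where "P w \<longleftrightarrow> w \<in> L2_zero L \<and>
     (\<forall>k. fourier_coeff L w k = complex_of_real (m (wave L k)) * fourier_coeff L u k)" for w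
  define w where "w = series (diag (\<lambda>k. m (wave L k)) (fourier u))"
  have w2: "w \<in> L2_per L" by (simp add: w_def)
  have cw: "cf w k = m (wave L k) * cf u k" for k
    unfolding w_def using B u2 by (simp add: coord_diag[of _ B])
  have "P w"
    unfolding P_def
  proof (intro conjI allI)
    show "w \<in> L2_zero L" using w2 cw u2 by (simp add: L2_zero_iff)
    show "fourier_coeff L w k = complex_of_real (m (wave L k)) * fourier_coeff L u k" for k
      unfolding fourier_coeff_cf[OF w2] fourier_coeff_cf[OF u2(1)] cw wave_minus even
      by (simp add: complex_eq_iff algebra_simps diff_divide_distrib add_divide_distrib)
  qed
  then have "\<exists>w. P w" by blast
  then have P: "P (multiplier L m u)" unfolding multiplier_def P_def by (rule someI_ex)
  then show z: "multiplier L m u \<in> L2_zero L" by (simp add: P_def)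
  then have m2: "multiplier L m u \<in> L2_per L" by (simp add: L2_zero_iff)
  have "fourier_coeff L (multiplier L m u) k = complex_of_real (m (wave L k)) * fourier_coeff L u k"
    using P by (simp add: P_def)
  then have "cf (multiplier L m u) k + cf (multiplier L m u) (- k) = m (wave L k) * (cf u k + cf u (- k))"
    "cf (multiplier L m u) k - cf (multiplier L m u) (- k) = m (wave L k) * (cf u k - cf u (- k))"
    unfolding fourier_coeff_cf[OF m2] fourier_coeff_cf[OF u2(1)] using L_pos
    by (simp_all add: complex_eq_iff field_simps)
  then show "cf (multiplier L m u) k = m (wave L k) * cf u k"
    by (simp add: algebra_simps)
qed

section \<open>Vector fields\<close>

lemma vec_measurable_iff:
  fixes v :: "'a \<Rightarrow> real^2"
  shows "v \<in> borel_measurable M \<longleftrightarrow> (\<forall>i. (\<lambda>x. v x $ i) \<in> borel_measurable M)"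
proof -
  have "v \<in> borel_measurable M \<longleftrightarrow> (\<forall>b\<in>Basis. (\<lambda>x. v x \<bullet> b) \<in> borel_measurable M)"
    by (rule borel_measurable_euclidean_space)
  also have "\<dots> \<longleftrightarrow> (\<forall>i. (\<lambda>x. v x $ i) \<in> borel_measurable M)"
    by (auto simp: Basis_vec_def inner_axis)
  finally show ?thesis .
qed

lemma norm_vec_square: "(norm v)\<^sup>2 = (v $ 1)\<^sup>2 + (v $ 2)\<^sup>2" for v :: "real^2"
  by (simp only: power2_norm_eq_inner inner_vec_def) (simp add: UNIV_2 power2_eq_square)

lemma L2_vec_iff: "v \<in> L2_per L \<longleftrightarrow> (\<forall>i. (\<lambda>x. v x $ i) \<in> L2_per L)" for v :: "real^2 \<Rightarrow> real^2"
proof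
  assume v: "v \<in> L2_per L"
  then have m: "v \<in> borel_measurable borel" and i: "integrable \<mu> (\<lambda>x. (norm (v x))\<^sup>2)" and p: "periodic L v"
    by (auto simp: L2_per_def integrable_cellm)
  show "\<forall>i. (\<lambda>x. v x $ i) \<in> L2_per L"
  proof
    fix j
    have mj: "(\<lambda>x. v x $ j) \<in> borel_measurable borel" using m vec_measurable_iff by blast
    have "integrable \<mu> (\<lambda>x. (v x $ j)\<^sup>2)"
    proof (rule Bochner_Integration.integrable_bound[OF i])
      show "(\<lambda>x. (v x $ j)\<^sup>2) \<in> borel_measurable \<mu>" using borel_measurable_cellm[OF mj] by simp
      have "(v x $ j)\<^sup>2 \<le> (norm (v x))\<^sup>2" for x
        using component_le_norm_cart[of "v x" j] by (simp add: abs_le_square_iff[symmetric])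
      then show "AE x in \<mu>. norm ((v x $ j)\<^sup>2) \<le> norm ((norm (v x))\<^sup>2)" by simp
    qed
    then show "(\<lambda>x. v x $ j) \<in> L2_per L"
      using mj p borel_measurable_cellm[OF mj] by (simp add: L2_per_iff square_integrable_def periodic_def)
  qed
next
  assume v: "\<forall>i. (\<lambda>x. v x $ i) \<in> L2_per L"
  then have "v \<in> borel_measurable borel" by (simp add: vec_measurable_iff L2_per_iff)
  moreover have "periodic L v" using v by (simp add: L2_per_iff periodic_def vec_eq_iff)
  moreover have "integrable \<mu> (\<lambda>x. (norm (v x))\<^sup>2)"
    unfolding norm_vec_square using v by (simp add: L2_per_iff square_integrable_def)
  ultimately show "v \<in> L2_per L" by (simp add: L2_per_def integrable_cellm)
qed

lemma ip_vec:
  fixes v w :: "real^2 \<Rightarrow> real^2"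
  assumes "\<And>i. (\<lambda>x. v x $ i) \<in> L2_per L" "\<And>i. (\<lambda>x. w x $ i) \<in> L2_per L"
  shows "ip L v w = ip L (\<lambda>x. v x $ 1) (\<lambda>x. w x $ 1) + ip L (\<lambda>x. v x $ 2) (\<lambda>x. w x $ 2)"
  unfolding ip_scalar
  using integrable_mult[OF assms(1)[of 1] assms(2)[of 1]] integrable_mult[OF assms(1)[of 2] assms(2)[of 2]]
  by (simp add: ip_def integral_cellm[symmetric] inner_vec_def UNIV_2)

lemma L2_norm_vec:
  fixes v :: "real^2 \<Rightarrow> real^2"
  assumes "\<And>i. (\<lambda>x. v x $ i) \<in> L2_per L"
  shows "(L2_norm L v)\<^sup>2 = (L2_norm L (\<lambda>x. v x $ 1))\<^sup>2 + (L2_norm L (\<lambda>x. v x $ 2))\<^sup>2"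
proof -
  have "(L2_norm L v)\<^sup>2 = (\<integral>x. (v x $ 1)\<^sup>2 + (v x $ 2)\<^sup>2 \<partial>\<mu>)"
    unfolding L2_norm_def integral_cellm[symmetric] norm_vec_square by simp
  then show ?thesis
    unfolding L2_norm_square using assms by (simp add: L2_per_iff square_integrable_def)
qed

lemma L2_zero_vec_iff: "v \<in> L2_zero L \<longleftrightarrow> (\<forall>i. (\<lambda>x. v x $ i) \<in> L2_zero L)" for v :: "real^2 \<Rightarrow> real^2"
proof -
  have "(LINT x:cell L|lborel. v x) = 0 \<longleftrightarrow> (\<forall>i. (LINT x:cell L|lborel. v x $ i) = 0)" if v: "v \<in> L2_per L"
  proof -
    have i: "integrable \<mu> (\<lambda>x. v x $ j)" for j
      using v L2_si cellm.integrable_if_square_integrable by (simp add: L2_vec_iff)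
    have "v = (\<lambda>x. v x $ 1 *\<^sub>R axis 1 1 + v x $ 2 *\<^sub>R axis 2 1)"
      by (simp add: fun_eq_iff vec_eq_iff forall_2 axis_def)
    moreover have "integrable \<mu> (\<lambda>x. v x $ 1 *\<^sub>R (axis 1 1 :: real^2) + v x $ 2 *\<^sub>R axis 2 1)"
      by (intro Bochner_Integration.integrable_add integrable_scaleR_left i)
    ultimately have "integrable \<mu> v" by simp
    then have "integral\<^sup>L \<mu> v $ j = (\<integral>x. v x $ j \<partial>\<mu>)" for j
      using integral_bounded_linear[OF bounded_linear_vec_nth] by metis
    then show ?thesis by (simp add: integral_cellm[symmetric] vec_eq_iff)
  qed
  then show ?thesis by (auto simp: L2_zero_def L2_vec_iff)
qed

text \<open>The unit vector orthogonal to the wave vector, along which the coefficient of a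
  divergence-free field must point. Division by zero makes it vanish at \<open>k = 0\<close>, in
  accordance with the zero mean.\<close>

definition dir :: "int^2 \<Rightarrow> 2 \<Rightarrow> real" where
  "dir k i = (if i = 1 then - wave L k $ 2 else wave L k $ 1) / norm (wave L k)"

lemma wave_eq_zero_iff: "wave L k = 0 \<longleftrightarrow> k = 0"
  using wave_eq_0_iff[OF L_pos, of k] by (simp add: vec_eq_iff)

lemma dir_zero: "dir 0 i = 0"
  by (simp add: dir_def wave_zero)

lemma dir_orthogonal: "wave L k $ 1 * dir k 1 + wave L k $ 2 * dir k 2 = 0"
  by (simp add: dir_def)

lemma dir_unit: "k \<noteq> 0 \<Longrightarrow> (dir k 1)\<^sup>2 + (dir k 2)\<^sup>2 = 1"
proof -
  assume "k \<noteq> 0"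
  then have "(norm (wave L k))\<^sup>2 \<noteq> 0" by (simp add: wave_eq_zero_iff)
  then show ?thesis
    by (simp add: dir_def power_divide flip: add_divide_distrib) (simp add: norm_vec_square)
qed

lemma abs_dir_le: "\<bar>dir k i\<bar> \<le> 1"
proof (cases "k = 0")
  case False
  have "(dir k i)\<^sup>2 \<le> (dir k 1)\<^sup>2 + (dir k 2)\<^sup>2" using exhaust_2[of i] by auto
  then show ?thesis using dir_unit[OF False] by (simp add: abs_square_le_1)
qed (simp add: dir_zero)

lemma dir_coefficient:
  assumes "wave L k $ 1 * a 1 + wave L k $ 2 * a 2 = 0" "k = 0 \<Longrightarrow> a i = 0"
  shows "a i = dir k i * (dir k 1 * a 1 + dir k 2 * a 2)"
proof (cases "k = 0")
  case False
  define w where "w = wave L k"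
  have n: "norm w \<noteq> 0" using False by (simp add: w_def wave_eq_zero_iff)
  have n2: "(norm w)\<^sup>2 = (w $ 1)\<^sup>2 + (w $ 2)\<^sup>2" by (rule norm_vec_square)
  have o: "w $ 1 * a 1 = - w $ 2 * a 2" using assms(1) by (simp add: w_def)
  have s: "dir k 1 * a 1 + dir k 2 * a 2 = (w $ 1 * a 2 - w $ 2 * a 1) / norm w"
    by (simp add: dir_def w_def[symmetric] diff_divide_distrib)
  consider "i = 1" | "i = 2" using exhaust_2 by blast
  then show ?thesis
  proof cases
    case 1
    have "- (w $ 2) * (w $ 1 * a 2 - w $ 2 * a 1) = w $ 1 * (- w $ 2 * a 2) + (w $ 2)\<^sup>2 * a 1"
      by (simp add: algebra_simps power2_eq_square)
    also have "\<dots> = (norm w)\<^sup>2 * a 1" unfolding o[symmetric] n2 by (simp add: algebra_simps power2_eq_square)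
    finally have "- (w $ 2) * (w $ 1 * a 2 - w $ 2 * a 1) / (norm w)\<^sup>2 = a 1" using n by simp
    then show ?thesis unfolding s using 1 by (simp add: dir_def w_def[symmetric] power2_eq_square)
  next
    case 2
    have "w $ 1 * (w $ 1 * a 2 - w $ 2 * a 1) = (w $ 1)\<^sup>2 * a 2 - w $ 2 * (w $ 1 * a 1)"
      by (simp add: algebra_simps power2_eq_square)
    also have "\<dots> = (norm w)\<^sup>2 * a 2" unfolding o n2 by (simp add: algebra_simps power2_eq_square)
    finally have "w $ 1 * (w $ 1 * a 2 - w $ 2 * a 1) / (norm w)\<^sup>2 = a 2" using n by simp
    then show ?thesis unfolding s using 2 by (simp add: dir_def w_def[symmetric] power2_eq_square)
  qed
qed (use assms in \<open>simp add: dir_zero\<close>)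

definition vfourier :: "(real^2 \<Rightarrow> real^2) \<Rightarrow> (int^2) ell2" where
  "vfourier v = diag (\<lambda>k. dir k 1) (fourier (\<lambda>x. v x $ 1)) + diag (\<lambda>k. dir k 2) (fourier (\<lambda>x. v x $ 2))"

definition zc :: "(real^2 \<Rightarrow> real^2) \<Rightarrow> int^2 \<Rightarrow> real" where
  "zc v k = dir k 1 * cf (\<lambda>x. v x $ 1) k + dir k 2 * cf (\<lambda>x. v x $ 2) k"

lemma coord_vfourier: "v \<in> L2_per L \<Longrightarrow> coord (vfourier v) k = zc v k"
  by (simp add: vfourier_def zc_def coord_diag[of _ 1] abs_dir_le L2_vec_iff)

text \<open>Testing with the gradient of the basis function of index \<open>- k\<close> isolates the
  divergence of the coefficient with index \<open>k\<close>; the converse sums these conditions by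
  Parseval's identity.\<close>

lemma H_div_iff:
  "v \<in> H_div L \<longleftrightarrow> (\<forall>i. (\<lambda>x. v x $ i) \<in> L2_zero L) \<and>
    (\<forall>k. wave L k $ 1 * cf (\<lambda>x. v x $ 1) k + wave L k $ 2 * cf (\<lambda>x. v x $ 2) k = 0)"
proof -
  have grad: "ip L v (\<lambda>x. \<chi> i. pd i \<phi> x) = - (\<Sum>\<^sub>\<infinity>k.
      (wave L k $ 1 * cf (\<lambda>x. v x $ 1) k + wave L k $ 2 * cf (\<lambda>x. v x $ 2) k) * cf \<phi> (- k))"
    if v: "\<And>i. (\<lambda>x. v x $ i) \<in> L2_per L" and \<phi>: "\<phi> \<in> test_fun L" for \<phi>
  proof -
    have p: "pd i \<phi> \<in> L2_per L" for i by (intro test_fun_L2 test_fun_pd \<phi>)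
    have sm: "(\<lambda>k. cf (\<lambda>x. v x $ i) k * cf (pd i \<phi>) k) summable_on UNIV" for i
      using summable_on_mult_square_summable[OF square_summable_coord[of "fourier (\<lambda>x. v x $ i)"]
          square_summable_coord[of "fourier (pd i \<phi>)"]] v p by simp
    have "ip L v (\<lambda>x. \<chi> i. pd i \<phi> x) = ip L (\<lambda>x. v x $ 1) (pd 1 \<phi>) + ip L (\<lambda>x. v x $ 2) (pd 2 \<phi>)"
      using ip_vec[of v "\<lambda>x. \<chi> i. pd i \<phi> x"] v p by simp
    also have "\<dots> = (\<Sum>\<^sub>\<infinity>k. cf (\<lambda>x. v x $ 1) k * cf (pd 1 \<phi>) k + cf (\<lambda>x. v x $ 2) k * cf (pd 2 \<phi>) k)"
      using v p sm by (simp add: ip_fourier infsum_add)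
    also have "\<dots> = (\<Sum>\<^sub>\<infinity>k. - ((wave L k $ 1 * cf (\<lambda>x. v x $ 1) k + wave L k $ 2 * cf (\<lambda>x. v x $ 2) k) * cf \<phi> (- k)))"
      by (rule infsum_cong) (simp add: cf_pd_test_fun[OF \<phi>] algebra_simps)
    finally show ?thesis by (simp add: Infinite_Sum.infsum_uminus)
  qed
  show ?thesis
  proof
    assume v: "v \<in> H_div L"
    then have vz: "\<forall>i. (\<lambda>x. v x $ i) \<in> L2_zero L" by (simp add: H_div_def L2_zero_vec_iff)
    then have v2: "(\<lambda>x. v x $ i) \<in> L2_per L" for i by (simp add: L2_zero_iff)
    have "wave L k $ 1 * cf (\<lambda>x. v x $ 1) k + wave L k $ 2 * cf (\<lambda>x. v x $ 2) k = 0" for k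
    proof -
      have "0 = ip L v (\<lambda>x. \<chi> i. pd i (e (- k)) x)"
        using v test_fun_hartley[OF L_pos] by (simp add: H_div_def)
      also have "\<dots> = ip L (\<lambda>x. v x $ 1) (pd 1 (e (- k))) + ip L (\<lambda>x. v x $ 2) (pd 2 (e (- k)))"
        using ip_vec[of v "\<lambda>x. \<chi> i. pd i (e (- k)) x"] v2 by (simp add: pd_hartley L2_scale)
      also have "\<dots> = - (wave L k $ 1 * cf (\<lambda>x. v x $ 1) k + wave L k $ 2 * cf (\<lambda>x. v x $ 2) k)"
        by (simp add: pd_hartley ip_scalar wave_minus cf_def integral_mult_scale)
      finally show ?thesis by simp
    qed
    then show "(\<forall>i. (\<lambda>x. v x $ i) \<in> L2_zero L) \<and>
      (\<forall>k. wave L k $ 1 * cf (\<lambda>x. v x $ 1) k + wave L k $ 2 * cf (\<lambda>x. v x $ 2) k = 0)"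
      using vz by blast
  next
    assume v: "(\<forall>i. (\<lambda>x. v x $ i) \<in> L2_zero L) \<and>
      (\<forall>k. wave L k $ 1 * cf (\<lambda>x. v x $ 1) k + wave L k $ 2 * cf (\<lambda>x. v x $ 2) k = 0)"
    then have v2: "(\<lambda>x. v x $ i) \<in> L2_per L" for i by (simp add: L2_zero_iff)
    show "v \<in> H_div L"
      using v grad[OF v2] by (simp add: H_div_def L2_zero_vec_iff)
  qed
qed

lemma H_div_components:
  assumes "v \<in> H_div L"
  shows "(\<lambda>x. v x $ i) \<in> L2_zero L" "(\<lambda>x. v x $ i) \<in> L2_per L" "v \<in> L2_per L"
    "cf (\<lambda>x. v x $ i) k = dir k i * zc v k"
proof -
  show 1: "(\<lambda>x. v x $ i) \<in> L2_zero L" for i using assms by (simp add: H_div_iff)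
  then show 2: "(\<lambda>x. v x $ i) \<in> L2_per L" for i by (simp add: L2_zero_iff)
  then show "v \<in> L2_per L" by (simp add: L2_vec_iff)
  show "cf (\<lambda>x. v x $ i) k = dir k i * zc v k"
    unfolding zc_def using dir_coefficient[of k "\<lambda>i. cf (\<lambda>x. v x $ i) k" i] assms 1
    by (auto simp: H_div_iff L2_zero_iff)
qed

definition vseries :: "(int^2) ell2 \<Rightarrow> real^2 \<Rightarrow> real^2" where
  "vseries z x = (\<chi> i. series (diag (\<lambda>k. dir k i) z) x)"

lemma cf_vseries: "cf (\<lambda>x. vseries z x $ i) k = dir k i * coord z k"
  by (simp add: vseries_def coord_diag[of _ 1] abs_dir_le)

lemma vseries_H_div: "vseries z \<in> H_div L"
proof -
  have "(\<lambda>x. vseries z x $ i) \<in> L2_zero L" for i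
    unfolding L2_zero_iff cf_vseries dir_zero by (simp add: vseries_def)
  moreover have "wave L k $ 1 * (dir k 1 * c) + wave L k $ 2 * (dir k 2 * c) = 0" for k c
    using dir_orthogonal[of k] by (simp add: mult.assoc[symmetric] flip: distrib_right)
  ultimately show ?thesis unfolding H_div_iff cf_vseries by simp
qed

lemma zc_vseries: "k \<noteq> 0 \<Longrightarrow> zc (vseries z) k = coord z k"
  unfolding zc_def cf_vseries using dir_unit[of k]
  by (simp add: mult.assoc[symmetric] power2_eq_square flip: distrib_right)

lemma zc_0: "zc v 0 = 0"
  by (simp add: zc_def dir_zero)

lemma zc_diff:
  "v \<in> L2_per L \<Longrightarrow> w \<in> L2_per L \<Longrightarrow> zc (\<lambda>x. v x - w x) k = zc v k - zc w k"
  by (simp add: zc_def L2_vec_iff cf_diff algebra_simps)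

lemma ip_H_div:
  assumes q: "q \<in> L2_per L" and w: "w \<in> H_div L"
  shows "ip L q w = (\<Sum>\<^sub>\<infinity>k. zc q k * zc w k)"
proof -
  note q' = q[unfolded L2_vec_iff, rule_format] and w' = H_div_components[OF w]
  have sm: "(\<lambda>k. cf (\<lambda>x. q x $ i) k * cf (\<lambda>x. w x $ i) k) summable_on UNIV" for i
    using summable_on_mult_square_summable[OF square_summable_coord[of "fourier (\<lambda>x. q x $ i)"]
        square_summable_coord[of "fourier (\<lambda>x. w x $ i)"]] q' w' by simp
  have "ip L q w = (\<Sum>\<^sub>\<infinity>k. cf (\<lambda>x. q x $ 1) k * cf (\<lambda>x. w x $ 1) k + cf (\<lambda>x. q x $ 2) k * cf (\<lambda>x. w x $ 2) k)"
    unfolding ip_vec[OF q' w'(2)] using q' w' sm by (simp add: ip_fourier infsum_add)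
  also have "\<dots> = (\<Sum>\<^sub>\<infinity>k. zc q k * zc w k)"
    by (rule infsum_cong) (simp add: w'(4) zc_def[of q] algebra_simps)
  finally show ?thesis .
qed

text \<open>In coordinates the projection keeps the component along \<open>dir\<close> and discards
  the rest, since \<open>ip_H_div\<close> shows that divergence-free fields see only that
  component.\<close>

lemma leray:
  assumes q: "q \<in> L2_per L"
  shows "leray L q \<in> H_div L" "zc (leray L q) k = zc q k"
proof -
  define P where "P u \<longleftrightarrow> u \<in> H_div L \<and> (\<forall>w\<in>H_div L. ip L (\<lambda>x. q x - u x) w = 0)" for u
  define u where "u = vseries (vfourier q)"
  have u: "u \<in> H_div L" unfolding u_def by (rule vseries_H_div)
  note u2 = H_div_components(3)[OF u]
  have zu: "zc u k = zc q k" for k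
    unfolding u_def using zc_vseries[of k "vfourier q"] by (cases "k = 0") (auto simp: zc_0 coord_vfourier q)
  have diffL2: "(\<lambda>x. q x - u x) \<in> L2_per L" if "u \<in> L2_per L" for u
    using q that by (simp add: L2_vec_iff L2_diff)
  have "P u"
    unfolding P_def using u by (simp add: ip_H_div diffL2 u2 zc_diff q zu)
  then have "\<exists>u. P u" by blast
  then have P: "P (leray L q)" unfolding leray_def P_def by (rule someI_ex)
  then show l: "leray L q \<in> H_div L" by (simp add: P_def)
  note l2 = H_div_components(3)[OF l]
  \<comment> \<open>Testing the residual against its own divergence-free part turns orthogonality
    into a vanishing sum of squares.\<close>
  define w where "w = vseries (vfourier (\<lambda>x. q x - leray L q x))"
  have w: "w \<in> H_div L" unfolding w_def by (rule vseries_H_div)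
  have zw: "zc w k = zc q k - zc (leray L q) k" for k
    unfolding w_def using zc_vseries[of k "vfourier (\<lambda>x. q x - leray L q x)"]
    by (cases "k = 0") (auto simp: zc_0 coord_vfourier diffL2[OF l2] zc_diff[OF q l2])
  have "0 = (\<Sum>\<^sub>\<infinity>k. zc (\<lambda>x. q x - leray L q x) k * zc w k)"
    using P w by (simp add: P_def ip_H_div diffL2[OF l2])
  also have "\<dots> = (\<Sum>\<^sub>\<infinity>k. (coord (vfourier (\<lambda>x. q x - leray L q x)) k)\<^sup>2)"
    by (rule infsum_cong) (simp add: zw zc_diff[OF q l2] coord_vfourier diffL2[OF l2] power2_eq_square)
  finally have "vfourier (\<lambda>x. q x - leray L q x) = 0"
    by (simp add: norm_ell2_square[symmetric])
  then have "zc (\<lambda>x. q x - leray L q x) k = 0"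
    using coord_vfourier[OF diffL2[OF l2], of k] by simp
  then show "zc (leray L q) k = zc q k" by (simp add: zc_diff[OF q l2])
qed

end

section \<open>Derivatives of products of smoothed functions\<close>

text \<open>Square summability of \<open>\<sigma>\<close> yields a sup bound by the Cauchy-Schwarz
  inequality, with constant \<open>\<Sigma>\<close>; boundedness of
  \<open>wave L k $ i * \<sigma> k\<close> yields one derivative in \<open>L^2\<close>. Together
  they bound the gradient of a product of two smoothed functions.\<close>

locale smoothing = torus +
  fixes \<sigma> :: "int^2 \<Rightarrow> real" and C1 :: real
  assumes \<sigma>_summable: "square_summable \<sigma>"
    and \<sigma>_gain: "\<bar>wave L k $ i * \<sigma> k\<bar> \<le> C1"
begin

definition \<Sigma> :: real where "\<Sigma> = 2 / L * sqrt (\<Sum>\<^sub>\<infinity>k. (\<sigma> k)\<^sup>2)"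

lemma \<Sigma>_nonneg: "\<Sigma> \<ge> 0"
  unfolding \<Sigma>_def using L_pos by (intro mult_nonneg_nonneg real_sqrt_ge_zero infsum_nonneg) auto

lemma C1_nonneg: "C1 \<ge> 0"
  using \<sigma>_gain[of 0 1] by (simp add: wave_zero)

lemma trig_sum_smooth_bound:
  assumes w: "\<And>k. cf w k = \<sigma> k * coord a k"
  shows "\<bar>trig_sum (freq_box n) (cf w) x\<bar> \<le> \<Sigma> * norm a"
proof -
  have "\<bar>trig_sum (freq_box n) (cf w) x\<bar> \<le> (\<Sum>k\<in>freq_box n. \<bar>cf w k * e k x\<bar>)"
    unfolding trig_sum_def by (rule sum_abs)
  also have "\<dots> \<le> (\<Sum>k\<in>freq_box n. 2 / L * (\<bar>\<sigma> k\<bar> * \<bar>coord a k\<bar>))"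
  proof (rule sum_mono)
    fix k
    have "\<bar>cf w k * e k x\<bar> = (\<bar>\<sigma> k\<bar> * \<bar>coord a k\<bar>) * \<bar>e k x\<bar>" by (simp add: w abs_mult)
    also have "\<dots> \<le> (\<bar>\<sigma> k\<bar> * \<bar>coord a k\<bar>) * (2 / L)"
      by (intro mult_left_mono abs_hartley_le L_pos) auto
    finally show "\<bar>cf w k * e k x\<bar> \<le> 2 / L * (\<bar>\<sigma> k\<bar> * \<bar>coord a k\<bar>)" by (simp add: mult.commute)
  qed
  also have "\<dots> = 2 / L * (\<Sum>k\<in>freq_box n. \<bar>\<sigma> k\<bar> * \<bar>coord a k\<bar>)" by (simp add: sum_distrib_left)
  also have "(\<Sum>k\<in>freq_box n. \<bar>\<sigma> k\<bar> * \<bar>coord a k\<bar>) \<le> sqrt (\<Sum>\<^sub>\<infinity>k. (\<sigma> k)\<^sup>2) * norm a"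
  proof -
    have "(\<Sum>k\<in>freq_box n. \<bar>\<sigma> k\<bar> * \<bar>coord a k\<bar>)\<^sup>2 \<le>
        (\<Sum>k\<in>freq_box n. \<bar>\<sigma> k\<bar>\<^sup>2) * (\<Sum>k\<in>freq_box n. \<bar>coord a k\<bar>\<^sup>2)"
      by (rule Cauchy_Schwarz_ineq_sum)
    also have "\<dots> \<le> (\<Sum>\<^sub>\<infinity>k. (\<sigma> k)\<^sup>2) * (norm a)\<^sup>2"
      using sum_le_infsum_squares[OF \<sigma>_summable finite_freq_box] sum_squares_le_norm[OF finite_freq_box]
      by (intro mult_mono) (auto intro: sum_nonneg infsum_nonneg)
    finally have "sqrt ((\<Sum>k\<in>freq_box n. \<bar>\<sigma> k\<bar> * \<bar>coord a k\<bar>)\<^sup>2) \<le> sqrt ((\<Sum>\<^sub>\<infinity>k. (\<sigma> k)\<^sup>2) * (norm a)\<^sup>2)"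
      by (rule real_sqrt_le_mono)
    then show ?thesis by (simp add: real_sqrt_mult sum_nonneg)
  qed
  finally show ?thesis using L_pos by (simp add: \<Sigma>_def mult.assoc mult_left_mono divide_right_mono)
qed

text \<open>The partial sums are bounded by \<open>B\<close> everywhere and converge in
  \<open>L^2\<close>. The excess of the modulus of \<open>w\<close> over \<open>B\<close> is
  dominated pointwise by the distance to each partial sum, so its norm is zero.\<close>

lemma smooth_AE_bounded:
  assumes w2: "w \<in> L2_per L" and w: "\<And>k. cf w k = \<sigma> k * coord a k"
  shows "AE x in \<mu>. \<bar>w x\<bar> \<le> \<Sigma> * norm a"
proof -
  define B where "B = \<Sigma> * norm a"
  have B: "B \<ge> 0" by (simp add: B_def \<Sigma>_nonneg)
  define S where "S n = trig_sum (freq_box n) (cf w)" for n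
  define f where "f x = max (\<bar>w x\<bar> - B) 0" for x
  have wm: "w \<in> borel_measurable \<mu>" and iw: "integrable \<mu> (\<lambda>x. (w x)\<^sup>2)"
    using L2_si[OF w2] by (auto simp: square_integrable_def)
  have fm: "f \<in> borel_measurable \<mu>"
    unfolding f_def[abs_def] using wm by (intro borel_measurable_max borel_measurable_diff borel_measurable_abs) auto
  have sf: "square_integrable \<mu> f"
    unfolding square_integrable_def
  proof
    show "integrable \<mu> (\<lambda>x. (f x)\<^sup>2)"
    proof (rule Bochner_Integration.integrable_bound[OF iw])
      have "(f x)\<^sup>2 \<le> (w x)\<^sup>2" for x
        using B by (simp add: abs_le_square_iff[symmetric] f_def)
      then show "AE x in \<mu>. norm ((f x)\<^sup>2) \<le> norm ((w x)\<^sup>2)" by simp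
    qed (use fm in simp)
  qed (rule fm)
  have le: "(\<integral>x. (f x)\<^sup>2 \<partial>\<mu>) \<le> (\<integral>x. (S n x - w x)\<^sup>2 \<partial>\<mu>)" for n
  proof (rule integral_mono)
    show "integrable \<mu> (\<lambda>x. (f x)\<^sup>2)" using sf by (simp add: square_integrable_def)
    show "integrable \<mu> (\<lambda>x. (S n x - w x)\<^sup>2)"
      using L2_si[OF L2_diff[OF L2_trig_sum w2]] by (simp add: square_integrable_def S_def)
    fix x
    have "\<bar>S n x\<bar> \<le> B" unfolding S_def B_def by (rule trig_sum_smooth_bound[OF w])
    then show "(f x)\<^sup>2 \<le> (S n x - w x)\<^sup>2"
      by (simp add: abs_le_square_iff[symmetric] f_def)
  qed
  have "(\<lambda>n. \<integral>x. (S n x - w x)\<^sup>2 \<partial>\<mu>) \<longlonglongrightarrow> 0" unfolding S_def by (rule trig_sum_tendsto[OF w2])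
  then have "(\<integral>x. (f x)\<^sup>2 \<partial>\<mu>) \<le> 0" using le by (intro LIMSEQ_le_const) auto
  moreover have "(\<integral>x. (f x)\<^sup>2 \<partial>\<mu>) \<ge> 0" by simp
  ultimately have "AE x in \<mu>. f x = 0" using integral_square_eq_0_iff[OF sf] by linarith
  then show ?thesis unfolding B_def[symmetric] by eventually_elim (simp add: f_def max_def split: if_splits)
qed

lemma L2_product:
  assumes "w1 \<in> L2_per L" "\<And>k. cf w1 k = \<sigma> k * coord a1 k"
    and "w2 \<in> L2_per L" "\<And>k. cf w2 k = \<sigma> k * coord a2 k"
  shows "(\<lambda>x. w1 x * w2 x) \<in> L2_per L"
proof -
  have "(\<lambda>x. w1 x * w2 x) \<in> borel_measurable borel" "periodic L (\<lambda>x. w1 x * w2 x)"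
    using assms(1,3) by (auto simp: L2_per_iff periodic_def)
  moreover have "square_integrable \<mu> (\<lambda>x. w1 x * w2 x)"
  proof (rule cellm.square_integrable_bounded)
    show "(\<lambda>x. w1 x * w2 x) \<in> borel_measurable \<mu>"
      using L2_si[OF assms(1)] L2_si[OF assms(3)] by (auto simp: square_integrable_def)
    show "AE x in \<mu>. \<bar>w1 x * w2 x\<bar> \<le> (\<Sigma> * norm a1) * (\<Sigma> * norm a2)"
      using smooth_AE_bounded[OF assms(1,2)] smooth_AE_bounded[OF assms(3,4)]
      by eventually_elim (auto simp: abs_mult intro!: mult_mono mult_nonneg_nonneg \<Sigma>_nonneg)
  qed
  ultimately show ?thesis by (simp add: L2_per_iff)
qed

definition trig_pd :: "2 \<Rightarrow> (int^2) set \<Rightarrow> (int^2 \<Rightarrow> real) \<Rightarrow> real^2 \<Rightarrow> real" where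
  "trig_pd i K c x = (\<Sum>k\<in>K. c k * (wave L k $ i * e (- k) x))"

lemma continuous_trig_sum: "continuous_on S (trig_sum K c)"
  unfolding trig_sum_def[abs_def] by (intro continuous_intros continuous_hartley)

lemma continuous_trig_pd: "continuous_on S (trig_pd i K c)"
  unfolding trig_pd_def[abs_def] by (intro continuous_intros continuous_hartley)

lemma L2_trig_pd: "trig_pd i K c \<in> L2_per L"
  unfolding trig_pd_def[abs_def] by (intro L2_sum L2_scale L2_hartley)

lemma DERIV_trig_sum:
  "((\<lambda>s. trig_sum K c (x + axis i s)) has_real_derivative trig_pd i K c x) (at 0)"
proof -
  have "((\<lambda>s. e k (x + axis i s)) has_real_derivative wave L k $ i * e (- k) x) (at 0)" for k
    using DERIV_along_axis[OF has_derivative_hartley, of L k x i] by (simp add: inner_axis)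
  then show ?thesis unfolding trig_sum_def trig_pd_def
    by (intro DERIV_sum DERIV_cmult)
qed

lemma trig_pd_norm:
  assumes K: "finite K"
  shows "(\<integral>x. (trig_pd i K c x)\<^sup>2 \<partial>\<mu>) = (\<Sum>k\<in>K. (wave L k $ i * c k)\<^sup>2)"
proof -
  have "trig_pd i K c x = trig_sum (uminus ` K) (\<lambda>k. - wave L k $ i * c (- k)) x" for x
    unfolding trig_pd_def trig_sum_def
    by (subst sum.reindex) (auto simp: wave_minus inj_on_def mult_ac)
  then have "(\<integral>x. (trig_pd i K c x)\<^sup>2 \<partial>\<mu>) =
      (\<integral>x. trig_sum (uminus ` K) (\<lambda>k. - wave L k $ i * c (- k)) x * trig_sum (uminus ` K) (\<lambda>k. - wave L k $ i * c (- k)) x \<partial>\<mu>)"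
    by (simp add: power2_eq_square)
  also have "\<dots> = (\<Sum>k\<in>uminus ` K. (- wave L k $ i * c (- k))\<^sup>2)"
    using K by (subst integral_mult_trig_sum[OF L2_trig_sum]) (simp add: cf_trig_sum power2_eq_square)
  also have "\<dots> = (\<Sum>k\<in>K. (wave L k $ i * c k)\<^sup>2)"
    by (subst sum.reindex) (auto simp: wave_minus inj_on_def)
  finally show ?thesis .
qed

lemma trig_pd_smooth_bound:
  assumes w: "\<And>k. cf w k = \<sigma> k * coord a k"
  shows "sqrt (\<integral>x. (trig_pd i (freq_box n) (cf w) x)\<^sup>2 \<partial>\<mu>) \<le> C1 * norm a"
proof -
  have "(\<Sum>k\<in>freq_box n. (wave L k $ i * cf w k)\<^sup>2) \<le> (\<Sum>k\<in>freq_box n. C1\<^sup>2 * (coord a k)\<^sup>2)"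
  proof (rule sum_mono)
    fix k
    have "(wave L k $ i * cf w k)\<^sup>2 = (wave L k $ i * \<sigma> k)\<^sup>2 * (coord a k)\<^sup>2"
      by (simp add: w power_mult_distrib)
    also have "\<dots> \<le> C1\<^sup>2 * (coord a k)\<^sup>2"
      using \<sigma>_gain[of k i] C1_nonneg by (intro mult_right_mono) (simp_all add: abs_le_square_iff[symmetric])
    finally show "(wave L k $ i * cf w k)\<^sup>2 \<le> C1\<^sup>2 * (coord a k)\<^sup>2" .
  qed
  also have "\<dots> \<le> (C1 * norm a)\<^sup>2"
    unfolding sum_distrib_left[symmetric] power_mult_distrib
    by (intro mult_left_mono sum_squares_le_norm) auto
  finally have "sqrt (\<Sum>k\<in>freq_box n. (wave L k $ i * cf w k)\<^sup>2) \<le> sqrt ((C1 * norm a)\<^sup>2)"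
    by (rule real_sqrt_le_mono)
  then show ?thesis using C1_nonneg by (simp add: trig_pd_norm)
qed

lemma abs_integral_bounded_mult_le:
  assumes f: "f \<in> L2_per L" and g: "g \<in> L2_per L" and b: "continuous_on UNIV b" and B: "\<And>x. \<bar>b x\<bar> \<le> B"
  shows "\<bar>\<integral>x. f x * (b x * g x) \<partial>\<mu>\<bar> \<le> sqrt (\<integral>x. (f x)\<^sup>2 \<partial>\<mu>) * (B * sqrt (\<integral>x. (g x)\<^sup>2 \<partial>\<mu>))"
    and "square_integrable \<mu> (\<lambda>x. b x * g x)"
proof -
  have B0: "B \<ge> 0" using B[of 0] by linarith
  have ig: "integrable \<mu> (\<lambda>x. (g x)\<^sup>2)" and gm: "g \<in> borel_measurable \<mu>"
    using L2_si[OF g] by (auto simp: square_integrable_def)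
  have bm: "b \<in> borel_measurable \<mu>" by (intro borel_measurable_cellm borel_measurable_continuous_onI b)
  have le: "(b x * g x)\<^sup>2 \<le> B\<^sup>2 * (g x)\<^sup>2" for x
    unfolding power_mult_distrib using B[of x] B0
    by (intro mult_right_mono) (simp_all add: abs_le_square_iff[symmetric])
  have ibg: "integrable \<mu> (\<lambda>x. (b x * g x)\<^sup>2)"
    by (rule Bochner_Integration.integrable_bound[of _ "\<lambda>x. B\<^sup>2 * (g x)\<^sup>2"])
       (use ig bm gm le in auto)
  then show sbg: "square_integrable \<mu> (\<lambda>x. b x * g x)"
    using bm gm by (simp add: square_integrable_def)
  have "(\<integral>x. (b x * g x)\<^sup>2 \<partial>\<mu>) \<le> B\<^sup>2 * (\<integral>x. (g x)\<^sup>2 \<partial>\<mu>)"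
    using integral_mono[OF ibg _ le] ig by simp
  then have "sqrt (\<integral>x. (b x * g x)\<^sup>2 \<partial>\<mu>) \<le> sqrt (B\<^sup>2 * (\<integral>x. (g x)\<^sup>2 \<partial>\<mu>))"
    by (rule real_sqrt_le_mono)
  then have "sqrt (\<integral>x. (b x * g x)\<^sup>2 \<partial>\<mu>) \<le> B * sqrt (\<integral>x. (g x)\<^sup>2 \<partial>\<mu>)"
    using B0 by (simp add: real_sqrt_mult)
  then show "\<bar>\<integral>x. f x * (b x * g x) \<partial>\<mu>\<bar> \<le> sqrt (\<integral>x. (f x)\<^sup>2 \<partial>\<mu>) * (B * sqrt (\<integral>x. (g x)\<^sup>2 \<partial>\<mu>))"
    by (intro order_trans[OF abs_integral_mult_le[OF L2_si[OF f] sbg]] mult_left_mono) auto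
qed

lemma trig_pd_bounded: "\<bar>trig_pd i K c x\<bar> \<le> (\<Sum>k\<in>K. \<bar>c k\<bar> * (\<bar>wave L k $ i\<bar> * (2 / L)))"
  unfolding trig_pd_def
proof (rule order_trans[OF sum_abs], rule sum_mono)
  fix k
  show "\<bar>c k * (wave L k $ i * e (- k) x)\<bar> \<le> \<bar>c k\<bar> * (\<bar>wave L k $ i\<bar> * (2 / L))"
    unfolding abs_mult by (intro mult_left_mono abs_hartley_le L_pos) auto
qed

text \<open>Integration by parts moves the derivative from the test sum to one of the factors. The
  differentiated factor is measured in \<open>L^2\<close>, the other in the sup norm; the two terms
  of the product rule explain the factor \<open>2\<close>.\<close>

lemma trig_product_estimate:
  assumes w1: "\<And>k. cf w1 k = \<sigma> k * coord a1 k" and w2: "\<And>k. cf w2 k = \<sigma> k * coord a2 k"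
  shows "\<bar>\<integral>x. trig_sum (freq_box n) (cf w1) x * (trig_sum (freq_box n) (cf w2) x * trig_pd i K c x) \<partial>\<mu>\<bar> \<le>
    2 * (\<Sigma> * C1) * norm a1 * norm a2 * sqrt (\<integral>x. (trig_sum K c x)\<^sup>2 \<partial>\<mu>)"
proof -
  define s1 where "s1 = trig_sum (freq_box n) (cf w1)"
  define s2 where "s2 = trig_sum (freq_box n) (cf w2)"
  define p1 where "p1 = trig_pd i (freq_box n) (cf w1)"
  define p2 where "p2 = trig_pd i (freq_box n) (cf w2)"
  define \<phi> where "\<phi> = trig_sum K c"
  define p where "p = trig_pd i K c"
  note defs = s1_def s2_def p1_def p2_def \<phi>_def p_def
  have c: "continuous_on S s1" "continuous_on S s2" "continuous_on S p1" "continuous_on S p2"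
    "continuous_on S \<phi>" "continuous_on S p" for S
    by (simp_all add: defs continuous_trig_sum continuous_trig_pd)
  have l2: "s1 \<in> L2_per L" "s2 \<in> L2_per L" "p1 \<in> L2_per L" "p2 \<in> L2_per L" "\<phi> \<in> L2_per L"
    by (simp_all add: defs L2_trig_pd)
  have "(\<integral>x. (s1 x * (s2 x * p x)) + (p1 x * (s2 x * \<phi> x) + p2 x * (s1 x * \<phi> x)) \<partial>\<mu>) = 0"
  proof (rule integral_directional_derivative[OF L_pos])
    show "continuous_on UNIV (\<lambda>x. s1 x * (s2 x * \<phi> x))"
      "continuous_on UNIV (\<lambda>x. (s1 x * (s2 x * p x)) + (p1 x * (s2 x * \<phi> x) + p2 x * (s1 x * \<phi> x)))"
      by (intro continuous_intros c)+
    show "periodic L (\<lambda>x. s1 x * (s2 x * \<phi> x))"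
      using l2 by (simp add: L2_per_iff periodic_def)
    fix x
    have d: "((\<lambda>s. s1 (x + axis i s)) has_real_derivative p1 x) (at 0)"
      "((\<lambda>s. s2 (x + axis i s)) has_real_derivative p2 x) (at 0)"
      "((\<lambda>s. \<phi> (x + axis i s)) has_real_derivative p x) (at 0)"
      unfolding defs by (rule DERIV_trig_sum)+
    show "((\<lambda>s. s1 (x + axis i s) * (s2 (x + axis i s) * \<phi> (x + axis i s))) has_real_derivative
      (s1 x * (s2 x * p x)) + (p1 x * (s2 x * \<phi> x) + p2 x * (s1 x * \<phi> x))) (at 0)"
      using DERIV_mult[OF d(1) DERIV_mult[OF d(2,3)]] by (simp add: axis_zero algebra_simps)
  qed
  moreover have "integrable \<mu> (\<lambda>x. s1 x * (s2 x * p x))" "integrable \<mu> (\<lambda>x. p1 x * (s2 x * \<phi> x))"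
    "integrable \<mu> (\<lambda>x. p2 x * (s1 x * \<phi> x))"
    by (intro continuous_integrable_cellm continuous_intros c)+
  ultimately have "(\<integral>x. s1 x * (s2 x * p x) \<partial>\<mu>) =
      - ((\<integral>x. p1 x * (s2 x * \<phi> x) \<partial>\<mu>) + (\<integral>x. p2 x * (s1 x * \<phi> x) \<partial>\<mu>))"
    by simp
  moreover have "\<bar>\<integral>x. p1 x * (s2 x * \<phi> x) \<partial>\<mu>\<bar> \<le> (C1 * norm a1) * ((\<Sigma> * norm a2) * sqrt (\<integral>x. (\<phi> x)\<^sup>2 \<partial>\<mu>))"
  proof (rule order_trans[OF abs_integral_bounded_mult_le(1)[OF l2(3) l2(5) c(2)]])
    show "\<bar>s2 x\<bar> \<le> \<Sigma> * norm a2" for x unfolding s2_def by (rule trig_sum_smooth_bound[OF w2])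
    show "sqrt (\<integral>x. (p1 x)\<^sup>2 \<partial>\<mu>) * (\<Sigma> * norm a2 * sqrt (\<integral>x. (\<phi> x)\<^sup>2 \<partial>\<mu>)) \<le>
        (C1 * norm a1) * ((\<Sigma> * norm a2) * sqrt (\<integral>x. (\<phi> x)\<^sup>2 \<partial>\<mu>))"
      unfolding p1_def by (intro mult_right_mono trig_pd_smooth_bound[OF w1] mult_nonneg_nonneg \<Sigma>_nonneg) auto
  qed
  moreover have "\<bar>\<integral>x. p2 x * (s1 x * \<phi> x) \<partial>\<mu>\<bar> \<le> (C1 * norm a2) * ((\<Sigma> * norm a1) * sqrt (\<integral>x. (\<phi> x)\<^sup>2 \<partial>\<mu>))"
  proof (rule order_trans[OF abs_integral_bounded_mult_le(1)[OF l2(4) l2(5) c(1)]])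
    show "\<bar>s1 x\<bar> \<le> \<Sigma> * norm a1" for x unfolding s1_def by (rule trig_sum_smooth_bound[OF w1])
    show "sqrt (\<integral>x. (p2 x)\<^sup>2 \<partial>\<mu>) * (\<Sigma> * norm a1 * sqrt (\<integral>x. (\<phi> x)\<^sup>2 \<partial>\<mu>)) \<le>
        (C1 * norm a2) * ((\<Sigma> * norm a1) * sqrt (\<integral>x. (\<phi> x)\<^sup>2 \<partial>\<mu>))"
      unfolding p2_def by (intro mult_right_mono trig_pd_smooth_bound[OF w2] mult_nonneg_nonneg \<Sigma>_nonneg) auto
  qed
  ultimately have "\<bar>\<integral>x. s1 x * (s2 x * p x) \<partial>\<mu>\<bar> \<le>
      (C1 * norm a1) * ((\<Sigma> * norm a2) * sqrt (\<integral>x. (\<phi> x)\<^sup>2 \<partial>\<mu>)) + (C1 * norm a2) * ((\<Sigma> * norm a1) * sqrt (\<integral>x. (\<phi> x)\<^sup>2 \<partial>\<mu>))"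
    by linarith
  then show ?thesis by (simp add: defs algebra_simps)
qed

lemma product_estimate:
  assumes w1L: "w1 \<in> L2_per L" and w1: "\<And>k. cf w1 k = \<sigma> k * coord a1 k"
    and w2L: "w2 \<in> L2_per L" and w2: "\<And>k. cf w2 k = \<sigma> k * coord a2 k"
  shows "\<bar>\<integral>x. w1 x * (w2 x * trig_pd i K c x) \<partial>\<mu>\<bar> \<le>
    2 * (\<Sigma> * C1) * norm a1 * norm a2 * sqrt (\<integral>x. (trig_sum K c x)\<^sup>2 \<partial>\<mu>)"
proof -
  define s1 where "s1 n = trig_sum (freq_box n) (cf w1)" for n
  define s2 where "s2 n = trig_sum (freq_box n) (cf w2)" for n
  define p where "p = trig_pd i K c"
  define B where "B = (\<Sum>k\<in>K. \<bar>c k\<bar> * (\<bar>wave L k $ i\<bar> * (2 / L)))"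
  have B: "\<bar>p x\<bar> \<le> B" for x unfolding p_def B_def by (rule trig_pd_bounded)
  have cp: "continuous_on S p" for S by (simp add: p_def continuous_trig_pd)
  have pL: "p \<in> L2_per L" by (simp add: p_def L2_trig_pd)
  have sL: "s1 n \<in> L2_per L" "s2 n \<in> L2_per L" for n by (simp_all add: s1_def s2_def)
  have lim1: "(\<lambda>n. \<integral>x. (s1 n x - w1 x)\<^sup>2 \<partial>\<mu>) \<longlonglongrightarrow> 0" and lim2: "(\<lambda>n. \<integral>x. (s2 n x - w2 x)\<^sup>2 \<partial>\<mu>) \<longlonglongrightarrow> 0"
    unfolding s1_def s2_def by (intro trig_sum_tendsto w1L w2L)+
  have w12p: "square_integrable \<mu> (\<lambda>x. p x * w1 x)" by (rule abs_integral_bounded_mult_le(2)[OF w1L w1L cp B])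
  have A: "(\<lambda>n. \<integral>x. s2 n x * (p x * w1 x) \<partial>\<mu>) \<longlonglongrightarrow> (\<integral>x. w2 x * (p x * w1 x) \<partial>\<mu>)"
    by (rule tendsto_integral_mult[OF L2_si[OF sL(2)] L2_si[OF w2L] w12p lim2])
  \<comment> \<open>The factors are replaced one at a time: here the error of the first meets the
    uniform sup bound of the second, while in \<open>A\<close> the product of \<open>p\<close> and
    \<open>w1\<close> is a fixed square integrable function.\<close>
  have D: "(\<lambda>n. \<integral>x. (s1 n x - w1 x) * (s2 n x * p x) \<partial>\<mu>) \<longlonglongrightarrow> 0"
  proof (rule Lim_null_comparison)
    show "\<forall>\<^sub>F n in sequentially. norm (\<integral>x. (s1 n x - w1 x) * (s2 n x * p x) \<partial>\<mu>) \<le>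
      sqrt (\<integral>x. (s1 n x - w1 x)\<^sup>2 \<partial>\<mu>) * ((\<Sigma> * norm a2) * sqrt (\<integral>x. (p x)\<^sup>2 \<partial>\<mu>))"
    proof (rule always_eventually, rule allI)
      fix n
      have "\<bar>s2 n x\<bar> \<le> \<Sigma> * norm a2" for x unfolding s2_def by (rule trig_sum_smooth_bound[OF w2])
      moreover have "continuous_on UNIV (s2 n)" unfolding s2_def by (rule continuous_trig_sum)
      ultimately show "norm (\<integral>x. (s1 n x - w1 x) * (s2 n x * p x) \<partial>\<mu>) \<le>
        sqrt (\<integral>x. (s1 n x - w1 x)\<^sup>2 \<partial>\<mu>) * ((\<Sigma> * norm a2) * sqrt (\<integral>x. (p x)\<^sup>2 \<partial>\<mu>))"
        using abs_integral_bounded_mult_le(1)[OF L2_diff[OF sL(1) w1L] pL] by simp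
    qed
    have "(\<lambda>n. sqrt (\<integral>x. (s1 n x - w1 x)\<^sup>2 \<partial>\<mu>) * ((\<Sigma> * norm a2) * sqrt (\<integral>x. (p x)\<^sup>2 \<partial>\<mu>))) \<longlonglongrightarrow>
        sqrt 0 * ((\<Sigma> * norm a2) * sqrt (\<integral>x. (p x)\<^sup>2 \<partial>\<mu>))"
      by (intro tendsto_intros lim1)
    then show "(\<lambda>n. sqrt (\<integral>x. (s1 n x - w1 x)\<^sup>2 \<partial>\<mu>) * ((\<Sigma> * norm a2) * sqrt (\<integral>x. (p x)\<^sup>2 \<partial>\<mu>))) \<longlonglongrightarrow> 0"
      by simp
  qed
  have eq: "(\<integral>x. s1 n x * (s2 n x * p x) \<partial>\<mu>) =
      (\<integral>x. (s1 n x - w1 x) * (s2 n x * p x) \<partial>\<mu>) + (\<integral>x. s2 n x * (p x * w1 x) \<partial>\<mu>)" for n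
  proof -
    have sp: "square_integrable \<mu> (\<lambda>x. s2 n x * p x)"
      by (rule square_integrable_continuous) (simp add: s2_def continuous_on_mult continuous_trig_sum cp)
    have "integrable \<mu> (\<lambda>x. (s1 n x - w1 x) * (s2 n x * p x))"
      by (rule square_integrable_mult[OF L2_si[OF L2_diff[OF sL(1) w1L]] sp])
    moreover have "integrable \<mu> (\<lambda>x. s2 n x * (p x * w1 x))"
      by (rule square_integrable_mult[OF L2_si[OF sL(2)] w12p])
    ultimately have "(\<integral>x. (s1 n x - w1 x) * (s2 n x * p x) \<partial>\<mu>) + (\<integral>x. s2 n x * (p x * w1 x) \<partial>\<mu>) =
       (\<integral>x. (s1 n x - w1 x) * (s2 n x * p x) + s2 n x * (p x * w1 x) \<partial>\<mu>)" by simp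
    also have "\<dots> = (\<integral>x. s1 n x * (s2 n x * p x) \<partial>\<mu>)"
      by (rule Bochner_Integration.integral_cong) (auto simp: algebra_simps)
    finally show ?thesis by simp
  qed
  have "(\<lambda>n. \<integral>x. s1 n x * (s2 n x * p x) \<partial>\<mu>) \<longlonglongrightarrow> 0 + (\<integral>x. w2 x * (p x * w1 x) \<partial>\<mu>)"
    unfolding eq by (intro tendsto_add D A)
  moreover have "(\<integral>x. w2 x * (p x * w1 x) \<partial>\<mu>) = (\<integral>x. w1 x * (w2 x * p x) \<partial>\<mu>)"
    by (rule Bochner_Integration.integral_cong) auto
  ultimately have "(\<lambda>n. \<bar>\<integral>x. s1 n x * (s2 n x * p x) \<partial>\<mu>\<bar>) \<longlonglongrightarrow> \<bar>\<integral>x. w1 x * (w2 x * p x) \<partial>\<mu>\<bar>"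
    by (intro tendsto_rabs) simp
  then show ?thesis unfolding p_def
    by (rule LIMSEQ_le_const2)
       (auto simp: s1_def s2_def intro!: exI trig_product_estimate[OF w1 w2])
qed

definition C2 :: real where "C2 = 2 * (\<Sigma> * C1)"

lemma C2_nonneg: "C2 \<ge> 0"
  by (simp add: C2_def \<Sigma>_nonneg C1_nonneg)

definition grad_product :: "2 \<Rightarrow> (real^2 \<Rightarrow> real) \<Rightarrow> (real^2 \<Rightarrow> real) \<Rightarrow> (int^2) ell2" where
  "grad_product i w1 w2 = fourier (weak_pd L i (\<lambda>x. w1 x * w2 x))"

text \<open>
  By duality with trigonometric polynomials: the gradient of the product is bounded as soon as its
  pairing with every trigonometric polynomial is, and there the product rule can be used for
  trigonometric approximations of the factors.
\<close>

lemma grad_product: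
  assumes w1L: "w1 \<in> L2_per L" and w1: "\<And>k. cf w1 k = \<sigma> k * coord a1 k"
    and w2L: "w2 \<in> L2_per L" and w2: "\<And>k. cf w2 k = \<sigma> k * coord a2 k"
  shows "weak_pd L i (\<lambda>x. w1 x * w2 x) \<in> L2_per L"
    and "coord (grad_product i w1 w2) k = - wave L k $ i * cf (\<lambda>x. w1 x * w2 x) (- k)"
    and "norm (grad_product i w1 w2) \<le> C2 * norm a1 * norm a2"
proof -
  define u where "u x = w1 x * w2 x" for x
  have u: "u \<in> L2_per L" unfolding u_def[abs_def] by (rule L2_product[OF assms])
  define c where "c k = - wave L k $ i * cf u (- k)" for k
  define B where "B = C2 * norm a1 * norm a2"
  have B: "B \<ge> 0" by (simp add: B_def C2_nonneg)
  have "(\<Sum>k\<in>K. (c k)\<^sup>2) \<le> B\<^sup>2" if K: "finite K" for K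
  proof -
    define X where "X = (\<Sum>k\<in>K. (c k)\<^sup>2)"
    have X0: "X \<ge> 0" by (simp add: X_def sum_nonneg)
    \<comment> \<open>The test sum carries the candidate coefficients themselves: its pairing is
      \<open>- X\<close> and its norm is \<open>sqrt X\<close>, so the product estimate reads
      \<open>X \<le> B * sqrt X\<close>.\<close>
    have "(\<integral>x. u x * trig_pd i K c x \<partial>\<mu>) = (\<integral>x. (\<Sum>k\<in>K. c k * wave L k $ i * (u x * e (- k) x)) \<partial>\<mu>)"
      by (simp add: trig_pd_def sum_distrib_left mult_ac)
    also have "\<dots> = (\<Sum>k\<in>K. c k * wave L k $ i * cf u (- k))"
      unfolding cf_def by (subst Bochner_Integration.integral_sum) (auto intro: integrable_mult u)
    also have "\<dots> = - X"
      by (simp add: X_def c_def power2_eq_square sum_negf mult_ac)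
    finally have "(\<integral>x. u x * trig_pd i K c x \<partial>\<mu>) = - X" .
    moreover have "(\<integral>x. (trig_sum K c x)\<^sup>2 \<partial>\<mu>) = X"
      using integral_mult_trig_sum[OF L2_trig_sum, of K c K c] K by (simp add: X_def cf_trig_sum power2_eq_square)
    ultimately have "X \<le> B * sqrt X"
      using product_estimate[OF assms, of i K c] X0 by (simp add: u_def B_def C2_def mult.assoc)
    then have "sqrt X * sqrt X \<le> B * sqrt X" using X0 by simp
    then have "sqrt X \<le> B" using X0 B mult_right_le_imp_le[of "sqrt X" "sqrt X" B] by (cases "X = 0") auto
    then show ?thesis unfolding X_def[symmetric] using X0 B
      by (metis real_sqrt_ge_0_iff real_sqrt_pow2 power_mono)
  qed
  then obtain b where b: "coord b = c" "norm b \<le> B" using ell2_boundedE[OF _ B, of c] by blast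
  have coordb: "coord b k = - wave L k $ i * cf u (- k)" for k by (simp add: b c_def)
  note wp = weak_pd[OF u coordb]
  show 1: "weak_pd L i (\<lambda>x. w1 x * w2 x) \<in> L2_per L" using wp(1) by (simp add: u_def[abs_def])
  have eq: "coord (grad_product i w1 w2) k = - wave L k $ i * cf u (- k)" for k
    unfolding grad_product_def using 1 wp(2)[of k] by (simp add: u_def[abs_def])
  then show "coord (grad_product i w1 w2) k = - wave L k $ i * cf (\<lambda>x. w1 x * w2 x) (- k)"
    by (simp add: u_def[abs_def])
  have "grad_product i w1 w2 = b" by (rule ell2_eqI) (simp add: eq coordb)
  then show "norm (grad_product i w1 w2) \<le> C2 * norm a1 * norm a2" using b by (simp add: B_def)
qed

text \<open>Bilinearity: change one factor at a time and apply the bound for a single product to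
  each of the two terms.\<close>

lemma grad_product_difference:
  assumes w1L: "w1 \<in> L2_per L" and w1: "\<And>k. cf w1 k = \<sigma> k * coord a1 k"
    and w2L: "w2 \<in> L2_per L" and w2: "\<And>k. cf w2 k = \<sigma> k * coord a2 k"
    and v1L: "v1 \<in> L2_per L" and v1: "\<And>k. cf v1 k = \<sigma> k * coord b1 k"
    and v2L: "v2 \<in> L2_per L" and v2: "\<And>k. cf v2 k = \<sigma> k * coord b2 k"
  shows "norm (grad_product i w1 w2 - grad_product i v1 v2) \<le>
    C2 * (norm (a1 - b1) * norm a2 + norm b1 * norm (a2 - b2))"
proof -
  define d1 where "d1 x = w1 x - v1 x" for x
  define d2 where "d2 x = w2 x - v2 x" for x
  have dL: "d1 \<in> L2_per L" "d2 \<in> L2_per L" unfolding d1_def[abs_def] d2_def[abs_def] by (intro L2_diff assms)+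
  have d1: "cf d1 k = \<sigma> k * coord (a1 - b1) k" and d2: "cf d2 k = \<sigma> k * coord (a2 - b2) k" for k
    unfolding d1_def[abs_def] d2_def[abs_def] using assms by (simp_all add: cf_diff algebra_simps)
  have "cf (\<lambda>x. w1 x * w2 x) k - cf (\<lambda>x. v1 x * v2 x) k = cf (\<lambda>x. d1 x * w2 x) k + cf (\<lambda>x. v1 x * d2 x) k" for k
  proof -
    have "cf (\<lambda>x. w1 x * w2 x) k - cf (\<lambda>x. v1 x * v2 x) k = cf (\<lambda>x. w1 x * w2 x - v1 x * v2 x) k"
      by (rule cf_diff[symmetric]) (rule L2_product[OF w1L w1 w2L w2] L2_product[OF v1L v1 v2L v2])+
    also have "(\<lambda>x. w1 x * w2 x - v1 x * v2 x) = (\<lambda>x. d1 x * w2 x + v1 x * d2 x)"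
      by (simp add: d1_def d2_def algebra_simps fun_eq_iff)
    also have "cf (\<lambda>x. d1 x * w2 x + v1 x * d2 x) k = cf (\<lambda>x. d1 x * w2 x) k + cf (\<lambda>x. v1 x * d2 x) k"
      by (rule cf_add) (rule L2_product[OF dL(1) d1 w2L w2] L2_product[OF v1L v1 dL(2) d2])+
    finally show ?thesis .
  qed
  note product_diff = this
  have "grad_product i w1 w2 - grad_product i v1 v2 = grad_product i d1 w2 + grad_product i v1 d2"
  proof (rule ell2_eqI)
    fix k
    have "coord (grad_product i w1 w2 - grad_product i v1 v2) k =
        - wave L k $ i * (cf (\<lambda>x. w1 x * w2 x) (- k) - cf (\<lambda>x. v1 x * v2 x) (- k))"
      unfolding coord_diff grad_product(2)[OF w1L w1 w2L w2] grad_product(2)[OF v1L v1 v2L v2]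
      by (rule right_diff_distrib[symmetric])
    also have "\<dots> = coord (grad_product i d1 w2 + grad_product i v1 d2) k"
      unfolding product_diff coord_add grad_product(2)[OF dL(1) d1 w2L w2] grad_product(2)[OF v1L v1 dL(2) d2]
      by (rule distrib_left)
    finally show "coord (grad_product i w1 w2 - grad_product i v1 v2) k =
        coord (grad_product i d1 w2 + grad_product i v1 d2) k" .
  qed
  then have "norm (grad_product i w1 w2 - grad_product i v1 v2) \<le>
      norm (grad_product i d1 w2) + norm (grad_product i v1 d2)" by (simp add: norm_triangle_ineq)
  also have "\<dots> \<le> C2 * norm (a1 - b1) * norm a2 + C2 * norm b1 * norm (a2 - b2)"
    by (intro add_mono grad_product(3)[OF dL(1) d1 w2L w2] grad_product(3)[OF v1L v1 dL(2) d2])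
  finally show ?thesis by (simp add: algebra_simps)
qed

end

section \<open>The truncated nonlinearity in Fourier variables\<close>

lemma sum_inverse_square_le:
  "(\<Sum>j\<le>n. 1 / (1 + (real j)\<^sup>2)) \<le> 2 * (\<Sum>j. inverse ((real (Suc j))\<^sup>2))"
proof -
  have "summable (\<lambda>j. inverse ((real j)\<^sup>2))" by (rule inverse_power_summable) simp
  then have s: "summable (\<lambda>j. inverse ((real (Suc j))\<^sup>2))" by (rule summable_Suc_iff[THEN iffD2])
  have "(\<Sum>j\<le>n. 1 / (1 + (real j)\<^sup>2)) \<le> (\<Sum>j\<le>n. 2 * inverse ((real (Suc j))\<^sup>2))"
  proof (rule sum_mono)
    fix j
    have "(1 + real j)\<^sup>2 \<le> 2 * (1 + (real j)\<^sup>2)"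
      using zero_le_power2[of "1 - real j"] by (simp add: power2_eq_square algebra_simps)
    then show "1 / (1 + (real j)\<^sup>2) \<le> 2 * inverse ((real (Suc j))\<^sup>2)"
      by (simp add: divide_simps add_pos_nonneg)
  qed
  also have "\<dots> \<le> 2 * (\<Sum>j. inverse ((real (Suc j))\<^sup>2))"
    unfolding sum_distrib_left[symmetric] by (intro mult_left_mono sum_le_suminf s) auto
  finally show ?thesis .
qed

text \<open>For nonnegative \<open>a\<close> and \<open>b\<close>,
  \<open>(1 + a) * (1 + b) \<le> (1 + a + b)^2\<close> separates the two lattice directions and
  reduces the claim to a convergent one-dimensional series. This is where dimension two enters: two
  derivatives give a square summable symbol.\<close>

lemma square_summable_lattice:
  assumes c: "c > 0"
  shows "square_summable (\<lambda>k :: int^2. 1 / (1 + c * ((real_of_int (k $ 1))\<^sup>2 + (real_of_int (k $ 2))\<^sup>2)))"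
proof -
  define g where "g j = 1 / (1 + c * (real_of_int j)\<^sup>2)" for j :: int
  define M where "M = max 1 (1 / c)"
  define A where "A = M * (2 * (\<Sum>j. inverse ((real (Suc j))\<^sup>2)))"
  have g0: "g j \<ge> 0" for j using c by (simp add: g_def)
  have gM: "g j \<le> M * (1 / (1 + (real_of_int j)\<^sup>2))" for j
  proof -
    have "1 \<le> M" "1 \<le> M * c" using c by (auto simp: M_def max_def field_simps)
    then have "1 + (real_of_int j)\<^sup>2 \<le> M + (M * c) * (real_of_int j)\<^sup>2"
      using mult_right_mono[of 1 "M * c" "(real_of_int j)\<^sup>2"] by simp
    then have "1 + (real_of_int j)\<^sup>2 \<le> M * (1 + c * (real_of_int j)\<^sup>2)" by (simp add: algebra_simps)
    moreover have "1 + c * (real_of_int j)\<^sup>2 > 0" "1 + (real_of_int j)\<^sup>2 > 0" using c by (auto intro: add_pos_nonneg)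
    ultimately show ?thesis by (simp add: g_def divide_simps mult.commute)
  qed
  have half: "(\<Sum>j\<le>n. g (int j)) \<le> A" for n
  proof -
    have "(\<Sum>j\<le>n. g (int j)) \<le> (\<Sum>j\<le>n. M * (1 / (1 + (real j)\<^sup>2)))"
      using gM by (intro sum_mono) (metis of_int_of_nat_eq)
    also have "\<dots> \<le> A" unfolding A_def sum_distrib_left[symmetric]
      by (intro mult_left_mono sum_inverse_square_le) (simp add: M_def)
    finally show ?thesis .
  qed
  have gsum: "(\<Sum>j\<in>{- int n..int n}. g j) \<le> 2 * A" for n
  proof -
    have "{- int n..int n} \<subseteq> int ` {..n} \<union> (\<lambda>j. - int j) ` {..n}"
    proof
      fix j assume j: "j \<in> {- int n..int n}"
      show "j \<in> int ` {..n} \<union> (\<lambda>j. - int j) ` {..n}"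
      proof (cases "j \<ge> 0")
        case True
        then have "j = int (nat j)" "nat j \<le> n" using j by auto
        then show ?thesis by blast
      next
        case False
        then have "j = - int (nat (- j))" "nat (- j) \<le> n" using j by auto
        then show ?thesis by blast
      qed
    qed
    then have "(\<Sum>j\<in>{- int n..int n}. g j) \<le> (\<Sum>j\<in>int ` {..n} \<union> (\<lambda>j. - int j) ` {..n}. g j)"
      by (intro sum_mono2) (auto simp: g0)
    also have "\<dots> \<le> (\<Sum>j\<in>int ` {..n}. g j) + (\<Sum>j\<in>(\<lambda>j. - int j) ` {..n}. g j)"
      by (subst sum_Un) (auto intro!: sum_nonneg simp: g0)
    also have "\<dots> = (\<Sum>j\<le>n. g (int j)) + (\<Sum>j\<le>n. g (int j))"
      by (subst (1 2) sum.reindex) (auto simp: inj_on_def g_def)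
    also have "\<dots> \<le> 2 * A" using half[of n] by simp
    finally show ?thesis .
  qed
  show ?thesis
  proof (rule square_summableI)
    fix K :: "(int^2) set" assume K: "finite K"
    define n where "n = nat (Max (insert 0 ((\<lambda>k. max \<bar>k $ 1\<bar> \<bar>k $ 2\<bar>) ` K)))"
    have Kn: "k $ 1 \<in> {- int n..int n} \<and> k $ 2 \<in> {- int n..int n}" if "k \<in> K" for k
    proof -
      have "max \<bar>k $ 1\<bar> \<bar>k $ 2\<bar> \<le> Max (insert 0 ((\<lambda>k. max \<bar>k $ 1\<bar> \<bar>k $ 2\<bar>) ` K))"
        using K that by (intro Max_ge) auto
      then have "max \<bar>k $ 1\<bar> \<bar>k $ 2\<bar> \<le> int n" unfolding n_def by linarith
      then show ?thesis by auto
    qed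
    have "(\<Sum>k\<in>K. (1 / (1 + c * ((real_of_int (k $ 1))\<^sup>2 + (real_of_int (k $ 2))\<^sup>2)))\<^sup>2) \<le> (\<Sum>k\<in>K. g (k $ 1) * g (k $ 2))"
    proof (rule sum_mono)
      fix k :: "int^2"
      define a b where "a = c * (real_of_int (k $ 1))\<^sup>2" and "b = c * (real_of_int (k $ 2))\<^sup>2"
      have ab: "a \<ge> 0" "b \<ge> 0" using c by (simp_all add: a_def b_def)
      have "(1 + a) * (1 + b) \<le> (1 + (a + b))\<^sup>2"
        using ab mult_nonneg_nonneg[OF ab] by (simp add: power2_eq_square algebra_simps)
      then have "1 / (1 + (a + b))\<^sup>2 \<le> 1 / ((1 + a) * (1 + b))"
        using ab by (intro divide_left_mono mult_pos_pos) (auto simp: add_pos_nonneg)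
      then show "(1 / (1 + c * ((real_of_int (k $ 1))\<^sup>2 + (real_of_int (k $ 2))\<^sup>2)))\<^sup>2 \<le> g (k $ 1) * g (k $ 2)"
        by (simp add: g_def a_def b_def power_divide distrib_left)
    qed
    also have "\<dots> = (\<Sum>(i, j)\<in>(\<lambda>k. (k $ 1, k $ 2)) ` K. g i * g j)"
      by (subst sum.reindex) (auto simp: inj_on_def vec_eq_iff forall_2)
    also have "\<dots> \<le> (\<Sum>(i, j)\<in>{- int n..int n} \<times> {- int n..int n}. g i * g j)"
      using Kn by (intro sum_mono2) (auto simp: g0)
    also have "\<dots> = (\<Sum>i\<in>{- int n..int n}. g i) * (\<Sum>j\<in>{- int n..int n}. g j)"
      by (simp add: sum_product sum.cartesian_product)
    also have "\<dots> \<le> (2 * A) * (2 * A)"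
      by (intro mult_mono gsum sum_nonneg g0 order_trans[OF _ gsum])
    finally show "(\<Sum>k\<in>K. (1 / (1 + c * ((real_of_int (k $ 1))\<^sup>2 + (real_of_int (k $ 2))\<^sup>2)))\<^sup>2) \<le> (2 * A) * (2 * A)" .
  qed
qed

text \<open>The mean value theorem covers positive arguments. At \<open>0\<close> nothing is known
  about differentiability, but \<open>chi\<close> is constant on \<open>[0, 1]\<close>, so the
  comparison can start at \<open>1\<close>.\<close>

lemma cutoff_lipschitz:
  assumes chi: "cutoff chi" and rs: "0 \<le> r" "0 \<le> s"
  shows "\<bar>chi r - chi s\<bar> \<le> 2 * \<bar>r - s\<bar>"
proof -
  have pos: "\<bar>chi r - chi s\<bar> \<le> 2 * \<bar>r - s\<bar>" if "0 < r" "r < s" for r s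
  proof -
    have "chi differentiable (at x)" if "x > 0" for x
      using chi that unfolding cutoff_def by (metis funpow_0)
    then have "\<And>x. r \<le> x \<Longrightarrow> x \<le> s \<Longrightarrow> DERIV chi x :> deriv chi x"
      using \<open>0 < r\<close> by (simp add: DERIV_deriv_iff_real_differentiable)
    from MVT2[OF \<open>r < s\<close> this] obtain z where z: "r < z" "z < s" "chi s - chi r = (s - r) * deriv chi z"
      by blast
    have "\<bar>deriv chi z\<bar> \<le> 2" using chi z \<open>0 < r\<close> unfolding cutoff_def by simp
    then have "\<bar>s - r\<bar> * \<bar>deriv chi z\<bar> \<le> \<bar>s - r\<bar> * 2" by (intro mult_left_mono) auto
    then have "\<bar>chi s - chi r\<bar> \<le> 2 * \<bar>s - r\<bar>" unfolding z(3) abs_mult by simp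
    then show ?thesis by (simp add: abs_minus_commute)
  qed
  have one: "chi t = 1" if "0 \<le> t" "t \<le> 1" for t using chi that by (simp add: cutoff_def)
  have zero: "\<bar>chi 0 - chi s\<bar> \<le> 2 * \<bar>0 - s\<bar>" if "s > 0" for s
  proof (cases "s \<le> 1")
    case True
    then show ?thesis using one that by simp
  next
    case False
    then show ?thesis using pos[of 1 s] one[of 0] one[of 1] by simp
  qed
  consider "r = s" | "0 < r" "r < s" | "0 < s" "s < r" | "r = 0" "0 < s" | "s = 0" "0 < r"
    using rs by linarith
  then show ?thesis
    by cases (use pos[of r s] pos[of s r] zero[of r] zero[of s] in \<open>auto simp: abs_minus_commute\<close>)
qed

type_synonym coeffs = "(int^2) ell2 \<times> (int^2) ell2"

locale truncated = torus +
  fixes \<alpha> :: real and N :: nat and f :: "real^2 \<Rightarrow> real" and chi :: "real \<Rightarrow> real" and \<rho> :: real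
  assumes \<alpha>_pos: "\<alpha> > 0" and f_zero: "f \<in> L2_zero L" and \<rho>_pos: "\<rho> > 0" and chi: "cutoff chi"
begin

lemma filter_pos: "0 < filter_symbol \<alpha> w" and filter_le: "filter_symbol \<alpha> w \<le> 1"
  unfolding filter_symbol_def by (auto simp: add_pos_nonneg divide_le_eq)

lemma filter_even: "filter_symbol \<alpha> (- w) = filter_symbol \<alpha> w"
  by (simp add: filter_symbol_def)

lemma deconv_bounds: "1 \<le> deconv_symbol \<alpha> N w" "deconv_symbol \<alpha> N w \<le> real N + 1"
proof -
  define r where "r = \<alpha>\<^sup>2 * (norm w)\<^sup>2 / (1 + \<alpha>\<^sup>2 * (norm w)\<^sup>2)"
  have r: "0 \<le> r" "r \<le> 1" unfolding r_def by (auto simp: add_pos_nonneg divide_le_eq)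
  have "(\<Sum>n\<le>N. r ^ n) \<le> (\<Sum>n\<le>N. 1)" using r by (intro sum_mono power_le_one)
  then show "deconv_symbol \<alpha> N w \<le> real N + 1" by (simp add: deconv_symbol_def r_def)
  have "r ^ 0 \<le> (\<Sum>n\<le>N. r ^ n)" by (rule member_le_sum) (use r in auto)
  then show "1 \<le> deconv_symbol \<alpha> N w" by (simp add: deconv_symbol_def r_def)
qed

lemma deconv_even: "deconv_symbol \<alpha> N (- w) = deconv_symbol \<alpha> N w"
  by (simp add: deconv_symbol_def)

lemma sqrt_deconv_bounds: "1 \<le> sqrt (deconv_symbol \<alpha> N w)" "sqrt (deconv_symbol \<alpha> N w) \<le> real N + 1"
proof -
  show "1 \<le> sqrt (deconv_symbol \<alpha> N w)" using deconv_bounds(1) by simp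
  have "real N + 1 \<le> (real N + 1)\<^sup>2" by (simp add: power2_eq_square)
  then show "sqrt (deconv_symbol \<alpha> N w) \<le> real N + 1"
    using deconv_bounds(2)[of w] by (intro real_le_lsqrt) (auto intro: order_trans)
qed

text \<open>The symbol of the composition \<open>DN_bar\<close> of filter and deconvolution.\<close>

definition sm :: "int^2 \<Rightarrow> real" where
  "sm k = deconv_symbol \<alpha> N (wave L k) * filter_symbol \<alpha> (wave L k)"

lemma abs_sm_le: "\<bar>sm k\<bar> \<le> (real N + 1) * filter_symbol \<alpha> (wave L k)"
  unfolding sm_def using deconv_bounds[of "wave L k"] filter_pos[of "wave L k"]
  by (simp add: abs_mult mult_right_mono)

lemma norm_wave_square: "(norm (wave L k))\<^sup>2 = (2 * pi / L)\<^sup>2 * ((real_of_int (k $ 1))\<^sup>2 + (real_of_int (k $ 2))\<^sup>2)"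
  unfolding norm_vec_square by (simp add: wave_def power_mult_distrib power_divide distrib_left)

lemma sm_summable: "square_summable sm"
proof -
  define c where "c = \<alpha>\<^sup>2 * (2 * pi / L)\<^sup>2"
  have c: "c > 0" using \<alpha>_pos L_pos by (simp add: c_def)
  define h where "h k = 1 / (1 + c * ((real_of_int (k $ 1))\<^sup>2 + (real_of_int (k $ 2))\<^sup>2))" for k :: "int^2"
  have h: "square_summable h" unfolding h_def[abs_def] by (rule square_summable_lattice[OF c])
  have fh: "filter_symbol \<alpha> (wave L k) = h k" for k
    by (simp add: filter_symbol_def norm_wave_square h_def c_def mult.assoc)
  show ?thesis
  proof (rule square_summableI)
    fix K :: "(int^2) set" assume K: "finite K"
    have "(\<Sum>k\<in>K. (sm k)\<^sup>2) \<le> (\<Sum>k\<in>K. (real N + 1)\<^sup>2 * (h k)\<^sup>2)"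
    proof (rule sum_mono)
      fix k
      have "\<bar>sm k\<bar> \<le> \<bar>(real N + 1) * h k\<bar>" using abs_sm_le[of k] by (simp add: fh abs_le_iff)
      then show "(sm k)\<^sup>2 \<le> (real N + 1)\<^sup>2 * (h k)\<^sup>2"
        by (simp only: abs_le_square_iff power_mult_distrib)
    qed
    also have "\<dots> \<le> (real N + 1)\<^sup>2 * (\<Sum>\<^sub>\<infinity>k. (h k)\<^sup>2)"
      unfolding sum_distrib_left[symmetric] by (intro mult_left_mono sum_le_infsum_squares[OF h K]) auto
    finally show "(\<Sum>k\<in>K. (sm k)\<^sup>2) \<le> (real N + 1)\<^sup>2 * (\<Sum>\<^sub>\<infinity>k. (h k)\<^sup>2)" .
  qed
qed

text \<open>From \<open>2 * \<alpha> * norm w \<le> 1 + \<alpha>^2 * (norm w)^2\<close> the filter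
  gains one derivative with constant \<open>1 / (2 * \<alpha>)\<close>, and the deconvolution costs
  at most the factor \<open>N + 1\<close>.\<close>

lemma sm_gain: "\<bar>wave L k $ i * sm k\<bar> \<le> (real N + 1) / (2 * \<alpha>)"
proof -
  define w where "w = wave L k"
  have "2 * \<alpha> * norm w \<le> 1 + \<alpha>\<^sup>2 * (norm w)\<^sup>2"
    using zero_le_power2[of "1 - \<alpha> * norm w"] by (simp add: power2_eq_square algebra_simps)
  then have fw: "norm w * filter_symbol \<alpha> w \<le> 1 / (2 * \<alpha>)"
    using \<alpha>_pos by (simp add: filter_symbol_def divide_simps add_pos_nonneg mult_ac)
  have "\<bar>w $ i * sm k\<bar> \<le> norm w * ((real N + 1) * filter_symbol \<alpha> w)"
    unfolding abs_mult using component_le_norm_cart[of w i] abs_sm_le[of k]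
    by (intro mult_mono) (auto simp: w_def)
  also have "\<dots> = (real N + 1) * (norm w * filter_symbol \<alpha> w)" by simp
  also have "\<dots> \<le> (real N + 1) * (1 / (2 * \<alpha>))" by (intro mult_left_mono fw) auto
  finally show ?thesis by (simp add: w_def)
qed

end

sublocale truncated \<subseteq> smoothing L sm "(real N + 1) / (2 * \<alpha>)"
  by unfold_locales (rule sm_summable sm_gain)+

section \<open>Phase space as a space of coefficient pairs\<close>

context truncated
begin

lemma DN_bar:
  assumes u: "u \<in> L2_zero L"
  shows "DN_bar L \<alpha> N u \<in> L2_per L" "coord (fourier u) = cf u" "cf (DN_bar L \<alpha> N u) k = sm k * coord (fourier u) k"
proof -
  have "\<bar>filter_symbol \<alpha> w\<bar> \<le> 1" "\<bar>deconv_symbol \<alpha> N w\<bar> \<le> real N + 1" for w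
    using filter_pos[of w] filter_le[of w] deconv_bounds[of w] by auto
  note m1 = multiplier[where m = "filter_symbol \<alpha>", OF u this(1) filter_even]
    and m2 = multiplier[where m = "deconv_symbol \<alpha> N", OF _ this(2) deconv_even]
  note m2 = m2[OF m1(1)]
  show "DN_bar L \<alpha> N u \<in> L2_per L" using m2(1) by (simp add: DN_bar_def L2_zero_iff)
  show c: "coord (fourier u) = cf u" using u by (simp add: L2_zero_iff)
  show "cf (DN_bar L \<alpha> N u) k = sm k * coord (fourier u) k"
    by (simp add: DN_bar_def m2(2) m1(2) sm_def c)
qed

lemma DN_vbar_component: "DN_vbar L \<alpha> N v x $ i = DN_bar L \<alpha> N (\<lambda>x. v x $ i) x"
  by (simp add: DN_vbar_def DN_bar_def vmultiplier_def)

definition coords :: "state \<Rightarrow> coeffs" where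
  "coords V = (vfourier (fst V), fourier (snd V))"

lemma fourier_component:
  "v \<in> H_div L \<Longrightarrow> fourier (\<lambda>x. v x $ i) = diag (\<lambda>k. dir k i) (vfourier v)"
  by (rule ell2_eqI) (simp add: H_div_components coord_diag[of _ 1] abs_dir_le coord_vfourier)

lemma norm_diag_le: "(\<And>k. \<bar>d k\<bar> \<le> B) \<Longrightarrow> norm (diag d y) \<le> B * norm y" for d :: "int^2 \<Rightarrow> real"
proof (rule norm_ell2_mono)
  assume d: "\<And>k. \<bar>d k\<bar> \<le> B"
  show "\<bar>coord (diag d y) k\<bar> \<le> B * \<bar>coord y k\<bar>" for k
    using d by (simp add: coord_diag[of d B] abs_mult mult_right_mono)
  show "B \<ge> 0" using d[of 0] by linarith
qed

lemma diag_diff: "(\<And>k. \<bar>d k\<bar> \<le> B) \<Longrightarrow> diag d (y - z) = diag d y - diag d z"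
  for d :: "int^2 \<Rightarrow> real"
  by (rule ell2_eqI) (simp add: coord_diag[of d B] algebra_simps)

text \<open>The squares of the two components of \<open>dir\<close> add up to \<open>1\<close> at
  every nonzero mode. At \<open>k = 0\<close> they do not, so that coordinate of \<open>y\<close>
  has to vanish. The multiplier \<open>d\<close> lets one statement serve both the plain norm and
  the \<open>D_N\<close> weighted one.\<close>

lemma dir_pythagoras:
  assumes y: "coord y 0 = 0" and d: "\<And>k. \<bar>d k\<bar> \<le> B"
  shows "(norm (diag d (diag (\<lambda>k. dir k 1) y)))\<^sup>2 + (norm (diag d (diag (\<lambda>k. dir k 2) y)))\<^sup>2 = (norm (diag d y))\<^sup>2"
proof -
  define z where "z i = diag d (diag (\<lambda>k. dir k i) y)" for i
  have z: "coord (z i) k = d k * (dir k i * coord y k)" for i k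
    by (simp add: z_def coord_diag[of d B] d coord_diag[of "\<lambda>k. dir k i" 1] abs_dir_le)
  have "((\<lambda>k. (coord (z 1) k)\<^sup>2 + (coord (z 2) k)\<^sup>2) has_sum (norm (z 1))\<^sup>2 + (norm (z 2))\<^sup>2) UNIV"
    by (intro has_sum_add has_sum_norm_ell2)
  moreover have "(coord (z 1) k)\<^sup>2 + (coord (z 2) k)\<^sup>2 = (coord (diag d y) k)\<^sup>2" for k
  proof (cases "k = 0")
    case False
    have "(coord (z 1) k)\<^sup>2 + (coord (z 2) k)\<^sup>2 = (d k * coord y k)\<^sup>2 * ((dir k 1)\<^sup>2 + (dir k 2)\<^sup>2)"
      by (simp add: z power_mult_distrib algebra_simps)
    then show ?thesis using dir_unit[OF False] by (simp add: coord_diag[of d B] d)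
  qed (simp add: z y coord_diag[of d B] d)
  ultimately have "((\<lambda>k. (coord (diag d y) k)\<^sup>2) has_sum (norm (z 1))\<^sup>2 + (norm (z 2))\<^sup>2) UNIV" by simp
  then have "(norm (z 1))\<^sup>2 + (norm (z 2))\<^sup>2 = (norm (diag d y))\<^sup>2"
    using has_sum_norm_ell2 has_sum_unique by blast
  then show ?thesis by (simp add: z_def)
qed

lemma coord_vfourier_0: "v \<in> H_div L \<Longrightarrow> coord (vfourier v) 0 = 0"
  by (simp add: coord_vfourier H_div_components zc_0)

lemma diag_1: "diag (\<lambda>_. 1) y = y"
  by (rule ell2_eqI) (simp add: coord_diag[of _ 1])

lemma norm_vfourier:
  assumes v: "v \<in> H_div L"
  shows "norm (vfourier v) = L2_norm L v"
proof -
  note c = H_div_components[OF v]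
  have "(L2_norm L v)\<^sup>2 = (norm (diag (\<lambda>k. dir k 1) (vfourier v)))\<^sup>2 + (norm (diag (\<lambda>k. dir k 2) (vfourier v)))\<^sup>2"
    unfolding L2_norm_vec[OF c(2)] parseval[OF c(2)] fourier_component[OF v] ..
  also have "\<dots> = (norm (vfourier v))\<^sup>2"
    using dir_pythagoras[OF coord_vfourier_0[OF v], of "\<lambda>_. 1" 1] by (simp add: diag_1)
  finally show ?thesis by (rule power2_eq_imp_eq[symmetric]) (simp_all add: L2_norm_nonneg)
qed

lemma phase_spaceD:
  assumes "V \<in> phase_space L"
  shows "fst V \<in> H_div L" "snd V \<in> L2_zero L" "snd V \<in> L2_per L"
  using assms by (auto simp: phase_space_def L2_zero_iff)

lemma state_norm_coords: "V \<in> phase_space L \<Longrightarrow> state_norm L V = norm (coords V)"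
  by (simp add: state_norm_def coords_def norm_Pair norm_vfourier phase_spaceD parseval)

lemma phase_space_diff:
  assumes "U \<in> phase_space L" "V \<in> phase_space L"
  shows "(\<lambda>x. fst U x - fst V x, \<lambda>x. snd U x - snd V x) \<in> phase_space L"
    "coords (\<lambda>x. fst U x - fst V x, \<lambda>x. snd U x - snd V x) = coords U - coords V"
proof -
  note u = phase_spaceD[OF assms(1)] and v = phase_spaceD[OF assms(2)]
  note uc = H_div_components[OF u(1)] and vc = H_div_components[OF v(1)]
  have z: "(\<lambda>x. p x - q x) \<in> L2_zero L" if "p \<in> L2_zero L" "q \<in> L2_zero L" for p q :: "real^2 \<Rightarrow> real"
    using that by (simp add: L2_zero_iff L2_diff cf_diff)
  have H: "(\<lambda>x. fst U x - fst V x) \<in> H_div L"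
    unfolding H_div_iff vector_minus_component
  proof (intro conjI allI)
    show "(\<lambda>x. fst U x $ i - fst V x $ i) \<in> L2_zero L" for i using uc vc by (intro z) auto
    show "wave L k $ 1 * cf (\<lambda>x. fst U x $ 1 - fst V x $ 1) k + wave L k $ 2 * cf (\<lambda>x. fst U x $ 2 - fst V x $ 2) k = 0" for k
    proof -
      have "wave L k $ 1 * cf (\<lambda>x. fst U x $ 1) k + wave L k $ 2 * cf (\<lambda>x. fst U x $ 2) k = 0"
        "wave L k $ 1 * cf (\<lambda>x. fst V x $ 1) k + wave L k $ 2 * cf (\<lambda>x. fst V x $ 2) k = 0"
        using u(1) v(1) by (auto simp: H_div_iff)
      then show ?thesis by (simp add: cf_diff uc vc algebra_simps)
    qed
  qed
  then show "(\<lambda>x. fst U x - fst V x, \<lambda>x. snd U x - snd V x) \<in> phase_space L"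
    using z[OF u(2) v(2)] by (simp add: phase_space_def)
  have "vfourier (\<lambda>x. fst U x - fst V x) = vfourier (fst U) - vfourier (fst V)"
    by (rule ell2_eqI) (simp add: coord_vfourier H_div_components(3)[OF H] uc vc zc_diff)
  then show "coords (\<lambda>x. fst U x - fst V x, \<lambda>x. snd U x - snd V x) = coords U - coords V"
    using u v by (simp add: coords_def fourier_diff)
qed

lemma state_dist_coords:
  "U \<in> phase_space L \<Longrightarrow> V \<in> phase_space L \<Longrightarrow> state_dist L U V = norm (coords U - coords V)"
  by (simp add: state_dist_def state_norm_coords phase_space_diff)

definition Dh :: "coeffs \<Rightarrow> coeffs" where
  "Dh x = (diag (\<lambda>k. sqrt (deconv_symbol \<alpha> N (wave L k))) (fst x),
           diag (\<lambda>k. sqrt (deconv_symbol \<alpha> N (wave L k))) (snd x))"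

lemma abs_sqrt_deconv: "\<bar>sqrt (deconv_symbol \<alpha> N w)\<bar> \<le> real N + 1"
  using sqrt_deconv_bounds[of w] by simp

lemma state_norm_DN_half:
  assumes V: "V \<in> phase_space L"
  shows "state_norm L (DN_half L \<alpha> N V) = norm (Dh (coords V))"
proof -
  note v = phase_spaceD[OF V] and c = H_div_components[OF phase_spaceD(1)[OF V]]
  define s where "s w = sqrt (deconv_symbol \<alpha> N w)" for w
  have s: "\<bar>s w\<bar> \<le> real N + 1" "s (- w) = s w" for w
    by (simp_all only: s_def abs_sqrt_deconv deconv_even)
  define w where "w i = multiplier L s (\<lambda>y. fst V y $ i)" for i
  have wz: "w i \<in> L2_per L" and cw: "cf (w i) k = s (wave L k) * cf (\<lambda>y. fst V y $ i) k" for i k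
    using multiplier[where m = s, OF c(1) s, of i] by (auto simp: w_def L2_zero_iff)
  have fw: "fourier (w i) = diag (\<lambda>k. s (wave L k)) (diag (\<lambda>k. dir k i) (vfourier (fst V)))" for i
    unfolding fourier_component[OF v(1), symmetric]
    by (rule ell2_eqI) (simp add: wz cw coord_diag[of _ "real N + 1"] s c)
  have "(L2_norm L (vmultiplier L s (fst V)))\<^sup>2 = (norm (fourier (w 1)))\<^sup>2 + (norm (fourier (w 2)))\<^sup>2"
    using L2_norm_vec[of "vmultiplier L s (fst V)"] wz
    by (simp add: vmultiplier_def w_def[symmetric] parseval)
  also have "\<dots> = (norm (diag (\<lambda>k. s (wave L k)) (vfourier (fst V))))\<^sup>2"
    unfolding fw by (rule dir_pythagoras[OF coord_vfourier_0[OF v(1)] s(1)])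
  finally have 1: "(L2_norm L (vmultiplier L s (fst V)))\<^sup>2 = (norm (diag (\<lambda>k. s (wave L k)) (vfourier (fst V))))\<^sup>2" .
  have t: "multiplier L s (snd V) \<in> L2_per L" "\<And>k. cf (multiplier L s (snd V)) k = s (wave L k) * cf (snd V) k"
    using multiplier[where m = s, OF v(2) s] by (auto simp: L2_zero_iff)
  have "fourier (multiplier L s (snd V)) = diag (\<lambda>k. s (wave L k)) (fourier (snd V))"
    by (rule ell2_eqI) (simp add: t coord_diag[of _ "real N + 1"] s v)
  then have 2: "(L2_norm L (multiplier L s (snd V)))\<^sup>2 = (norm (diag (\<lambda>k. s (wave L k)) (fourier (snd V))))\<^sup>2"
    by (simp add: parseval t)
  show ?thesis
    using 1 2 unfolding state_norm_def DN_half_def Dh_def coords_def norm_Pair s_def[symmetric] by simp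
qed

lemma Dh_diff: "Dh (x - y) = Dh x - Dh y"
  by (simp add: Dh_def diag_diff[where B = "real N + 1"] abs_sqrt_deconv)

lemma norm_Dh_le: "norm (Dh x) \<le> (real N + 1) * norm x"
proof -
  have n: "norm (diag (\<lambda>k. sqrt (deconv_symbol \<alpha> N (wave L k))) y) \<le> (real N + 1) * norm y" for y
    by (rule norm_diag_le) (rule abs_sqrt_deconv)
  have "(norm (Dh x))\<^sup>2 \<le> ((real N + 1) * norm (fst x))\<^sup>2 + ((real N + 1) * norm (snd x))\<^sup>2"
    by (simp add: Dh_def norm_Pair) (intro add_mono power_mono n; simp)
  also have "\<dots> = ((real N + 1) * norm x)\<^sup>2"
    by (simp add: norm_prod_def power_mult_distrib distrib_left)
  finally show ?thesis by (rule power2_le_imp_le) simp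
qed

text \<open>The symbol of \<open>D_N\<close> is at least \<open>1\<close>. This transfers the
  cut-off, which is formulated in the weighted norm, to the norm of the phase space.\<close>

lemma norm_le_norm_Dh: "norm x \<le> norm (Dh x)"
proof -
  have n: "norm y \<le> norm (diag (\<lambda>k. sqrt (deconv_symbol \<alpha> N (wave L k))) y)" for y
  proof -
    have "norm y \<le> 1 * norm (diag (\<lambda>k. sqrt (deconv_symbol \<alpha> N (wave L k))) y)"
    proof (rule norm_ell2_mono)
      fix k
      have "1 * \<bar>coord y k\<bar> \<le> \<bar>sqrt (deconv_symbol \<alpha> N (wave L k))\<bar> * \<bar>coord y k\<bar>"
        using sqrt_deconv_bounds(1)[of "wave L k"] by (intro mult_right_mono) auto
      then show "\<bar>coord y k\<bar> \<le> 1 * \<bar>coord (diag (\<lambda>k. sqrt (deconv_symbol \<alpha> N (wave L k))) y) k\<bar>"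
        by (simp add: coord_diag[of _ "real N + 1"] abs_sqrt_deconv abs_mult)
    qed simp
    then show ?thesis by simp
  qed
  show ?thesis unfolding norm_prod_def Dh_def by (auto intro!: add_mono power_mono n)
qed

end

section \<open>Bound and Lipschitz constant of the truncated nonlinearity\<close>

context truncated
begin

definition wv :: "state \<Rightarrow> 2 \<Rightarrow> real^2 \<Rightarrow> real" where
  "wv V i = DN_bar L \<alpha> N (\<lambda>x. fst V x $ i)"

definition wt :: "state \<Rightarrow> real^2 \<Rightarrow> real" where
  "wt V = DN_bar L \<alpha> N (snd V)"

definition momentum_part :: "state \<Rightarrow> 2 \<Rightarrow> (int^2) ell2" where
  "momentum_part V j = grad_product 1 (wv V 1) (wv V j) + grad_product 2 (wv V 2) (wv V j)"

definition heat_part :: "state \<Rightarrow> (int^2) ell2" where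
  "heat_part V = grad_product 1 (wt V) (wv V 1) + grad_product 2 (wt V) (wv V 2)"

definition dd :: "2 \<Rightarrow> (int^2) ell2 \<Rightarrow> (int^2) ell2" where
  "dd i = diag (\<lambda>k. dir k i)"

text \<open>The nonlinearity before truncation. Combining the two momentum components with
  \<open>dd 1\<close> and \<open>dd 2\<close> performs the Leray projection; the buoyancy acts only
  in the second component.\<close>

definition G :: "state \<Rightarrow> coeffs" where
  "G V = (dd 1 (momentum_part V 1) + dd 2 (momentum_part V 2) - dd 2 (fourier (snd V)),
          heat_part V - fourier f)"

lemma coord_dd: "coord (dd i y) k = dir k i * coord y k"
  by (simp add: dd_def coord_diag[of _ 1] abs_dir_le)

lemma dd_diff: "dd i (y - z) = dd i y - dd i z"
  by (rule ell2_eqI) (simp add: coord_dd algebra_simps)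

lemma norm_dd_le: "norm (dd i y) \<le> norm y"
  using norm_diag_le[of "\<lambda>k. dir k i" 1 y] abs_dir_le by (simp add: dd_def)

context
  fixes V assumes V: "V \<in> phase_space L"
begin

lemma wv: "wv V i \<in> L2_per L" "cf (wv V i) k = sm k * coord (fourier (\<lambda>x. fst V x $ i)) k"
  using DN_bar[OF H_div_components(1)[OF phase_spaceD(1)[OF V]]] by (auto simp: wv_def)

lemma wt: "wt V \<in> L2_per L" "cf (wt V) k = sm k * coord (fourier (snd V)) k"
  using DN_bar[OF phase_spaceD(2)[OF V]] by (auto simp: wt_def)

lemma norm_component_le: "norm (fourier (\<lambda>x. fst V x $ i)) \<le> norm (coords V)"
  using norm_dd_le[of i "vfourier (fst V)"] norm_fst_le[of "vfourier (fst V)" "fourier (snd V)"]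
  by (simp add: fourier_component[OF phase_spaceD(1)[OF V]] dd_def coords_def)

lemma norm_temperature_le: "norm (fourier (snd V)) \<le> norm (coords V)"
  using norm_snd_le[of "fourier (snd V)" "vfourier (fst V)"] by (simp add: coords_def)

lemma momentum_flux:
  shows "(\<lambda>x. momentum_flux_div L \<alpha> N (fst V) x $ j) \<in> L2_per L"
    and "cf (\<lambda>x. momentum_flux_div L \<alpha> N (fst V) x $ j) k = coord (momentum_part V j) k"
proof -
  define h where "h i = weak_pd L i (\<lambda>y. wv V i y * wv V j y)" for i
  have eq: "(\<lambda>x. momentum_flux_div L \<alpha> N (fst V) x $ j) = (\<lambda>x. h 1 x + h 2 x)"
    by (simp add: momentum_flux_div_def weak_div_tensor_def tensor_def DN_vbar_component UNIV_2 h_def wv_def)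
  have h: "h i \<in> L2_per L" for i unfolding h_def by (rule grad_product(1)[OF wv wv])
  have "fourier (h i) = grad_product i (wv V i) (wv V j)" for i by (simp add: h_def grad_product_def)
  then have ch: "cf (h i) k = coord (grad_product i (wv V i) (wv V j)) k" for i
    using coord_fourier[OF h] by metis
  show "(\<lambda>x. momentum_flux_div L \<alpha> N (fst V) x $ j) \<in> L2_per L" unfolding eq by (intro L2_add h)
  show "cf (\<lambda>x. momentum_flux_div L \<alpha> N (fst V) x $ j) k = coord (momentum_part V j) k"
    unfolding eq by (simp add: cf_add h ch momentum_part_def)
qed

lemma momentum_forcing:
  shows "(\<lambda>y. momentum_flux_div L \<alpha> N (fst V) y - snd V y *\<^sub>R axis 2 1) \<in> L2_per L" (is "?q \<in> _")
    and "zc (\<lambda>y. momentum_flux_div L \<alpha> N (fst V) y - snd V y *\<^sub>R axis 2 1) k = coord (fst (G V)) k"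
proof -
  have q1: "(\<lambda>x. ?q x $ 1) = (\<lambda>x. momentum_flux_div L \<alpha> N (fst V) x $ 1)"
    and q2: "(\<lambda>x. ?q x $ 2) = (\<lambda>x. momentum_flux_div L \<alpha> N (fst V) x $ 2 - snd V x)"
    by (simp_all add: axis_def)
  note t = phase_spaceD(3)[OF V]
  show "?q \<in> L2_per L"
    unfolding L2_vec_iff forall_2 q1 q2 by (intro conjI momentum_flux L2_diff t)
  show "zc ?q k = coord (fst (G V)) k"
    unfolding zc_def q1 q2 cf_diff[OF momentum_flux(1) t] momentum_flux(2)
    by (simp add: G_def coord_dd t algebra_simps)
qed

lemma heat_forcing:
  shows "(\<lambda>x. heat_flux_div L \<alpha> N (fst V) (snd V) x - f x) \<in> L2_per L"
    and "cf (\<lambda>x. heat_flux_div L \<alpha> N (fst V) (snd V) x - f x) k = coord (snd (G V)) k"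
proof -
  define h where "h i = weak_pd L i (\<lambda>y. wt V y * wv V i y)" for i
  have eq: "heat_flux_div L \<alpha> N (fst V) (snd V) = (\<lambda>x. h 1 x + h 2 x)"
    by (simp add: heat_flux_div_def weak_div_def DN_vbar_component UNIV_2 h_def wv_def wt_def fun_eq_iff)
  have h: "h i \<in> L2_per L" for i unfolding h_def by (rule grad_product(1)[OF wt wv])
  have "fourier (h i) = grad_product i (wt V) (wv V i)" for i by (simp add: h_def grad_product_def)
  then have ch: "cf (h i) k = coord (grad_product i (wt V) (wv V i)) k" for i
    using coord_fourier[OF h] by metis
  have f: "f \<in> L2_per L" using f_zero by (simp add: L2_zero_iff)
  show "(\<lambda>x. heat_flux_div L \<alpha> N (fst V) (snd V) x - f x) \<in> L2_per L"
    unfolding eq by (intro L2_diff L2_add h f)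
  show "cf (\<lambda>x. heat_flux_div L \<alpha> N (fst V) (snd V) x - f x) k = coord (snd (G V)) k"
    unfolding eq by (simp add: cf_diff cf_add L2_add h f ch G_def heat_part_def)
qed

text \<open>Four products occur in the momentum and two in the heat equation, hence the
  \<open>6\<close>; the linear term is the buoyancy and the constant one the heat source.\<close>

lemma norm_G_le: "norm (G V) \<le> 6 * C2 * (norm (coords V))\<^sup>2 + norm (coords V) + norm (fourier f)"
proof -
  define R where "R = norm (coords V)"
  have R: "R \<ge> 0" by (simp add: R_def)
  have gm: "norm (grad_product i (wv V i') (wv V j)) \<le> C2 * R\<^sup>2" for i i' j
  proof -
    have "norm (grad_product i (wv V i') (wv V j)) \<le>
        C2 * norm (fourier (\<lambda>x. fst V x $ i')) * norm (fourier (\<lambda>x. fst V x $ j))"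
      by (rule grad_product(3)[OF wv wv])
    also have "\<dots> \<le> C2 * R * R"
      unfolding R_def by (intro mult_mono mult_left_mono norm_component_le mult_nonneg_nonneg C2_nonneg) auto
    finally show ?thesis by (simp add: power2_eq_square mult.assoc)
  qed
  have gh: "norm (grad_product i (wt V) (wv V j)) \<le> C2 * R\<^sup>2" for i j
  proof -
    have "norm (grad_product i (wt V) (wv V j)) \<le> C2 * norm (fourier (snd V)) * norm (fourier (\<lambda>x. fst V x $ j))"
      by (rule grad_product(3)[OF wt wv])
    also have "\<dots> \<le> C2 * R * R"
      unfolding R_def
      by (intro mult_mono mult_left_mono norm_component_le norm_temperature_le mult_nonneg_nonneg C2_nonneg) auto
    finally show ?thesis by (simp add: power2_eq_square mult.assoc)
  qed
  have m: "norm (dd j (momentum_part V j)) \<le> C2 * R\<^sup>2 + C2 * R\<^sup>2" for j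
    unfolding momentum_part_def
    by (rule order_trans[OF norm_dd_le], rule order_trans[OF norm_triangle_ineq], intro add_mono gm)
  have t: "norm (dd 2 (fourier (snd V))) \<le> R"
    unfolding R_def by (rule order_trans[OF norm_dd_le norm_temperature_le])
  have h: "norm (heat_part V) \<le> C2 * R\<^sup>2 + C2 * R\<^sup>2"
    unfolding heat_part_def by (rule order_trans[OF norm_triangle_ineq], intro add_mono gh)
  have 1: "norm (fst (G V)) \<le> ((C2 * R\<^sup>2 + C2 * R\<^sup>2) + (C2 * R\<^sup>2 + C2 * R\<^sup>2)) + R"
    unfolding G_def fst_conv
    by (rule order_trans[OF norm_triangle_ineq4], intro add_mono t order_trans[OF norm_triangle_ineq] m)
  have 2: "norm (snd (G V)) \<le> (C2 * R\<^sup>2 + C2 * R\<^sup>2) + norm (fourier f)"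
    unfolding G_def snd_conv
    by (rule order_trans[OF norm_triangle_ineq4], intro add_mono h order_refl)
  have "norm (G V) \<le> norm (fst (G V)) + norm (snd (G V))"
    using norm_Pair_le[of "fst (G V)" "snd (G V)"] by simp
  then show ?thesis using 1 2 unfolding R_def by linarith
qed

end

lemma norm_G_diff_le:
  assumes U: "U \<in> phase_space L" and V: "V \<in> phase_space L"
  shows "norm (G U - G V) \<le>
    (6 * C2 * (norm (coords U) + norm (coords V)) + 1) * norm (coords U - coords V)"
proof -
  define d where "d = norm (coords U - coords V)"
  define Q where "Q = C2 * (d * norm (coords U) + norm (coords V) * d)"
  define W where "W = (\<lambda>x. fst U x - fst V x, \<lambda>x. snd U x - snd V x)"
  have W: "W \<in> phase_space L" "coords W = coords U - coords V"
    unfolding W_def by (rule phase_space_diff[OF U V])+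
  have dv: "norm (fourier (\<lambda>x. fst U x $ i) - fourier (\<lambda>x. fst V x $ i)) \<le> d" for i
  proof -
    have "fourier (\<lambda>x. fst U x $ i) - fourier (\<lambda>x. fst V x $ i) = fourier (\<lambda>x. fst W x $ i)"
      unfolding W_def using H_div_components(2)[OF phase_spaceD(1)] U V by (simp add: fourier_diff)
    then show ?thesis using norm_component_le[OF W(1), of i] by (simp add: W(2) d_def)
  qed
  have dt: "norm (fourier (snd U) - fourier (snd V)) \<le> d"
  proof -
    have "fourier (snd U) - fourier (snd V) = fourier (snd W)"
      unfolding W_def using phase_spaceD(3) U V by (simp add: fourier_diff)
    then show ?thesis using norm_temperature_le[OF W(1)] by (simp add: W(2) d_def)
  qed
  have gm: "norm (grad_product i (wv U i') (wv U j) - grad_product i (wv V i') (wv V j)) \<le> Q" for i i' j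
    unfolding Q_def
    by (rule order_trans[OF grad_product_difference[OF wv[OF U] wv[OF U] wv[OF V] wv[OF V]]])
       (intro mult_left_mono add_mono mult_mono dv norm_component_le U V C2_nonneg; simp add: d_def)
  have gh: "norm (grad_product i (wt U) (wv U j) - grad_product i (wt V) (wv V j)) \<le> Q" for i j
    unfolding Q_def
    by (rule order_trans[OF grad_product_difference[OF wt[OF U] wv[OF U] wt[OF V] wv[OF V]]])
       (intro mult_left_mono add_mono mult_mono dv dt norm_component_le norm_temperature_le U V C2_nonneg; simp add: d_def)
  have m: "norm (dd j (momentum_part U j) - dd j (momentum_part V j)) \<le> Q + Q" for j
    unfolding dd_diff[symmetric] momentum_part_def
    by (rule order_trans[OF norm_dd_le], rule order_trans[OF norm_diff_triangle_ineq], intro add_mono gm)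
  have t: "norm (dd 2 (fourier (snd U)) - dd 2 (fourier (snd V))) \<le> d"
    unfolding dd_diff[symmetric] by (rule order_trans[OF norm_dd_le dt])
  have h: "norm (heat_part U - heat_part V) \<le> Q + Q"
    unfolding heat_part_def by (rule order_trans[OF norm_diff_triangle_ineq], intro add_mono gh)
  have "fst (G U - G V) = (dd 1 (momentum_part U 1) - dd 1 (momentum_part V 1)) +
      (dd 2 (momentum_part U 2) - dd 2 (momentum_part V 2)) - (dd 2 (fourier (snd U)) - dd 2 (fourier (snd V)))"
    by (simp add: G_def)
  also have "norm \<dots> \<le> ((Q + Q) + (Q + Q)) + d"
    by (rule order_trans[OF norm_triangle_ineq4], intro add_mono t order_trans[OF norm_triangle_ineq] m)
  finally have 1: "norm (fst (G U - G V)) \<le> ((Q + Q) + (Q + Q)) + d" .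
  have 2: "norm (snd (G U - G V)) \<le> Q + Q" using h by (simp add: G_def)
  have "norm (G U - G V) \<le> norm (fst (G U - G V)) + norm (snd (G U - G V))"
    by (rule norm_Pair_le[of "fst (G U - G V)" "snd (G U - G V)", unfolded prod.collapse])
  also have "\<dots> \<le> 6 * Q + d" using 1 2 by linarith
  finally show ?thesis by (simp add: Q_def d_def algebra_simps)
qed

definition FS :: "state \<Rightarrow> coeffs" where
  "FS V = - (cut L \<alpha> N chi \<rho> V *\<^sub>R G V)"

lemma cut_coords: "V \<in> phase_space L \<Longrightarrow> cut L \<alpha> N chi \<rho> V = chi (norm (Dh (coords V)) / \<rho>)"
  by (simp add: cut_def state_norm_DN_half)

lemma cut_bounds: "V \<in> phase_space L \<Longrightarrow> 0 \<le> cut L \<alpha> N chi \<rho> V \<and> cut L \<alpha> N chi \<rho> V \<le> 1"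
  using chi \<rho>_pos by (simp add: cut_coords cutoff_def)

text \<open>All nonlinear estimates are needed only where the cut-off is active, and there the state
  lies in a fixed ball.\<close>

lemma cut_nonzero:
  assumes "V \<in> phase_space L" "cut L \<alpha> N chi \<rho> V \<noteq> 0"
  shows "norm (coords V) \<le> 2 * \<rho>"
proof -
  have "norm (Dh (coords V)) / \<rho> < 2"
    using chi assms unfolding cutoff_def cut_coords[OF assms(1)] by (meson not_le)
  then show ?thesis using norm_le_norm_Dh[of "coords V"] \<rho>_pos by (simp add: field_simps)
qed

lemma cut_lipschitz:
  assumes "U \<in> phase_space L" "V \<in> phase_space L"
  shows "\<bar>cut L \<alpha> N chi \<rho> U - cut L \<alpha> N chi \<rho> V\<bar> \<le> 2 * (real N + 1) / \<rho> * norm (coords U - coords V)"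
proof -
  have "\<bar>cut L \<alpha> N chi \<rho> U - cut L \<alpha> N chi \<rho> V\<bar> \<le> 2 * \<bar>norm (Dh (coords U)) / \<rho> - norm (Dh (coords V)) / \<rho>\<bar>"
    unfolding cut_coords[OF assms(1)] cut_coords[OF assms(2)]
    by (rule cutoff_lipschitz[OF chi]) (use \<rho>_pos in auto)
  also have "\<dots> = 2 / \<rho> * \<bar>norm (Dh (coords U)) - norm (Dh (coords V))\<bar>"
    using \<rho>_pos by (simp add: diff_divide_distrib[symmetric] abs_divide)
  also have "\<dots> \<le> 2 / \<rho> * ((real N + 1) * norm (coords U - coords V))"
  proof (rule mult_left_mono)
    have "\<bar>norm (Dh (coords U)) - norm (Dh (coords V))\<bar> \<le> norm (Dh (coords U - coords V))"
      unfolding Dh_diff by (rule norm_triangle_ineq3)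
    also have "\<dots> \<le> (real N + 1) * norm (coords U - coords V)" by (rule norm_Dh_le)
    finally show "\<bar>norm (Dh (coords U)) - norm (Dh (coords V))\<bar> \<le> (real N + 1) * norm (coords U - coords V)" .
  qed (use \<rho>_pos in simp)
  also have "\<dots> = 2 * (real N + 1) / \<rho> * norm (coords U - coords V)"
    by (simp only: times_divide_eq_left times_divide_eq_right mult.assoc)
  finally show ?thesis .
qed

text \<open>\<open>KF\<close> is the bound of \<open>norm_G_le\<close> on the ball of radius
  \<open>2 * \<rho>\<close>. In \<open>\<Lambda>F\<close> the first summand is the Lipschitz
  constant of \<open>G\<close> on that ball, with \<open>24 = 6 * (2 + 2)\<close>, and the second is
  the Lipschitz constant of the cut-off times \<open>KF\<close>.\<close>

definition KF :: real where "KF = 6 * C2 * (2 * \<rho>)\<^sup>2 + 2 * \<rho> + norm (fourier f)"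
definition \<Lambda>F :: real where "\<Lambda>F = (24 * C2 * \<rho> + 1) + 2 * (real N + 1) / \<rho> * KF"

lemma KF_nonneg: "KF \<ge> 0"
  using C2_nonneg \<rho>_pos by (simp add: KF_def)

lemma \<Lambda>F_pos: "\<Lambda>F > 0"
proof -
  have "0 \<le> 24 * C2 * \<rho>" using C2_nonneg \<rho>_pos by simp
  moreover have "0 \<le> 2 * (real N + 1) / \<rho> * KF" using \<rho>_pos KF_nonneg by simp
  ultimately show ?thesis unfolding \<Lambda>F_def by linarith
qed

lemma norm_G_le_KF:
  assumes "V \<in> phase_space L" "norm (coords V) \<le> 2 * \<rho>"
  shows "norm (G V) \<le> KF"
proof -
  have "(norm (coords V))\<^sup>2 \<le> (2 * \<rho>)\<^sup>2" using assms(2) by (rule power_mono) simp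
  then have "6 * C2 * (norm (coords V))\<^sup>2 \<le> 6 * C2 * (2 * \<rho>)\<^sup>2"
    using C2_nonneg by (intro mult_left_mono) auto
  then show ?thesis using norm_G_le[OF assms(1)] assms(2) unfolding KF_def by linarith
qed

lemma norm_FS_le: "V \<in> phase_space L \<Longrightarrow> norm (FS V) \<le> KF"
proof (cases "cut L \<alpha> N chi \<rho> V = 0")
  case False
  assume V: "V \<in> phase_space L"
  have "\<bar>cut L \<alpha> N chi \<rho> V\<bar> * norm (G V) \<le> 1 * KF"
    using cut_bounds[OF V] norm_G_le_KF[OF V cut_nonzero[OF V False]] by (intro mult_mono) auto
  then show ?thesis by (simp add: FS_def)
qed (simp add: FS_def KF_nonneg)

lemma FS_lipschitz:
  assumes U: "U \<in> phase_space L" and V: "V \<in> phase_space L"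
  shows "norm (FS U - FS V) \<le> \<Lambda>F * norm (coords U - coords V)"
proof -
  \<comment> \<open>If the cut-off is nonzero at \<open>V\<close>, then \<open>G V\<close> is
    bounded by \<open>KF\<close>. The difference of the states' \<open>G\<close> values carries the
    factor \<open>u\<close>, so it matters only if \<open>U\<close> lies in the ball as well. The
    roles of the states can be exchanged, and if both cut-offs vanish there is nothing to
    show.\<close>
  have main: "norm (FS U - FS V) \<le> \<Lambda>F * norm (coords U - coords V)"
    if U: "U \<in> phase_space L" and V: "V \<in> phase_space L" and nz: "cut L \<alpha> N chi \<rho> V \<noteq> 0" for U V
  proof -
    define u v where "u = cut L \<alpha> N chi \<rho> U" and "v = cut L \<alpha> N chi \<rho> V"
    define d where "d = norm (coords U - coords V)"
    have u: "0 \<le> u" "u \<le> 1" using cut_bounds[OF U] by (auto simp: u_def)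
    have 1: "norm (u *\<^sub>R (G U - G V)) \<le> (24 * C2 * \<rho> + 1) * d"
    proof (cases "u = 0")
      case True
      then show ?thesis using C2_nonneg \<rho>_pos by (simp add: d_def)
    next
      case False
      have "norm (u *\<^sub>R (G U - G V)) \<le> 1 * norm (G U - G V)"
        using u by (simp only: norm_scaleR) (intro mult_right_mono; simp)
      also have "\<dots> \<le> (6 * C2 * (norm (coords U) + norm (coords V)) + 1) * d"
        unfolding d_def using norm_G_diff_le[OF U V] by simp
      also have "\<dots> \<le> (6 * C2 * (2 * \<rho> + 2 * \<rho>) + 1) * d"
        using cut_nonzero[OF U] cut_nonzero[OF V nz] False
        by (intro mult_right_mono add_mono mult_left_mono) (auto simp: u_def d_def C2_nonneg)
      finally show ?thesis by (simp add: algebra_simps)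
    qed
    have 2: "norm ((u - v) *\<^sub>R G V) \<le> (2 * (real N + 1) / \<rho> * d) * KF"
      unfolding norm_scaleR u_def v_def d_def
      by (intro mult_mono cut_lipschitz U V norm_G_le_KF cut_nonzero nz) (use \<rho>_pos in auto)
    have "FS U - FS V = - (u *\<^sub>R (G U - G V) + (u - v) *\<^sub>R G V)"
      by (simp add: FS_def u_def v_def algebra_simps)
    then have "norm (FS U - FS V) = norm (u *\<^sub>R (G U - G V) + (u - v) *\<^sub>R G V)" by (simp only: norm_minus_cancel)
    also have "\<dots> \<le> (24 * C2 * \<rho> + 1) * d + (2 * (real N + 1) / \<rho> * d) * KF"
      by (rule norm_triangle_mono[OF 1 2])
    also have "\<dots> = \<Lambda>F * d" by (simp add: \<Lambda>F_def algebra_simps)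
    finally show ?thesis by (simp add: d_def)
  qed
  consider "cut L \<alpha> N chi \<rho> V \<noteq> 0" | "cut L \<alpha> N chi \<rho> U \<noteq> 0" | "cut L \<alpha> N chi \<rho> U = 0" "cut L \<alpha> N chi \<rho> V = 0"
    by blast
  then show ?thesis
  proof cases
    case 1
    then show ?thesis by (rule main[OF U V])
  next
    case 2
    then show ?thesis using main[OF V U] by (simp add: norm_minus_commute)
  next
    case 3
    then show ?thesis using \<Lambda>F_pos by (simp add: FS_def)
  qed
qed

section \<open>Extension to all coefficient pairs and reduction of solutions\<close>

definition drop0 :: "(int^2) ell2 \<Rightarrow> (int^2) ell2" where
  "drop0 = diag (\<lambda>k. if k = 0 then 0 else 1)"

lemma coord_drop0: "coord (drop0 y) k = (if k = 0 then 0 else coord y k)"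
  by (simp add: drop0_def coord_diag[of _ 1])

text \<open>A right inverse of \<open>coords\<close> up to the zero modes: \<open>vseries\<close>
  removes the zero mode by itself because \<open>dir\<close> vanishes there, whereas the scalar
  series needs \<open>drop0\<close>.\<close>

definition state_of :: "coeffs \<Rightarrow> state" where
  "state_of x = (vseries (fst x), series (drop0 (snd x)))"

lemma state_of: "state_of x \<in> phase_space L" "coords (state_of x) = (drop0 (fst x), drop0 (snd x))"
proof -
  show "state_of x \<in> phase_space L"
    by (simp add: state_of_def phase_space_def vseries_H_div L2_zero_iff coord_drop0)
  have "vfourier (vseries z) = drop0 z" for z
    by (rule ell2_eqI)
       (use zc_vseries in \<open>auto simp: coord_vfourier H_div_components(3)[OF vseries_H_div] coord_drop0 zc_0\<close>)
  moreover have "fourier (series y) = y" for y by (rule ell2_eqI) simp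
  ultimately show "coords (state_of x) = (drop0 (fst x), drop0 (snd x))"
    by (simp add: coords_def state_of_def)
qed

lemma coords_drop0:
  assumes "V \<in> phase_space L"
  shows "coords (state_of (coords V)) = coords V"
proof -
  have "drop0 (vfourier (fst V)) = vfourier (fst V)" "drop0 (fourier (snd V)) = fourier (snd V)"
    using coord_vfourier_0[OF phase_spaceD(1)[OF assms]] phase_spaceD[OF assms]
    by (auto intro!: ell2_eqI simp: coord_drop0 L2_zero_iff)
  then show ?thesis unfolding state_of(2) by (simp add: coords_def)
qed

text \<open>The abstract theory wants a nonlinearity on a full Banach space. Composition with
  \<open>state_of\<close> provides it without loss in the constants, since dropping the zero modes
  is a contraction.\<close>

definition Fh :: "coeffs \<Rightarrow> coeffs" where
  "Fh x = FS (state_of x)"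

lemma norm_Fh_le: "norm (Fh x) \<le> KF"
  unfolding Fh_def by (rule norm_FS_le[OF state_of(1)])

lemma Fh_lipschitz: "norm (Fh x - Fh y) \<le> \<Lambda>F * norm (x - y)"
proof -
  have d: "norm (drop0 p - drop0 q) \<le> norm (p - q)" for p q
    using norm_diag_le[of "\<lambda>k. if k = 0 then 0 else 1" 1 "p - q"]
    by (simp add: drop0_def diag_diff[of _ 1])
  have "norm (Fh x - Fh y) \<le> \<Lambda>F * norm (coords (state_of x) - coords (state_of y))"
    unfolding Fh_def by (rule FS_lipschitz[OF state_of(1) state_of(1)])
  also have "norm (coords (state_of x) - coords (state_of y)) \<le> norm (x - y)"
    unfolding state_of(2) norm_prod_def using d by (auto intro!: add_mono power_mono)
  finally show ?thesis using \<Lambda>F_pos by (simp add: mult_left_mono)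
qed

text \<open>\<open>state_of (coords V)\<close> may be another representative of \<open>V\<close>;
  the Lipschitz estimate at distance zero shows that \<open>FS\<close> does not distinguish
  them.\<close>

lemma Fh_coords: "V \<in> phase_space L \<Longrightarrow> Fh (coords V) = FS V"
  using FS_lipschitz[OF state_of(1)[of "coords V"], of V] by (simp add: Fh_def coords_drop0)

lemma coord_FS_0: "V \<in> phase_space L \<Longrightarrow> coord (fst (FS V)) 0 = 0 \<and> coord (snd (FS V)) 0 = 0"
proof -
  assume V: "V \<in> phase_space L"
  have "coord (grad_product i (wt V) (wv V j)) 0 = 0" for i j
    using grad_product(2)[OF wt[OF V] wv[OF V], of i j 0] by (simp add: wave_zero)
  then show ?thesis using f_zero
    by (simp add: FS_def G_def heat_part_def coord_dd dir_zero L2_zero_iff)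
qed

lemma coord_Fh_0: "coord (fst (Fh x)) 0 = 0" "coord (snd (Fh x)) 0 = 0"
  using coord_FS_0[OF state_of(1)] by (simp_all add: Fh_def)

lemma coords_0: "V \<in> phase_space L \<Longrightarrow> coord (fst (coords V)) 0 = 0 \<and> coord (snd (coords V)) 0 = 0"
  by (simp add: coords_def coord_vfourier_0 phase_spaceD) (metis L2_zero_iff phase_spaceD(2))

lemma continuous_coords:
  assumes "continuous_curve L V"
  shows "continuous_on {0..} (\<lambda>t. coords (V t))"
  unfolding continuous_on_def
proof
  fix t :: real assume t: "t \<in> {0..}"
  have ph: "V s \<in> phase_space L" if "s \<ge> 0" for s using assms that by (simp add: continuous_curve_def)
  have "((\<lambda>s. state_dist L (V s) (V t)) \<longlongrightarrow> 0) (at t within {0..})"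
    using assms t by (simp add: continuous_curve_def)
  moreover have "\<forall>\<^sub>F s in at t within {0..}. state_dist L (V s) (V t) = norm (coords (V s) - coords (V t))"
    unfolding eventually_at_filter by (rule always_eventually) (use ph t state_dist_coords in auto)
  ultimately have "((\<lambda>s. norm (coords (V s) - coords (V t))) \<longlongrightarrow> 0) (at t within {0..})"
    by (rule Lim_transform_eventually)
  then have "((\<lambda>s. coords (V s) - coords (V t)) \<longlongrightarrow> 0) (at t within {0..})"
    by (rule tendsto_norm_zero_cancel)
  then show "((\<lambda>s. coords (V s)) \<longlongrightarrow> coords (V t)) (at t within {0..})" by (simp add: LIM_zero_iff)
qed

lemma ip_laplacian: "ip L u (laplacian (e k)) = - (norm (wave L k))\<^sup>2 * cf u k" for u :: "real^2 \<Rightarrow> real"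
  unfolding laplacian_hartley ip_scalar cf_def by (rule integral_mult_scale)

text \<open>The weak equations are tested with single basis functions. For the velocity the two
  components are combined along \<open>dir k\<close>, a combination that \<open>leray\<close> leaves
  unchanged, so the projected forcing becomes a coordinate of \<open>Fh\<close>.\<close>

lemma solution_coeffs:
  assumes sol: "truncated_solution \<nu> \<kappa> L \<alpha> N f chi \<rho> V" and t: "t \<ge> 0"
  shows "((\<lambda>s. - (\<nu> * (norm (wave L k))\<^sup>2) * coord (fst (coords (V s))) k + coord (fst (Fh (coords (V s)))) k)
      has_integral coord (fst (coords (V t))) k - coord (fst (coords (V 0))) k) {0..t}" (is ?A)
    and "((\<lambda>s. - (\<kappa> * (norm (wave L k))\<^sup>2) * coord (snd (coords (V s))) k + coord (snd (Fh (coords (V s)))) k)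
      has_integral coord (snd (coords (V t))) k - coord (snd (coords (V 0))) k) {0..t}" (is ?B)
proof -
  have ph: "V s \<in> phase_space L" if "s \<ge> 0" for s
    using sol that by (simp add: truncated_solution_def continuous_curve_def)
  define q where "q s = (\<lambda>y. momentum_flux_div L \<alpha> N (fst (V s)) y - snd (V s) y *\<^sub>R axis 2 1)" for s
  define c where "c s = cut L \<alpha> N chi \<rho> (V s)" for s
  define w2 where "w2 = (norm (wave L k))\<^sup>2"
  have comp: "((\<lambda>s. \<nu> * (- w2 * cf (\<lambda>x. fst (V s) x $ j) k) - c s * cf (\<lambda>x. leray L (q s) x $ j) k)
      has_integral cf (\<lambda>x. fst (V t) x $ j) k - cf (\<lambda>x. fst (V 0) x $ j) k) {0..t}" for j
  proof -
    have "weak_heat L \<nu> (\<lambda>t x. fst (V t) x $ j) (\<lambda>t x. - (c t * leray L (q t) x $ j))"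
      using sol unfolding truncated_solution_def q_def c_def by blast
    then have "((\<lambda>s. \<nu> * ip L (\<lambda>x. fst (V s) x $ j) (laplacian (e k)) + ip L (\<lambda>x. - (c s * leray L (q s) x $ j)) (e k))
        has_integral ip L (\<lambda>x. fst (V t) x $ j) (e k) - ip L (\<lambda>x. fst (V 0) x $ j) (e k)) {0..t}"
      using t test_fun_hartley[OF L_pos] unfolding weak_heat_def by blast
    moreover have "ip L (\<lambda>x. - (c s * leray L (q s) x $ j)) (e k) = - c s * cf (\<lambda>x. leray L (q s) x $ j) k" for s
      using cf_scale[of "- c s" "\<lambda>x. leray L (q s) x $ j" k] by (simp add: cf_ip)
    ultimately have "((\<lambda>s. \<nu> * (- w2 * cf (\<lambda>x. fst (V s) x $ j) k) + - c s * cf (\<lambda>x. leray L (q s) x $ j) k)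
        has_integral cf (\<lambda>x. fst (V t) x $ j) k - cf (\<lambda>x. fst (V 0) x $ j) k) {0..t}"
      by (simp only: ip_laplacian w2_def cf_ip[symmetric])
    then show ?thesis by (simp only: mult_minus_left add_uminus_conv_diff)
  qed
  have "((\<lambda>s. dir k 1 * (\<nu> * (- w2 * cf (\<lambda>x. fst (V s) x $ 1) k) - c s * cf (\<lambda>x. leray L (q s) x $ 1) k) +
      dir k 2 * (\<nu> * (- w2 * cf (\<lambda>x. fst (V s) x $ 2) k) - c s * cf (\<lambda>x. leray L (q s) x $ 2) k))
      has_integral dir k 1 * (cf (\<lambda>x. fst (V t) x $ 1) k - cf (\<lambda>x. fst (V 0) x $ 1) k) +
        dir k 2 * (cf (\<lambda>x. fst (V t) x $ 2) k - cf (\<lambda>x. fst (V 0) x $ 2) k)) {0..t}"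
    by (intro has_integral_add has_integral_mult_right comp)
  moreover have "dir k 1 * (cf (\<lambda>x. fst (V t) x $ 1) k - cf (\<lambda>x. fst (V 0) x $ 1) k) +
        dir k 2 * (cf (\<lambda>x. fst (V t) x $ 2) k - cf (\<lambda>x. fst (V 0) x $ 2) k) =
      coord (fst (coords (V t))) k - coord (fst (coords (V 0))) k"
    using H_div_components(3)[OF phase_spaceD(1)[OF ph]] t by (simp add: coords_def coord_vfourier zc_def algebra_simps)
  moreover have "dir k 1 * (\<nu> * (- w2 * cf (\<lambda>x. fst (V s) x $ 1) k) - c s * cf (\<lambda>x. leray L (q s) x $ 1) k) +
      dir k 2 * (\<nu> * (- w2 * cf (\<lambda>x. fst (V s) x $ 2) k) - c s * cf (\<lambda>x. leray L (q s) x $ 2) k) =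
      - (\<nu> * w2) * coord (fst (coords (V s))) k + coord (fst (Fh (coords (V s)))) k" if s: "s \<in> {0..t}" for s
  proof -
    have p: "V s \<in> phase_space L" using ph s by simp
    have "coord (fst (Fh (coords (V s)))) k = - c s * coord (fst (G (V s))) k"
      by (simp add: Fh_coords[OF p] FS_def c_def)
    also have "coord (fst (G (V s))) k = zc (leray L (q s)) k"
      using leray(2)[OF momentum_forcing(1)[OF p]] momentum_forcing(2)[OF p] by (simp add: q_def)
    finally have 1: "coord (fst (Fh (coords (V s)))) k = - c s * zc (leray L (q s)) k" .
    have 2: "coord (fst (coords (V s))) k = zc (fst (V s)) k"
      using H_div_components(3)[OF phase_spaceD(1)[OF p]] by (simp add: coords_def coord_vfourier)
    show ?thesis unfolding 1 2 zc_def by (simp add: algebra_simps)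
  qed
  ultimately show ?A unfolding w2_def[symmetric] by (subst has_integral_cong[symmetric]) auto
  have "weak_heat L \<kappa> (\<lambda>t. snd (V t)) (\<lambda>t x. - (c t * (heat_flux_div L \<alpha> N (fst (V t)) (snd (V t)) x - f x)))"
    using sol unfolding truncated_solution_def c_def by blast
  then have "((\<lambda>s. \<kappa> * ip L (snd (V s)) (laplacian (e k)) +
      ip L (\<lambda>x. - (c s * (heat_flux_div L \<alpha> N (fst (V s)) (snd (V s)) x - f x))) (e k))
      has_integral ip L (snd (V t)) (e k) - ip L (snd (V 0)) (e k)) {0..t}"
    using t test_fun_hartley[OF L_pos] unfolding weak_heat_def by blast
  moreover have "ip L (snd (V s)) (e k) = coord (snd (coords (V s))) k" if "s \<ge> 0" for s
    using phase_spaceD(3)[OF ph[OF that]] by (simp add: coords_def cf_ip)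
  moreover have "\<kappa> * ip L (snd (V s)) (laplacian (e k)) +
      ip L (\<lambda>x. - (c s * (heat_flux_div L \<alpha> N (fst (V s)) (snd (V s)) x - f x))) (e k) =
      - (\<kappa> * w2) * coord (snd (coords (V s))) k + coord (snd (Fh (coords (V s)))) k" if s: "s \<in> {0..t}" for s
  proof -
    have p: "V s \<in> phase_space L" using ph s by simp
    have "ip L (\<lambda>x. - (c s * (heat_flux_div L \<alpha> N (fst (V s)) (snd (V s)) x - f x))) (e k) =
        - c s * cf (\<lambda>x. heat_flux_div L \<alpha> N (fst (V s)) (snd (V s)) x - f x) k"
      using cf_scale[of "- c s" "\<lambda>x. heat_flux_div L \<alpha> N (fst (V s)) (snd (V s)) x - f x" k] by (simp add: cf_ip)
    also have "\<dots> = coord (snd (Fh (coords (V s)))) k"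
      by (simp add: heat_forcing(2)[OF p] Fh_coords[OF p] FS_def c_def)
    finally have 1: "ip L (\<lambda>x. - (c s * (heat_flux_div L \<alpha> N (fst (V s)) (snd (V s)) x - f x))) (e k) =
        coord (snd (Fh (coords (V s)))) k" .
    have 2: "coord (snd (coords (V s))) k = cf (snd (V s)) k"
      using phase_spaceD(3)[OF p] by (simp add: coords_def)
    show ?thesis unfolding 1 2 ip_laplacian w2_def by simp
  qed
  ultimately show ?B unfolding w2_def[symmetric] using t by (subst has_integral_cong[symmetric]) auto
qed

end

section \<open>Diagonal semigroups\<close>

lemma bounded_linear_diag:
  assumes d: "\<And>i. \<bar>d i\<bar> \<le> B"
  shows "bounded_linear (diag d)"
proof (rule bounded_linear_intro)
  show "diag d (x + y) = diag d x + diag d y" for x y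
    by (rule ell2_eqI) (simp add: coord_diag[of d B] d algebra_simps)
  show "diag d (r *\<^sub>R x) = r *\<^sub>R diag d x" for r x
    by (rule ell2_eqI) (simp add: coord_diag[of d B] d)
  have "B \<ge> 0" using d[of undefined] by linarith
  then have "norm (diag d x) \<le> B * norm x" for x
    by (intro norm_ell2_mono) (simp_all add: coord_diag[of d B] d abs_mult mult_right_mono)
  then show "norm (diag d x) \<le> norm x * B" for x by (simp add: mult.commute)
qed

lift_definition unit_ell2 :: "'i \<Rightarrow> 'i ell2" is "\<lambda>i j. if j = i then 1 else 0"
proof (rule square_summableI)
  fix i :: 'i and K :: "'i set" assume K: "finite K"
  have "(\<Sum>j\<in>K. (if j = i then 1 else 0 :: real)\<^sup>2) = (\<Sum>j\<in>K. if j = i then 1 else 0)"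
    by (intro sum.cong) auto
  also have "\<dots> \<le> 1" using K by (simp add: sum.delta)
  finally show "(\<Sum>j\<in>K. (if j = i then 1 else 0 :: real)\<^sup>2) \<le> 1" .
qed

lemma coord_unit: "coord (unit_ell2 i) j = (if j = i then 1 else 0)"
  by transfer simp

lemma ell2_finite_approximation:
  assumes \<epsilon>: "\<epsilon> > 0"
  shows "\<exists>K. finite K \<and> norm (x - (\<Sum>i\<in>K. coord x i *\<^sub>R unit_ell2 i)) \<le> \<epsilon>"
proof -
  have "(norm x)\<^sup>2 - \<epsilon>\<^sup>2 < (norm x)\<^sup>2" using \<epsilon> by simp
  then have "\<forall>\<^sub>F K in finite_subsets_at_top UNIV. (norm x)\<^sup>2 - \<epsilon>\<^sup>2 < (\<Sum>i\<in>K. (coord x i)\<^sup>2)"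
    using has_sum_norm_ell2[of x] unfolding has_sum_def by (rule order_tendstoD(1)[rotated])
  then obtain K where K: "finite K" "(norm x)\<^sup>2 - \<epsilon>\<^sup>2 < (\<Sum>i\<in>K. (coord x i)\<^sup>2)"
    unfolding eventually_finite_subsets_at_top by auto
  define y where "y = x - (\<Sum>i\<in>K. coord x i *\<^sub>R unit_ell2 i)"
  have y: "coord y j = (if j \<in> K then 0 else coord x j)" for j
    using K(1) by (simp add: y_def coord_sum coord_unit if_distrib cong: if_cong)
  have "norm y \<le> \<epsilon>"
  proof (rule norm_ell2_leI)
    fix J :: "'a set" assume J: "finite J"
    have "(\<Sum>j\<in>J. (coord y j)\<^sup>2) \<le> (\<Sum>j\<in>J \<union> K. (coord y j)\<^sup>2)" using J K by (intro sum_mono2) auto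
    also have "\<dots> = (\<Sum>j\<in>(J \<union> K) - K. (coord y j)\<^sup>2)"
      using J K by (intro sum.mono_neutral_right) (auto simp: y)
    also have "\<dots> = (\<Sum>j\<in>(J \<union> K) - K. (coord x j)\<^sup>2)" by (intro sum.cong) (auto simp: y)
    also have "\<dots> = (\<Sum>j\<in>J \<union> K. (coord x j)\<^sup>2) - (\<Sum>j\<in>K. (coord x j)\<^sup>2)"
      using J K by (intro sum_diff) auto
    also have "\<dots> \<le> \<epsilon>\<^sup>2" using sum_squares_le_norm[of "J \<union> K" x] J K by simp
    finally show "(\<Sum>j\<in>J. (coord y j)\<^sup>2) \<le> \<epsilon>\<^sup>2" .
  qed (use \<epsilon> in simp)
  then show ?thesis using K(1) by (auto simp: y_def)
qed

text \<open>For a finitely supported vector the curve is a finite sum of continuous terms.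
  Multipliers bounded by \<open>1\<close> make the approximation by such vectors uniform in
  \<open>t\<close>.\<close>

lemma continuous_on_diag:
  fixes S :: "real set"
  assumes c: "\<And>i. continuous_on S (\<lambda>t. d t i)" and b: "\<And>t i. t \<in> S \<Longrightarrow> \<bar>d t i\<bar> \<le> 1"
  shows "continuous_on S (\<lambda>t. diag (d t) x)"
proof -
  have "\<exists>K. finite K \<and> norm (x - (\<Sum>i\<in>K. coord x i *\<^sub>R unit_ell2 i)) \<le> inverse (real (Suc n))" for n
    by (rule ell2_finite_approximation) simp
  then obtain K where K: "\<And>n. finite (K n)"
    "\<And>n. norm (x - (\<Sum>i\<in>K n. coord x i *\<^sub>R unit_ell2 i)) \<le> inverse (real (Suc n))" by metis
  define X where "X n = (\<Sum>i\<in>K n. coord x i *\<^sub>R unit_ell2 i)" for n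
  show ?thesis
  proof (rule uniform_limit_theorem[where F = sequentially])
    have "continuous_on S (\<lambda>t. diag (d t) (X n))" for n
    proof -
      have eq: "diag (d t) (X n) = (\<Sum>i\<in>K n. (d t i * coord x i) *\<^sub>R unit_ell2 i)" if "t \<in> S" for t
        by (rule ell2_eqI)
           (use K(1)[of n] b[OF that] in \<open>simp add: coord_diag[of _ 1] X_def coord_sum coord_unit if_distrib cong: if_cong\<close>)
      have "continuous_on S (\<lambda>t. \<Sum>i\<in>K n. (d t i * coord x i) *\<^sub>R unit_ell2 i)"
        by (intro continuous_intros c)
      then show ?thesis by (simp add: eq cong: continuous_on_cong)
    qed
    then show "\<forall>\<^sub>F n in sequentially. continuous_on S (\<lambda>t. diag (d t) (X n))" by simp
    show "uniform_limit S (\<lambda>n t. diag (d t) (X n)) (\<lambda>t. diag (d t) x) sequentially"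
    proof (rule uniform_limitI)
      fix \<epsilon> :: real assume "\<epsilon> > 0"
      then have "\<forall>\<^sub>F n in sequentially. inverse (real (Suc n)) < \<epsilon>"
        using order_tendstoD(2)[OF LIMSEQ_inverse_real_of_nat] by blast
      then show "\<forall>\<^sub>F n in sequentially. \<forall>t\<in>S. dist (diag (d t) (X n)) (diag (d t) x) < \<epsilon>"
      proof eventually_elim
        case (elim n)
        have "dist (diag (d t) (X n)) (diag (d t) x) \<le> inverse (real (Suc n))" if t: "t \<in> S" for t
        proof -
          have "diag (d t) (X n) - diag (d t) x = diag (d t) (X n - x)"
            using bounded_linear.linear[OF bounded_linear_diag[of "d t", OF b[OF t]]] by (simp add: linear_diff)
          also have "norm \<dots> \<le> 1 * norm (X n - x)"
            using b[OF t] by (intro norm_ell2_mono) (simp_all add: coord_diag[of _ 1] abs_mult mult_left_le_one_le)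
          also have "\<dots> \<le> inverse (real (Suc n))" using K(2)[of n] by (simp add: X_def norm_minus_commute)
          finally show ?thesis by (simp add: dist_norm)
        qed
        then show ?case using elim by (meson le_less_trans)
      qed
    qed
  qed simp
qed

text \<open>The rates are those of decay, so running time backwards gives the growing exponential;
  it is bounded because only rates up to \<open>a\<close> are kept.\<close>

definition slow_flow :: "('i \<Rightarrow> real) \<Rightarrow> real \<Rightarrow> real \<Rightarrow> 'i ell2 \<Rightarrow> 'i ell2" where
  "slow_flow rt a t = diag (\<lambda>i. if rt i \<le> a then exp (rt i * t) else 0)"

definition fast_flow :: "('i \<Rightarrow> real) \<Rightarrow> real \<Rightarrow> real \<Rightarrow> 'i ell2 \<Rightarrow> 'i ell2" where
  "fast_flow rt a t = diag (\<lambda>i. if rt i \<le> a then 0 else exp (- rt i * t))"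

lemma slow_factor_le: "t \<ge> 0 \<Longrightarrow> \<bar>if rt i \<le> a then exp (rt i * t) else 0\<bar> \<le> exp (a * t)" for a t :: real
  by (simp add: mult_right_mono)

lemma fast_factor_le:
  "t \<ge> 0 \<Longrightarrow> (\<And>i. rt i \<le> a \<or> b \<le> rt i) \<Longrightarrow> \<bar>if rt i \<le> a then 0 else exp (- rt i * t)\<bar> \<le> exp (- b * t)"
  for a b t :: real
  by (auto intro!: mult_right_mono)

lemma coord_slow_flow:
  "t \<ge> 0 \<Longrightarrow> coord (slow_flow rt a t x) i = (if rt i \<le> a then exp (rt i * t) else 0) * coord x i"
  unfolding slow_flow_def by (rule coord_diag[OF slow_factor_le])

lemma coord_fast_flow:
  "t \<ge> 0 \<Longrightarrow> (\<And>i. rt i \<le> a \<or> b \<le> rt i) \<Longrightarrow>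
    coord (fast_flow rt a t x) i = (if rt i \<le> a then 0 else exp (- rt i * t)) * coord x i"
  unfolding fast_flow_def by (rule coord_diag[OF fast_factor_le])

lemma growth_semigroup_slow_flow: "growth_semigroup (slow_flow rt a) a"
proof (rule growth_semigroup.intro)
  fix s t :: real and x :: "'a ell2"
  show "bounded_linear (slow_flow rt a t)" if "t \<ge> 0"
    unfolding slow_flow_def by (rule bounded_linear_diag[OF slow_factor_le[OF that]])
  show "slow_flow rt a (s + t) x = slow_flow rt a s (slow_flow rt a t x)" if "s \<ge> 0" "t \<ge> 0"
    using that by (intro ell2_eqI) (simp add: coord_slow_flow distrib_left exp_add)
  show "norm (slow_flow rt a t x) \<le> exp (a * t) * norm x" if "t \<ge> 0"
    by (rule norm_ell2_mono[OF _ exp_ge_zero])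
       (simp only: coord_slow_flow[OF that] abs_mult, rule mult_right_mono[OF slow_factor_le[OF that] abs_ge_zero])
  \<comment> \<open>Taking out the factor \<open>exp (a * t)\<close> leaves multipliers bounded by
    \<open>1\<close>, as \<open>continuous_on_diag\<close> requires.\<close>
  have "continuous_on {0..} (\<lambda>t. exp (a * t) *\<^sub>R diag (\<lambda>i. if rt i \<le> a then exp ((rt i - a) * t) else 0) x)"
  proof (intro continuous_intros continuous_on_diag)
    show "continuous_on {0..} (\<lambda>t. if rt i \<le> a then exp ((rt i - a) * t) else 0)" for i
      by (cases "rt i \<le> a") (auto intro!: continuous_intros)
  qed (simp add: mult_nonpos_nonneg)
  moreover have "exp (a * t) *\<^sub>R diag (\<lambda>i. if rt i \<le> a then exp ((rt i - a) * t) else 0) x = slow_flow rt a t x"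
    if "t \<in> {0..}" for t
  proof (rule ell2_eqI)
    fix i
    have "\<bar>if rt i \<le> a then exp ((rt i - a) * t) else 0\<bar> \<le> 1" for i
      using that by (simp add: mult_nonpos_nonneg)
    moreover have "exp (a * t) * exp ((rt i - a) * t) = exp (rt i * t)"
      by (simp add: exp_add[symmetric] algebra_simps)
    ultimately show "coord (exp (a * t) *\<^sub>R diag (\<lambda>i. if rt i \<le> a then exp ((rt i - a) * t) else 0) x) i =
        coord (slow_flow rt a t x) i"
      using that by (simp add: coord_slow_flow coord_diag[of _ 1])
  qed
  ultimately show "continuous_on {0..} (\<lambda>t. slow_flow rt a t x)"
    by (rule continuous_on_cong[THEN iffD1, OF refl, rotated])
qed

lemma growth_semigroup_fast_flow:
  assumes gap: "\<And>i. rt i \<le> a \<or> b \<le> rt i" and b: "b \<ge> 0"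
  shows "growth_semigroup (fast_flow rt a) (- b)"
proof (rule growth_semigroup.intro)
  fix s t :: real and x :: "'a ell2"
  show "bounded_linear (fast_flow rt a t)" if "t \<ge> 0"
    unfolding fast_flow_def by (rule bounded_linear_diag[OF fast_factor_le[where rt = rt, OF that gap]])
  show "fast_flow rt a (s + t) x = fast_flow rt a s (fast_flow rt a t x)" if "s \<ge> 0" "t \<ge> 0"
    using that by (intro ell2_eqI) (simp add: coord_fast_flow[where rt = rt, OF _ gap] right_diff_distrib exp_diff exp_minus field_simps)
  show "norm (fast_flow rt a t x) \<le> exp (- b * t) * norm x" if "t \<ge> 0"
    by (rule norm_ell2_mono[OF _ exp_ge_zero])
       (simp only: coord_fast_flow[where rt = rt, OF that gap] abs_mult, rule mult_right_mono[OF fast_factor_le[where rt = rt, OF that gap] abs_ge_zero])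
  show "continuous_on {0..} (\<lambda>t. fast_flow rt a t x)"
    unfolding fast_flow_def
  proof (rule continuous_on_diag)
    show "continuous_on {0..} (\<lambda>t. if rt i \<le> a then 0 else exp (- rt i * t))" for i
      by (cases "rt i \<le> a") (auto intro!: continuous_intros)
    show "\<bar>if rt i \<le> a then 0 else exp (- rt i * t)\<bar> \<le> 1" if "t \<in> {0..}" for t i
    proof -
      have t: "t \<ge> 0" using that by simp
      have "exp (- b * t) \<le> 1" using b t by simp
      then show ?thesis by (rule order_trans[OF fast_factor_le[where rt = rt, OF t gap]])
    qed
  qed
qed

lemma growth_semigroup_Pair:
  assumes U: "growth_semigroup U \<omega>" and V: "growth_semigroup V \<omega>"
  shows "growth_semigroup (\<lambda>t z. (U t (fst z), V t (snd z))) \<omega>"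
proof -
  interpret U: growth_semigroup U \<omega> by (rule U)
  interpret V: growth_semigroup V \<omega> by (rule V)
  show ?thesis
  proof (rule growth_semigroup.intro)
    fix s t :: real and z
    show "bounded_linear (\<lambda>z. (U t (fst z), V t (snd z)))" if "t \<ge> 0"
      by (intro bounded_linear_Pair bounded_linear_compose[OF U.linear[OF that]]
          bounded_linear_compose[OF V.linear[OF that]] bounded_linear_fst bounded_linear_snd)
    show "(U (s + t) (fst z), V (s + t) (snd z)) =
      (U s (fst (U t (fst z), V t (snd z))), V s (snd (U t (fst z), V t (snd z))))" if "s \<ge> 0" "t \<ge> 0"
      using that by (simp add: U.semigroup V.semigroup)
    show "norm (U t (fst z), V t (snd z)) \<le> exp (\<omega> * t) * norm z" if "t \<ge> 0"
    proof -
      have "(norm (U t (fst z), V t (snd z)))\<^sup>2 \<le> (exp (\<omega> * t) * norm (fst z))\<^sup>2 + (exp (\<omega> * t) * norm (snd z))\<^sup>2"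
        by (simp add: norm_Pair) (intro add_mono power_mono U.growth V.growth that; simp)
      also have "\<dots> = (exp (\<omega> * t) * norm z)\<^sup>2"
        by (simp add: norm_prod_def power_mult_distrib distrib_left)
      finally show ?thesis by (rule power2_le_imp_le) simp
    qed
    show "continuous_on {0..} (\<lambda>t. (U t (fst z), V t (snd z)))"
      by (intro continuous_on_Pair U.strongly_continuous V.strongly_continuous)
  qed
qed

text \<open>Continuity turns the integral equation into a differential equation, whose integrating
  factor gives explicit antiderivatives. The first formula looks back from \<open>t\<close> and
  serves the fast modes; the second looks ahead from \<open>s\<close> and serves the slow
  modes.\<close>

lemma scalar_duhamel:
  fixes c g :: "real \<Rightarrow> real"
  assumes c: "continuous_on {0..} c" and g: "continuous_on {0..} g"
    and eq: "\<And>t. t \<ge> 0 \<Longrightarrow> ((\<lambda>s. - l * c s + g s) has_integral c t - c 0) {0..t}"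
    and st: "0 \<le> s" "s \<le> t"
  shows "((\<lambda>r. exp (- l * r) * g (t - r)) has_integral c t - exp (- l * (t - s)) * c s) {0..t - s}"
    and "((\<lambda>r. exp (l * r) * g (s + r)) has_integral exp (l * (t - s)) * c t - c s) {0..t - s}"
proof -
  have deriv: "(c has_real_derivative - l * c x + g x) (at x within {0..t})" if x: "x \<in> {0..t}" for x
  proof -
    have "continuous_on {0..t} (\<lambda>s. - l * c s + g s)"
      by (intro continuous_intros continuous_on_subset[OF c] continuous_on_subset[OF g]) auto
    from integral_has_vector_derivative[OF this x]
    have "((\<lambda>u. c 0 + integral {0..u} (\<lambda>s. - l * c s + g s)) has_real_derivative - l * c x + g x) (at x within {0..t})"
      by (auto intro!: derivative_eq_intros simp: has_real_derivative_iff_has_vector_derivative[symmetric])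
    moreover have "c 0 + integral {0..u} (\<lambda>s. - l * c s + g s) = c u" if "u \<in> {0..t}" for u
      using integral_unique[OF eq[of u]] that by simp
    ultimately show ?thesis
      by (rule has_field_derivative_transform_within[OF _ zero_less_one x])
  qed
  have d1: "((\<lambda>r. c (t - r)) has_real_derivative - (- l * c (t - r) + g (t - r))) (at r within {0..t - s})"
    if r: "r \<in> {0..t - s}" for r
  proof -
    have "(c has_real_derivative - l * c (t - r) + g (t - r)) (at (t - r) within (\<lambda>r. t - r) ` {0..t - s})"
      by (rule DERIV_subset[OF deriv]) (use r st in auto)
    moreover have "((\<lambda>r. t - r) has_real_derivative - 1) (at r within {0..t - s})"
      by (auto intro!: derivative_eq_intros)
    ultimately show ?thesis using DERIV_image_chain by (fastforce simp: o_def)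
  qed
  have d2: "((\<lambda>r. c (s + r)) has_real_derivative - l * c (s + r) + g (s + r)) (at r within {0..t - s})"
    if r: "r \<in> {0..t - s}" for r
  proof -
    have "(c has_real_derivative - l * c (s + r) + g (s + r)) (at (s + r) within (\<lambda>r. s + r) ` {0..t - s})"
      by (rule DERIV_subset[OF deriv]) (use r st in auto)
    moreover have "((\<lambda>r. s + r) has_real_derivative 1) (at r within {0..t - s})"
      by (auto intro!: derivative_eq_intros)
    ultimately show ?thesis using DERIV_image_chain by (fastforce simp: o_def)
  qed
  have "((\<lambda>r. exp (- l * r) * g (t - r)) has_integral
      - (exp (- l * (t - s)) * c (t - (t - s))) - (- (exp (- l * 0) * c (t - 0)))) {0..t - s}"
  proof (rule fundamental_theorem_of_calculus)
    fix r assume r: "r \<in> {0..t - s}"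
    have "((\<lambda>r. - (exp (- l * r) * c (t - r))) has_real_derivative exp (- l * r) * g (t - r)) (at r within {0..t - s})"
      by (rule derivative_eq_intros d1[OF r] refl)+ (simp add: algebra_simps)
    then show "((\<lambda>r. - (exp (- l * r) * c (t - r))) has_vector_derivative exp (- l * r) * g (t - r)) (at r within {0..t - s})"
      by (simp only: has_real_derivative_iff_has_vector_derivative)
  qed (use st in simp)
  then show "((\<lambda>r. exp (- l * r) * g (t - r)) has_integral c t - exp (- l * (t - s)) * c s) {0..t - s}" by simp
  have "((\<lambda>r. exp (l * r) * g (s + r)) has_integral
      exp (l * (t - s)) * c (s + (t - s)) - exp (l * 0) * c (s + 0)) {0..t - s}"
  proof (rule fundamental_theorem_of_calculus)
    fix r assume r: "r \<in> {0..t - s}"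
    have "((\<lambda>r. exp (l * r) * c (s + r)) has_real_derivative exp (l * r) * g (s + r)) (at r within {0..t - s})"
      by (rule derivative_eq_intros d2[OF r] refl)+ (simp add: algebra_simps)
    then show "((\<lambda>r. exp (l * r) * c (s + r)) has_vector_derivative exp (l * r) * g (s + r)) (at r within {0..t - s})"
      by (simp only: has_real_derivative_iff_has_vector_derivative)
  qed (use st in simp)
  then show "((\<lambda>r. exp (l * r) * g (s + r)) has_integral exp (l * (t - s)) * c t - c s) {0..t - s}" by simp
qed

section \<open>The inertial manifold\<close>

locale gapped = truncated +
  fixes \<nu> \<kappa> a b :: real
  assumes visc: "\<nu> > 0" "\<kappa> > 0" and a_pos: "a \<ge> 0" and ab: "a + 4 * \<Lambda>F < b"
    and gap1: "\<nu> * (norm (wave L k))\<^sup>2 \<le> a \<or> b \<le> \<nu> * (norm (wave L k))\<^sup>2"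
    and gap2: "\<kappa> * (norm (wave L k))\<^sup>2 \<le> a \<or> b \<le> \<kappa> * (norm (wave L k))\<^sup>2"
begin

text \<open>
  The zero mode does not occur in the phase space; giving it the fast rate \<open>b\<close> forces it to vanish
  on the invariant manifold of the extended system.
\<close>

definition rate :: "real \<Rightarrow> int^2 \<Rightarrow> real" where
  "rate \<eta> k = (if k = 0 then b else \<eta> * (norm (wave L k))\<^sup>2)"

lemma b_above: "a < b" "b \<ge> 0"
  using ab \<Lambda>F_pos a_pos by auto

lemma rate_gap: "rate \<nu> k \<le> a \<or> b \<le> rate \<nu> k" "rate \<kappa> k \<le> a \<or> b \<le> rate \<kappa> k"
  using gap1[of k] gap2[of k] by (auto simp: rate_def)

definition Ub :: "real \<Rightarrow> coeffs \<Rightarrow> coeffs" where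
  "Ub t z = (slow_flow (rate \<nu>) a t (fst z), slow_flow (rate \<kappa>) a t (snd z))"

definition Uf :: "real \<Rightarrow> coeffs \<Rightarrow> coeffs" where
  "Uf t z = (fast_flow (rate \<nu>) a t (fst z), fast_flow (rate \<kappa>) a t (snd z))"

lemma coord_Ub:
  "t \<ge> 0 \<Longrightarrow> coord (fst (Ub t z)) k = (if rate \<nu> k \<le> a then exp (rate \<nu> k * t) else 0) * coord (fst z) k"
  "t \<ge> 0 \<Longrightarrow> coord (snd (Ub t z)) k = (if rate \<kappa> k \<le> a then exp (rate \<kappa> k * t) else 0) * coord (snd z) k"
  unfolding Ub_def fst_conv snd_conv by (rule coord_slow_flow; assumption)+

lemma coord_Uf:
  "t \<ge> 0 \<Longrightarrow> coord (fst (Uf t z)) k = (if rate \<nu> k \<le> a then 0 else exp (- rate \<nu> k * t)) * coord (fst z) k"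
  "t \<ge> 0 \<Longrightarrow> coord (snd (Uf t z)) k = (if rate \<kappa> k \<le> a then 0 else exp (- rate \<kappa> k * t)) * coord (snd z) k"
  unfolding Uf_def fst_conv snd_conv
  by (rule coord_fast_flow[OF _ rate_gap(1)] coord_fast_flow[OF _ rate_gap(2)]; assumption)+

lemma coeffs_eqI:
  fixes x y :: coeffs
  assumes "\<And>k. coord (fst x) k = coord (fst y) k" "\<And>k. coord (snd x) k = coord (snd y) k"
  shows "x = y"
  using assms by (intro prod_eqI ell2_eqI)

sublocale dichotomy Ub Uf a b Fh KF \<Lambda>F
proof -
  have b: "growth_semigroup Ub a"
    using growth_semigroup_Pair[OF growth_semigroup_slow_flow growth_semigroup_slow_flow] unfolding Ub_def .
  have f: "growth_semigroup Uf (- b)"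
    using growth_semigroup_Pair[OF growth_semigroup_fast_flow[OF rate_gap(1) b_above(2)]
        growth_semigroup_fast_flow[OF rate_gap(2) b_above(2)]] unfolding Uf_def .
  show "dichotomy Ub Uf a b Fh KF \<Lambda>F"
  proof (intro dichotomy.intro b f dichotomy_axioms.intro)
    show "Ub 0 x + Uf 0 x = x" for x
      by (rule coeffs_eqI) (simp_all add: coord_Ub coord_Uf)
    show "Ub s (Uf t x) = 0" if "s \<ge> 0" "t \<ge> 0" for s t x
      by (rule coeffs_eqI) (simp_all add: coord_Ub coord_Uf that)
    show "Uf s (Ub t x) = 0" if "s \<ge> 0" "t \<ge> 0" for s t x
      by (rule coeffs_eqI) (simp_all add: coord_Ub coord_Uf that)
  qed (use norm_Fh_le Fh_lipschitz a_pos \<Lambda>F_pos ab in auto)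
qed

text \<open>Coordinates are bounded linear functionals, hence commute with the integral and separate
  points. Each vector identity thus splits into scalar Duhamel formulas, one for every mode.\<close>

lemma mild_if_coordinates:
  assumes c: "continuous_on {0..} C"
    and 1: "\<And>k t. t \<ge> 0 \<Longrightarrow> ((\<lambda>s. - rate \<nu> k * coord (fst (C s)) k + coord (fst (Fh (C s))) k)
      has_integral coord (fst (C t)) k - coord (fst (C 0)) k) {0..t}"
    and 2: "\<And>k t. t \<ge> 0 \<Longrightarrow> ((\<lambda>s. - rate \<kappa> k * coord (snd (C s)) k + coord (snd (Fh (C s))) k)
      has_integral coord (snd (C t)) k - coord (snd (C 0)) k) {0..t}"
  shows "mild C {0..}"
  unfolding mild_def
proof (intro conjI ballI impI)
  fix s t :: real assume "s \<in> {0..}" "t \<in> {0..}" and st: "s \<le> t"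
  then have s: "0 \<le> s" by simp
  define x where "x = t - s"
  have x: "x \<ge> 0" using st by (simp add: x_def)
  have bl1: "bounded_linear (\<lambda>z::coeffs. coord (fst z) k)" and bl2: "bounded_linear (\<lambda>z::coeffs. coord (snd z) k)" for k
    by (rule bounded_linear_compose[OF bounded_linear_coord] bounded_linear_fst bounded_linear_snd)+
  have cF: "continuous_on {0..} (\<lambda>t. Fh (C t))" by (rule continuous_on_F_comp[OF c])
  have cc: "continuous_on {0..} (\<lambda>t. coord (fst (C t)) k)" "continuous_on {0..} (\<lambda>t. coord (snd (C t)) k)"
    "continuous_on {0..} (\<lambda>t. coord (fst (Fh (C t))) k)" "continuous_on {0..} (\<lambda>t. coord (snd (Fh (C t))) k)" for k
    by (rule bounded_linear.continuous_on[OF bl1] bounded_linear.continuous_on[OF bl2] c cF)+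
  have i1: "continuous_on {0..x} (\<lambda>r. Fh (C (t - r)))" "continuous_on {0..x} (\<lambda>r. Fh (C (s + r)))"
    by (rule continuous_on_compose2[OF cF]; use s st in \<open>auto intro!: continuous_intros simp: x_def\<close>)+
  note iF = f.integrable_convolution[OF i1(1)] and iB = b.integrable_convolution[OF i1(2)]
  have d1: "((\<lambda>r. exp (- rate \<nu> k * r) * coord (fst (Fh (C (t - r)))) k) has_integral
      coord (fst (C t)) k - exp (- rate \<nu> k * x) * coord (fst (C s)) k) {0..x}"
    "((\<lambda>r. exp (rate \<nu> k * r) * coord (fst (Fh (C (s + r)))) k) has_integral
      exp (rate \<nu> k * x) * coord (fst (C t)) k - coord (fst (C s)) k) {0..x}" for k
    using scalar_duhamel[OF cc(1) cc(3) 1 s st] unfolding x_def by blast+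
  have d2: "((\<lambda>r. exp (- rate \<kappa> k * r) * coord (snd (Fh (C (t - r)))) k) has_integral
      coord (snd (C t)) k - exp (- rate \<kappa> k * x) * coord (snd (C s)) k) {0..x}"
    "((\<lambda>r. exp (rate \<kappa> k * r) * coord (snd (Fh (C (s + r)))) k) has_integral
      exp (rate \<kappa> k * x) * coord (snd (C t)) k - coord (snd (C s)) k) {0..x}" for k
    using scalar_duhamel[OF cc(2) cc(4) 2 s st] unfolding x_def by blast+
  have fast1: "coord (fst (integral {0..x} (\<lambda>r. Uf r (Fh (C (t - r)))))) k =
      (if rate \<nu> k \<le> a then 0 else coord (fst (C t)) k - exp (- rate \<nu> k * x) * coord (fst (C s)) k)" for k
  proof -
    have "coord (fst (integral {0..x} (\<lambda>r. Uf r (Fh (C (t - r)))))) k =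
        integral {0..x} (\<lambda>r. coord (fst (Uf r (Fh (C (t - r))))) k)"
      using integral_linear[OF iF bl1] by (simp add: o_def)
    also have "\<dots> = integral {0..x} (\<lambda>r. (if rate \<nu> k \<le> a then 0 else exp (- rate \<nu> k * r)) * coord (fst (Fh (C (t - r)))) k)"
      by (rule integral_cong) (simp only: coord_Uf atLeastAtMost_iff)
    finally show ?thesis using integral_unique[OF d1(1)[of k]] by simp
  qed
  have fast2: "coord (snd (integral {0..x} (\<lambda>r. Uf r (Fh (C (t - r)))))) k =
      (if rate \<kappa> k \<le> a then 0 else coord (snd (C t)) k - exp (- rate \<kappa> k * x) * coord (snd (C s)) k)" for k
  proof -
    have "coord (snd (integral {0..x} (\<lambda>r. Uf r (Fh (C (t - r)))))) k =
        integral {0..x} (\<lambda>r. coord (snd (Uf r (Fh (C (t - r))))) k)"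
      using integral_linear[OF iF bl2] by (simp add: o_def)
    also have "\<dots> = integral {0..x} (\<lambda>r. (if rate \<kappa> k \<le> a then 0 else exp (- rate \<kappa> k * r)) * coord (snd (Fh (C (t - r)))) k)"
      by (rule integral_cong) (simp only: coord_Uf atLeastAtMost_iff)
    finally show ?thesis using integral_unique[OF d2(1)[of k]] by simp
  qed
  have slow1: "coord (fst (integral {0..x} (\<lambda>r. Ub r (Fh (C (s + r)))))) k =
      (if rate \<nu> k \<le> a then exp (rate \<nu> k * x) * coord (fst (C t)) k - coord (fst (C s)) k else 0)" for k
  proof -
    have "coord (fst (integral {0..x} (\<lambda>r. Ub r (Fh (C (s + r)))))) k =
        integral {0..x} (\<lambda>r. coord (fst (Ub r (Fh (C (s + r))))) k)"
      using integral_linear[OF iB bl1] by (simp add: o_def)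
    also have "\<dots> = integral {0..x} (\<lambda>r. (if rate \<nu> k \<le> a then exp (rate \<nu> k * r) else 0) * coord (fst (Fh (C (s + r)))) k)"
      by (rule integral_cong) (simp only: coord_Ub atLeastAtMost_iff)
    finally show ?thesis using integral_unique[OF d1(2)[of k]] by simp
  qed
  have slow2: "coord (snd (integral {0..x} (\<lambda>r. Ub r (Fh (C (s + r)))))) k =
      (if rate \<kappa> k \<le> a then exp (rate \<kappa> k * x) * coord (snd (C t)) k - coord (snd (C s)) k else 0)" for k
  proof -
    have "coord (snd (integral {0..x} (\<lambda>r. Ub r (Fh (C (s + r)))))) k =
        integral {0..x} (\<lambda>r. coord (snd (Ub r (Fh (C (s + r))))) k)"
      using integral_linear[OF iB bl2] by (simp add: o_def)
    also have "\<dots> = integral {0..x} (\<lambda>r. (if rate \<kappa> k \<le> a then exp (rate \<kappa> k * r) else 0) * coord (snd (Fh (C (s + r)))) k)"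
      by (rule integral_cong) (simp only: coord_Ub atLeastAtMost_iff)
    finally show ?thesis using integral_unique[OF d2(2)[of k]] by simp
  qed
  show "Uf 0 (C t) = Uf (t - s) (C s) + integral {0..t - s} (\<lambda>r. Uf r (Fh (C (t - r))))"
    unfolding x_def[symmetric]
    by (rule coeffs_eqI) (simp_all add: coord_Uf x fast1 fast2)
  show "Ub 0 (C s) = Ub (t - s) (C t) - integral {0..t - s} (\<lambda>r. Ub r (Fh (C (s + r))))"
    unfolding x_def[symmetric]
    by (rule coeffs_eqI) (simp_all add: coord_Ub x slow1 slow2)
qed (use c in \<open>auto simp: is_interval_1\<close>)

lemma mild_solution:
  assumes sol: "truncated_solution \<nu> \<kappa> L \<alpha> N f chi \<rho> V"
  shows "mild (\<lambda>t. coords (V t)) {0..}"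
proof (rule mild_if_coordinates)
  have ph: "V t \<in> phase_space L" if "t \<ge> 0" for t
    using sol that by (simp add: truncated_solution_def continuous_curve_def)
  show "continuous_on {0..} (\<lambda>t. coords (V t))"
    using sol by (intro continuous_coords) (simp add: truncated_solution_def)
  fix k :: "int^2" and t :: real assume t: "t \<ge> 0"
  have z: "((\<lambda>s. 0) has_integral 0) {0..t}" by simp
  show "((\<lambda>s. - rate \<nu> k * coord (fst (coords (V s))) k + coord (fst (Fh (coords (V s)))) k)
      has_integral coord (fst (coords (V t))) k - coord (fst (coords (V 0))) k) {0..t}"
  proof (cases "k = 0")
    case True
    have "((\<lambda>s. - rate \<nu> 0 * coord (fst (coords (V s))) 0 + coord (fst (Fh (coords (V s)))) 0) has_integral 0) {0..t}"
      by (rule has_integral_eq[OF _ z]) (simp add: coords_0 ph coord_Fh_0)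
    then show ?thesis using True t by (simp add: coords_0 ph)
  next
    case False
    then show ?thesis using solution_coeffs(1)[OF sol t, of k] by (simp add: rate_def)
  qed
  show "((\<lambda>s. - rate \<kappa> k * coord (snd (coords (V s))) k + coord (snd (Fh (coords (V s)))) k)
      has_integral coord (snd (coords (V t))) k - coord (snd (coords (V 0))) k) {0..t}"
  proof (cases "k = 0")
    case True
    have "((\<lambda>s. - rate \<kappa> 0 * coord (snd (coords (V s))) 0 + coord (snd (Fh (coords (V s)))) 0) has_integral 0) {0..t}"
      by (rule has_integral_eq[OF _ z]) (simp add: coords_0 ph coord_Fh_0)
    then show ?thesis using True t by (simp add: coords_0 ph)
  next
    case False
    then show ?thesis using solution_coeffs(2)[OF sol t, of k] by (simp add: rate_def)
  qed
qed

lemma eq_0_if_exp_bound: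
  assumes "\<And>T. T \<ge> 0 \<Longrightarrow> \<bar>x\<bar> \<le> exp (- b * T) * B"
  shows "x = (0 :: real)"
proof -
  have "filterlim (\<lambda>T. (- b) * T) at_bot at_top"
    using b_pos by (intro filterlim_tendsto_neg_mult_at_bot[OF tendsto_const] filterlim_ident) auto
  then have "((\<lambda>T. exp ((- b) * T) * B) \<longlongrightarrow> 0 * B) at_top"
    by (intro tendsto_intros filterlim_compose[OF exp_at_bot])
  then have "\<bar>x\<bar> \<le> 0 * B"
    by (rule tendsto_lowerbound) (use assms in \<open>auto intro: eventually_mono[OF eventually_ge_at_top[of 0]]\<close>)
  then show ?thesis by simp
qed

text \<open>The nonlinearity has no zero mode, so this coordinate only decays, with rate
  \<open>b\<close>. Being bounded in the arbitrarily distant past, it must be zero. Hence points of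
  the manifold come from actual states.\<close>

lemma manifold_coord_0:
  assumes "x \<in> manifold"
  shows "coord (fst x) 0 = 0 \<and> coord (snd x) 0 = 0"
proof -
  obtain y B where y: "mild y {..0}" "\<And>t. t \<le> 0 \<Longrightarrow> norm (Uf 0 (y t)) \<le> B" "y 0 = x"
    using assms by (rule manifoldE) (rule that)
  have r0: "rate \<eta> 0 = b" "\<not> rate \<eta> 0 \<le> a" for \<eta> using b_above by (simp_all add: rate_def)
  have bl1: "bounded_linear (\<lambda>z::coeffs. coord (fst z) 0)" and bl2: "bounded_linear (\<lambda>z::coeffs. coord (snd z) 0)"
    by (rule bounded_linear_compose[OF bounded_linear_coord] bounded_linear_fst bounded_linear_snd)+
  have main: "\<bar>coord (fst x) 0\<bar> \<le> exp (- b * T) * B \<and> \<bar>coord (snd x) 0\<bar> \<le> exp (- b * T) * B" if T: "T \<ge> 0" for T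
  proof -
    have e: "Uf 0 x = Uf T (y (- T)) + integral {0..T} (\<lambda>r. Uf r (Fh (y (0 - r))))"
      using mild_fast[OF y(1), of "- T" 0] T y(3) by simp
    have i: "(\<lambda>r. Uf r (Fh (y (0 - r)))) integrable_on {0..T}"
      using f.integrable_convolution[OF mild_continuous(1)[OF y(1), of "- T" 0]] T by simp
    have "coord (fst (integral {0..T} (\<lambda>r. Uf r (Fh (y (0 - r)))))) 0 = integral {0..T} (\<lambda>r. coord (fst (Uf r (Fh (y (0 - r))))) 0)"
      using integral_linear[OF i bl1] by (simp add: o_def)
    also have "\<dots> = integral {0..T} (\<lambda>r. 0)"
      by (rule integral_cong) (simp add: coord_Uf coord_Fh_0)
    finally have z1: "coord (fst (integral {0..T} (\<lambda>r. Uf r (Fh (y (0 - r)))))) 0 = 0" by simp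
    have "coord (snd (integral {0..T} (\<lambda>r. Uf r (Fh (y (0 - r)))))) 0 = integral {0..T} (\<lambda>r. coord (snd (Uf r (Fh (y (0 - r))))) 0)"
      using integral_linear[OF i bl2] by (simp add: o_def)
    also have "\<dots> = integral {0..T} (\<lambda>r. 0)"
      by (rule integral_cong) (simp add: coord_Uf coord_Fh_0)
    finally have z2: "coord (snd (integral {0..T} (\<lambda>r. Uf r (Fh (y (0 - r)))))) 0 = 0" by simp
    have x1: "coord (fst x) 0 = exp (- b * T) * coord (fst (Uf 0 (y (- T)))) 0"
      using arg_cong[OF e, of "\<lambda>z. coord (fst z) 0"] z1 T b_above by (simp add: coord_Uf r0)
    have x2: "coord (snd x) 0 = exp (- b * T) * coord (snd (Uf 0 (y (- T)))) 0"
      using arg_cong[OF e, of "\<lambda>z. coord (snd z) 0"] z2 T b_above by (simp add: coord_Uf r0)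
    have n: "norm (Uf 0 (y (- T))) \<le> B" using y(2) T by simp
    have "\<bar>coord (fst (Uf 0 (y (- T)))) 0\<bar> \<le> B" "\<bar>coord (snd (Uf 0 (y (- T)))) 0\<bar> \<le> B"
      using abs_coord_le_norm[of "fst (Uf 0 (y (- T)))" 0] abs_coord_le_norm[of "snd (Uf 0 (y (- T)))" 0]
        norm_fst_le[of "fst (Uf 0 (y (- T)))" "snd (Uf 0 (y (- T)))"]
        norm_snd_le[of "snd (Uf 0 (y (- T)))" "fst (Uf 0 (y (- T)))"] n
      unfolding prod.collapse by linarith+
    then show ?thesis unfolding x1 x2 abs_mult by (auto intro: mult_left_mono)
  qed
  show ?thesis using eq_0_if_exp_bound main by blast
qed

definition inertial :: "state set" where
  "inertial = {V \<in> phase_space L. coords V \<in> manifold}"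

lemma state_of_manifold:
  assumes "x \<in> manifold"
  shows "state_of x \<in> inertial" "coords (state_of x) = x"
proof -
  have "drop0 (fst x) = fst x" "drop0 (snd x) = snd x"
    using manifold_coord_0[OF assms] by (auto intro!: ell2_eqI simp: coord_drop0)
  then show "coords (state_of x) = x" by (simp add: state_of(2))
  then show "state_of x \<in> inertial" using assms state_of(1) by (simp add: inertial_def)
qed

text \<open>The eigenvalues grow like the square of the frequency, so an upper bound on the rate
  confines \<open>k\<close> to a box. This is the source of finite dimension.\<close>

lemma finite_slow_modes: "finite {k. rate \<eta> k \<le> a}" if "\<eta> > 0" for \<eta>
proof -
  define c where "c = \<eta> * (2 * pi / L)\<^sup>2"
  have c: "c > 0" using that L_pos by (simp add: c_def)
  obtain n :: nat where n: "a / c < real n" using reals_Archimedean2 by blast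
  have "{k. rate \<eta> k \<le> a} \<subseteq> freq_box n"
  proof
    fix k assume "k \<in> {k. rate \<eta> k \<le> a}"
    then have "\<eta> * (norm (wave L k))\<^sup>2 \<le> a" using b_above by (auto simp: rate_def split: if_splits)
    then have "c * ((real_of_int (k $ 1))\<^sup>2 + (real_of_int (k $ 2))\<^sup>2) \<le> a"
      by (simp add: norm_wave_square c_def mult.assoc)
    then have "(real_of_int (k $ 1))\<^sup>2 + (real_of_int (k $ 2))\<^sup>2 \<le> a / c" using c by (simp add: field_simps)
    then have le: "real_of_int ((k $ 1)\<^sup>2 + (k $ 2)\<^sup>2) < real n" using n by simp
    have "\<bar>k $ i\<bar> \<le> int n" for i
    proof -
      have "\<bar>k $ i\<bar> \<le> (k $ i)\<^sup>2"
        by (metis abs_ge_zero abs_le_square_iff abs_of_nonneg int_one_le_iff_zero_less linorder_not_le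
            mult_le_cancel_left1 order_refl power2_abs power2_eq_square zero_le_power2 order_antisym_conv)
      also have "\<dots> \<le> (k $ 1)\<^sup>2 + (k $ 2)\<^sup>2" using exhaust_2[of i] by auto
      also have "\<dots> \<le> int n" using le by linarith
      finally show ?thesis .
    qed
    then show "k \<in> freq_box n" by (simp add: freq_box_def)
  qed
  then show ?thesis by (rule finite_subset) simp
qed

text \<open>A disjoint sum, because the same wave vector may be slow for the velocity and fast for
  the temperature. Its cardinality is the dimension of the manifold.\<close>

definition slow_modes :: "(int^2 + int^2) set" where
  "slow_modes = {k. rate \<nu> k \<le> a} <+> {k. rate \<kappa> k \<le> a}"

definition mode_coord :: "coeffs \<Rightarrow> int^2 + int^2 \<Rightarrow> real" where
  "mode_coord z m = (case m of Inl k \<Rightarrow> coord (fst z) k | Inr k \<Rightarrow> coord (snd z) k)"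

lemma finite_slow: "finite slow_modes"
  unfolding slow_modes_def by (intro finite_Plus finite_slow_modes visc)

lemma norm_finite_support:
  assumes "finite K" "\<And>k. k \<notin> K \<Longrightarrow> coord x k = 0"
  shows "(norm x)\<^sup>2 = (\<Sum>k\<in>K. (coord x k)\<^sup>2)"
proof -
  have "(\<Sum>\<^sub>\<infinity>k. (coord x k)\<^sup>2) = (\<Sum>\<^sub>\<infinity>k\<in>K. (coord x k)\<^sup>2)"
    by (rule infsum_cong_neutral) (use assms in auto)
  then show ?thesis using assms(1) by (simp add: norm_ell2_square)
qed

lemma norm_Ub_0: "norm (Ub 0 z) = sqrt (\<Sum>m\<in>slow_modes. (mode_coord z m)\<^sup>2)"
proof -
  have 1: "(norm (fst (Ub 0 z)))\<^sup>2 = (\<Sum>k\<in>{k. rate \<nu> k \<le> a}. (coord (fst z) k)\<^sup>2)"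
    by (subst norm_finite_support[OF finite_slow_modes[OF visc(1)]]) (auto simp: coord_Ub)
  have 2: "(norm (snd (Ub 0 z)))\<^sup>2 = (\<Sum>k\<in>{k. rate \<kappa> k \<le> a}. (coord (snd z) k)\<^sup>2)"
    by (subst norm_finite_support[OF finite_slow_modes[OF visc(2)]]) (auto simp: coord_Ub)
  have "(\<Sum>m\<in>slow_modes. (mode_coord z m)\<^sup>2) = (norm (fst (Ub 0 z)))\<^sup>2 + (norm (snd (Ub 0 z)))\<^sup>2"
    unfolding slow_modes_def 1 2
    by (subst sum.Plus) (auto simp: mode_coord_def finite_slow_modes visc)
  then show ?thesis by (simp add: norm_prod_def)
qed

lemma ex_coeffs_with_slow_modes: "\<exists>z. \<forall>m\<in>slow_modes. mode_coord z m = p m"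
proof -
  define x where "x = (\<Sum>k\<in>{k. rate \<nu> k \<le> a}. p (Inl k) *\<^sub>R unit_ell2 k)"
  define y where "y = (\<Sum>k\<in>{k. rate \<kappa> k \<le> a}. p (Inr k) *\<^sub>R unit_ell2 k)"
  have "coord x k = p (Inl k)" if "rate \<nu> k \<le> a" for k
    using that finite_slow_modes[OF visc(1)] by (simp add: x_def coord_sum coord_unit if_distrib cong: if_cong)
  moreover have "coord y k = p (Inr k)" if "rate \<kappa> k \<le> a" for k
    using that finite_slow_modes[OF visc(2)] by (simp add: y_def coord_sum coord_unit if_distrib cong: if_cong)
  ultimately have "\<forall>m\<in>slow_modes. mode_coord (x, y) m = p m"
    by (auto simp: slow_modes_def mode_coord_def)
  then show ?thesis by blast
qed

lemma state_dist_nonneg: "state_dist L V W \<ge> 0"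
  by (simp add: state_dist_def state_norm_def)

text \<open>The slow coordinates form one global chart: they are bi-Lipschitz on the manifold by
  \<open>manifold_lipschitz\<close>, and by \<open>manifold_exists\<close> they take every value,
  which makes images of balls open. The radius \<open>1\<close> is an arbitrary choice.\<close>

lemma inertial_lipschitz_manifold: "lipschitz_manifold L (card slow_modes) inertial"
  unfolding lipschitz_manifold_def
proof (intro conjI ballI)
  show "subset_of_phase_space L inertial"
    by (auto simp: subset_of_phase_space_def inertial_def state_dist_coords)
  define n where "n = card slow_modes"
  obtain h where h: "bij_betw h {..<n} slow_modes"
    using ex_bij_betw_nat_finite[OF finite_slow] by (auto simp: n_def lessThan_atLeast0)
  \<comment> \<open>The value \<open>0\<close> from index \<open>n\<close> on places the chart in
    \<open>Euclidean_space n\<close>.\<close>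
  define \<psi> where "\<psi> V i = (if i < n then mode_coord (coords V) (h i) else 0)" for V i
  have L2: "L2_set (\<lambda>i. \<psi> V i - \<psi> W i) {..<n} = norm (Ub 0 (coords V) - Ub 0 (coords W))" for V W
  proof -
    have "(\<Sum>i<n. (\<psi> V i - \<psi> W i)\<^sup>2) = (\<Sum>i<n. (mode_coord (coords V - coords W) (h i))\<^sup>2)"
      by (intro sum.cong) (auto simp: \<psi>_def mode_coord_def split: sum.splits)
    also have "\<dots> = (\<Sum>m\<in>slow_modes. (mode_coord (coords V - coords W) m)\<^sup>2)"
      using h by (rule sum.reindex_bij_betw)
    finally show ?thesis
      unfolding L2_set_def b.diff[OF order_refl, symmetric] norm_Ub_0 by simp
  qed
  have lip: "(1 - \<delta>) * state_dist L V W \<le> L2_set (\<lambda>i. \<psi> V i - \<psi> W i) {..<n}"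
    and lip': "L2_set (\<lambda>i. \<psi> V i - \<psi> W i) {..<n} \<le> 1 * state_dist L V W"
    if "V \<in> inertial" "W \<in> inertial" for V W
  proof -
    have VW: "V \<in> phase_space L" "W \<in> phase_space L" "coords V \<in> manifold" "coords W \<in> manifold"
      using that by (auto simp: inertial_def)
    have "norm (coords V - coords W) \<le> 1 / (1 - \<delta>) * norm (Ub 0 (coords V) - Ub 0 (coords W))"
      by (rule manifold_lipschitz[OF VW(3,4)])
    then show "(1 - \<delta>) * state_dist L V W \<le> L2_set (\<lambda>i. \<psi> V i - \<psi> W i) {..<n}"
      unfolding L2 state_dist_coords[OF VW(1,2)] using \<delta>_bounds by (simp add: field_simps)
    show "L2_set (\<lambda>i. \<psi> V i - \<psi> W i) {..<n} \<le> 1 * state_dist L V W"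
      unfolding L2 state_dist_coords[OF VW(1,2)]
      using b.growth[of 0 "coords V - coords W"] by (simp add: b.diff)
  qed
  fix V assume V: "V \<in> inertial"
  have triangle: "state_dist L V W' \<le> state_dist L V W + state_dist L W W'" if "W \<in> inertial" "W' \<in> inertial" for W W'
    using that V norm_triangle_ineq[of "coords V - coords W" "coords W - coords W'"]
    by (simp add: inertial_def state_dist_coords)
  define P where "P = \<psi> ` {W \<in> inertial. state_dist L V W < 1}"
  have "openin (Euclidean_space n) P"
  proof (subst openin_subopen, rule ballI)
    fix p0 assume "p0 \<in> P"
    then obtain W0 where W0: "W0 \<in> inertial" "state_dist L V W0 < 1" "p0 = \<psi> W0" by (auto simp: P_def)
    \<comment> \<open>The room left in the ball at \<open>W0\<close>, converted into chart distance
      by the lower Lipschitz constant \<open>1 - \<delta>\<close>. The neighbourhood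
      \<open>Q\<close> is measured by the sum of absolute values, which dominates the Euclidean
      distance.\<close>
    define \<epsilon> where "\<epsilon> = (1 - \<delta>) * (1 - state_dist L V W0)"
    define Q where "Q = {p \<in> topspace (Euclidean_space n). (\<Sum>i<n. \<bar>p i - p0 i\<bar>) \<in> {..<\<epsilon>}}"
    have proj: "continuous_map (Euclidean_space n) euclideanreal (\<lambda>p. p i)" for i
      unfolding Euclidean_space_def
      by (intro continuous_map_from_subtopology continuous_map_product_projection) simp
    have "continuous_map (Euclidean_space n) euclideanreal (\<lambda>p. \<Sum>i<n. \<bar>p i - p0 i\<bar>)"
      by (intro continuous_map_sum continuous_map_real_abs continuous_map_diff proj) auto
    then have "openin (Euclidean_space n) Q"
      unfolding Q_def by (rule openin_continuous_map_preimage) simp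
    moreover have "p0 \<in> Q"
      using W0 \<delta>_bounds by (auto simp: Q_def topspace_Euclidean_space \<psi>_def \<epsilon>_def)
    moreover have "Q \<subseteq> P"
    proof
      fix p assume p: "p \<in> Q"
      obtain z where z: "\<forall>m\<in>slow_modes. mode_coord z m = p (inv_into {..<n} h m)"
        \<comment> \<open>Surjectivity of the chart: any prescribed slow coordinates are realized by
          some coefficient pair, and the graph property moves that pair onto the manifold without
          changing them.\<close>
        using ex_coeffs_with_slow_modes[of "\<lambda>m. p (inv_into {..<n} h m)"] by blast
      obtain x where x: "x \<in> manifold" "Ub 0 x = Ub 0 z" using manifold_exists by blast
      define W where "W = state_of x"
      have W: "W \<in> inertial" "coords W = x" using state_of_manifold[OF x(1)] by (auto simp: W_def)
      have "mode_coord x m = mode_coord z m" if m: "m \<in> slow_modes" for m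
      proof -
        have "mode_coord (Ub 0 u) m = mode_coord u m" for u
          using m by (auto simp: slow_modes_def mode_coord_def coord_Ub)
        then show ?thesis using x(2) by metis
      qed
      then have "mode_coord x (h i) = p i" if "i < n" for i
        using z h that by (simp add: bij_betw_apply bij_betw_inv_into_left)
      then have \<psi>W: "\<psi> W = p"
        using p W(2) by (auto simp: fun_eq_iff \<psi>_def Q_def topspace_Euclidean_space)
      have "(1 - \<delta>) * state_dist L W0 W \<le> L2_set (\<lambda>i. \<psi> W0 i - \<psi> W i) {..<n}" by (rule lip[OF W0(1) W(1)])
      also have "\<dots> \<le> (\<Sum>i<n. \<bar>\<psi> W0 i - \<psi> W i\<bar>)" by (rule L2_set_le_sum_abs)
      also have "\<dots> < \<epsilon>" using p by (simp add: Q_def \<psi>W W0(3) abs_minus_commute)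
      finally have "state_dist L W0 W < 1 - state_dist L V W0"
        unfolding \<epsilon>_def using \<delta>_bounds by (simp add: mult_less_cancel_left)
      then have "state_dist L V W < 1" using triangle[OF W0(1) W(1)] by linarith
      then show "p \<in> P" unfolding P_def using W(1) \<psi>W by blast
    qed
    ultimately show "\<exists>T. openin (Euclidean_space n) T \<and> p0 \<in> T \<and> T \<subseteq> P" by blast
  qed
  then show "\<exists>r>0. \<exists>\<psi>. \<exists>c>0. \<exists>C.
        openin (Euclidean_space (card slow_modes)) (\<psi> ` {W \<in> inertial. state_dist L V W < r}) \<and>
        (\<forall>W\<in>{W \<in> inertial. state_dist L V W < r}. \<forall>W'\<in>{W \<in> inertial. state_dist L V W < r}.
           c * state_dist L W W' \<le> L2_set (\<lambda>i. \<psi> W i - \<psi> W' i) {..<card slow_modes} \<and>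
           L2_set (\<lambda>i. \<psi> W i - \<psi> W' i) {..<card slow_modes} \<le> C * state_dist L W W')"
    unfolding n_def[symmetric]
    using lip lip' \<delta>_bounds
    by (intro exI[of _ "1 :: real"] exI[of _ "1 - \<delta>"] exI[of _ \<psi>] conjI ballI) (auto simp: P_def)
qed

theorem inertial_manifold_inertial:
  assumes S: "solution_semigroup \<nu> \<kappa> L \<alpha> N f chi \<rho> S"
  shows "inertial_manifold L S inertial"
proof -
  have sol: "truncated_solution \<nu> \<kappa> L \<alpha> N f chi \<rho> (\<lambda>t. S t V)" and S0: "state_dist L (S 0 V) V = 0"
    if "V \<in> phase_space L" for V
    using S that by (auto simp: solution_semigroup_def)
  have ph: "S t V \<in> phase_space L" if "V \<in> phase_space L" "t \<ge> 0" for t V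
    using sol[OF that(1)] that(2) by (simp add: truncated_solution_def continuous_curve_def)
  \<comment> \<open>The solution starts at \<open>V\<close> only up to a null set; equality holds
    after passing to coefficients.\<close>
  have c0: "coords (S 0 V) = coords V" if "V \<in> phase_space L" for V
    using S0[OF that] by (simp add: state_dist_coords ph that)
  have inv: "S t ` inertial \<subseteq> inertial" if "t \<ge> 0" for t
  proof
    fix W assume "W \<in> S t ` inertial"
    then obtain V where V: "V \<in> phase_space L" "coords V \<in> manifold" "W = S t V" by (auto simp: inertial_def)
    have "coords (S t V) \<in> manifold"
      using manifold_invariant[OF mild_solution[OF sol[OF V(1)]] _ that] V by (simp add: c0)
    then show "W \<in> inertial" using ph[OF V(1) that] V(3) by (simp add: inertial_def)
  qed
  \<comment> \<open>The constant involves the initial state only through the bound \<open>R\<close>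
    of its norm, and the rate is always \<open>\<gamma>\<close>; this is the uniformity on bounded
    sets.\<close>
  have attract: "dist_to_set L (S t V) inertial \<le> (R + KF / b) / (1 - \<delta>) * exp (- \<gamma> * t)"
    if V: "V \<in> phase_space L" and R: "state_norm L V \<le> R" and t: "t \<ge> 0" for V R t
  proof -
    obtain x where x: "x \<in> manifold"
      "norm (coords (S t V) - x) \<le> (norm (Uf 0 (coords (S 0 V))) + KF / b) / (1 - \<delta>) * exp (- \<gamma> * t)"
      using manifold_attracts[OF mild_solution[OF sol[OF V]] t] by blast
    have "dist_to_set L (S t V) inertial \<le> state_dist L (S t V) (state_of x)"
      unfolding dist_to_set_def
    proof (rule cINF_lower)
      show "bdd_below ((\<lambda>W. state_dist L (S t V) W) ` inertial)" by (rule bdd_belowI2[of _ 0]) (rule state_dist_nonneg)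
      show "state_of x \<in> inertial" using state_of_manifold[OF x(1)] by blast
    qed
    also have "\<dots> = norm (coords (S t V) - x)"
      using state_of_manifold[OF x(1)] ph[OF V t] by (simp add: state_dist_coords state_of(1))
    also have "\<dots> \<le> (norm (Uf 0 (coords (S 0 V))) + KF / b) / (1 - \<delta>) * exp (- \<gamma> * t)" by (rule x(2))
    also have "\<dots> \<le> (R + KF / b) / (1 - \<delta>) * exp (- \<gamma> * t)"
    proof -
      have "norm (Uf 0 (coords (S 0 V))) \<le> R"
        using f.growth[of 0 "coords V"] R by (simp add: c0[OF V] state_norm_coords[OF V])
      then show ?thesis using \<delta>_bounds by (intro mult_right_mono divide_right_mono) auto
    qed
    finally show ?thesis .
  qed
  obtain x where "x \<in> manifold" using manifold_exists by blast
  then have "inertial \<noteq> {}" using state_of_manifold by blast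
  moreover have "\<exists>n. lipschitz_manifold L n inertial" using inertial_lipschitz_manifold by blast
  moreover have "\<exists>C. \<forall>V0\<in>B. \<forall>t\<ge>0. dist_to_set L (S t V0) inertial \<le> C * exp (- \<gamma> * t)"
    if "B \<subseteq> phase_space L \<and> (\<exists>R. \<forall>V\<in>B. state_norm L V \<le> R)" for B
    using attract that by blast
  ultimately show ?thesis
    unfolding inertial_manifold_def using inv \<gamma>_pos by blast
qed

end

text \<open>Up to the factor \<open>(2 * pi / L)^2\<close> the squared wave numbers are sums of two
  squares, so a common gap of any width exists in both spectra. The width
  \<open>4 * \<Lambda>F + 1\<close> makes the gap condition strict.\<close>

lemma (in truncated) ex_spectral_gap:
  assumes visc: "\<nu> > 0" "\<kappa> > 0"
  shows "\<exists>a b. gapped L \<alpha> N f chi \<rho> \<nu> \<kappa> a b"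
proof -
  define c where "c = (2 * pi / L)\<^sup>2"
  have c: "c > 0" using L_pos by (simp add: c_def)
  obtain x where x: "x > 0" "\<And>m. sum2sq m \<Longrightarrow>
      (\<nu> * c * of_int m \<le> x \<or> x + (4 * \<Lambda>F + 1) \<le> \<nu> * c * of_int m) \<and>
      (\<kappa> * c * of_int m \<le> x \<or> x + (4 * \<Lambda>F + 1) \<le> \<kappa> * c * of_int m)"
    using ex_common_gap_sum2sq[of "\<nu> * c" "\<kappa> * c" "4 * \<Lambda>F + 1"] visc c by auto
  have w: "(norm (wave L k))\<^sup>2 = c * of_int ((k $ 1)\<^sup>2 + (k $ 2)\<^sup>2)" for k
    by (simp add: norm_wave_square c_def)
  have s: "sum2sq ((k $ 1)\<^sup>2 + (k $ 2)\<^sup>2)" for k :: "int^2" by (auto simp: sum2sq_def)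
  have "gapped L \<alpha> N f chi \<rho> \<nu> \<kappa> x (x + (4 * \<Lambda>F + 1))"
    by unfold_locales (use visc x(1) x(2)[OF s] in \<open>auto simp: w mult.assoc\<close>)
  then show ?thesis by blast
qed

theorem theorem4p4:
  fixes \<nu> \<kappa> \<alpha> L \<rho> :: real and N :: nat
    and f :: "real^2 \<Rightarrow> real"
    and chi :: "real \<Rightarrow> real"
    and S :: "real \<Rightarrow> state \<Rightarrow> state"
  assumes "\<nu> > 0" and "\<kappa> > 0" and "\<alpha> > 0" and "L > 0"
    and "f \<in> L2_zero L"
    and "\<rho> > 0" and "absorbing_radius \<nu> \<kappa> L \<alpha> N f \<rho>"
    and "cutoff chi"
    and "solution_semigroup \<nu> \<kappa> L \<alpha> N f chi \<rho> S"
  shows "\<exists>M. inertial_manifold L S M \<and>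
           (\<forall>V0\<in>phase_space L. \<exists>C. \<exists>\<omega>>0. \<forall>t\<ge>0.
              dist_to_set L (S t V0) M \<le> C * exp (- \<omega> * t))"
proof -
  interpret truncated L \<alpha> N f chi \<rho>
    by unfold_locales (use assms in auto)
  obtain a b where "gapped L \<alpha> N f chi \<rho> \<nu> \<kappa> a b"
    using ex_spectral_gap assms(1,2) by blast
  then interpret gapped L \<alpha> N f chi \<rho> \<nu> \<kappa> a b .
  have M: "inertial_manifold L S inertial" by (rule inertial_manifold_inertial[OF assms(9)])
  moreover have "\<exists>C. \<exists>\<omega>>0. \<forall>t\<ge>0. dist_to_set L (S t V0) inertial \<le> C * exp (- \<omega> * t)"
    if V0: "V0 \<in> phase_space L" for V0
  proof -
    \<comment> \<open>The statement for a single trajectory is the uniform attraction applied to the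
      bounded set with one element.\<close>
    have "{V0} \<subseteq> phase_space L \<and> (\<exists>R. \<forall>V\<in>{V0}. state_norm L V \<le> R)" using V0 by auto
    then show ?thesis using M unfolding inertial_manifold_def by (metis singletonI)
  qed
  ultimately show ?thesis by blast
qed

end
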